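(* Let $T=\mathbb{C}/(\mathbb{Z}\omega_1+\mathbb{Z}\omega_2)$ be a flat torus. For $\rho=4\pi$, there exists a unique solution of the mean field equation $\triangle u+\rho e^u=\rho\,\delta_0$ on $T$.
   Context: $\omega_1,\omega_2\in\mathbb{C}$ are linearly independent over $\mathbb{R}$; the volume of $T$ is normalized to be $1$; $\delta_0$ is the Dirac measure at $0\in T$. *)

theory Defs
  imports "HOL-Analysis.Analysis" "HOL-Library.FuncSet"
begin

definition period_lattice :: "complex \<Rightarrow> complex \<Rightarrow> complex set" where
  "period_lattice \<omega>1 \<omega>2 = {of_int m * \<omega>1 + of_int n * \<omega>2 | m n. True}"

definition period_rel :: "complex \<Rightarrow> complex \<Rightarrow> (complex \<times> complex) set" where
  "period_rel \<omega>1 \<omega>2 = {(z, w). z - w \<in> period_lattice \<omega>1 \<omega>2}"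

definition torus :: "complex \<Rightarrow> complex \<Rightarrow> complex set set" where
  "torus \<omega>1 \<omega>2 = UNIV // period_rel \<omega>1 \<omega>2"

definition torus_proj :: "complex \<Rightarrow> complex \<Rightarrow> complex \<Rightarrow> complex set" where
  "torus_proj \<omega>1 \<omega>2 z = period_rel \<omega>1 \<omega>2 `` {z}"

definition fundamental_parallelogram :: "complex \<Rightarrow> complex \<Rightarrow> complex set" where
  "fundamental_parallelogram \<omega>1 \<omega>2 =
     {of_real s * \<omega>1 + of_real t * \<omega>2 | s t. s \<in> {0..<1} \<and> t \<in> {0..<1}}"

text \<open>
  The torus carries the measure that Lebesgue measure on the plane induces on it. The half-open
  fundamental parallelogram contains exactly one representative of every point, so integration
  over the torus is integration of the lift over that parallelogram.
\<close>

definition torus_volume :: "complex \<Rightarrow> complex \<Rightarrow> real" where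
  "torus_volume \<omega>1 \<omega>2 = measure lborel (fundamental_parallelogram \<omega>1 \<omega>2)"

definition torus_integrable :: "complex \<Rightarrow> complex \<Rightarrow> (complex set \<Rightarrow> real) \<Rightarrow> bool" where
  "torus_integrable \<omega>1 \<omega>2 g \<longleftrightarrow>
     set_integrable lborel (fundamental_parallelogram \<omega>1 \<omega>2) (\<lambda>z. g (torus_proj \<omega>1 \<omega>2 z))"

text \<open>
  On an open set this is the usual notion of being \<open>k\<close> times continuously differentiable; the
  sets used below are open.
\<close>

primrec Ck_on :: "nat \<Rightarrow> (complex \<Rightarrow> real) \<Rightarrow> complex set \<Rightarrow> bool" where
  "Ck_on 0 f S \<longleftrightarrow> continuous_on S f"
| "Ck_on (Suc k) f S \<longleftrightarrow>
     (\<forall>z\<in>S. f differentiable (at z)) \<and> (\<forall>v. Ck_on k (\<lambda>z. frechet_derivative f (at z) v) S)"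

definition laplacian :: "(complex \<Rightarrow> real) \<Rightarrow> complex \<Rightarrow> real" where
  "laplacian f z =
     (\<Sum>b\<in>Basis. frechet_derivative (\<lambda>w. frechet_derivative f (at w) b) (at z) b)"

definition torus_test_function :: "complex \<Rightarrow> complex \<Rightarrow> (complex set \<Rightarrow> real) \<Rightarrow> bool" where
  "torus_test_function \<omega>1 \<omega>2 \<phi> \<longleftrightarrow> (\<forall>k. Ck_on k (\<lambda>z. \<phi> (torus_proj \<omega>1 \<omega>2 z)) UNIV)"

text \<open>
  A solution of \<open>\<Delta>u + \<rho> e\<^sup>u = \<rho> \<delta>\<^sub>0\<close> is a function on the punctured torus that is twice
  continuously differentiable there and satisfies the equation on the whole torus, including the
  puncture, in the sense of distributions. Integrability of \<open>u\<close> and of \<open>e\<^sup>u\<close> is what makes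
  both sides distributions on the torus; the last conjunct is the equation paired with a test
  function \<open>\<phi>\<close>, the pairing with the Dirac measure at the origin being \<open>\<phi>(0)\<close>. Extensionality
  fixes the meaningless value of \<open>u\<close> at the puncture, so that equality of solutions is equality
  of functions on the punctured torus.
\<close>

definition mean_field_solution ::
  "complex \<Rightarrow> complex \<Rightarrow> real \<Rightarrow> (complex set \<Rightarrow> real) \<Rightarrow> bool" where
  "mean_field_solution \<omega>1 \<omega>2 \<rho> u \<longleftrightarrow>
     u \<in> extensional (torus \<omega>1 \<omega>2 - {torus_proj \<omega>1 \<omega>2 0}) \<and>
     Ck_on 2 (\<lambda>z. u (torus_proj \<omega>1 \<omega>2 z)) (- period_lattice \<omega>1 \<omega>2) \<and>
     torus_integrable \<omega>1 \<omega>2 u \<and>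
     torus_integrable \<omega>1 \<omega>2 (\<lambda>p. exp (u p)) \<and>
     (\<forall>\<phi>. torus_test_function \<omega>1 \<omega>2 \<phi> \<longrightarrow>
        (LINT z:fundamental_parallelogram \<omega>1 \<omega>2|lborel.
           u (torus_proj \<omega>1 \<omega>2 z) * laplacian (\<lambda>w. \<phi> (torus_proj \<omega>1 \<omega>2 w)) z)
        + \<rho> * (LINT z:fundamental_parallelogram \<omega>1 \<omega>2|lborel.
           exp (u (torus_proj \<omega>1 \<omega>2 z)) * \<phi> (torus_proj \<omega>1 \<omega>2 z))
        = \<rho> * \<phi> (torus_proj \<omega>1 \<omega>2 0))"

end

theory Submission
  imports Defs "HOL-Complex_Analysis.Complex_Analysis" "HOL-Probability.Probability"
begin

text \<open>
  Existence: there are entire theta functions \<open>A\<close>, \<open>B\<close> that are exchanged by translation by \<open>\<omega>2\<close>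
  and multiplied by 1 and -1 under translation by \<open>\<omega>1\<close>. The pull-back of the spherical metric under
  \<open>B/A\<close> has density \<open>q = (2/\<pi>) |W|\<^sup>2 / (|A|\<^sup>2 + |B|\<^sup>2)\<^sup>2\<close> with \<open>W\<close> the Wronskian, which is periodic
  and vanishes to second order exactly at the lattice, so \<open>U = ln q\<close> solves Liouville's equation.

  Uniqueness: let \<open>v\<close> be another solution. Potential theory with the kernel \<open>U\<close> and the Brezis-Merle
  argument show that \<open>w = v - U\<close> is Lipschitz. The difference of the Schwarzian derivatives
  \<open>v\<^bsub>zz\<^esub> - v\<^bsub>z\<^esub>\<^sup>2/2\<close> of \<open>v\<close> and \<open>U\<close> is elliptic with at most a simple pole, hence a constant, and the
  constant is 0 because \<open>w\<^bsub>z\<^esub>\<close> tends to 0 at the origin. Then \<open>e\<^bsup>-(v+U)/2\<^esup> w\<^bsub>z\<^esub>\<close> is antiholomorphic, hence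
  also a constant \<open>k\<close>. On the closed geodesics through the half periods \<open>w\<close> has a critical point, which
  gives \<open>Re (k \<omega>1) = Re (k \<omega>2) = 0\<close>, so \<open>k = 0\<close>. Thus \<open>w\<close> is locally constant and the equation forces
  \<open>e\<^sup>v = e\<^sup>U\<close>.
\<close>

section \<open>Calculus of \<open>C\<^sup>k\<close> functions on the plane\<close>

text \<open>About a solution nothing is known at the puncture beyond integrability of
  \<open>u\<close> and \<open>e^u\<close>, so its singularity has to be extracted from the weak
  equation. The explicit solution does double duty for this: q has total mass 1 and U behaves like 2
  ln |z| at 0, so \<Delta>U = 4 pi (\<delta>_0 - q) on the torus. Hence U serves as a Green function
  with q as background density, and its regularisations ln (q + \<epsilon>) are smooth periodic test
  functions.

  The factor 2/pi in q is forced: ln |W|^2 is harmonic off the lattice and \<Delta> ln (|A|^2 +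
  |B|^2) = 4 |W|^2 / (|A|^2 + |B|^2)^2, so \<Delta> ln q = -8 |W|^2 / (|A|^2 + |B|^2)^2, which has
  to equal -4 pi q.

  Boundedness of w_z is what removes the double poles from the difference of the Schwarzians. That
  an elliptic function with at most one simple pole per cell is constant is then used three times:
  to identify the Wronskian, for the Schwarzians, and for k. Since \<open>v\<close> is only twice
  differentiable, holomorphy of its Schwarzian and bounds on second derivatives are obtained in
  integrated form, by local primitives and by averages over circles.\<close>

abbreviation dird :: "complex \<Rightarrow> (complex \<Rightarrow> real) \<Rightarrow> complex \<Rightarrow> real" where
  "dird v f z \<equiv> frechet_derivative f (at z) v"

lemma laplacian_eq: "laplacian f z = dird 1 (dird 1 f) z + dird \<i> (dird \<i> f) z"
  by (simp add: laplacian_def Basis_complex_def)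

lemma dird_eqI: "(f has_derivative f') (at z) \<Longrightarrow> dird v f z = f' v"
  by (metis frechet_derivative_at)

lemma has_derivative_dird: "f differentiable (at z) \<Longrightarrow> (f has_derivative (\<lambda>v. dird v f z)) (at z)"
  by (simp add: frechet_derivative_works)

lemma dird_linear: "f differentiable (at z) \<Longrightarrow> linear (\<lambda>v. dird v f z)"
  using has_derivative_dird has_derivative_linear by blast

lemma dird_Re_Im:
  assumes "f differentiable (at z)"
  shows "dird v f z = Re v * dird 1 f z + Im v * dird \<i> f z"
proof -
  interpret linear "\<lambda>v. dird v f z" by (rule dird_linear[OF assms])
  have "v = Re v *\<^sub>R 1 + Im v *\<^sub>R \<i>" by (simp add: complex_eq_iff)
  then show ?thesis by (metis add scale real_scaleR_def)
qed

lemma dird_cong_open: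
  assumes "open S" "z \<in> S" "\<And>w. w \<in> S \<Longrightarrow> f w = g w"
  shows "dird v f z = dird v g z"
proof -
  have "(f has_derivative h) (at z) \<longleftrightarrow> (g has_derivative h) (at z)" for h
    using assms has_derivative_transform_within_open by metis
  then show ?thesis unfolding frechet_derivative_def by simp
qed

lemma differentiable_cong_open:
  assumes "open S" "z \<in> S" "\<And>w. w \<in> S \<Longrightarrow> f w = g w"
  shows "f differentiable (at z) \<longleftrightarrow> g differentiable (at z)"
  unfolding differentiable_def using assms has_derivative_transform_within_open by metis

lemma laplacian_cong_open:
  assumes "open S" "z \<in> S" "\<And>w. w \<in> S \<Longrightarrow> f w = g w"
  shows "laplacian f z = laplacian g z"
proof -
  have "dird v (dird v f) z = dird v (dird v g) z" for v
    by (rule dird_cong_open[OF assms(1,2)]) (rule dird_cong_open[OF assms(1) _ assms(3)])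
  then show ?thesis by (simp add: laplacian_eq)
qed

lemma dird_line:
  assumes "f differentiable (at (a + of_real t * v))"
  shows "((\<lambda>t. f (a + of_real t * v)) has_real_derivative dird v f (a + of_real t * v)) (at t)"
proof -
  have *: "((\<lambda>t. a + complex_of_real t * v) has_derivative (\<lambda>h. of_real h * v)) (at t)"
    by (auto intro!: derivative_eq_intros)
  have "((\<lambda>t. f (a + of_real t * v)) has_derivative (\<lambda>h. dird (of_real h * v) f (a + of_real t * v))) (at t)"
    using diff_chain_at[OF * has_derivative_dird[OF assms]] by (simp add: o_def)
  moreover have "dird (of_real h * v) f (a + of_real t * v) = dird v f (a + of_real t * v) * h" for h
  proof -
    interpret linear "\<lambda>w. dird w f (a + of_real t * v)" by (rule dird_linear[OF assms])
    show ?thesis using scale[of h v] by (simp add: scaleR_conv_of_real)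
  qed
  ultimately show ?thesis by (simp add: has_field_derivative_def mult_commute_abs)
qed

lemma Ck_on_cong:
  assumes "open S" "\<And>z. z \<in> S \<Longrightarrow> f z = g z"
  shows "Ck_on k f S \<longleftrightarrow> Ck_on k g S"
  using assms(2)
proof (induction k arbitrary: f g)
  case 0
  then show ?case by (simp cong: continuous_on_cong)
next
  case (Suc k)
  have "Ck_on k (dird v f) S \<longleftrightarrow> Ck_on k (dird v g) S" for v
    by (rule Suc.IH) (rule dird_cong_open[OF assms(1) _ Suc.prems])
  moreover have "f differentiable (at z) \<longleftrightarrow> g differentiable (at z)" if "z \<in> S" for z
    by (rule differentiable_cong_open[OF assms(1) that Suc.prems])
  ultimately show ?case by simp
qed

lemma Ck_on_subset: "Ck_on k f S \<Longrightarrow> T \<subseteq> S \<Longrightarrow> Ck_on k f T"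
  by (induction k arbitrary: f) (auto intro: continuous_on_subset)

lemma Ck_on_Un:
  assumes "open S" "open T" "Ck_on k f S" "Ck_on k f T"
  shows "Ck_on k f (S \<union> T)"
  using assms(3,4) by (induction k arbitrary: f) (use assms(1,2) in \<open>auto intro: continuous_on_open_Un\<close>)

lemma Ck_on_SucD: "Ck_on (Suc k) f S \<Longrightarrow> Ck_on k f S"
proof (induction k arbitrary: f)
  case 0
  then show ?case
    by (auto intro!: continuous_at_imp_continuous_on simp: differentiable_imp_continuous_within)
next
  case (Suc k)
  then show ?case by auto
qed

lemma Ck_on_le: "Ck_on k f S \<Longrightarrow> j \<le> k \<Longrightarrow> Ck_on j f S"
  by (induction k) (auto simp del: Ck_on.simps(2) simp: le_Suc_eq dest: Ck_on_SucD)

lemma Ck_on_imp_continuous: "Ck_on k f S \<Longrightarrow> continuous_on S f"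
  using Ck_on_le[of k f S 0] by simp

lemma Ck_on_const [intro]: "Ck_on k (\<lambda>z. c) S"
  by (induction k arbitrary: c) auto

lemma Ck_on_add:
  assumes "open S" "Ck_on k f S" "Ck_on k g S"
  shows "Ck_on k (\<lambda>z. f z + g z) S"
  using assms(2,3)
proof (induction k arbitrary: f g)
  case 0
  then show ?case by (auto intro: continuous_intros)
next
  case (Suc k)
  have "dird v (\<lambda>z. f z + g z) z = dird v f z + dird v g z" if "z \<in> S" for v z
    by (rule dird_eqI) (use Suc.prems that in \<open>auto intro!: derivative_eq_intros has_derivative_dird\<close>)
  then show ?case using Suc
    by (auto simp: Ck_on_cong[OF assms(1), where f = "\<lambda>z. dird _ (\<lambda>z. f z + g z) z"])
qed

lemma dird_mult:
  fixes f g :: "complex \<Rightarrow> real"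
  assumes "f differentiable (at z)" "g differentiable (at z)"
  shows "dird v (\<lambda>z. f z * g z) z = f z * dird v g z + dird v f z * g z"
  by (rule dird_eqI) (auto intro!: derivative_eq_intros has_derivative_dird assms)

lemma Ck_on_mult:
  assumes "open S" "Ck_on k f S" "Ck_on k g S"
  shows "Ck_on k (\<lambda>z. f z * g z) S"
  using assms(2,3)
proof (induction k arbitrary: f g)
  case 0
  then show ?case by (auto intro: continuous_intros)
next
  case (Suc k)
  have "Ck_on k (\<lambda>z. f z * dird v g z + dird v f z * g z) S" for v
    using Suc.prems Ck_on_SucD[OF Suc.prems(1)] Ck_on_SucD[OF Suc.prems(2)]
    by (auto intro!: Ck_on_add[OF assms(1)] Suc.IH)
  moreover have "dird v (\<lambda>z. f z * g z) z = f z * dird v g z + dird v f z * g z" if "z \<in> S" for v z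
    using Suc.prems that by (auto intro!: dird_mult)
  ultimately show ?case using Suc.prems
    by (auto simp: Ck_on_cong[OF assms(1), where f = "\<lambda>z. dird _ (\<lambda>z. f z * g z) z"])
qed

lemma Ck_on_cmult: "open S \<Longrightarrow> Ck_on k f S \<Longrightarrow> Ck_on k (\<lambda>z. c * f z) S"
  by (rule Ck_on_mult) auto

lemma Ck_on_diff: "open S \<Longrightarrow> Ck_on k f S \<Longrightarrow> Ck_on k g S \<Longrightarrow> Ck_on k (\<lambda>z. f z - g z) S"
  using Ck_on_add[of S k f "\<lambda>z. (-1) * g z"] Ck_on_cmult[of S k g "-1"] by simp

section \<open>Compositions with smooth functions of one real variable\<close>

lemma dird_compose:
  fixes f :: "complex \<Rightarrow> real" and F :: "real \<Rightarrow> real"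
  assumes "f differentiable (at z)" "(F has_real_derivative d) (at (f z))"
  shows "((\<lambda>z. F (f z)) has_derivative (\<lambda>v. d * dird v f z)) (at z)"
    and "dird v (\<lambda>z. F (f z)) z = d * dird v f z"
proof -
  show "((\<lambda>z. F (f z)) has_derivative (\<lambda>v. d * dird v f z)) (at z)"
    using diff_chain_at[OF has_derivative_dird[OF assms(1)], of F "(*) d"] assms(2)
    by (simp add: has_field_derivative_def o_def)
  then show "dird v (\<lambda>z. F (f z)) z = d * dird v f z" by (rule dird_eqI)
qed

text \<open>The outer function comes with all its derivatives, as a sequence in which
  \<open>F (Suc j)\<close> is the derivative of \<open>F j\<close>. With \<open>j\<close> arbitrary,
  the induction on \<open>k\<close> needs only the product rule. Logarithm, reciprocal, exponential
  and the cutoff function are all instances.\<close>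

lemma Ck_on_compose:
  fixes F :: "nat \<Rightarrow> real \<Rightarrow> real"
  assumes "open S" and F: "\<And>j x. x \<in> I \<Longrightarrow> (F j has_real_derivative F (Suc j) x) (at x)"
    and "Ck_on k f S" "\<And>z. z \<in> S \<Longrightarrow> f z \<in> I"
  shows "Ck_on k (\<lambda>z. F j (f z)) S"
  using assms(3)
proof (induction k arbitrary: j)
  case 0
  have "continuous_on I (F j)" for j
    using F by (meson continuous_at_imp_continuous_on DERIV_isCont)
  with 0 assms(4) show ?case by (auto intro: continuous_on_compose2)
next
  case (Suc k)
  have "Ck_on k (\<lambda>z. F (Suc j) (f z) * dird v f z) S" for v
    by (rule Ck_on_mult[OF assms(1) Suc.IH[OF Ck_on_SucD[OF Suc.prems]]]) (use Suc.prems in auto)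
  moreover have "dird v (\<lambda>z. F j (f z)) z = F (Suc j) (f z) * dird v f z"
    "(\<lambda>z. F j (f z)) differentiable (at z)" if "z \<in> S" for v z
    using dird_compose[of f z "F j" "F (Suc j) (f z)"] F[OF assms(4)[OF that]] Suc.prems that
    by (auto simp: differentiable_def)
  ultimately show ?case
    by (auto simp: Ck_on_cong[OF assms(1), where f = "\<lambda>z. dird _ (\<lambda>z. F j (f z)) z"])
qed

text \<open>The \<open>j\<close>-th derivative of ln in closed form. Index 1 is the reciprocal, so
  the same sequence also serves for quotients.\<close>

definition ln_deriv :: "nat \<Rightarrow> real \<Rightarrow> real" where
  "ln_deriv j x = (case j of 0 \<Rightarrow> ln x | Suc i \<Rightarrow> (-1) ^ i * fact i / x ^ Suc i)"

lemma ln_deriv_has_derivative: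
  assumes "x \<in> {0<..}"
  shows "(ln_deriv j has_real_derivative ln_deriv (Suc j) x) (at x)"
proof (cases j)
  case 0
  have "ln_deriv 0 = ln" by (auto simp: ln_deriv_def)
  then show ?thesis using assms 0 by (auto simp: ln_deriv_def intro!: derivative_eq_intros)
next
  case (Suc i)
  have eq: "ln_deriv (Suc i) = (\<lambda>x. (-1) ^ i * fact i / x ^ Suc i)" by (auto simp: ln_deriv_def)
  have "((\<lambda>x. (-1) ^ i * fact i / x ^ Suc i) has_real_derivative
     - ((-1) ^ i * fact i * (real (Suc i) * x ^ i)) / (x ^ Suc i * x ^ Suc i)) (at x)"
    using assms by (auto intro!: derivative_eq_intros simp del: power_Suc of_nat_Suc)
  also have "- ((-1) ^ i * fact i * (real (Suc i) * x ^ i)) / (x ^ Suc i * x ^ Suc i) = ln_deriv (Suc (Suc i)) x"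
    using assms by (simp add: ln_deriv_def divide_simps)
  finally show ?thesis unfolding Suc eq .
qed

lemma Ck_on_ln:
  assumes "open S" "Ck_on k f S" "\<And>z. z \<in> S \<Longrightarrow> f z > 0"
  shows "Ck_on k (\<lambda>z. ln (f z)) S"
  using Ck_on_compose[of S "{0<..}" ln_deriv k f 0] ln_deriv_has_derivative assms
  by (simp add: ln_deriv_def)

lemma Ck_on_divide:
  assumes "open S" "Ck_on k f S" "Ck_on k g S" "\<And>z. z \<in> S \<Longrightarrow> g z > 0"
  shows "Ck_on k (\<lambda>z. f z / g z) S"
proof -
  have "Ck_on k (\<lambda>z. ln_deriv 1 (g z)) S"
    by (rule Ck_on_compose[of S "{0<..}" ln_deriv k g 1]) (use assms ln_deriv_has_derivative in auto)
  from Ck_on_mult[OF assms(1,2) this] show ?thesis by (simp add: ln_deriv_def)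
qed

lemma Ck_on_exp:
  assumes "open S" "Ck_on k f S"
  shows "Ck_on k (\<lambda>z. exp (f z)) S"
  using Ck_on_compose[OF assms(1) _ assms(2), of UNIV "\<lambda>_. exp" 0] by (auto simp: DERIV_exp)

lemma dird_Re_holomorphic:
  assumes "F holomorphic_on S" "open S" "z \<in> S"
  shows "((\<lambda>z. Re (F z)) has_derivative (\<lambda>v. Re (deriv F z * v))) (at z)"
    and "dird v (\<lambda>z. Re (F z)) z = Re (deriv F z * v)"
proof -
  have "(F has_field_derivative deriv F z) (at z)"
    using assms holomorphic_derivI by blast
  then show *: "((\<lambda>z. Re (F z)) has_derivative (\<lambda>v. Re (deriv F z * v))) (at z)"
    unfolding has_field_derivative_def by (rule has_derivative_Re)
  then show "dird v (\<lambda>z. Re (F z)) z = Re (deriv F z * v)" by (rule dird_eqI)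
qed

text \<open>The derivative of Re F in direction v is Re (F' v), again the real part of a holomorphic
  function, so the induction runs over F.\<close>

lemma Ck_on_Re_holomorphic:
  assumes "open S" "F holomorphic_on S"
  shows "Ck_on k (\<lambda>z. Re (F z)) S"
  using assms(2)
proof (induction k arbitrary: F)
  case 0
  then show ?case by (auto intro!: continuous_intros holomorphic_on_imp_continuous_on)
next
  case (Suc k)
  have "Ck_on k (\<lambda>z. Re (deriv F z * v)) S" for v
    by (rule Suc.IH) (auto intro!: holomorphic_intros Suc.prems assms)
  moreover have "(\<lambda>z. Re (F z)) differentiable (at z)" if "z \<in> S" for z
    using dird_Re_holomorphic(1)[OF Suc.prems assms(1) that] by (auto simp: differentiable_def)
  ultimately show ?case
    using dird_Re_holomorphic(2)[OF Suc.prems assms(1)]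
    by (auto simp: Ck_on_cong[OF assms(1), where f = "\<lambda>z. dird _ (\<lambda>z. Re (F z)) z"])
qed

lemma Ck_on_norm_square:
  assumes "open S" "F holomorphic_on S"
  shows "Ck_on k (\<lambda>z. (cmod (F z))\<^sup>2) S"
proof -
  have "(cmod (F z))\<^sup>2 = Re (F z) * Re (F z) + Re (- \<i> * F z) * Re (- \<i> * F z)" for z
    by (simp only: cmod_power2) (simp add: power2_eq_square)
  then show ?thesis
    by (simp only:)
       (intro Ck_on_add Ck_on_mult Ck_on_Re_holomorphic assms holomorphic_intros)
qed

lemma dird_affine:
  assumes "f differentiable (at (a + c * z))"
  shows "((\<lambda>z. f (a + c * z)) has_derivative (\<lambda>v. dird (c * v) f (a + c * z))) (at z)"
    and "dird v (\<lambda>z. f (a + c * z)) z = dird (c * v) f (a + c * z)"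
proof -
  have *: "((\<lambda>z. a + c * z) has_derivative (*) c) (at z)"
    by (auto intro!: derivative_eq_intros)
  show "((\<lambda>z. f (a + c * z)) has_derivative (\<lambda>v. dird (c * v) f (a + c * z))) (at z)"
    using diff_chain_at[OF * has_derivative_dird[OF assms]] by (simp add: o_def)
  then show "dird v (\<lambda>z. f (a + c * z)) z = dird (c * v) f (a + c * z)" by (rule dird_eqI)
qed

lemma Ck_on_affine:
  assumes "open S" "open T" "Ck_on k f S" "\<And>z. z \<in> T \<Longrightarrow> a + c * z \<in> S"
  shows "Ck_on k (\<lambda>z. f (a + c * z)) T"
  using assms(3)
proof (induction k arbitrary: f)
  case 0
  then show ?case using assms(4)
    by (auto intro!: continuous_on_compose2[of S f] continuous_intros)
next
  case (Suc k)
  have "Ck_on k (\<lambda>z. dird (c * v) f (a + c * z)) T" for v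
    by (rule Suc.IH) (use Suc.prems in auto)
  moreover have "dird v (\<lambda>z. f (a + c * z)) z = dird (c * v) f (a + c * z)"
    "(\<lambda>z. f (a + c * z)) differentiable (at z)" if "z \<in> T" for v z
    using dird_affine[of f a c z] Suc.prems assms(4)[OF that] by (auto simp: differentiable_def)
  ultimately show ?case
    by (auto simp: Ck_on_cong[OF assms(2), where f = "\<lambda>z. dird _ (\<lambda>z. f (a + c * z)) z"])
qed

lemma laplacian_affine:
  assumes "open S" "Ck_on 2 f S" "a + c * z \<in> S" "c = 1 \<or> c = -1"
  shows "laplacian (\<lambda>z. f (a + c * z)) z = laplacian f (a + c * z)"
proof -
  have D: "f differentiable (at w)" "dird v f differentiable (at w)" if "w \<in> S" for v w
    using assms(2) that by (auto simp: numeral_2_eq_2)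
  have op: "open ((\<lambda>z. a + c * z) -` S)"
    by (intro open_vimage assms continuous_intros)
  have "dird v (dird v (\<lambda>z. f (a + c * z))) z = dird v (dird v f) (a + c * z)" for v
  proof -
    have "dird v (dird v (\<lambda>z. f (a + c * z))) z = dird v (\<lambda>w. dird (c * v) f (a + c * w)) z"
      by (rule dird_cong_open[OF op]) (use assms in \<open>auto intro!: dird_affine D\<close>)
    also have "\<dots> = dird (c * v) (dird (c * v) f) (a + c * z)"
      by (rule dird_affine) (rule D[OF assms(3)])
    also have "\<dots> = dird v (dird v f) (a + c * z)"
    proof (cases "c = 1")
      case False
      then have c: "c = -1" using assms(4) by simp
      have m: "dird (- v) f w = - dird v f w" if "w \<in> S" for w
        using dird_Re_Im[OF D(1)[OF that], of v] dird_Re_Im[OF D(1)[OF that], of "- v"] by simp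
      have "dird (- v) (dird (- v) f) (a - z) = dird (- v) (\<lambda>w. - dird v f w) (a - z)"
        by (rule dird_cong_open[OF assms(1)]) (use assms c m in auto)
      also have "\<dots> = - dird (- v) (dird v f) (a - z)"
        by (rule dird_eqI) (use assms c in \<open>auto intro!: derivative_eq_intros has_derivative_dird D\<close>)
      also have "\<dots> = dird v (dird v f) (a - z)"
        using dird_Re_Im[of "dird v f" "a - z" v] dird_Re_Im[of "dird v f" "a - z" "- v"] D(2)[of "a - z" v]
          assms(3) c by simp
      finally show ?thesis using c by simp
    qed auto
    finally show ?thesis .
  qed
  then show ?thesis by (simp add: laplacian_eq)
qed

lemma laplacian_ln:
  assumes "open S" "Ck_on 2 f S" "z \<in> S" "\<And>z. z \<in> S \<Longrightarrow> f z > 0"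
  shows "laplacian (\<lambda>z. ln (f z)) z = laplacian f z / f z - ((dird 1 f z)\<^sup>2 + (dird \<i> f z)\<^sup>2) / (f z)\<^sup>2"
proof -
  have D: "f differentiable (at w)" "dird v f differentiable (at w)" if "w \<in> S" for v w
    using assms(2) that by (auto simp: numeral_2_eq_2)
  have "dird v (dird v (\<lambda>z. ln (f z))) z = dird v (dird v f) z / f z - (dird v f z)\<^sup>2 / (f z)\<^sup>2" for v
  proof -
    have "dird v (dird v (\<lambda>z. ln (f z))) z = dird v (\<lambda>w. inverse (f w) * dird v f w) z"
      by (rule dird_cong_open[OF assms(1,3)])
        (use assms in \<open>auto intro!: dird_compose D DERIV_ln\<close>)
    also have "\<dots> = inverse (f z) * dird v (dird v f) z + dird v (\<lambda>w. inverse (f w)) z * dird v f z"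
      using assms by (intro dird_mult D) (auto intro!: differentiable_inverse D simp: less_imp_neq[symmetric])
    also have "dird v (\<lambda>w. inverse (f w)) z = - (inverse (f z) ^ Suc (Suc 0)) * dird v f z"
      using assms(3,4) by (intro dird_compose D DERIV_inverse) (auto simp: less_imp_neq[symmetric])
    finally show ?thesis by (simp add: field_simps power2_eq_square)
  qed
  then show ?thesis by (simp add: laplacian_eq add_divide_distrib)
qed

text \<open>The mean value theorem is applied twice: in direction \<open>v\<close> to the increment
  of \<open>f\<close> along \<open>h w\<close>, then in direction \<open>w\<close> to the
  \<open>v\<close>-derivative of \<open>f\<close>.\<close>

lemma mixed_difference:
  assumes "Ck_on 2 f S" "h > 0" and "\<And>s t. 0 \<le> s \<Longrightarrow> s \<le> h \<Longrightarrow> 0 \<le> t \<Longrightarrow> t \<le> h \<Longrightarrow> z + of_real s * v + of_real t * w \<in> S"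
  obtains s t where "0 \<le> s" "s \<le> h" "0 \<le> t" "t \<le> h"
    "f (z + of_real h * v + of_real h * w) - f (z + of_real h * v) - f (z + of_real h * w) + f z
      = h\<^sup>2 * dird w (dird v f) (z + of_real s * v + of_real t * w)"
proof -
  have D: "f differentiable (at w)" "dird v f differentiable (at w)" if "w \<in> S" for v w
    using assms(1) that by (auto simp: numeral_2_eq_2)
  let ?\<phi> = "\<lambda>s. f (z + of_real h * w + of_real s * v) - f (z + of_real s * v)"
  have in1: "z + of_real h * w + of_real s * v \<in> S" "z + of_real s * v \<in> S" if "0 \<le> s" "s \<le> h" for s
    using assms(3)[of s h] assms(3)[of s 0] assms(2) that by (auto simp: algebra_simps)
  have "(?\<phi> has_real_derivative dird v f (z + of_real h * w + of_real s * v) - dird v f (z + of_real s * v)) (at s)"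
    if "0 \<le> s" "s \<le> h" for s
    using in1[OF that] by (intro DERIV_diff dird_line D)
  from MVT2[OF assms(2) this] obtain s where s: "0 < s" "s < h"
    "?\<phi> h - ?\<phi> 0 = h * (dird v f (z + of_real h * w + of_real s * v) - dird v f (z + of_real s * v))"
    by auto
  have "((\<lambda>t. dird v f (z + of_real s * v + of_real t * w)) has_real_derivative dird w (dird v f) (z + of_real s * v + of_real t * w)) (at t)"
    if "0 \<le> t" "t \<le> h" for t
    using assms(3)[of s t] s that by (intro dird_line D) auto
  from MVT2[OF assms(2) this] obtain t where t: "0 < t" "t < h"
    "dird v f (z + of_real s * v + of_real h * w) - dird v f (z + of_real s * v)
      = h * dird w (dird v f) (z + of_real s * v + of_real t * w)"
    by auto
  show ?thesis
    by (rule that[of s t]) (use s t in \<open>auto simp: algebra_simps power2_eq_square\<close>)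
qed

text \<open>One and the same second difference is \<open>h^2\<close> times either mixed derivative,
  taken at points of a small parallelogram at \<open>z\<close>. Continuity of both derivatives at
  \<open>z\<close> then excludes a gap, with \<open>e\<close> as half of the supposed gap.\<close>

lemma dird_commute:
  assumes "open S" "Ck_on 2 f S" "z \<in> S"
  shows "dird w (dird v f) z = dird v (dird w f) z"
proof (rule ccontr)
  assume neq: "dird w (dird v f) z \<noteq> dird v (dird w f) z"
  define e where "e = \<bar>dird w (dird v f) z - dird v (dird w f) z\<bar> / 2"
  have e: "e > 0" using neq by (simp add: e_def)
  have cont: "(dird b (dird a f) \<longlongrightarrow> dird b (dird a f) z) (nhds z)" for a b
  proof -
    have "continuous_on S (dird b (dird a f))" using assms(2) by (auto simp: numeral_2_eq_2)
    then have "isCont (dird b (dird a f)) z" using assms continuous_on_eq_continuous_at by blast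
    then show ?thesis unfolding isCont_def by (rule tendsto_at_iff_tendsto_nhds[THEN iffD1])
  qed
  have "\<forall>\<^sub>F x in nhds z. x \<in> S \<and> dist (dird w (dird v f) x) (dird w (dird v f) z) < e
      \<and> dist (dird v (dird w f) x) (dird v (dird w f) z) < e"
    using cont e assms
    by (intro eventually_conj tendstoD) (auto simp: eventually_nhds)
  then obtain d where d: "d > 0" and dd: "\<And>x. dist x z < d \<Longrightarrow> x \<in> S \<and> dist (dird w (dird v f) x) (dird w (dird v f) z) < e
      \<and> dist (dird v (dird w f) x) (dird v (dird w f) z) < e"
    unfolding eventually_nhds_metric by blast
  define h where "h = d / (cmod v + cmod w + 1) / 2"
  have h: "h > 0" using d by (auto simp: h_def intro!: divide_pos_pos add_nonneg_pos)
  have near: "dist (z + of_real s * a + of_real t * b) z < d"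
    if "0 \<le> s" "s \<le> h" "0 \<le> t" "t \<le> h" "{a,b} = {v,w}" for s t a b
  proof -
    have "dist (z + of_real s * a + of_real t * b) z \<le> s * cmod a + t * cmod b"
      using norm_triangle_ineq[of "of_real s * a" "of_real t * b"] that by (simp add: dist_norm norm_mult)
    also have "\<dots> \<le> h * cmod a + h * cmod b" using that by (intro add_mono mult_right_mono) auto
    also have "\<dots> = h * (cmod v + cmod w)"
      using that(5) by (auto simp: doubleton_eq_iff algebra_simps)
    also have "\<dots> < h * ((cmod v + cmod w + 1) * 2)"
    proof -
      have "cmod v + cmod w < (cmod v + cmod w + 1) * 2" by (smt (verit) norm_ge_zero)
      then show ?thesis using h by simp
    qed
    also have "\<dots> = d"
    proof -
      have "cmod v + cmod w + 1 \<noteq> 0" by (smt (verit) norm_ge_zero)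
      then show ?thesis by (simp add: h_def field_simps)
    qed
    finally show ?thesis .
  qed
  obtain s t where st: "0 \<le> s" "s \<le> h" "0 \<le> t" "t \<le> h"
    "f (z + of_real h * v + of_real h * w) - f (z + of_real h * v) - f (z + of_real h * w) + f z
      = h\<^sup>2 * dird w (dird v f) (z + of_real s * v + of_real t * w)"
    by (rule mixed_difference[OF assms(2) h, of z v w]) (use near dd in auto)
  obtain s' t' where st': "0 \<le> s'" "s' \<le> h" "0 \<le> t'" "t' \<le> h"
    "f (z + of_real h * w + of_real h * v) - f (z + of_real h * w) - f (z + of_real h * v) + f z
      = h\<^sup>2 * dird v (dird w f) (z + of_real s' * w + of_real t' * v)"
    by (rule mixed_difference[OF assms(2) h, of z w v]) (use near dd in \<open>auto simp: insert_commute\<close>)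
  have "h\<^sup>2 * dird w (dird v f) (z + of_real s * v + of_real t * w) = h\<^sup>2 * dird v (dird w f) (z + of_real s' * w + of_real t' * v)"
    using st(5) st'(5) by (simp add: algebra_simps)
  then have "dird w (dird v f) (z + of_real s * v + of_real t * w) = dird v (dird w f) (z + of_real s' * w + of_real t' * v)"
    using h by simp
  moreover have "\<bar>dird w (dird v f) (z + of_real s * v + of_real t * w) - dird w (dird v f) z\<bar> < e"
    using dd[OF near[OF st(1-4)]] by (auto simp: dist_real_def)
  moreover have "\<bar>dird v (dird w f) (z + of_real s' * w + of_real t' * v) - dird v (dird w f) z\<bar> < e"
    using dd[OF near[OF st'(1-4)]] by (auto simp: dist_real_def insert_commute)
  ultimately show False unfolding e_def by (smt (verit) field_sum_of_halves)
qed

section \<open>Lattices and elliptic functions\<close>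

text \<open>The number \<open>Im (cnj \<omega>1 * \<omega>2)\<close> is the signed area of the
  period parallelogram. Its being nonzero expresses linear independence over the reals, and its sign
  is the orientation of the basis, which matters for the theta functions.\<close>

locale lattice =
  fixes \<omega>1 \<omega>2 :: complex
  assumes nondegenerate: "Im (cnj \<omega>1 * \<omega>2) \<noteq> 0"
begin

abbreviation "\<Lambda> \<equiv> period_lattice \<omega>1 \<omega>2"
abbreviation "P \<equiv> fundamental_parallelogram \<omega>1 \<omega>2"

text \<open>Cramer's rule for the real coordinates with respect to the basis
  \<open>\<omega>1\<close>, \<open>\<omega>2\<close>.\<close>

definition coord1 :: "complex \<Rightarrow> real" where "coord1 z = Im (cnj z * \<omega>2) / Im (cnj \<omega>1 * \<omega>2)"
definition coord2 :: "complex \<Rightarrow> real" where "coord2 z = Im (cnj \<omega>1 * z) / Im (cnj \<omega>1 * \<omega>2)"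

lemma coord_decomp: "of_real (coord1 z) * \<omega>1 + of_real (coord2 z) * \<omega>2 = z"
proof -
  define d where "d = Re \<omega>1 * Im \<omega>2 - Im \<omega>1 * Re \<omega>2"
  have d: "d \<noteq> 0" using nondegenerate by (simp add: d_def)
  have c: "coord1 z = (Re z * Im \<omega>2 - Im z * Re \<omega>2) / d" "coord2 z = (Re \<omega>1 * Im z - Im \<omega>1 * Re z) / d"
    by (simp_all add: coord1_def coord2_def d_def)
  have "(Re z * Im \<omega>2 - Im z * Re \<omega>2) * Re \<omega>1 + (Re \<omega>1 * Im z - Im \<omega>1 * Re z) * Re \<omega>2 = Re z * d"
    "(Re z * Im \<omega>2 - Im z * Re \<omega>2) * Im \<omega>1 + (Re \<omega>1 * Im z - Im \<omega>1 * Re z) * Im \<omega>2 = Im z * d"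
    by (simp_all add: d_def algebra_simps)
  then show ?thesis using d
    by (simp add: complex_eq_iff c add_divide_distrib[symmetric] divide_eq_eq)
qed

lemma coord_add: "coord1 (z + w) = coord1 z + coord1 w" "coord2 (z + w) = coord2 z + coord2 w"
  by (simp_all add: coord1_def coord2_def add_divide_distrib diff_divide_distrib algebra_simps)

lemma coord_scale: "coord1 (of_real r * z) = r * coord1 z" "coord2 (of_real r * z) = r * coord2 z"
  by (simp_all add: coord1_def coord2_def add_divide_distrib diff_divide_distrib algebra_simps)

lemma coord_minus: "coord1 (- z) = - coord1 z" "coord2 (- z) = - coord2 z"
  using coord_scale[of "-1" z] by simp_all

lemma coord_diff: "coord1 (z - w) = coord1 z - coord1 w" "coord2 (z - w) = coord2 z - coord2 w"
  using coord_add[of z "-w"] by (simp_all add: coord_minus)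

lemma coord_generators: "coord1 \<omega>1 = 1" "coord1 \<omega>2 = 0" "coord2 \<omega>1 = 0" "coord2 \<omega>2 = 1"
  using nondegenerate by (simp_all add: coord1_def coord2_def field_simps)

lemma coord_combination:
  "coord1 (of_real s * \<omega>1 + of_real t * \<omega>2) = s" "coord2 (of_real s * \<omega>1 + of_real t * \<omega>2) = t"
  by (simp_all add: coord_add coord_scale coord_generators)

lemma continuous_on_coord [continuous_intros]:
  assumes "continuous_on S f"
  shows "continuous_on S (\<lambda>z. coord1 (f z))" "continuous_on S (\<lambda>z. coord2 (f z))"
  unfolding coord1_def coord2_def divide_inverse by (intro continuous_intros assms)+

lemma lattice_iff_coord: "z \<in> \<Lambda> \<longleftrightarrow> coord1 z \<in> \<int> \<and> coord2 z \<in> \<int>"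
proof
  assume "z \<in> \<Lambda>"
  then obtain m n :: int where z: "z = of_int m * \<omega>1 + of_int n * \<omega>2"
    unfolding period_lattice_def by blast
  then have "z = of_real (of_int m) * \<omega>1 + of_real (of_int n) * \<omega>2" by simp
  then show "coord1 z \<in> \<int> \<and> coord2 z \<in> \<int>" by (simp only: coord_combination) auto
next
  assume "coord1 z \<in> \<int> \<and> coord2 z \<in> \<int>"
  then obtain m n :: int where "coord1 z = of_int m" "coord2 z = of_int n"
    by (auto elim!: Ints_cases)
  then have "z = of_int m * \<omega>1 + of_int n * \<omega>2" using coord_decomp[of z] by simp
  then show "z \<in> \<Lambda>" unfolding period_lattice_def by blast
qed

lemma parallelogram_iff_coord: "z \<in> P \<longleftrightarrow> 0 \<le> coord1 z \<and> coord1 z < 1 \<and> 0 \<le> coord2 z \<and> coord2 z < 1"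
  (is "_ = ?R z")
proof -
  have "?R z" if "z \<in> P" using that by (auto simp: fundamental_parallelogram_def coord_combination)
  moreover have "z \<in> P" if "?R z"
    unfolding fundamental_parallelogram_def using coord_decomp[of z, symmetric] that by auto
  ultimately show ?thesis by blast
qed

lemma lattice_add: "z \<in> \<Lambda> \<Longrightarrow> w \<in> \<Lambda> \<Longrightarrow> z + w \<in> \<Lambda>"
  and lattice_minus: "z \<in> \<Lambda> \<Longrightarrow> - z \<in> \<Lambda>"
  and lattice_diff: "z \<in> \<Lambda> \<Longrightarrow> w \<in> \<Lambda> \<Longrightarrow> z - w \<in> \<Lambda>"
  by (simp_all add: lattice_iff_coord coord_add coord_diff coord_minus)

lemma lattice_zero [simp]: "0 \<in> \<Lambda>"
  by (simp add: lattice_iff_coord coord1_def coord2_def)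

lemma lattice_generators: "\<omega>1 \<in> \<Lambda>" "\<omega>2 \<in> \<Lambda>"
  by (simp_all add: lattice_iff_coord coord_generators)

lemma lattice_translate_iff: "w \<in> \<Lambda> \<Longrightarrow> z + w \<in> \<Lambda> \<longleftrightarrow> z \<in> \<Lambda>"
  using lattice_add lattice_diff by (metis add_diff_cancel)

lemma lattice_minus_iff: "- z \<in> \<Lambda> \<longleftrightarrow> z \<in> \<Lambda>"
  using lattice_minus by (metis minus_minus)

lemma closed_lattice: "closed \<Lambda>"
proof -
  have "\<Lambda> = coord1 -` \<int> \<inter> coord2 -` \<int>" by (auto simp: lattice_iff_coord)
  then show ?thesis
    by (simp only:) (intro closed_Int closed_vimage closed_Ints continuous_intros)
qed

lemma open_off_lattice: "open (- \<Lambda>)"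
  using closed_lattice by (simp add: open_Compl)

lemma countable_lattice: "countable \<Lambda>"
proof -
  have "\<Lambda> = (\<lambda>(m::int, n::int). of_int m * \<omega>1 + of_int n * \<omega>2) ` UNIV"
    by (auto simp: period_lattice_def)
  then show ?thesis by (metis countable_image countableI_type)
qed

lemma open_meets_off_lattice:
  assumes "open S" "S \<noteq> {}"
  shows "\<exists>z\<in>S. z \<notin> \<Lambda>"
proof (rule ccontr)
  assume "\<not> (\<exists>z\<in>S. z \<notin> \<Lambda>)"
  then have "S \<subseteq> \<Lambda>" by blast
  moreover obtain x where "x \<in> S" using assms(2) by blast
  with assms(1) obtain r where "r > 0" "ball x r \<subseteq> S" by (rule openE)
  ultimately have "countable (ball x r)" using countable_lattice countable_subset[of "ball x r" \<Lambda>] by simp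
  then show False using uncountable_ball[OF \<open>r > 0\<close>, of x] by simp
qed

lemma connected_off_lattice: "connected (- \<Lambda>)"
  by (rule path_connected_imp_connected, rule path_connected_complement_countable)
     (auto simp: countable_lattice)

lemma coord_bounded:
  obtains C where "C > 0" "\<And>z. \<bar>coord1 z\<bar> \<le> C * cmod z" "\<And>z. \<bar>coord2 z\<bar> \<le> C * cmod z"
proof -
  define C where "C = (cmod \<omega>1 + cmod \<omega>2) / \<bar>Im (cnj \<omega>1 * \<omega>2)\<bar>"
  have "\<omega>1 \<noteq> 0" using nondegenerate by auto
  then have "C > 0" using nondegenerate by (auto simp: C_def intro!: divide_pos_pos add_pos_nonneg)
  moreover have "\<bar>coord1 z\<bar> \<le> C * cmod z" for z
  proof -
    have "\<bar>Im (cnj z * \<omega>2)\<bar> \<le> cmod \<omega>2 * cmod z"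
      using abs_Im_le_cmod[of "cnj z * \<omega>2"] by (simp only: norm_mult complex_mod_cnj mult.commute)
    also have "\<dots> \<le> (cmod \<omega>1 + cmod \<omega>2) * cmod z" by (intro mult_right_mono) auto
    finally show ?thesis unfolding coord1_def C_def abs_divide times_divide_eq_left
      using nondegenerate by (intro divide_right_mono) auto
  qed
  moreover have "\<bar>coord2 z\<bar> \<le> C * cmod z" for z
  proof -
    have "\<bar>Im (cnj \<omega>1 * z)\<bar> \<le> cmod \<omega>1 * cmod z"
      using abs_Im_le_cmod[of "cnj \<omega>1 * z"] by (simp only: norm_mult complex_mod_cnj)
    also have "\<dots> \<le> (cmod \<omega>1 + cmod \<omega>2) * cmod z" by (intro mult_right_mono) auto
    finally show ?thesis unfolding coord2_def C_def abs_divide times_divide_eq_left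
      using nondegenerate by (intro divide_right_mono) auto
  qed
  ultimately show ?thesis using that by blast
qed

lemma reduce_to_parallelogram:
  obtains w where "w \<in> \<Lambda>" "z - w \<in> P"
proof
  let ?w = "of_real (of_int \<lfloor>coord1 z\<rfloor>) * \<omega>1 + of_real (of_int \<lfloor>coord2 z\<rfloor>) * \<omega>2"
  show "?w \<in> \<Lambda>" by (simp only: lattice_iff_coord coord_combination) auto
  show "z - ?w \<in> P"
    by (simp only: parallelogram_iff_coord coord_diff coord_combination) linarith
qed

text \<open>A compact fundamental cell centred at 0, whose only lattice point is 0. It serves for
  extremal arguments and estimates near the puncture, whereas the half-open \<open>P\<close> serves
  for integration.\<close>

definition closed_cell :: "complex set" where
  "closed_cell = (\<lambda>(s, t). of_real s * \<omega>1 + of_real t * \<omega>2) ` ({-1/2..1/2} \<times> {-1/2..1/2})"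

lemma compact_closed_cell: "compact closed_cell"
  unfolding closed_cell_def
  by (intro compact_continuous_image compact_Times)
     (auto intro!: continuous_intros simp: case_prod_beta)

lemma closed_cell_iff_coord: "z \<in> closed_cell \<longleftrightarrow> \<bar>coord1 z\<bar> \<le> 1/2 \<and> \<bar>coord2 z\<bar> \<le> 1/2"
proof
  assume "z \<in> closed_cell"
  then show "\<bar>coord1 z\<bar> \<le> 1/2 \<and> \<bar>coord2 z\<bar> \<le> 1/2"
    unfolding closed_cell_def by (auto simp: coord_combination abs_le_iff)
next
  assume "\<bar>coord1 z\<bar> \<le> 1/2 \<and> \<bar>coord2 z\<bar> \<le> 1/2"
  then show "z \<in> closed_cell"
    unfolding closed_cell_def
    by (intro image_eqI[of _ _ "(coord1 z, coord2 z)"]) (auto simp: coord_decomp)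
qed

lemma closed_cell_lattice: "z \<in> closed_cell \<Longrightarrow> z \<in> \<Lambda> \<Longrightarrow> z = 0"
proof -
  assume z: "z \<in> closed_cell" "z \<in> \<Lambda>"
  then have "coord1 z = 0" "coord2 z = 0"
    using Ints_nonzero_abs_ge1[of "coord1 z"] Ints_nonzero_abs_ge1[of "coord2 z"]
    by (auto simp: lattice_iff_coord closed_cell_iff_coord)
  then show "z = 0" using coord_decomp[of z] by simp
qed

lemma reduce_to_cell:
  obtains w where "w \<in> \<Lambda>" "z - w \<in> closed_cell"
proof
  let ?w = "of_real (of_int (round (coord1 z))) * \<omega>1 + of_real (of_int (round (coord2 z))) * \<omega>2"
  show "?w \<in> \<Lambda>" by (simp only: lattice_iff_coord coord_combination) auto
  show "z - ?w \<in> closed_cell"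
    using of_int_round_abs_le[of "coord1 z"] of_int_round_abs_le[of "coord2 z"]
    by (simp only: closed_cell_iff_coord coord_diff coord_combination) linarith
qed

lemma ball_subset_cell:
  obtains d where "d > 0" "ball 0 d \<subseteq> closed_cell"
proof -
  obtain C where C: "C > 0" "\<And>z. \<bar>coord1 z\<bar> \<le> C * cmod z" "\<And>z. \<bar>coord2 z\<bar> \<le> C * cmod z"
    using coord_bounded by blast
  have "z \<in> closed_cell" if "cmod z < 1 / (2 * C)" for z
  proof -
    have "C * cmod z \<le> 1 / 2" using that C(1) by (simp add: field_simps)
    then show ?thesis using C(2,3)[of z] by (simp add: closed_cell_iff_coord)
  qed
  then show ?thesis using C(1) by (intro that[of "1 / (2 * C)"]) auto
qed

section \<open>Periodic functions and elliptic functions\<close>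

definition periodic :: "(complex \<Rightarrow> 'a) \<Rightarrow> bool" where
  "periodic f \<longleftrightarrow> (\<forall>z. \<forall>w\<in>\<Lambda>. f (z + w) = f z)"

lemma periodicD: "periodic f \<Longrightarrow> w \<in> \<Lambda> \<Longrightarrow> f (z + w) = f z"
  by (auto simp: periodic_def)

lemma periodicD_diff: "periodic f \<Longrightarrow> w \<in> \<Lambda> \<Longrightarrow> f (z - w) = f z"
  using periodicD[of f "- w" z] lattice_minus by simp

text \<open>The type of values is arbitrary, so this also applies to predicates such as "vanishes at
  z", whose invariance survives nonzero multipliers.\<close>

lemma periodic_if_generators:
  assumes 1: "\<And>z. f (z + \<omega>1) = f z" and 2: "\<And>z. f (z + \<omega>2) = f z"
  shows "periodic f"
proof -
  have A: "f (z + of_int m * w) = f z" if "\<And>z. f (z + w) = f z" for z m w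
  proof (induction m rule: int_induct[where k = 0])
    case (step1 i)
    then show ?case using that[of "z + of_int i * w"] by (simp add: algebra_simps)
  next
    case (step2 i)
    then show ?case using that[of "z + of_int (i - 1) * w"] by (simp add: algebra_simps)
  qed simp
  show ?thesis
    unfolding periodic_def period_lattice_def
    using A[OF 1] A[OF 2] by (auto simp: add.assoc[symmetric])
qed

lemma periodic_bounded:
  fixes f :: "complex \<Rightarrow> 'a :: real_normed_vector"
  assumes "periodic f" "continuous_on UNIV f"
  obtains B where "B > 0" "\<And>z. norm (f z) \<le> B"
proof -
  have "compact (f ` closed_cell)"
    by (intro compact_continuous_image compact_closed_cell) (rule continuous_on_subset[OF assms(2)], simp)
  then obtain B where B: "B > 0" "\<And>z. z \<in> closed_cell \<Longrightarrow> norm (f z) \<le> B"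
    using compact_imp_bounded bounded_pos by (metis imageI)
  have "norm (f z) \<le> B" for z
  proof -
    obtain w where "w \<in> \<Lambda>" "z - w \<in> closed_cell" by (rule reduce_to_cell)
    then show ?thesis using B(2)[of "z - w"] periodicD_diff[OF assms(1)] by metis
  qed
  then show ?thesis using that B by blast
qed

text \<open>The limit makes the singularity at 0 removable, and periodicity carries this to every
  lattice point. The extension is entire and periodic, hence bounded, and Liouville's theorem
  applies.\<close>

lemma elliptic_no_pole_constant:
  assumes hol: "f holomorphic_on - \<Lambda>" and per: "\<And>z w. z \<notin> \<Lambda> \<Longrightarrow> w \<in> \<Lambda> \<Longrightarrow> f (z + w) = f z"
    and lim: "((\<lambda>z. z * f z) \<longlongrightarrow> 0) (at 0)"
  shows "\<exists>c. \<forall>z. z \<notin> \<Lambda> \<longrightarrow> f z = c"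
proof -
  obtain d where d: "d > 0" "ball 0 d \<subseteq> closed_cell" by (rule ball_subset_cell)
  have off: "z \<notin> \<Lambda>" if "z \<in> ball 0 d - {0}" for z
    using that d(2) closed_cell_lattice by blast
  have "f holomorphic_on (ball 0 d - {0})"
    by (rule holomorphic_on_subset[OF hol]) (use off in auto)
  then obtain g where g: "g holomorphic_on ball 0 d" "\<And>z. z \<in> ball 0 d - {0} \<Longrightarrow> g z = f z"
    using holomorphic_on_extend_lim[of f "ball 0 d" 0] d lim by (auto simp: interior_open)
  define F where "F z = (if z \<in> \<Lambda> then g 0 else f z)" for z
  have perF: "periodic F"
    unfolding periodic_def using per lattice_translate_iff by (auto simp: F_def)
  have F_near: "F z = g z" if "z \<in> ball 0 d" for z
    using that g(2) off by (cases "z = 0") (auto simp: F_def)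
  have F_at: "F field_differentiable (at z)" for z
  proof (cases "z \<in> \<Lambda>")
    case True
    have "g field_differentiable (at (z - z))"
      using holomorphic_on_imp_differentiable_at[OF g(1) open_ball, of 0] d(1) by simp
    moreover have "(\<lambda>x. x - z) field_differentiable (at z)"
      by (intro field_differentiable_diff field_differentiable_ident field_differentiable_const)
    ultimately have "(\<lambda>x. g (x - z)) field_differentiable (at z)"
      using field_differentiable_compose[of "\<lambda>x. x - z" z g] by (simp add: o_def)
    moreover have "g (x - z) = F x" if "x \<in> ball z d" for x
      using F_near[of "x - z"] periodicD_diff[OF perF True, of x] that by (simp add: dist_norm norm_minus_commute)
    ultimately show ?thesis
      using d(1) has_field_derivative_transform_within_open[of "\<lambda>x. g (x - z)" _ z "ball z d" F]
      unfolding field_differentiable_def by (metis open_ball centre_in_ball)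
  next
    case False
    have "f field_differentiable (at z)"
      using hol False open_off_lattice holomorphic_on_imp_differentiable_at by blast
    then show ?thesis
      using False open_off_lattice has_field_derivative_transform_within_open[of f _ z "- \<Lambda>" F]
      unfolding field_differentiable_def F_def by (metis ComplD ComplI)
  qed
  then have holF: "F holomorphic_on UNIV" by (auto simp: holomorphic_on_def field_differentiable_at_within)
  then obtain B where "\<And>z. norm (F z) \<le> B"
    using periodic_bounded[OF perF holomorphic_on_imp_continuous_on] by metis
  then have "bounded (range F)" by (auto simp: bounded_iff)
  then obtain c where c: "\<And>z. F z = c" using Liouville_theorem[OF holF] by (auto simp: constant_on_def)
  show ?thesis by (rule exI[of _ c]) (use c F_def in metis)
qed

end

text \<open>
  An elliptic function cannot have a single simple pole: after subtracting a constant it is odd,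
  hence vanishes at the half periods, and \<open>E z * E (z + \<omega>1/2)\<close> is then elliptic without poles
  and vanishes at \<open>\<omega>2/2\<close>.
\<close>

theorem (in lattice) elliptic_simple_pole_constant:
  assumes hol: "f holomorphic_on - \<Lambda>" and per: "\<And>z w. z \<notin> \<Lambda> \<Longrightarrow> w \<in> \<Lambda> \<Longrightarrow> f (z + w) = f z"
    and lim: "((\<lambda>z. z\<^sup>2 * f z) \<longlongrightarrow> 0) (at 0)"
  shows "\<exists>c. \<forall>z. z \<notin> \<Lambda> \<longrightarrow> f z = c"
proof -
  obtain d where d: "d > 0" "ball 0 d \<subseteq> closed_cell" by (rule ball_subset_cell)
  have off: "z \<notin> \<Lambda>" if "z \<in> ball 0 d - {0}" for z
    using that d(2) closed_cell_lattice by blast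
  have "(\<lambda>z. z * f z) holomorphic_on (ball 0 d - {0})"
    by (intro holomorphic_intros holomorphic_on_subset[OF hol]) (use off in auto)
  moreover have "((\<lambda>z. (z - 0) * (z * f z)) \<longlongrightarrow> 0) (at 0)"
    using lim by (simp add: power2_eq_square mult.assoc)
  ultimately obtain g where g: "g holomorphic_on ball 0 d" "\<And>z. z \<in> ball 0 d - {0} \<Longrightarrow> g z = z * f z"
    using holomorphic_on_extend_lim[of "\<lambda>z. z * f z" "ball 0 d" 0] d by (auto simp: interior_open)
  have "continuous (at 0) g"
    using g(1) d(1) holomorphic_on_imp_continuous_on continuous_on_eq_continuous_at[of "ball 0 d" g] by auto
  then have "(g \<longlongrightarrow> g 0) (at 0)" by (simp add: isCont_def)
  moreover have "\<forall>\<^sub>F z in at 0. g z = z * f z"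
    using eventually_at_in_open[of "ball 0 d" 0] d(1) g(2) by (auto elim: eventually_mono)
  ultimately have lim1: "((\<lambda>z. z * f z) \<longlongrightarrow> g 0) (at 0)"
    by (rule Lim_transform_eventually)
  have lim2: "((\<lambda>z. (- z) * f (- z)) \<longlongrightarrow> g 0) (at 0)"
  proof -
    have "filterlim uminus (at 0) (at (0::complex))"
      by (auto simp: filterlim_at intro!: tendsto_eq_intros eventually_at_filter[THEN iffD2])
    from filterlim_compose[OF lim1 this] show ?thesis .
  qed
  \<comment> \<open>The residue of \<open>f (- z)\<close> at 0 is the negative of that of
    \<open>f z\<close>, so the sum has no pole.\<close>
  have "\<exists>c. \<forall>z. z \<notin> \<Lambda> \<longrightarrow> f z + f (- z) = c"
  proof (rule elliptic_no_pole_constant)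
    have "(\<lambda>z. f (- z)) holomorphic_on - \<Lambda>"
      by (intro holomorphic_on_compose_gen[OF _ hol, unfolded o_def] holomorphic_intros) (auto simp: lattice_minus_iff)
    then show "(\<lambda>z. f z + f (- z)) holomorphic_on - \<Lambda>" by (intro holomorphic_intros hol)
    show "f (z + w) + f (- (z + w)) = f z + f (- z)" if "z \<notin> \<Lambda>" "w \<in> \<Lambda>" for z w
      using per[OF that] per[of "- z" "- w"] that by (simp add: lattice_minus_iff)
    have "((\<lambda>z. z * f z - (- z) * f (- z)) \<longlongrightarrow> g 0 - g 0) (at 0)"
      by (intro tendsto_intros lim1 lim2)
    then show "((\<lambda>z. z * (f z + f (- z))) \<longlongrightarrow> 0) (at 0)" by (simp add: algebra_simps)
  qed
  then obtain c where c: "\<And>z. z \<notin> \<Lambda> \<Longrightarrow> f z + f (- z) = c" by blast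
  define E where "E z = f z - c / 2" for z
  have holE: "E holomorphic_on - \<Lambda>" unfolding E_def by (intro holomorphic_intros hol)
  have perE: "E (z + w) = E z" if "z \<notin> \<Lambda>" "w \<in> \<Lambda>" for z w
    using per that by (simp add: E_def)
  have odd: "E (- z) = - E z" if "z \<notin> \<Lambda>" for z
    unfolding E_def using c[OF that, symmetric] by (simp add: field_simps)
  have half: "E (w / 2) = 0" if "w \<in> \<Lambda>" "w / 2 \<notin> \<Lambda>" for w
  proof -
    have "E (w / 2) = E (- (w / 2) + w)" by (simp add: field_simps)
    also have "\<dots> = - E (w / 2)" using perE[of "- (w / 2)" w] odd that by (simp add: lattice_minus_iff)
    finally show ?thesis by (simp add: eq_neg_iff_add_eq_0)
  qed
  have halfoff: "\<omega>1 / 2 \<notin> \<Lambda>" "\<omega>2 / 2 \<notin> \<Lambda>"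
  proof -
    have "(1/2 :: real) \<notin> \<int>" using fraction_not_in_Ints[of 2 1, where 'a = real] by simp
    moreover have "coord1 (\<omega>1 / 2) = 1/2" "coord2 (\<omega>2 / 2) = 1/2"
      using coord_scale[of "1/2" \<omega>1] coord_scale[of "1/2" \<omega>2] by (simp_all add: coord_generators)
    ultimately show "\<omega>1 / 2 \<notin> \<Lambda>" "\<omega>2 / 2 \<notin> \<Lambda>" by (metis lattice_iff_coord)+
  qed
  \<comment> \<open>Translation by \<open>\<omega>1 / 2\<close> exchanges the two factors of
    \<open>E z * E (z + \<omega>1 / 2)\<close>, so the product is elliptic for the finer lattice
    generated by \<open>\<omega>1 / 2\<close> and \<open>\<omega>2\<close>, and it suffices to
    examine it at 0.\<close>
  interpret H: lattice "\<omega>1 / 2" \<omega>2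
    by unfold_locales (use nondegenerate in \<open>simp add: diff_divide_distrib[symmetric]\<close>)
  have I: "Im (cnj (\<omega>1 / 2) * x) = Im (cnj \<omega>1 * x) / 2" for x by (simp add: field_simps)
  have half_half: "x / 2 / (y / 2) = x / y" "x / (y / 2) = 2 * (x / y)" for x y :: real by simp_all
  have Hc: "H.coord1 z = 2 * coord1 z" "H.coord2 z = coord2 z" for z
    unfolding H.coord1_def coord1_def H.coord2_def coord2_def I by (simp_all only: half_half)
  have sub: "z \<in> H.\<Lambda>" if "z \<in> \<Lambda>" for z
    using that by (auto simp: H.lattice_iff_coord lattice_iff_coord Hc)
  have sub2: "z \<notin> \<Lambda>" "z + \<omega>1 / 2 \<notin> \<Lambda>" if "z \<notin> H.\<Lambda>" for z
  proof -
    show "z \<notin> \<Lambda>" using that sub by blast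
    show "z + \<omega>1 / 2 \<notin> \<Lambda>" using that sub H.lattice_translate_iff[OF H.lattice_generators(1)] by blast
  qed
  have "\<exists>k. \<forall>z. z \<notin> H.\<Lambda> \<longrightarrow> E z * E (z + \<omega>1 / 2) = k"
  proof (rule H.elliptic_no_pole_constant)
    have "(\<lambda>z. E (z + \<omega>1 / 2)) holomorphic_on - H.\<Lambda>"
      by (intro holomorphic_on_compose_gen[OF _ holE, unfolded o_def] holomorphic_intros) (use sub2 in auto)
    then show "(\<lambda>z. E z * E (z + \<omega>1 / 2)) holomorphic_on - H.\<Lambda>"
      by (intro holomorphic_intros holomorphic_on_subset[OF holE]) (use sub2 in auto)
    have A: "E (z + \<omega>1 / 2) * E (z + \<omega>1 / 2 + \<omega>1 / 2) = E z * E (z + \<omega>1 / 2)" if "z \<notin> H.\<Lambda>" for z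
      using perE[of z \<omega>1] sub2[OF that] lattice_generators by (simp add: add.assoc)
    have B: "E (z + \<omega>2) * E (z + \<omega>2 + \<omega>1 / 2) = E z * E (z + \<omega>1 / 2)" if "z \<notin> H.\<Lambda>" for z
      using perE[of z \<omega>2] perE[of "z + \<omega>1 / 2" \<omega>2] sub2[OF that] lattice_generators by (simp add: algebra_simps)
    define K where "K z = (if z \<in> H.\<Lambda> then 0 else E z * E (z + \<omega>1 / 2))" for z
    have "H.periodic K"
      by (rule H.periodic_if_generators)
         (use A B H.lattice_translate_iff H.lattice_generators in \<open>auto simp: K_def\<close>)
    then show "E (z + w) * E (z + w + \<omega>1 / 2) = E z * E (z + \<omega>1 / 2)" if "z \<notin> H.\<Lambda>" "w \<in> H.\<Lambda>" for z w
      using H.periodicD[of K w z] that H.lattice_translate_iff by (auto simp: K_def)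
    \<comment> \<open>At 0 the possible simple pole of \<open>E z\<close> meets the zero of the
      other factor, whose limit is \<open>E (\<omega>1 / 2) = 0\<close>.\<close>
    have "((\<lambda>z. z * E z) \<longlongrightarrow> g 0) (at 0)"
    proof -
      have "((\<lambda>z. z * f z - z * (c / 2)) \<longlongrightarrow> g 0 - 0 * (c / 2)) (at 0)" by (intro tendsto_intros lim1)
      then show ?thesis by (simp add: E_def algebra_simps)
    qed
    moreover have "((\<lambda>z. E (z + \<omega>1 / 2)) \<longlongrightarrow> E (\<omega>1 / 2)) (at 0)"
    proof -
      have "isCont E (\<omega>1 / 2)"
        using holE halfoff open_off_lattice holomorphic_on_imp_continuous_on continuous_on_eq_continuous_at by blast
      then have "((\<lambda>h. E (\<omega>1 / 2 + h)) \<longlongrightarrow> E (\<omega>1 / 2)) (at 0)" by (simp only: isCont_iff)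
      then show ?thesis by (simp add: add.commute)
    qed
    ultimately have "((\<lambda>z. z * E z * E (z + \<omega>1 / 2)) \<longlongrightarrow> g 0 * E (\<omega>1 / 2)) (at 0)"
      by (rule tendsto_mult)
    then show "((\<lambda>z. z * (E z * E (z + \<omega>1 / 2))) \<longlongrightarrow> 0) (at 0)"
      using half[OF lattice_generators(1) halfoff(1)] by (simp add: mult.assoc)
  qed
  then obtain k where k: "\<And>z. z \<notin> H.\<Lambda> \<Longrightarrow> E z * E (z + \<omega>1 / 2) = k" by blast
  have "\<omega>2 / 2 \<notin> H.\<Lambda>"
  proof -
    have "(1/2 :: real) \<notin> \<int>" using fraction_not_in_Ints[of 2 1, where 'a = real] by simp
    moreover have "H.coord2 (\<omega>2 / 2) = 1/2"
      using H.coord_scale[of "1/2" \<omega>2] by (simp add: H.coord_generators)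
    ultimately show ?thesis by (metis H.lattice_iff_coord)
  qed
  then have "k = 0" using k[of "\<omega>2 / 2"] half[OF lattice_generators(2) halfoff(2)] by simp
  have "E z = 0" if z: "z \<notin> \<Lambda>" for z
  proof (rule ccontr)
    assume "E z \<noteq> 0"
    have "open ((\<lambda>z. z) -` (E -` (- {0}) \<inter> - \<Lambda>) \<inter> - H.\<Lambda>)"
      using continuous_open_preimage[OF holomorphic_on_imp_continuous_on[OF holE] open_off_lattice, of "- {0}"]
        H.open_off_lattice by (auto simp: Int_commute)
    then have op: "open (E -` (- {0}) \<inter> - \<Lambda> \<inter> - H.\<Lambda>)" by simp
    have op2: "open (E -` (- {0}) \<inter> - \<Lambda>)"
      using continuous_open_preimage[OF holomorphic_on_imp_continuous_on[OF holE] open_off_lattice, of "- {0}"]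
      by (auto simp: Int_commute)
    have ne: "E -` (- {0}) \<inter> - \<Lambda> \<inter> - H.\<Lambda> \<noteq> {}"
      using H.open_meets_off_lattice[OF op2] z \<open>E z \<noteq> 0\<close> by auto
    \<comment> \<open>Where \<open>E\<close> is nonzero its translate has to vanish, because the
      product is 0. So \<open>E\<close> vanishes on an open set, and the identity theorem on the
      connected complement of the lattice makes it zero.\<close>
    let ?S = "(\<lambda>z. z + \<omega>1 / 2) ` (E -` (- {0}) \<inter> - \<Lambda> \<inter> - H.\<Lambda>)"
    have "open ?S" using open_translation[OF op, of "\<omega>1 / 2"] by (simp add: add.commute)
    moreover have "?S \<subseteq> - \<Lambda>" using sub2 by auto
    moreover have "E x = 0" if "x \<in> ?S" for x using that k \<open>k = 0\<close> by auto
    moreover have "?S \<noteq> {}" using ne by simp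
    ultimately have "E z = 0"
      using z by (intro analytic_continuation_open[of ?S "- \<Lambda>" E "\<lambda>_. 0" z] open_off_lattice connected_off_lattice holE holomorphic_intros) simp_all
    then show False using \<open>E z \<noteq> 0\<close> by simp
  qed
  then show ?thesis by (intro exI[of _ "c / 2"]) (auto simp: E_def)
qed

lemma lattice_if_independent:
  assumes "\<omega>1 \<noteq> \<omega>2" "independent {\<omega>1, \<omega>2}"
  shows "lattice \<omega>1 \<omega>2"
proof
  show "Im (cnj \<omega>1 * \<omega>2) \<noteq> 0"
  proof
    assume *: "Im (cnj \<omega>1 * \<omega>2) = 0"
    have 1: "\<omega>1 \<noteq> 0" using assms(2) dependent_zero[of "{\<omega>1, \<omega>2}"] by blast
    have ind: "independent (insert \<omega>2 {\<omega>1})" using assms(2) by (simp add: insert_commute)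
    have "cnj \<omega>1 * \<omega>2 = of_real (Re (cnj \<omega>1 * \<omega>2))" using * by (simp add: complex_eq_iff)
    moreover have "\<omega>1 * cnj \<omega>1 = of_real ((cmod \<omega>1)\<^sup>2)" by (rule complex_norm_square[symmetric])
    ultimately have "of_real ((cmod \<omega>1)\<^sup>2) * \<omega>2 = of_real (Re (cnj \<omega>1 * \<omega>2)) * \<omega>1"
      by (metis mult.assoc mult.commute)
    then have "\<omega>2 = (Re (cnj \<omega>1 * \<omega>2) / (cmod \<omega>1)\<^sup>2) *\<^sub>R \<omega>1"
      using 1 by (simp add: scaleR_conv_of_real field_simps)
    then have "\<omega>2 \<in> span {\<omega>1}" by (metis span_base span_scale singletonI)
    moreover have "\<omega>2 \<notin> span {\<omega>1}"
      using ind assms(1) by (subst (asm) independent_insert) auto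
    ultimately show False by simp
  qed
qed

section \<open>A pair of theta functions\<close>

text \<open>The q-Pochhammer symbol (Y; p)_\<infinity>, the infinite product of the factors 1 - p^n
  Y over n \<ge> 0.\<close>

definition qprod :: "complex \<Rightarrow> complex \<Rightarrow> complex" where
  "qprod p Y = lim (\<lambda>N. \<Prod>n<N. 1 - p ^ n * Y)"

lemma qprod_uniform_limit:
  assumes "cmod p < 1"
  shows "uniform_limit (cball 0 R) (\<lambda>N Y. \<Prod>n<N. 1 - p ^ n * Y) (qprod p) sequentially"
proof -
  have "uniformly_convergent_on (cball 0 R) (\<lambda>N Y. \<Prod>n<N. 1 - p ^ n * Y)"
  proof (rule uniformly_convergent_on_prod')
    show "uniformly_convergent_on (cball 0 R) (\<lambda>N Y. \<Sum>n<N. norm ((1 - p ^ n * Y) - 1))"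
    proof (rule Weierstrass_m_test'_ev)
      show "\<forall>\<^sub>F n in sequentially. \<forall>Y\<in>cball 0 R. norm (norm ((1 - p ^ n * Y) - 1)) \<le> cmod p ^ n * R"
        by (auto simp: norm_mult norm_power intro!: always_eventually mult_left_mono)
      show "summable (\<lambda>n. cmod p ^ n * R)"
        using assms by (intro summable_mult2 summable_geometric) auto
    qed
  qed (auto intro!: continuous_intros)
  then show ?thesis
    unfolding qprod_def using uniformly_convergent_uniform_limit_iff by blast
qed

lemma qprod_LIMSEQ:
  assumes "cmod p < 1"
  shows "(\<lambda>N. \<Prod>n<N. 1 - p ^ n * Y) \<longlonglongrightarrow> qprod p Y"
  by (rule tendsto_uniform_limitI[OF qprod_uniform_limit[OF assms, of "cmod Y"]]) auto

lemma qprod_holomorphic: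
  assumes "cmod p < 1"
  shows "qprod p holomorphic_on UNIV"
proof (rule holomorphic_uniform_sequence)
  fix x :: complex
  have "cball x 1 \<subseteq> cball 0 (cmod x + 1)"
    by (simp add: subset_iff dist_norm) (metis add.commute norm_minus_commute norm_triangle_sub order_trans add_left_mono)
  then have "uniform_limit (cball x 1) (\<lambda>N Y. \<Prod>n<N. 1 - p ^ n * Y) (qprod p) sequentially"
    using uniform_limit_on_subset[OF qprod_uniform_limit[OF assms]] by blast
  then show "\<exists>d>0. cball x d \<subseteq> UNIV \<and> uniform_limit (cball x d) (\<lambda>N Y. \<Prod>n<N. 1 - p ^ n * Y) (qprod p) sequentially"
    by (intro exI[of _ 1]) auto
qed (auto intro!: holomorphic_intros)

lemma qprod_compose_holomorphic [holomorphic_intros]: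
  assumes "cmod p < 1" "f holomorphic_on S"
  shows "(\<lambda>z. qprod p (f z)) holomorphic_on S"
  using holomorphic_on_compose_gen[OF assms(2) qprod_holomorphic[OF assms(1)]] by (simp add: o_def)

lemma qprod_unfold:
  assumes "cmod p < 1"
  shows "qprod p Y = (1 - Y) * qprod p (p * Y)"
proof -
  have "(\<lambda>N. (1 - Y) * (\<Prod>n<N. 1 - p ^ n * (p * Y))) \<longlonglongrightarrow> (1 - Y) * qprod p (p * Y)"
    by (intro tendsto_intros qprod_LIMSEQ assms)
  moreover have "(1 - Y) * (\<Prod>n<N. 1 - p ^ n * (p * Y)) = (\<Prod>n<Suc N. 1 - p ^ n * Y)" for N
    by (subst prod.lessThan_Suc_shift) (simp add: mult_ac)
  moreover have "(\<lambda>N. \<Prod>n<Suc N. 1 - p ^ n * Y) \<longlonglongrightarrow> qprod p Y"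
    by (rule LIMSEQ_Suc[OF qprod_LIMSEQ[OF assms]])
  ultimately show ?thesis using LIMSEQ_unique by fastforce
qed

lemma qprod_nonzero:
  assumes "cmod p < 1" "\<And>n. p ^ n * Y \<noteq> 1"
  shows "qprod p Y \<noteq> 0"
proof -
  have conv: "convergent_prod (\<lambda>n. 1 + (- (p ^ n * Y)))"
  proof (rule summable_imp_convergent_prod_complex)
    show "summable (\<lambda>n. norm (- (p ^ n * Y)))"
      using assms by (auto simp: norm_mult norm_power intro!: summable_mult2 summable_geometric)
    show "- (p ^ k * Y) \<noteq> - 1" for k using assms(2)[of k] by simp
  qed
  have "(\<lambda>N. \<Prod>n\<le>N. 1 + - (p ^ n * Y)) \<longlonglongrightarrow> prodinf (\<lambda>n. 1 + - (p ^ n * Y))"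
    using conv by (rule convergent_prod_LIMSEQ)
  moreover have "(\<lambda>N. \<Prod>n\<le>N. 1 + - (p ^ n * Y)) \<longlonglongrightarrow> qprod p Y"
    using LIMSEQ_Suc[OF qprod_LIMSEQ[OF assms(1), of Y]] by (simp add: lessThan_Suc_atMost)
  ultimately have "qprod p Y = prodinf (\<lambda>n. 1 + - (p ^ n * Y))"
    using LIMSEQ_unique by blast
  then show ?thesis using prodinf_nonzero[OF conv] assms(2) by simp
qed

section \<open>Wronskians of entire functions\<close>

lemma entire_has_derivative: "f holomorphic_on UNIV \<Longrightarrow> (f has_field_derivative deriv f z) (at z)"
  using holomorphic_derivI by blast

lemma entire_deriv_shift:
  assumes "f holomorphic_on UNIV"
  shows "((\<lambda>z. f (z + c)) has_field_derivative deriv f (z + c)) (at z)"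
  using DERIV_shift entire_has_derivative[OF assms] by blast

text \<open>With this sign the derivative of B/A is -W/A^2, so zeros of the Wronskian are the
  critical points of the map B/A to the sphere.\<close>

definition wronskian :: "(complex \<Rightarrow> complex) \<Rightarrow> (complex \<Rightarrow> complex) \<Rightarrow> complex \<Rightarrow> complex" where
  "wronskian A B z = deriv A z * B z - A z * deriv B z"

text \<open>A common multiplier \<open>E\<close> enters only through its square, since the terms
  with its derivative cancel.\<close>

lemma wronskian_shift:
  assumes "A holomorphic_on UNIV" "B holomorphic_on UNIV" "C holomorphic_on UNIV" "D holomorphic_on UNIV"
    "E holomorphic_on UNIV" and A: "\<And>z. A (z + c) = E z * C z" and B: "\<And>z. B (z + c) = E z * D z"
  shows "wronskian A B (z + c) = (E z)\<^sup>2 * wronskian C D z"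
proof -
  have dA: "deriv A (z + c) = E z * deriv C z + deriv E z * C z"
    using entire_deriv_shift[OF assms(1), of c z] assms(3,5)
      DERIV_mult'[OF entire_has_derivative[of E z] entire_has_derivative[of C z]]
    unfolding A by (metis DERIV_unique)
  have dB: "deriv B (z + c) = E z * deriv D z + deriv E z * D z"
    using entire_deriv_shift[OF assms(2), of c z] assms(4,5)
      DERIV_mult'[OF entire_has_derivative[of E z] entire_has_derivative[of D z]]
    unfolding B by (metis DERIV_unique)
  show ?thesis unfolding wronskian_def A B dA dB by (simp add: algebra_simps power2_eq_square)
qed

lemma wronskian_swap: "wronskian B A z = - wronskian A B z"
  by (simp add: wronskian_def)

lemma wronskian_minus_right:
  assumes "B holomorphic_on UNIV"
  shows "wronskian A (\<lambda>z. - B z) z = - wronskian A B z"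
  using DERIV_imp_deriv[OF DERIV_minus[OF entire_has_derivative[OF assms]]] by (simp add: wronskian_def)

text \<open>
  The pair is obtained by splitting a theta function \<open>\<Theta>\<close> of period \<open>2\<omega>1\<close>, given by its product
  expansion, into its \<open>\<omega>1\<close>-periodic and \<open>\<omega>1\<close>-antiperiodic parts. The Wronskian of the two parts has the
  multipliers of the odd theta function with simple zeros at the lattice points, so
  \<open>elliptic_simple_pole_constant\<close> identifies the two up to a constant.
\<close>

lemma (in lattice) theta_pair_oriented:
  assumes pos: "Im (\<omega>2 / \<omega>1) > 0"
  obtains A B \<kappa> where "A holomorphic_on UNIV" "B holomorphic_on UNIV"
    "\<And>z. A (- z) = A z" "\<And>z. B (- z) = B z"
    "\<And>z. A (z + \<omega>1) = A z" "\<And>z. B (z + \<omega>1) = - B z"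
    "\<And>z. A (z + \<omega>2) = exp (\<kappa> - \<i> * pi / \<omega>1 * z) * B z"
    "\<And>z. B (z + \<omega>2) = exp (\<kappa> - \<i> * pi / \<omega>1 * z) * A z"
    "\<And>z. A z = 0 \<Longrightarrow> B z \<noteq> 0"
    "\<And>z. wronskian A B z = 0 \<longleftrightarrow> z \<in> \<Lambda>"
    "deriv (wronskian A B) 0 \<noteq> 0"
proof -
  define \<tau> where "\<tau> = \<omega>2 / \<omega>1"
  have w1: "\<omega>1 \<noteq> 0" using nondegenerate by auto
  have w2: "\<omega>2 = \<tau> * \<omega>1" using w1 by (simp add: \<tau>_def)
  \<comment> \<open>Here \<open>q\<close> is the nome, \<open>Q\<close> its square root and
    \<open>p\<close> its square. Below, \<open>y\<close> is a coordinate of period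
    \<open>2 \<omega>1\<close>; translation by \<open>\<omega>1\<close> changes its sign and
    translation by \<open>\<omega>2\<close> multiplies it by \<open>q\<close>.\<close>
  define q where "q = exp (\<i> * pi * \<tau>)"
  define Q where "Q = exp (\<i> * pi * \<tau> / 2)"
  define p where "p = q\<^sup>2"
  define y where "y z = exp (\<i> * pi / \<omega>1 * z)" for z
  have Im\<tau>: "Im \<tau> > 0" using pos by (simp add: \<tau>_def)
  have q1: "cmod q < 1" using Im\<tau> by (simp add: q_def)
  have Q1: "cmod Q < 1" using Im\<tau> by (simp add: Q_def)
  have p1: "cmod p < 1" using q1 by (simp add: p_def norm_power power_less_one_iff)
  have nz [simp]: "q \<noteq> 0" "Q \<noteq> 0" "p \<noteq> 0" "y z \<noteq> 0" for z by (simp_all add: q_def Q_def p_def y_def)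
  have QQ: "q = Q * Q" unfolding q_def Q_def exp_add[symmetric] by (rule arg_cong[of _ _ exp]) (simp add: field_simps)
  have y0: "y 0 = 1" by (simp add: y_def)
  have ym: "y (- z) = inverse (y z)" for z by (simp add: y_def exp_minus)
  have y1: "y (z + \<omega>1) = - y z" for z
    using w1 by (simp add: y_def distrib_left exp_add)
  have y2: "y (z + \<omega>2) = q * y z" for z
  proof -
    have "\<i> * pi / \<omega>1 * (z + \<omega>2) = \<i> * pi * \<tau> + \<i> * pi / \<omega>1 * z"
      using w1 by (simp add: w2 field_simps)
    then show ?thesis by (simp add: y_def q_def exp_add)
  qed
  have holy: "y holomorphic_on UNIV" unfolding y_def by (intro holomorphic_intros)
  \<comment> \<open>By the Jacobi triple product this is, up to a constant factor, the sum of
    Q^(n^2) y^n over all integers n.\<close>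
  define \<Theta> where "\<Theta> z = qprod q (- (Q * y z)) * qprod q (- (Q * inverse (y z)))" for z
  have hol\<Theta>: "\<Theta> holomorphic_on UNIV"
    unfolding \<Theta>_def using q1 by (intro holomorphic_intros holy) auto
  have \<Theta>m: "\<Theta> (- z) = \<Theta> z" for z by (simp add: \<Theta>_def ym mult.commute)
  have \<Theta>1: "\<Theta> (z + \<omega>1 + \<omega>1) = \<Theta> z" for z unfolding \<Theta>_def y1 by simp
  \<comment> \<open>Replacing \<open>y\<close> by \<open>q y\<close> removes the factor
    \<open>1 + Q y\<close> from the first product and adds \<open>1 + 1/(Q y)\<close> to the second.
    The quotient of the two factors is \<open>e\<close>.\<close>
  define e where "e z = inverse (Q * y z)" for z
  have enz: "e z \<noteq> 0" for z by (simp add: e_def)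
  have e1: "e (z + \<omega>1) = - e z" for z by (simp add: e_def y1)
  have \<Theta>2: "\<Theta> (z + \<omega>2) = e z * \<Theta> z" for z
  proof -
    define C where "C = qprod q (- (Q * (q * y z)))"
    define D where "D = qprod q (- (Q * inverse (y z)))"
    have 1: "qprod q (- (Q * y z)) = (1 + Q * y z) * C"
      using qprod_unfold[OF q1, of "- (Q * y z)"] by (simp add: mult_ac C_def)
    have "Q * inverse (q * y z) = e z" by (simp add: e_def QQ field_simps)
    moreover have "q * e z = Q * inverse (y z)" by (simp add: e_def QQ field_simps)
    ultimately have 2: "qprod q (- (Q * inverse (q * y z))) = (1 + e z) * D"
      using qprod_unfold[OF q1, of "- e z"] by (simp add: D_def)
    have "e z * (1 + Q * y z) = 1 + e z" by (simp add: e_def field_simps)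
    then have "(1 + e z) * C * D = e z * ((1 + Q * y z) * C * D)" by (simp add: mult.assoc[symmetric])
    then show ?thesis unfolding \<Theta>_def y2 1 2 C_def[symmetric] D_def[symmetric] by (simp add: mult_ac)
  qed
  have \<Theta>0: "\<Theta> 0 \<noteq> 0"
  proof -
    have "q ^ n * (- Q) \<noteq> 1" for n
    proof
      assume "q ^ n * (- Q) = 1"
      then have "cmod q ^ n * cmod Q = 1" by (metis norm_mult norm_minus_cancel norm_one norm_power)
      moreover have "cmod q ^ n * cmod Q \<le> 1 * cmod Q"
        using q1 by (intro mult_right_mono power_le_one) auto
      ultimately show False using Q1 by simp
    qed
    then show ?thesis using qprod_nonzero[OF q1, of "- Q"] by (simp add: \<Theta>_def y0)
  qed
  \<comment> \<open>Up to a constant factor this is the Jacobi theta function \<theta>_1, with zeros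
    where \<open>y^2\<close> is an integral power of \<open>p\<close>. Its multipliers are -1 and
    \<open>-e^2\<close>.\<close>
  define \<Psi> where "\<Psi> z = inverse (y z) * (qprod p ((y z)\<^sup>2) * qprod p (p * inverse ((y z)\<^sup>2)))" for z
  have hol\<Psi>: "\<Psi> holomorphic_on UNIV"
    unfolding \<Psi>_def using p1 by (intro holomorphic_intros holy) auto
  have \<Psi>1: "\<Psi> (z + \<omega>1) = - \<Psi> z" for z by (simp add: \<Psi>_def y1)
  have \<Psi>2: "\<Psi> (z + \<omega>2) = - (e z)\<^sup>2 * \<Psi> z" for z
  proof -
    define C where "C = qprod p (p * (y z)\<^sup>2)"
    define D where "D = qprod p (p * inverse ((y z)\<^sup>2))"
    have 1: "qprod p ((y z)\<^sup>2) = (1 - (y z)\<^sup>2) * C"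
      using qprod_unfold[OF p1, of "(y z)\<^sup>2"] by (simp add: C_def)
    have "p * inverse ((q * y z)\<^sup>2) = inverse ((y z)\<^sup>2)" by (simp add: p_def field_simps)
    then have 2: "qprod p (p * inverse ((q * y z)\<^sup>2)) = (1 - inverse ((y z)\<^sup>2)) * D"
      using qprod_unfold[OF p1, of "inverse ((y z)\<^sup>2)"] by (simp add: D_def)
    have 3: "qprod p ((q * y z)\<^sup>2) = C" by (simp add: C_def p_def power_mult_distrib)
    have "inverse (q * y z) * (1 - inverse ((y z)\<^sup>2)) = - (e z)\<^sup>2 * (inverse (y z) * (1 - (y z)\<^sup>2))"
      by (simp add: e_def QQ field_simps power2_eq_square)
    then have "inverse (q * y z) * (1 - inverse ((y z)\<^sup>2)) * (C * D) = - (e z)\<^sup>2 * (inverse (y z) * (1 - (y z)\<^sup>2)) * (C * D)"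
      by (rule arg_cong)
    then show ?thesis unfolding \<Psi>_def y2 1 2 3 D_def[symmetric] by (simp only: mult_ac)
  qed
  have yexp: "(y z)\<^sup>2 = exp (2 * \<i> * pi / \<omega>1 * z)" for z
    unfolding y_def power2_eq_square exp_add[symmetric] by (rule arg_cong[of _ _ exp]) (simp add: field_simps)
  have pexp: "p ^ n = exp (2 * \<i> * pi * \<tau> * of_nat n)" for n
    unfolding p_def q_def power2_eq_square exp_add[symmetric] exp_of_nat_mult[symmetric]
    by (rule arg_cong[of _ _ exp]) (simp add: algebra_simps)
  have lat: "z \<in> \<Lambda>" if "exp (2 * \<i> * pi / \<omega>1 * z + 2 * \<i> * pi * \<tau> * of_int k) = 1" for z k
  proof -
    define X where "X = 2 * \<i> * pi / \<omega>1 * z + 2 * \<i> * pi * \<tau> * of_int k"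
    have "exp X = 1" using that by (simp only: X_def)
    then obtain m :: int where "Re X = 0" "Im X = of_int (2 * m) * pi"
      unfolding exp_eq_1 by blast
    then have "X = 2 * \<i> * pi * of_int m" by (auto simp: complex_eq_iff)
    moreover have "X = 2 * \<i> * pi * (z / \<omega>1 + \<tau> * of_int k)"
      by (simp add: X_def distrib_left)
    ultimately have "z / \<omega>1 + \<tau> * of_int k = of_int m" by simp
    then have "z = of_int m * \<omega>1 + of_int (- k) * \<omega>2" using w1 by (simp add: w2 field_simps)
    then show ?thesis unfolding period_lattice_def by blast
  qed
  have \<Psi>off: "\<Psi> z \<noteq> 0" if "z \<notin> \<Lambda>" for z
  proof -
    have "qprod p ((y z)\<^sup>2) \<noteq> 0"
    proof (rule qprod_nonzero[OF p1])
      show "p ^ n * (y z)\<^sup>2 \<noteq> 1" for n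
        using lat[of z "int n"] that by (auto simp: yexp pexp exp_add mult.commute)
    qed
    moreover have "qprod p (p * inverse ((y z)\<^sup>2)) \<noteq> 0"
    proof (rule qprod_nonzero[OF p1])
      fix n
      show "p ^ n * (p * inverse ((y z)\<^sup>2)) \<noteq> 1"
      proof
        assume "p ^ n * (p * inverse ((y z)\<^sup>2)) = 1"
        then have "(y z)\<^sup>2 = p ^ Suc n" by (simp add: field_simps)
        then have "exp (2 * \<i> * pi / \<omega>1 * z + 2 * \<i> * pi * \<tau> * of_int (- int (Suc n))) = 1"
          unfolding exp_add yexp[symmetric] by (simp add: pexp exp_minus del: of_nat_Suc power_Suc)
        then show False using lat that by blast
      qed
    qed
    ultimately show ?thesis by (simp add: \<Psi>_def)
  qed
  \<comment> \<open>Translation by \<open>\<omega>1\<close> changes the sign of \<open>y\<close>, so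
    \<open>A\<close> collects the even and \<open>B\<close> the odd powers of \<open>y\<close>.
    Since \<open>e\<close> is odd in \<open>y\<close>, translation by \<open>\<omega>2\<close>
    exchanges the two.\<close>
  define A where "A z = (\<Theta> z + \<Theta> (z + \<omega>1)) / 2" for z
  define B where "B z = (\<Theta> z - \<Theta> (z + \<omega>1)) / 2" for z
  have holS: "(\<lambda>z. \<Theta> (z + \<omega>1)) holomorphic_on UNIV"
    using holomorphic_on_compose_gen[OF _ hol\<Theta>, of "\<lambda>z. z + \<omega>1" UNIV] by (simp add: o_def holomorphic_intros)
  have holA: "A holomorphic_on UNIV" and holB: "B holomorphic_on UNIV"
    unfolding A_def B_def by (intro holomorphic_intros hol\<Theta> holS; simp)+
  have \<Theta>m1: "\<Theta> (- z + \<omega>1) = \<Theta> (z + \<omega>1)" for z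
    using \<Theta>m[of "z - \<omega>1"] \<Theta>1[of "z - \<omega>1"] by simp
  have Am: "A (- z) = A z" and Bm: "B (- z) = B z" for z
    unfolding A_def B_def \<Theta>m \<Theta>m1 by simp_all
  have A1: "A (z + \<omega>1) = A z" and B1: "B (z + \<omega>1) = - B z" for z
    unfolding A_def B_def \<Theta>1 by simp_all (simp add: minus_divide_left)
  have \<Theta>21: "\<Theta> (z + \<omega>2 + \<omega>1) = - e z * \<Theta> (z + \<omega>1)" for z
    using \<Theta>2[of "z + \<omega>1"] unfolding e1 by (simp add: add_ac)
  have A2: "A (z + \<omega>2) = e z * B z" and B2: "B (z + \<omega>2) = e z * A z" for z
    unfolding A_def B_def \<Theta>2 \<Theta>21 by (simp_all add: algebra_simps diff_divide_distrib add_divide_distrib)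
  define W where "W = wronskian A B"
  have holW: "W holomorphic_on UNIV"
    unfolding W_def wronskian_def by (intro holomorphic_intros holA holB) auto
  have W1: "W (z + \<omega>1) = - W z" for z
    using wronskian_shift[of A B A "\<lambda>z. - B z" "\<lambda>_. 1" \<omega>1 z] holA holB
    by (simp add: W_def A1 B1 wronskian_minus_right holomorphic_intros)
  have W2: "W (z + \<omega>2) = - (e z)\<^sup>2 * W z" for z
  proof -
    have "e holomorphic_on UNIV" unfolding e_def by (intro holomorphic_intros holy) auto
    then show ?thesis
      using wronskian_shift[of A B B A e \<omega>2 z] holA holB A2 B2 by (simp add: W_def wronskian_swap[of B A])
  qed
  have D\<Psi>: "(\<Psi> has_field_derivative deriv \<Psi> 0) (at 0)" by (rule entire_has_derivative[OF hol\<Psi>])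
  have \<Psi>00: "\<Psi> 0 = 0" using qprod_unfold[OF p1, of 1] by (simp add: \<Psi>_def y0)
  have D\<Psi>0: "deriv \<Psi> 0 \<noteq> 0"
  proof -
    \<comment> \<open>Splitting off the factor \<open>1 - y^2\<close> exhibits the zero at 0: what
      remains there is the square of (p; p)_\<infinity>, which is nonzero.\<close>
    define R where "R z = qprod p (p * (y z)\<^sup>2) * qprod p (p * inverse ((y z)\<^sup>2))" for z
    have holR: "R holomorphic_on UNIV" unfolding R_def using p1 by (intro holomorphic_intros holy) auto
    have "\<Psi> z = (y (- z) - y z) * R z" for z
      unfolding \<Psi>_def R_def ym qprod_unfold[OF p1, of "(y z)\<^sup>2"] by (simp add: field_simps power2_eq_square)
    then have \<Psi>R: "\<Psi> = (\<lambda>z. (y (- z) - y z) * R z)" by auto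
    have "(\<Psi> has_field_derivative (- 2 * (\<i> * pi / \<omega>1)) * R 0) (at 0)"
      unfolding \<Psi>R y_def using w1
      by (auto intro!: derivative_eq_intros entire_has_derivative[OF holR])
    then have "deriv \<Psi> 0 = (- 2 * (\<i> * pi / \<omega>1)) * R 0" by (rule DERIV_imp_deriv)
    moreover have "qprod p p \<noteq> 0"
    proof (rule qprod_nonzero[OF p1])
      show "p ^ n * p \<noteq> 1" for n
      proof
        assume "p ^ n * p = 1"
        then have "cmod p ^ Suc n = 1" by (metis norm_one norm_power power_Suc2)
        then show False using p1 power_Suc_less_one[of "cmod p" n] by simp
      qed
    qed
    ultimately show ?thesis using w1 by (simp add: R_def y0)
  qed
  have "\<exists>c. \<forall>z. z \<notin> \<Lambda> \<longrightarrow> W z / \<Psi> z = c"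
  proof (rule elliptic_simple_pole_constant)
    show "(\<lambda>z. W z / \<Psi> z) holomorphic_on - \<Lambda>"
      using \<Psi>off by (intro holomorphic_intros holomorphic_on_subset[OF holW] holomorphic_on_subset[OF hol\<Psi>]) auto
    have "periodic (\<lambda>z. W z / \<Psi> z)"
      by (rule periodic_if_generators) (simp_all add: W1 W2 \<Psi>1 \<Psi>2 enz)
    then show "W (z + w) / \<Psi> (z + w) = W z / \<Psi> z" if "w \<in> \<Lambda>" for z w
      using periodicD that by fast
    have "((\<lambda>z. \<Psi> z / z) \<longlongrightarrow> deriv \<Psi> 0) (at 0)"
      using D\<Psi> \<Psi>00 by (simp add: has_field_derivative_iff)
    moreover have "(W \<longlongrightarrow> W 0) (at 0)"
      using holomorphic_on_imp_continuous_on[OF holW] by (auto simp: continuous_on_eq_continuous_at isCont_def)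
    ultimately have "((\<lambda>z. z * (W z / (\<Psi> z / z))) \<longlongrightarrow> 0 * (W 0 / deriv \<Psi> 0)) (at 0)"
      using D\<Psi>0 by (intro tendsto_intros) auto
    then show "((\<lambda>z. z\<^sup>2 * (W z / \<Psi> z)) \<longlongrightarrow> 0) (at 0)"
      by (simp add: power2_eq_square mult_ac)
  qed
  then obtain c where c: "\<And>z. z \<notin> \<Lambda> \<Longrightarrow> W z = c * \<Psi> z" using \<Psi>off by (metis nonzero_mult_div_cancel_right times_divide_eq_left)
  have Wc: "W z = c * \<Psi> z" for z
  proof (rule analytic_continuation_open[of "- \<Lambda>" UNIV W "\<lambda>z. c * \<Psi> z"])
    show "- \<Lambda> \<noteq> {}" using open_meets_off_lattice[of UNIV] by auto
  qed (use c holW hol\<Psi> open_off_lattice in \<open>auto intro!: holomorphic_intros\<close>)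
  \<comment> \<open>If the Wronskian vanished identically, \<open>B\<close> would be a multiple of
    \<open>A\<close>. As \<open>A\<close> is periodic and \<open>B\<close> antiperiodic under
    \<open>\<omega>1\<close>, both would vanish, against
    \<open>A 0 + B 0 = \<Theta> 0\<close>.\<close>
  have c0: "c \<noteq> 0"
  proof
    assume "c = 0"
    then have W0: "deriv A z * B z = A z * deriv B z" for z
      using Wc[of z] by (simp add: W_def wronskian_def)
    have contA: "continuous_on UNIV A" by (rule holomorphic_on_imp_continuous_on[OF holA])
    have "open (A -` (- {0}))" by (intro open_vimage contA) auto
    have "\<exists>z. A z \<noteq> 0"
    proof (rule ccontr)
      assume "\<nexists>z. A z \<noteq> 0"
      then have "A z = 0" "B z = 0" for z using A2[of z] enz[of z] by simp_all
      then have "A 0 + B 0 = 0" by simp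
      moreover have "A 0 + B 0 = \<Theta> 0" by (simp add: A_def B_def add_divide_distrib[symmetric])
      ultimately show False using \<Theta>0 by simp
    qed
    then obtain z0 where z0: "A z0 \<noteq> 0" by blast
    obtain r where r: "r > 0" "ball z0 r \<subseteq> A -` (- {0})"
      using \<open>open (A -` (- {0}))\<close> z0 openE by blast
    have "((\<lambda>z. B z / A z) has_field_derivative 0) (at z)" if "z \<in> ball z0 r" for z
    proof -
      have "A z \<noteq> 0" using r that by auto
      then have "((\<lambda>z. B z / A z) has_field_derivative (deriv B z * A z - B z * deriv A z) / (A z * A z)) (at z)"
        by (intro DERIV_divide entire_has_derivative holA holB)
      then show ?thesis using W0[of z] by (simp add: mult.commute)
    qed
    then have "\<exists>k. \<forall>z\<in>ball z0 r. B z / A z = k"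
      by (intro has_field_derivative_zero_constant) (auto intro: has_field_derivative_at_within)
    then obtain k where k: "\<And>z. z \<in> ball z0 r \<Longrightarrow> B z / A z = k" by blast
    have k': "B z = k * A z" if "z \<in> ball z0 r" for z
    proof -
      have "A z \<noteq> 0" using r that by auto
      then show ?thesis using k[OF that] by (simp add: divide_eq_eq)
    qed
    have BkA: "B z = k * A z" for z
      by (rule analytic_continuation_open[of "ball z0 r" UNIV B "\<lambda>z. k * A z"])
         (use k' r holA holB in \<open>auto intro!: holomorphic_intros\<close>)
    have "A 0 + B 0 = \<Theta> 0" by (simp add: A_def B_def add_divide_distrib[symmetric])
    moreover have "B z = 0" for z using BkA[of "z + \<omega>1"] BkA[of z] A1 B1 by simp
    moreover have "A z = 0" for z using B2[of z] enz[of z] \<open>\<And>z. B z = 0\<close> by simp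
    ultimately show False using \<Theta>0 by simp
  qed
  have W00: "W 0 = 0"
    using Wc \<Psi>00 by simp
  have "periodic (\<lambda>z. W z = 0)"
    by (rule periodic_if_generators) (simp_all add: W1 W2 enz)
  then have Wzero: "W z = 0 \<longleftrightarrow> z \<in> \<Lambda>" for z
    using periodicD[of "\<lambda>z. W z = 0" z 0] W00 Wc[of z] c0 \<Psi>off[of z] by auto
  \<comment> \<open>At a common zero the Wronskian vanishes, so it lies on the lattice and may be
    moved to 0, where the sum \<open>\<Theta> 0\<close> is nonzero.\<close>
  have "periodic (\<lambda>z. A z = 0 \<and> B z = 0)"
    by (rule periodic_if_generators) (auto simp: A1 B1 A2 B2 enz)
  then have common: "A 0 = 0 \<and> B 0 = 0" if "A z = 0" "B z = 0" "z \<in> \<Lambda>" for z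
    using periodicD[of "\<lambda>z. A z = 0 \<and> B z = 0" z 0] that by simp
  have AB: "B z \<noteq> 0" if "A z = 0" for z
  proof
    assume "B z = 0"
    then have "W z = 0" using that by (simp add: W_def wronskian_def)
    then have "A 0 = 0 \<and> B 0 = 0" using common that \<open>B z = 0\<close> Wzero by blast
    moreover have "A 0 + B 0 = \<Theta> 0" by (simp add: A_def B_def add_divide_distrib[symmetric])
    ultimately show False using \<Theta>0 by simp
  qed
  have "deriv W 0 = c * deriv \<Psi> 0"
  proof -
    have "(W has_field_derivative c * deriv \<Psi> 0) (at 0)"
      using DERIV_cmult[OF D\<Psi>, of c] Wc by (metis (no_types, lifting) ext)
    then show ?thesis by (rule DERIV_imp_deriv)
  qed
  then have DW: "deriv W 0 \<noteq> 0" using c0 D\<Psi>0 by simp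
  have e: "e z = exp (- (\<i> * pi * \<tau> / 2) - \<i> * pi / \<omega>1 * z)" for z
    by (simp only: e_def Q_def y_def exp_diff exp_minus divide_inverse inverse_mult_distrib)
  show ?thesis
    by (rule that[of A B "- (\<i> * pi * \<tau> / 2)"])
       (use holA holB Am Bm A1 B1 A2 B2 AB Wzero DW e in \<open>simp_all add: W_def\<close>)
qed

text \<open>For a negatively oriented basis the oriented case is applied to
  \<open>\<omega>1\<close>, \<open>- \<omega>2\<close>, which spans the same lattice, and the
  relation for translation by \<open>- \<omega>2\<close> is inverted. This reverses the sign of
  \<open>\<mu>\<close>, and the sign function records the orientation. The value of
  \<open>\<mu> * \<omega>1\<close> determines the total mass of the density q.\<close>

theorem (in lattice) theta_pair:
  obtains A B \<kappa> \<mu> where "A holomorphic_on UNIV" "B holomorphic_on UNIV"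
    "\<And>z. A (- z) = A z" "\<And>z. B (- z) = B z"
    "\<And>z. A (z + \<omega>1) = A z" "\<And>z. B (z + \<omega>1) = - B z"
    "\<And>z. A (z + \<omega>2) = exp (\<kappa> + \<mu> * z) * B z"
    "\<And>z. B (z + \<omega>2) = exp (\<kappa> + \<mu> * z) * A z"
    "\<And>z. A z = 0 \<Longrightarrow> B z \<noteq> 0"
    "\<And>z. wronskian A B z = 0 \<longleftrightarrow> z \<in> \<Lambda>"
    "deriv (wronskian A B) 0 \<noteq> 0"
    "\<mu> * \<omega>1 = - \<i> * (sgn (Im (cnj \<omega>1 * \<omega>2)) * pi)"
proof -
  have w1: "\<omega>1 \<noteq> 0" using nondegenerate by auto
  have Im_eq: "Im (\<omega>2 / \<omega>1) = Im (cnj \<omega>1 * \<omega>2) / (cmod \<omega>1)\<^sup>2"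
    by (subst complex_div_cnj) (simp add: mult.commute)
  show ?thesis
  proof (cases "Im (cnj \<omega>1 * \<omega>2) > 0")
    case True
    then have "Im (\<omega>2 / \<omega>1) > 0" using Im_eq w1 by simp
    then show ?thesis
    proof (rule theta_pair_oriented)
      fix A B \<kappa> assume
        AB: "A holomorphic_on UNIV" "B holomorphic_on UNIV"
        "\<And>z. A (- z) = A z" "\<And>z. B (- z) = B z"
        "\<And>z. A (z + \<omega>1) = A z" "\<And>z. B (z + \<omega>1) = - B z"
        "\<And>z. A (z + \<omega>2) = exp (\<kappa> - \<i> * pi / \<omega>1 * z) * B z"
        "\<And>z. B (z + \<omega>2) = exp (\<kappa> - \<i> * pi / \<omega>1 * z) * A z"
        "\<And>z. A z = 0 \<Longrightarrow> B z \<noteq> 0"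
        "\<And>z. wronskian A B z = 0 \<longleftrightarrow> z \<in> \<Lambda>"
        "deriv (wronskian A B) 0 \<noteq> 0"
      show ?thesis
        by (rule that[of A B \<kappa> "- \<i> * pi / \<omega>1"]) (use AB w1 True in \<open>simp_all add: sgn_if\<close>)
    qed
  next
    case False
    then have neg: "Im (cnj \<omega>1 * \<omega>2) < 0" using nondegenerate by simp
    interpret N: lattice \<omega>1 "- \<omega>2" by unfold_locales (use neg in simp)
    have coords: "N.coord1 z = coord1 z" "N.coord2 z = - coord2 z" for z
      using nondegenerate by (simp_all add: N.coord1_def coord1_def N.coord2_def coord2_def field_simps)
    have lat: "N.\<Lambda> = \<Lambda>"
      by (auto simp: set_eq_iff lattice_iff_coord N.lattice_iff_coord coords)
    have "Im (\<omega>2 / \<omega>1) < 0" unfolding Im_eq using w1 neg by (intro divide_neg_pos) auto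
    then have "Im (- \<omega>2 / \<omega>1) > 0" by simp
    then show ?thesis
    proof (rule N.theta_pair_oriented[unfolded add_uminus_conv_diff])
    fix A B \<kappa> assume
      AB: "A holomorphic_on UNIV" "B holomorphic_on UNIV"
      "\<And>z. A (- z) = A z" "\<And>z. B (- z) = B z"
      "\<And>z. A (z + \<omega>1) = A z" "\<And>z. B (z + \<omega>1) = - B z"
      and sh: "\<And>z. A (z - \<omega>2) = exp (\<kappa> - \<i> * pi / \<omega>1 * z) * B z"
      "\<And>z. B (z - \<omega>2) = exp (\<kappa> - \<i> * pi / \<omega>1 * z) * A z"
      and AB': "\<And>z. A z = 0 \<Longrightarrow> B z \<noteq> 0"
      "\<And>z. wronskian A B z = 0 \<longleftrightarrow> z \<in> N.\<Lambda>"
      "deriv (wronskian A B) 0 \<noteq> 0"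
    define \<kappa>' where "\<kappa>' = \<i> * pi / \<omega>1 * \<omega>2 - \<kappa>"
    have inv: "exp (\<kappa>' + \<i> * pi / \<omega>1 * z) * exp (\<kappa> - \<i> * pi / \<omega>1 * (z + \<omega>2)) = 1" for z
    proof -
      have "\<kappa>' + \<i> * pi / \<omega>1 * z + (\<kappa> - \<i> * pi / \<omega>1 * (z + \<omega>2)) = 0"
        by (simp add: \<kappa>'_def distrib_left)
      then show ?thesis unfolding exp_add[symmetric] by simp
    qed
    have "B (z + \<omega>2) = exp (\<kappa>' + \<i> * pi / \<omega>1 * z) * A z"
      "A (z + \<omega>2) = exp (\<kappa>' + \<i> * pi / \<omega>1 * z) * B z" for z
      using sh[of "z + \<omega>2"] inv[of z] by (simp_all add: mult.assoc[symmetric])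
    then show ?thesis
      by (intro that[of A B \<kappa>' "\<i> * pi / \<omega>1"]) (use AB AB' lat w1 neg in \<open>simp_all add: sgn_if\<close>)
    qed
  qed
qed

section \<open>Integration over the torus\<close>

text \<open>Agreement on boxes suffices. The product form allows a linear change of variables in the
  plane to be carried out one real variable at a time.\<close>

lemma lborel_complex_eq:
  "(lborel :: complex measure) = distr (lborel \<Otimes>\<^sub>M lborel) borel (\<lambda>(x, y). Complex x y)"
proof (rule lborel_eqI)
  have meas: "(\<lambda>(x, y). Complex x y) \<in> borel_measurable (lborel \<Otimes>\<^sub>M lborel)"
  proof -
    have "continuous_on UNIV (\<lambda>p::real \<times> real. Complex (fst p) (snd p))"
      unfolding Complex_eq by (intro continuous_intros)
    then show ?thesis
      by (simp add: case_prod_beta' lborel_prod borel_measurable_continuous_onI)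
  qed
  fix l u :: complex assume lu: "\<And>b. b \<in> Basis \<Longrightarrow> l \<bullet> b \<le> u \<bullet> b"
  have "(\<lambda>(x, y). Complex x y) -` box l u = {Re l<..<Re u} \<times> {Im l<..<Im u}"
    by (auto simp: box_def Basis_complex_def)
  then have "emeasure (distr (lborel \<Otimes>\<^sub>M lborel) borel (\<lambda>(x, y). Complex x y)) (box l u)
      = emeasure (lborel \<Otimes>\<^sub>M lborel) ({Re l<..<Re u} \<times> {Im l<..<Im u})"
    by (subst emeasure_distr[OF meas]) (auto simp: space_pair_measure)
  also have "\<dots> = emeasure lborel {Re l<..<Re u} * emeasure lborel {Im l<..<Im u}"
    by (subst lborel.emeasure_pair_measure_Times) auto
  also have "\<dots> = ennreal (\<Prod>b\<in>Basis. (u - l) \<bullet> b)"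
    using lu[of 1] lu[of \<i>] by (simp add: Basis_complex_def ennreal_mult)
  finally show "emeasure (distr (lborel \<Otimes>\<^sub>M lborel) borel (\<lambda>(x, y). Complex x y)) (box l u)
      = (\<Prod>b\<in>Basis. (u - l) \<bullet> b)" .
qed simp

lemma nn_integral_lborel_complex:
  assumes "f \<in> borel_measurable borel"
  shows "(\<integral>\<^sup>+z. f z \<partial>lborel) = (\<integral>\<^sup>+x. \<integral>\<^sup>+y. f (Complex x y) \<partial>lborel \<partial>lborel)"
proof -
  have cont: "continuous_on UNIV (\<lambda>p::real \<times> real. Complex (fst p) (snd p))"
    unfolding Complex_eq by (intro continuous_intros)
  have meas: "(\<lambda>p. Complex (fst p) (snd p)) \<in> borel_measurable (lborel \<Otimes>\<^sub>M lborel)"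
    using cont by (simp add: lborel_prod borel_measurable_continuous_onI)
  have "(\<integral>\<^sup>+z. f z \<partial>lborel) = (\<integral>\<^sup>+p. f (Complex (fst p) (snd p)) \<partial>(lborel \<Otimes>\<^sub>M lborel))"
    by (subst lborel_complex_eq) (use assms meas in \<open>simp add: nn_integral_distr case_prod_beta'\<close>)
  also have "\<dots> = (\<integral>\<^sup>+x. \<integral>\<^sup>+y. f (Complex x y) \<partial>lborel \<partial>lborel)"
    using meas assms by (subst lborel.nn_integral_fst[symmetric]) (auto intro: measurable_compose)
  finally show ?thesis .
qed

context lattice
begin

lemma measurable_lattice_chart:
  "(\<lambda>p. of_real (fst p) * \<omega>1 + of_real (snd p) * \<omega>2) \<in> borel_measurable (lborel \<Otimes>\<^sub>M lborel)"
proof -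
  have "continuous_on UNIV (\<lambda>p::real \<times> real. of_real (fst p) * \<omega>1 + of_real (snd p) * \<omega>2)"
    by (intro continuous_intros)
  then show ?thesis by (simp add: lborel_prod borel_measurable_continuous_onI)
qed

text \<open>The change of variables by a linear map of determinant \<open>D\<close>. For nonnegative
  integrands the order of integration can be exchanged without integrability hypotheses.\<close>

lemma nn_integral_lattice_chart:
  assumes f[measurable]: "f \<in> borel_measurable borel"
  shows "(\<integral>\<^sup>+z. f z \<partial>lborel) = ennreal \<bar>Im (cnj \<omega>1 * \<omega>2)\<bar> *
    (\<integral>\<^sup>+t. \<integral>\<^sup>+s. f (of_real s * \<omega>1 + of_real t * \<omega>2) \<partial>lborel \<partial>lborel)"
proof -
  define a b c d where abcd: "a = Re \<omega>1" "b = Im \<omega>1" "c = Re \<omega>2" "d = Im \<omega>2"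
  define D where "D = a * d - b * c"
  have D: "Im (cnj \<omega>1 * \<omega>2) = D" by (simp add: D_def abcd)
  have D0: "D \<noteq> 0" using nondegenerate D by simp
  define g where "g x y = f (Complex x y)" for x y
  have target: "g (a * s + c * t) (b * s + d * t) = f (of_real s * \<omega>1 + of_real t * \<omega>2)" for s t
    unfolding g_def by (rule arg_cong[of _ _ f]) (simp add: complex_eq_iff abcd mult.commute)
  have [measurable]: "(\<lambda>p. g (h1 p) (h2 p)) \<in> borel_measurable N"
    if "h1 \<in> borel_measurable N" "h2 \<in> borel_measurable N" for h1 h2 and N :: "'m measure"
    unfolding g_def Complex_eq using that by measurable
  have start: "(\<integral>\<^sup>+z. f z \<partial>lborel) = (\<integral>\<^sup>+x. \<integral>\<^sup>+y. g x y \<partial>lborel \<partial>lborel)"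
    unfolding g_def by (rule nn_integral_lborel_complex[OF f])
  show ?thesis
  \<comment> \<open>If \<open>a\<close> is nonzero, the substitutions y = (b/a) x + (D/a) t and x =
    c t + a s are affine in one variable each and contribute the factors |D/a| and |a|. If
    \<open>a\<close> is 0, the substitutions are x = c t and y = d t + b s.\<close>
  proof (cases "a = 0")
    case False
    have "(\<integral>\<^sup>+x. \<integral>\<^sup>+y. g x y \<partial>lborel \<partial>lborel)
        = (\<integral>\<^sup>+x. ennreal \<bar>D / a\<bar> * (\<integral>\<^sup>+t. g x (b / a * x + D / a * t) \<partial>lborel) \<partial>lborel)"
      using D0 False by (intro nn_integral_cong nn_integral_real_affine) auto
    also have "\<dots> = ennreal \<bar>D / a\<bar> * (\<integral>\<^sup>+x. \<integral>\<^sup>+t. g x (b / a * x + D / a * t) \<partial>lborel \<partial>lborel)"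
      by (rule nn_integral_cmult) measurable
    also have "(\<integral>\<^sup>+x. \<integral>\<^sup>+t. g x (b / a * x + D / a * t) \<partial>lborel \<partial>lborel)
        = (\<integral>\<^sup>+t. \<integral>\<^sup>+x. g x (b / a * x + D / a * t) \<partial>lborel \<partial>lborel)"
      by (rule lborel_pair.Fubini') measurable
    also have "\<dots> = (\<integral>\<^sup>+t. ennreal \<bar>a\<bar> * (\<integral>\<^sup>+s. g (c * t + a * s) (b / a * (c * t + a * s) + D / a * t) \<partial>lborel) \<partial>lborel)"
      using False by (intro nn_integral_cong nn_integral_real_affine) auto
    also have "\<dots> = ennreal \<bar>a\<bar> * (\<integral>\<^sup>+t. \<integral>\<^sup>+s. g (c * t + a * s) (b / a * (c * t + a * s) + D / a * t) \<partial>lborel \<partial>lborel)"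
      by (rule nn_integral_cmult) measurable
    also have "(\<lambda>t s. g (c * t + a * s) (b / a * (c * t + a * s) + D / a * t))
        = (\<lambda>t s. f (of_real s * \<omega>1 + of_real t * \<omega>2))"
    proof (intro ext)
      fix t s
      have "b / a * (c * t + a * s) + D / a * t = b * s + d * t"
        using False by (simp add: D_def field_simps)
      then show "g (c * t + a * s) (b / a * (c * t + a * s) + D / a * t) = f (of_real s * \<omega>1 + of_real t * \<omega>2)"
        using target[of s t] by (simp add: add.commute)
    qed
    finally have "(\<integral>\<^sup>+z. f z \<partial>lborel) = ennreal \<bar>D / a\<bar> * (ennreal \<bar>a\<bar> *
      (\<integral>\<^sup>+t. \<integral>\<^sup>+s. f (of_real s * \<omega>1 + of_real t * \<omega>2) \<partial>lborel \<partial>lborel))" using start by simp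
    moreover have "ennreal \<bar>D / a\<bar> * ennreal \<bar>a\<bar> = ennreal \<bar>D\<bar>"
      using False by (simp add: ennreal_mult[symmetric] abs_divide)
    ultimately show ?thesis unfolding D by (simp add: mult.assoc[symmetric])
  next
    case True
    have bc: "b \<noteq> 0" "c \<noteq> 0" "\<bar>c\<bar> * \<bar>b\<bar> = \<bar>D\<bar>" using D0 True by (auto simp: D_def abs_mult)
    have "(\<integral>\<^sup>+x. \<integral>\<^sup>+y. g x y \<partial>lborel \<partial>lborel) = ennreal \<bar>c\<bar> * (\<integral>\<^sup>+t. \<integral>\<^sup>+y. g (0 + c * t) y \<partial>lborel \<partial>lborel)"
      using bc by (intro nn_integral_real_affine) auto
    also have "(\<integral>\<^sup>+t. \<integral>\<^sup>+y. g (0 + c * t) y \<partial>lborel \<partial>lborel)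
        = (\<integral>\<^sup>+t. ennreal \<bar>b\<bar> * (\<integral>\<^sup>+s. g (0 + c * t) (d * t + b * s) \<partial>lborel) \<partial>lborel)"
      using bc by (intro nn_integral_cong nn_integral_real_affine) auto
    also have "\<dots> = ennreal \<bar>b\<bar> * (\<integral>\<^sup>+t. \<integral>\<^sup>+s. g (0 + c * t) (d * t + b * s) \<partial>lborel \<partial>lborel)"
      by (rule nn_integral_cmult) measurable
    also have "(\<lambda>t s. g (0 + c * t) (d * t + b * s)) = (\<lambda>t s. f (of_real s * \<omega>1 + of_real t * \<omega>2))"
      using target True by (auto simp: fun_eq_iff add.commute)
    finally have "(\<integral>\<^sup>+z. f z \<partial>lborel) = ennreal \<bar>c\<bar> * (ennreal \<bar>b\<bar> *
      (\<integral>\<^sup>+t. \<integral>\<^sup>+s. f (of_real s * \<omega>1 + of_real t * \<omega>2) \<partial>lborel \<partial>lborel))" using start by simp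
    then show ?thesis unfolding D using bc by (simp add: mult.assoc[symmetric] ennreal_mult[symmetric])
  qed
qed

lemma P_borel [measurable]: "P \<in> sets borel"
proof -
  have "P = {z. 0 \<le> coord1 z} \<inter> {z. coord1 z < 1} \<inter> {z. 0 \<le> coord2 z} \<inter> {z. coord2 z < 1}"
    by (auto simp: parallelogram_iff_coord)
  moreover have "closed {z. 0 \<le> coord1 z}" "open {z. coord1 z < 1}" "closed {z. 0 \<le> coord2 z}" "open {z. coord2 z < 1}"
    by (auto intro!: closed_Collect_le open_Collect_less continuous_intros)
  ultimately show ?thesis by auto
qed

lemma emeasure_P: "emeasure lborel P = ennreal \<bar>Im (cnj \<omega>1 * \<omega>2)\<bar>"
proof -
  have "emeasure lborel P = (\<integral>\<^sup>+z. indicator P z \<partial>lborel)" by simp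
  also have "\<dots> = ennreal \<bar>Im (cnj \<omega>1 * \<omega>2)\<bar> *
    (\<integral>\<^sup>+t. \<integral>\<^sup>+s. indicator P (of_real s * \<omega>1 + of_real t * \<omega>2) \<partial>lborel \<partial>lborel)"
    by (rule nn_integral_lattice_chart) measurable
  also have "(\<lambda>t s. indicator P (of_real s * \<omega>1 + of_real t * \<omega>2)) =
      (\<lambda>t s. indicator {0..<1} t * indicator {0..<1::real} s :: ennreal)"
    by (auto simp: fun_eq_iff indicator_def parallelogram_iff_coord coord_combination)
  also have "(\<integral>\<^sup>+t. \<integral>\<^sup>+s. indicator {0..<1::real} t * indicator {0..<1::real} s \<partial>lborel \<partial>lborel) = (1::ennreal)"
    by (simp add: nn_integral_cmult)
  finally show ?thesis by simp
qed

end

section \<open>The torus as a probability space\<close>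

locale unit_torus = lattice +
  assumes volume_one: "torus_volume \<omega>1 \<omega>2 = 1"
begin

lemma area_one: "\<bar>Im (cnj \<omega>1 * \<omega>2)\<bar> = 1"
  using volume_one unfolding torus_volume_def measure_def emeasure_P by simp

abbreviation TM :: "complex measure" where "TM \<equiv> restrict_space lborel P"

lemma space_TM: "space TM = P" by (simp add: space_restrict_space)

lemma prob_space_TM: "prob_space TM"
proof (rule prob_spaceI)
  have "emeasure TM P = emeasure lborel P" by (subst emeasure_restrict_space) auto
  then show "emeasure TM (space TM) = 1" by (simp only: space_TM emeasure_P area_one ennreal_1)
qed

sublocale TM: prob_space TM by (rule prob_space_TM)

lemma measurable_TM: "f \<in> borel_measurable borel \<Longrightarrow> f \<in> borel_measurable TM"
  by (rule measurable_restrict_space1) simp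

lemma integral_TM: "integral\<^sup>L TM f = (LINT z:P|lborel. f z)" for f :: "complex \<Rightarrow> 'a::{banach,second_countable_topology}"
  by (simp add: integral_restrict_space set_lebesgue_integral_def)

lemma integrable_TM: "integrable TM f \<longleftrightarrow> set_integrable lborel P f" for f :: "complex \<Rightarrow> 'a::{banach,second_countable_topology}"
  by (simp add: integrable_restrict_space set_integrable_def)

lemma nn_integral_TM:
  assumes [measurable]: "f \<in> borel_measurable borel"
  shows "(\<integral>\<^sup>+z. f z \<partial>TM) = (\<integral>\<^sup>+t. \<integral>\<^sup>+s. f (of_real s * \<omega>1 + of_real t * \<omega>2) * (indicator {0..<1} s * indicator {0..<1} t) \<partial>lborel \<partial>lborel)"
proof -
  have "(\<integral>\<^sup>+z. f z \<partial>TM) = (\<integral>\<^sup>+z. f z * indicator P z \<partial>lborel)"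
    by (rule nn_integral_restrict_space) simp
  also have "\<dots> = (\<integral>\<^sup>+t. \<integral>\<^sup>+s. f (of_real s * \<omega>1 + of_real t * \<omega>2) * indicator P (of_real s * \<omega>1 + of_real t * \<omega>2) \<partial>lborel \<partial>lborel)"
  proof -
    have meas: "(\<lambda>z. f z * indicator P z) \<in> borel_measurable borel" by measurable
    show ?thesis unfolding nn_integral_lattice_chart[OF meas] area_one by simp
  qed
  also have "(\<lambda>t s. f (of_real s * \<omega>1 + of_real t * \<omega>2) * indicator P (of_real s * \<omega>1 + of_real t * \<omega>2))
      = (\<lambda>t s. f (of_real s * \<omega>1 + of_real t * \<omega>2) * (indicator {0..<1} s * indicator {0..<1} t))"
    by (auto simp: fun_eq_iff indicator_def parallelogram_iff_coord coord_combination)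
  finally show ?thesis .
qed

lemma TM_eq_distr:
  "TM = distr (restrict_space (lborel \<Otimes>\<^sub>M lborel) ({0..<1} \<times> {0..<1})) (restrict_space borel P)
     (\<lambda>p. of_real (fst p) * \<omega>1 + of_real (snd p) * \<omega>2)" (is "_ = distr ?N _ ?L")
proof (rule measure_eqI)
  show "sets TM = sets (distr ?N (restrict_space borel P) ?L)"
    by (simp add: sets_restrict_space)
  have L: "?L \<in> measurable ?N (restrict_space borel P)"
    by (rule measurable_restrict_space3[OF measurable_lattice_chart])
       (auto simp: parallelogram_iff_coord coord_combination)
  fix A assume "A \<in> sets TM"
  then have A: "A \<subseteq> P" "A \<in> sets borel"
    by (auto simp: sets_restrict_space)
  have A': "A \<in> sets (restrict_space borel P)" using A by (auto simp: sets_restrict_space image_iff intro!: bexI[of _ A])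
  have sq: "{0..<1::real} \<times> {0..<1::real} \<in> sets (lborel \<Otimes>\<^sub>M lborel)"
    by (intro pair_measureI) auto
  have "emeasure TM A = (\<integral>\<^sup>+z. indicator A z \<partial>TM)"
    using \<open>A \<in> sets TM\<close> by simp
  also have "\<dots> = (\<integral>\<^sup>+t. \<integral>\<^sup>+s. indicator A (of_real s * \<omega>1 + of_real t * \<omega>2) * (indicator {0..<1} s * indicator {0..<1} t) \<partial>lborel \<partial>lborel)"
    by (rule nn_integral_TM) (use A in measurable)
  also have "\<dots> = (\<integral>\<^sup>+p. indicator A (?L p) * (indicator {0..<1} (fst p) * indicator {0..<1} (snd p)) \<partial>(lborel \<Otimes>\<^sub>M lborel))"
    using A measurable_lattice_chart by (subst lborel_pair.nn_integral_snd[symmetric]) (auto intro!: borel_measurable_times_ennreal measurable_compose[OF measurable_lattice_chart])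
  also have "\<dots> = (\<integral>\<^sup>+p. indicator A (?L p) * indicator ({0..<1} \<times> {0..<1}) p \<partial>(lborel \<Otimes>\<^sub>M lborel))"
    by (intro nn_integral_cong) (auto simp: indicator_def)
  also have "\<dots> = (\<integral>\<^sup>+p. indicator A (?L p) \<partial>?N)"
    using sq by (subst nn_integral_restrict_space) auto
  also have "\<dots> = (\<integral>\<^sup>+z. indicator A z \<partial>distr ?N (restrict_space borel P) ?L)"
    by (subst nn_integral_distr[OF L]) (use A' in auto)
  also have "\<dots> = emeasure (distr ?N (restrict_space borel P) ?L) A"
    using A' by simp
  finally show "emeasure TM A = emeasure (distr ?N (restrict_space borel P) ?L) A" .
qed

text \<open>Both orders are recorded because a derivative along \<open>\<omega>1\<close> is
  integrated first in \<open>s\<close> and one along \<open>\<omega>2\<close> first in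
  \<open>t\<close>. A continuous integrand is bounded on the unit square, so Fubini's theorem
  applies.\<close>

lemma integral_TM_iterated:
  fixes f :: "complex \<Rightarrow> real"
  assumes "continuous_on UNIV f"
  shows "integral\<^sup>L TM f = (LBINT t:{0..<1}. LBINT s:{0..<1}. f (of_real s * \<omega>1 + of_real t * \<omega>2))"
    and "integral\<^sup>L TM f = (LBINT s:{0..<1}. LBINT t:{0..<1}. f (of_real s * \<omega>1 + of_real t * \<omega>2))"
proof -
  let ?L = "\<lambda>p. of_real (fst p) * \<omega>1 + of_real (snd p) * \<omega>2"
  let ?N = "restrict_space (lborel \<Otimes>\<^sub>M (lborel :: real measure)) ({0..<1} \<times> {0..<1})"
  have fm[measurable]: "f \<in> borel_measurable borel" by (rule borel_measurable_continuous_onI[OF assms])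
  have sq: "{0..<1::real} \<times> {0..<1::real} \<in> sets (lborel \<Otimes>\<^sub>M lborel)"
    by (intro pair_measureI) auto
  have L: "?L \<in> measurable ?N (restrict_space borel P)"
    by (rule measurable_restrict_space3[OF measurable_lattice_chart])
       (auto simp: parallelogram_iff_coord coord_combination)
  let ?h = "\<lambda>p. indicator ({0..<1} \<times> {0..<1}) p *\<^sub>R f (?L p)"
  have "integral\<^sup>L TM f = (\<integral>p. f (?L p) \<partial>?N)"
    by (subst TM_eq_distr, rule integral_distr[OF L]) (rule measurable_restrict_space1[OF fm])
  also have "\<dots> = (\<integral>p. ?h p \<partial>(lborel \<Otimes>\<^sub>M lborel))"
    using sq by (subst integral_restrict_space) auto
  finally have eq: "integral\<^sup>L TM f = (\<integral>p. ?h p \<partial>(lborel \<Otimes>\<^sub>M lborel))" .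
  have cont: "continuous_on UNIV (\<lambda>p::real\<times>real. f (?L p))"
    by (intro continuous_on_compose2[OF assms]) (auto intro!: continuous_intros)
  have "compact ((\<lambda>p. f (?L p)) ` ({0..1} \<times> {0..1}))"
    by (intro compact_continuous_image compact_Times continuous_on_subset[OF cont]) auto
  then have "bounded ((\<lambda>p. f (?L p)) ` ({0..1} \<times> {0..1}))" by (rule compact_imp_bounded)
  then obtain B where B: "\<And>p. p \<in> {0..1} \<times> {0..1} \<Longrightarrow> \<bar>f (?L p)\<bar> \<le> B"
    unfolding bounded_iff by force
  have fin: "emeasure (lborel \<Otimes>\<^sub>M lborel) ({0..<1::real} \<times> {0..<1::real}) < \<infinity>"
    by (subst lborel.emeasure_pair_measure_Times) auto
  have int: "integrable (lborel \<Otimes>\<^sub>M lborel) ?h"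
    using B by (intro integrableI_bounded_set[where A = "{0..<1} \<times> {0..<1}" and B = B] sq fin)
      (auto simp: indicator_def intro!: AE_I2 borel_measurable_scaleR measurable_compose[OF measurable_lattice_chart fm] borel_measurable_indicator sq)
  have "(\<integral>p. ?h p \<partial>(lborel \<Otimes>\<^sub>M lborel)) = (LBINT t. LBINT s. ?h (s, t))"
    using lborel_pair.integral_snd[of "\<lambda>s t. ?h (s, t)"] int by (simp add: case_prod_beta')
  also have "(\<lambda>t. LBINT s. ?h (s, t)) = (\<lambda>t. indicator {0..<1} t *\<^sub>R (LBINT s:{0..<1}. f (of_real s * \<omega>1 + of_real t * \<omega>2)))"
    by (auto simp: fun_eq_iff indicator_def set_lebesgue_integral_def if_distrib cong: if_cong intro!: Bochner_Integration.integral_cong)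
  finally show "integral\<^sup>L TM f = (LBINT t:{0..<1}. LBINT s:{0..<1}. f (of_real s * \<omega>1 + of_real t * \<omega>2))"
    using eq by (simp add: set_lebesgue_integral_def)
  have "(\<integral>p. ?h p \<partial>(lborel \<Otimes>\<^sub>M lborel)) = (LBINT s. LBINT t. ?h (s, t))"
    using lborel_pair.integral_fst'[OF int] by simp
  also have "(\<lambda>s. LBINT t. ?h (s, t)) = (\<lambda>s. indicator {0..<1} s *\<^sub>R (LBINT t:{0..<1}. f (of_real s * \<omega>1 + of_real t * \<omega>2)))"
    by (auto simp: fun_eq_iff indicator_def set_lebesgue_integral_def if_distrib cong: if_cong intro!: Bochner_Integration.integral_cong)
  finally show "integral\<^sup>L TM f = (LBINT s:{0..<1}. LBINT t:{0..<1}. f (of_real s * \<omega>1 + of_real t * \<omega>2))"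
    using eq by (simp add: set_lebesgue_integral_def)
qed

lemma P_subset_compact: "P \<subseteq> (\<lambda>(s, t). of_real s * \<omega>1 + of_real t * \<omega>2) ` ({0..1} \<times> {0..1})"
proof
  fix z assume "z \<in> P"
  then show "z \<in> (\<lambda>(s, t). of_real s * \<omega>1 + of_real t * \<omega>2) ` ({0..1} \<times> {0..1})"
    by (intro image_eqI[of _ _ "(coord1 z, coord2 z)"]) (auto simp: coord_decomp parallelogram_iff_coord)
qed

lemma bounded_on_P:
  fixes f :: "complex \<Rightarrow> 'a::real_normed_vector"
  assumes "continuous_on UNIV f"
  obtains B where "\<And>z. z \<in> P \<Longrightarrow> norm (f z) \<le> B"
proof -
  have "compact (f ` (\<lambda>(s, t). of_real s * \<omega>1 + of_real t * \<omega>2) ` ({0..1} \<times> {0..1}))"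
    by (intro compact_continuous_image compact_Times continuous_on_subset[OF assms])
       (auto intro!: continuous_intros simp: case_prod_beta)
  then obtain B where "\<And>y. y \<in> f ` (\<lambda>(s, t). of_real s * \<omega>1 + of_real t * \<omega>2) ` ({0..1} \<times> {0..1}) \<Longrightarrow> norm y \<le> B"
    using compact_imp_bounded bounded_iff by metis
  then show ?thesis using that P_subset_compact by blast
qed

lemma continuous_measurable_TM:
  fixes f :: "complex \<Rightarrow> 'a::{second_countable_topology, real_normed_vector}"
  assumes "continuous_on UNIV f" shows "f \<in> borel_measurable TM"
  by (rule measurable_TM[OF borel_measurable_continuous_onI[OF assms]])

lemma continuous_integrable_TM:
  fixes f :: "complex \<Rightarrow> real"
  assumes "continuous_on UNIV f"
  shows "integrable TM f"
proof -
  obtain B where B: "\<And>z. z \<in> P \<Longrightarrow> norm (f z) \<le> B" using bounded_on_P[OF assms] by blast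
  show ?thesis
    by (rule TM.integrable_const_bound[of _ B])
       (use B continuous_measurable_TM[OF assms] in \<open>auto simp: space_TM\<close>)
qed

text \<open>Translates of the lattice are countable. The point \<open>z\<close> is arbitrary so that
  kernels singular on \<open>z + \<Lambda>\<close> can be handled almost everywhere.\<close>

lemma AE_TM_off_lattice: "AE y in TM. y - z \<notin> \<Lambda>"
proof -
  have "countable ((\<lambda>w. z + w) ` \<Lambda>)" using countable_lattice by simp
  then have "(\<lambda>w. z + w) ` \<Lambda> \<in> null_sets lborel" by (rule countable_imp_null_set_lborel)
  then have "AE y in lborel. y \<notin> (\<lambda>w. z + w) ` \<Lambda>" by (rule AE_not_in)
  then have "AE y in lborel. y - z \<notin> \<Lambda>"
    by (rule AE_mp) (auto intro!: AE_I2 simp: image_iff)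
  then show ?thesis by (subst AE_restrict_space_iff) (auto elim: eventually_mono)
qed

section \<open>Integrals of derivatives over the torus and Green's identity\<close>

lemma LBINT_unit_FTC:
  fixes F :: "real \<Rightarrow> real"
  assumes "\<And>x. (F has_real_derivative f x) (at x)" "continuous_on UNIV f"
  shows "(LBINT x:{0..<1}. f x) = F 1 - F 0"
proof -
  have "(LBINT x:{0..<1}. f x) = (LBINT x:{0..1}. f x)"
    unfolding set_lebesgue_integral_def
  proof (rule integral_cong_AE)
    have [measurable]: "f \<in> borel_measurable borel" by (rule borel_measurable_continuous_onI[OF assms(2)])
    show "(\<lambda>x. indicator {0..<1} x *\<^sub>R f x) \<in> borel_measurable lborel" by measurable
    show "(\<lambda>x. indicator {0..1} x *\<^sub>R f x) \<in> borel_measurable lborel" by measurable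
    have "AE x in lborel. x \<noteq> (1::real)" by (rule AE_lborel_singleton)
    then show "AE x in lborel. indicator {0..<1} x *\<^sub>R f x = indicator {0..1} x *\<^sub>R f x"
      by eventually_elim (auto simp: indicator_def)
  qed
  also have "\<dots> = F 1 - F 0"
    unfolding set_lebesgue_integral_def
    using integral_FTC_Icc_real[of 0 1 F f] assms
    by (simp add: continuous_on_eq_continuous_at mult.commute)
  finally show ?thesis .
qed

lemma integral_dird:
  assumes F: "Ck_on 1 F UNIV" and 1: "\<And>z. F (z + \<omega>1) = F z + c1" and 2: "\<And>z. F (z + \<omega>2) = F z + c2"
  shows "integral\<^sup>L TM (dird v F) = coord1 v * c1 + coord2 v * c2"
proof -
  have D: "F differentiable (at z)" "continuous_on UNIV (dird v F)" for v z
    using F by auto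
  have line: "continuous_on UNIV (\<lambda>t::real. dird v F (a + of_real t * w))" for v a w
    by (intro continuous_on_compose2[OF D(2)]) (auto intro!: continuous_intros)
  have i1: "integral\<^sup>L TM (dird \<omega>1 F) = c1"
  proof -
    have "(LBINT s:{0..<1}. dird \<omega>1 F (of_real s * \<omega>1 + of_real t * \<omega>2)) = c1" for t
      using LBINT_unit_FTC[OF dird_line[OF D(1)] line, of "of_real t * \<omega>2" \<omega>1] 1[of "of_real t * \<omega>2"]
      by (simp add: add.commute)
    then show ?thesis by (simp add: integral_TM_iterated(1)[OF D(2)] set_integral_const)
  qed
  have i2: "integral\<^sup>L TM (dird \<omega>2 F) = c2"
  proof -
    have "(LBINT t:{0..<1}. dird \<omega>2 F (of_real s * \<omega>1 + of_real t * \<omega>2)) = c2" for s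
      using LBINT_unit_FTC[OF dird_line[OF D(1)] line, of "of_real s * \<omega>1" \<omega>2] 2[of "of_real s * \<omega>1"]
      by simp
    then show ?thesis by (simp add: integral_TM_iterated(2)[OF D(2)] set_integral_const)
  qed
  have "dird v F z = coord1 v * dird \<omega>1 F z + coord2 v * dird \<omega>2 F z" for z
  proof -
    interpret linear "\<lambda>v. dird v F z" by (rule dird_linear[OF D(1)])
    have "dird v F z = dird (coord1 v *\<^sub>R \<omega>1 + coord2 v *\<^sub>R \<omega>2) F z"
      by (simp add: scaleR_conv_of_real coord_decomp)
    then show ?thesis by (simp only: add scale real_scaleR_def)
  qed
  then have "integral\<^sup>L TM (dird v F) = (\<integral>z. coord1 v * dird \<omega>1 F z + coord2 v * dird \<omega>2 F z \<partial>TM)"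
    by simp
  also have "\<dots> = coord1 v * c1 + coord2 v * c2"
    by (subst Bochner_Integration.integral_add)
       (auto intro!: integrable_mult_right continuous_integrable_TM D(2) simp: i1 i2)
  finally show ?thesis .
qed

lemma integral_dird_periodic:
  assumes "Ck_on 1 F UNIV" "periodic F"
  shows "integral\<^sup>L TM (dird v F) = 0"
  using integral_dird[OF assms(1), of 0 0 v] periodicD[OF assms(2)] lattice_generators by simp

lemma periodic_dird:
  assumes "periodic F"
  shows "periodic (dird v F)"
  unfolding periodic_def
proof (intro allI ballI)
  fix z w assume w: "w \<in> \<Lambda>"
  have shift: "(F has_derivative D) (at z)" if "(F has_derivative D) (at (z + w))" "w \<in> \<Lambda>" for z w D
  proof -
    have "((\<lambda>x. x + w) has_derivative (\<lambda>x. x)) (at z)" by (auto intro!: derivative_eq_intros)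
    from diff_chain_at[OF this that(1)] have "((\<lambda>x. F (x + w)) has_derivative D) (at z)" by (simp add: o_def)
    then show ?thesis by (simp only: periodicD[OF assms that(2)])
  qed
  have "(F has_derivative D) (at (z + w)) \<longleftrightarrow> (F has_derivative D) (at z)" for D
    using shift[of D z w] shift[of D "z + w" "- w"] w lattice_minus by auto
  then show "dird v F (z + w) = dird v F z" unfolding frechet_derivative_def by simp
qed

lemma laplacian_eq_dird:
  assumes "Ck_on 2 F S" "z \<in> S"
  shows "dird v F differentiable (at z)" "F differentiable (at z)"
  using assms by (auto simp: numeral_2_eq_2)

lemma continuous_on_laplacian: "Ck_on 2 F S \<Longrightarrow> continuous_on S (laplacian F)"
  unfolding laplacian_eq[abs_def] by (auto simp: numeral_2_eq_2 intro!: continuous_intros)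

lemma periodic_laplacian:
  assumes "periodic F"
  shows "periodic (laplacian F)"
proof -
  have "periodic (dird v (dird v F))" for v
    by (intro periodic_dird assms)
  then show ?thesis unfolding periodic_def laplacian_eq by simp
qed

lemma integral_laplacian_periodic:
  assumes "Ck_on 2 F UNIV" "periodic F"
  shows "integral\<^sup>L TM (laplacian F) = 0"
proof -
  have C: "Ck_on 1 F UNIV" "Ck_on 1 (dird v F) UNIV" for v
    using assms(1) Ck_on_SucD[of 1 F UNIV] by (auto simp: numeral_2_eq_2)
  have "integral\<^sup>L TM (dird v (dird v F)) = 0" for v
    by (intro integral_dird_periodic periodic_dird C assms(2))
  moreover have "integrable TM (dird v (dird v F))" for v
    using C by (intro continuous_integrable_TM) auto
  ultimately show ?thesis unfolding laplacian_eq by simp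
qed

text \<open>The field f dg - g df vanishes where \<open>g\<close> does, so it extends by 0 across
  the set where \<open>f\<close> may be singular and remains periodic and continuously
  differentiable. Its divergence then has integral 0. The second conclusion records that the product
  is integrable.\<close>

lemma green_periodic_supported:
  assumes f: "Ck_on 2 f S" "periodic f" "open S" and g: "Ck_on 2 g UNIV" "periodic g"
    and N: "open N" "\<And>z. z \<in> N \<Longrightarrow> g z = 0" "S \<union> N = UNIV"
  shows "integral\<^sup>L TM (\<lambda>z. f z * laplacian g z) = integral\<^sup>L TM (\<lambda>z. laplacian f z * g z)"
    and "continuous_on UNIV (\<lambda>z. laplacian f z * g z)"
proof -
  have C: "Ck_on 1 h W" "Ck_on 1 (dird v h) W" if "Ck_on 2 h W" for v h W
    using that Ck_on_SucD[of 1 h W] by (auto simp: numeral_2_eq_2)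
  have D: "h differentiable (at z)" "dird v h differentiable (at z)" if "Ck_on 2 h W" "z \<in> W" for v h z W
    using laplacian_eq_dird[OF that] by auto
  have gS: "Ck_on 2 g S" using g(1) Ck_on_subset by blast
  have zero1: "dird v h z = 0" if "\<And>z. z \<in> N \<Longrightarrow> h z = 0" "z \<in> N" for v z and h :: "complex \<Rightarrow> real"
    using dird_cong_open[OF N(1) that(2), of h "\<lambda>_. 0" v] that(1) by simp
  have gN: "dird v g z = 0" "dird v (dird v g) z = 0" if "z \<in> N" for v z
    using zero1[OF N(2) that] zero1[of "dird v g" z v] zero1[OF N(2)] that by auto
  define V where "V v z = f z * dird v g z - dird v f z * g z" for v z
  have VN: "V v z = 0" if "z \<in> N" for v z using that gN N(2) by (simp add: V_def)
  have "Ck_on 1 (V v) S" for v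
    unfolding V_def
    by (intro Ck_on_diff Ck_on_mult f(3) C(1)[OF f(1)] C(2)[OF f(1)] C(1)[OF gS] C(2)[OF gS])
  moreover have "Ck_on 1 (V v) N" for v
    using Ck_on_cong[OF N(1), of "V v" "\<lambda>_. 0" 1] VN Ck_on_const by auto
  ultimately have CV: "Ck_on 1 (V v) UNIV" for v
    using Ck_on_Un[OF f(3) N(1)] N(3) by metis
  have "periodic (V v)" for v
    using periodic_dird[OF f(2)] periodic_dird[OF g(2)] f(2) g(2)
    unfolding periodic_def V_def by simp
  then have zero: "integral\<^sup>L TM (dird v (V v)) = 0" for v by (intro integral_dird_periodic CV)
  have dV: "dird v (V v) z = f z * dird v (dird v g) z - dird v (dird v f) z * g z" for v z
  proof (cases "z \<in> S")
    case True
    have "(V v has_derivative (\<lambda>w. (f z * dird w (dird v g) z + dird w f z * dird v g z) -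
        (dird v f z * dird w g z + dird w (dird v f) z * g z))) (at z)"
      unfolding V_def by (auto intro!: derivative_eq_intros has_derivative_dird D[OF f(1) True] D[OF gS True])
    from dird_eqI[OF this, of v] show ?thesis by simp
  next
    case False
    then have "z \<in> N" using N(3) by blast
    then show ?thesis using zero1[of "V v" z v] VN gN N(2) by simp
  qed
  have int: "integrable TM (dird v (V v))" for v
    using CV by (intro continuous_integrable_TM) auto
  have "f z * laplacian g z - laplacian f z * g z = dird 1 (V 1) z + dird \<i> (V \<i>) z" for z
    by (simp add: dV laplacian_eq algebra_simps)
  then have I: "(\<integral>z. f z * laplacian g z - laplacian f z * g z \<partial>TM) = 0"
    using zero int by (simp add: Bochner_Integration.integral_add)
  have c1: "continuous_on UNIV (\<lambda>z. f z * laplacian g z)"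
  proof -
    have "continuous_on S (\<lambda>z. f z * laplacian g z)"
      by (intro continuous_on_mult continuous_on_laplacian[OF gS] Ck_on_imp_continuous[OF f(1)])
    moreover have "continuous_on N (\<lambda>z. f z * laplacian g z)"
      using gN by (simp add: laplacian_eq cong: continuous_on_cong)
    ultimately show ?thesis using continuous_on_open_Un[OF f(3) N(1)] N(3) by metis
  qed
  show c2: "continuous_on UNIV (\<lambda>z. laplacian f z * g z)"
  proof -
    have "continuous_on S (\<lambda>z. laplacian f z * g z)"
      by (intro continuous_on_mult continuous_on_laplacian[OF f(1)] Ck_on_imp_continuous[OF gS])
    moreover have "continuous_on N (\<lambda>z. laplacian f z * g z)"
      using N(2) by (simp cong: continuous_on_cong)
    ultimately show ?thesis using continuous_on_open_Un[OF f(3) N(1)] N(3) by metis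
  qed
  show "integral\<^sup>L TM (\<lambda>z. f z * laplacian g z) = integral\<^sup>L TM (\<lambda>z. laplacian f z * g z)"
    using I Bochner_Integration.integral_diff[OF continuous_integrable_TM[OF c1] continuous_integrable_TM[OF c2]]
    by simp
qed

lemma green_periodic:
  assumes "Ck_on 2 f UNIV" "periodic f" "Ck_on 2 g UNIV" "periodic g"
  shows "integral\<^sup>L TM (\<lambda>z. f z * laplacian g z) = integral\<^sup>L TM (\<lambda>z. laplacian f z * g z)"
  by (rule green_periodic_supported(1)[of f UNIV g "{}"]) (use assms in auto)

end

section \<open>An explicit solution\<close>

lemma laplacian_add:
  assumes "open S" "Ck_on 2 f S" "Ck_on 2 g S" "z \<in> S"
  shows "laplacian (\<lambda>z. f z + g z) z = laplacian f z + laplacian g z"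
proof -
  have D: "h differentiable (at w)" "dird v h differentiable (at w)" if "w \<in> S" "Ck_on 2 h S" for v w h
    using that by (auto simp: numeral_2_eq_2)
  have "dird v (dird v (\<lambda>z. f z + g z)) z = dird v (dird v f) z + dird v (dird v g) z" for v
  proof -
    have "dird v (dird v (\<lambda>z. f z + g z)) z = dird v (\<lambda>z. dird v f z + dird v g z) z"
      by (rule dird_cong_open[OF assms(1,4)], rule dird_eqI)
         (auto intro!: derivative_eq_intros has_derivative_dird D assms)
    also have "\<dots> = dird v (dird v f) z + dird v (dird v g) z"
      by (rule dird_eqI) (auto intro!: derivative_eq_intros has_derivative_dird D assms)
    finally show ?thesis .
  qed
  then show ?thesis by (simp add: laplacian_eq)
qed

lemma laplacian_const: "laplacian (\<lambda>z. c) z = 0"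
  by (simp add: laplacian_eq)

lemma laplacian_cmult:
  assumes "open S" "Ck_on 2 f S" "z \<in> S"
  shows "laplacian (\<lambda>z. c * f z) z = c * laplacian f z"
proof -
  have D: "f differentiable (at w)" "dird v f differentiable (at w)" if "w \<in> S" for v w
    using that assms(2) by (auto simp: numeral_2_eq_2)
  have "dird v (dird v (\<lambda>z. c * f z)) z = c * dird v (dird v f) z" for v
  proof -
    have "dird v (dird v (\<lambda>z. c * f z)) z = dird v (\<lambda>z. c * dird v f z) z"
      by (rule dird_cong_open[OF assms(1,3)], rule dird_eqI)
         (auto intro!: derivative_eq_intros has_derivative_dird D assms)
    also have "\<dots> = c * dird v (dird v f) z"
      by (rule dird_eqI) (auto intro!: derivative_eq_intros has_derivative_dird D assms)
    finally show ?thesis .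
  qed
  then show ?thesis by (simp add: laplacian_eq distrib_left)
qed

section \<open>Logarithms of norms of holomorphic functions\<close>

lemma norm_square_derivative:
  assumes "F holomorphic_on S" "open S" "z \<in> S"
  shows "((\<lambda>z. (cmod (F z))\<^sup>2) has_derivative
      (\<lambda>v. 2 * (Re (F z) * Re (deriv F z * v) + Im (F z) * Im (deriv F z * v)))) (at z)"
proof -
  have F: "(F has_derivative (*) (deriv F z)) (at z)"
    using holomorphic_derivI[OF assms] by (simp add: has_field_derivative_def)
  have "((\<lambda>z. (Re (F z))\<^sup>2 + (Im (F z))\<^sup>2) has_derivative
      (\<lambda>v. 2 * (Re (F z) * Re (deriv F z * v) + Im (F z) * Im (deriv F z * v)))) (at z)"
    by (rule derivative_eq_intros has_derivative_Re[OF F] has_derivative_Im[OF F] refl)+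
       (simp add: fun_eq_iff algebra_simps)
  then show ?thesis by (simp only: cmod_power2)
qed

lemma laplacian_norm_square:
  assumes "F holomorphic_on S" "open S" "z \<in> S"
  shows "laplacian (\<lambda>z. (cmod (F z))\<^sup>2) z = 4 * (cmod (deriv F z))\<^sup>2"
proof -
  have dF: "deriv F holomorphic_on S" by (intro holomorphic_deriv assms)
  have F: "(F has_derivative (*) (deriv F z)) (at z)" and F': "(deriv F has_derivative (*) (deriv (deriv F) z)) (at z)"
    using holomorphic_derivI[OF assms] holomorphic_derivI[OF dF assms(2,3)] by (simp_all add: has_field_derivative_def)
  have "dird v (dird v (\<lambda>z. (cmod (F z))\<^sup>2)) z = 2 * ((Re (deriv F z * v))\<^sup>2 + (Im (deriv F z * v))\<^sup>2
      + Re (F z) * Re (deriv (deriv F) z * v * v) + Im (F z) * Im (deriv (deriv F) z * v * v))" for v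
  proof -
    have "dird v (dird v (\<lambda>z. (cmod (F z))\<^sup>2)) z
        = dird v (\<lambda>z. 2 * (Re (F z) * Re (deriv F z * v) + Im (F z) * Im (deriv F z * v))) z"
      by (rule dird_cong_open[OF assms(2,3)], rule dird_eqI, rule norm_square_derivative) (use assms in auto)
    also have "\<dots> = 2 * ((Re (deriv F z * v))\<^sup>2 + (Im (deriv F z * v))\<^sup>2
      + Re (F z) * Re (deriv (deriv F) z * v * v) + Im (F z) * Im (deriv (deriv F) z * v * v))"
    proof -
      have "((\<lambda>z. deriv F z * v) has_derivative (\<lambda>h. deriv (deriv F) z * h * v)) (at z)"
        by (rule has_derivative_mult_left[OF F'])
      note G = has_derivative_Re[OF this] has_derivative_Im[OF this]
      have "((\<lambda>z. 2 * (Re (F z) * Re (deriv F z * v) + Im (F z) * Im (deriv F z * v))) has_derivative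
        (\<lambda>h. 2 * ((Re (F z) * Re (deriv (deriv F) z * h * v) + Re (deriv F z * h) * Re (deriv F z * v))
           + (Im (F z) * Im (deriv (deriv F) z * h * v) + Im (deriv F z * h) * Im (deriv F z * v))))) (at z)"
        by (intro has_derivative_mult_right has_derivative_add has_derivative_mult G
            has_derivative_Re[OF F] has_derivative_Im[OF F])
      from dird_eqI[OF this, of v] show ?thesis by (simp only: power2_eq_square) (simp add: algebra_simps)
    qed
    finally show ?thesis .
  qed
  from this[of 1] this[of \<i>] show ?thesis
    unfolding laplacian_eq by (simp add: cmod_power2 mult.assoc)
qed

text \<open>Lagrange's identity: (|A|^2 + |B|^2)(|A'|^2 + |B'|^2) exceeds the square modulus of
  cnj(A) A' + cnj(B) B' by |A' B - A B'|^2, and the gradient of |A|^2 + |B|^2 has length twice the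
  modulus of that sum. With B = 0 this says that ln |A|^2 is harmonic where A is nonzero.\<close>

lemma laplacian_ln_pair:
  assumes A: "A holomorphic_on UNIV" and B: "B holomorphic_on UNIV"
    and S: "open S" "z \<in> S" "\<And>z. z \<in> S \<Longrightarrow> (cmod (A z))\<^sup>2 + (cmod (B z))\<^sup>2 > 0"
  shows "laplacian (\<lambda>z. ln ((cmod (A z))\<^sup>2 + (cmod (B z))\<^sup>2)) z
    = 4 * (cmod (wronskian A B z))\<^sup>2 / ((cmod (A z))\<^sup>2 + (cmod (B z))\<^sup>2)\<^sup>2"
proof -
  let ?f = "\<lambda>z. (cmod (A z))\<^sup>2 + (cmod (B z))\<^sup>2"
  have hol: "A holomorphic_on S" "B holomorphic_on S" using A B by (auto intro: holomorphic_on_subset)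
  have C: "Ck_on 2 (\<lambda>z. (cmod (A z))\<^sup>2) S" "Ck_on 2 (\<lambda>z. (cmod (B z))\<^sup>2) S"
    by (intro Ck_on_norm_square S hol)+
  have L: "laplacian ?f z = 4 * ((cmod (deriv A z))\<^sup>2 + (cmod (deriv B z))\<^sup>2)"
    using laplacian_add[OF S(1) C S(2)] laplacian_norm_square[OF hol(1) S(1,2)] laplacian_norm_square[OF hol(2) S(1,2)]
    by simp
  have dd: "dird v ?f z = 2 * (Re (A z) * Re (deriv A z * v) + Im (A z) * Im (deriv A z * v)
      + (Re (B z) * Re (deriv B z * v) + Im (B z) * Im (deriv B z * v)))" for v
    by (rule dird_eqI, rule has_derivative_eq_rhs,
        rule has_derivative_add[OF norm_square_derivative[OF hol(1) S(1,2)] norm_square_derivative[OF hol(2) S(1,2)]])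
       (simp add: algebra_simps)
  have "?f z * laplacian ?f z - ((dird 1 ?f z)\<^sup>2 + (dird \<i> ?f z)\<^sup>2) = 4 * (cmod (wronskian A B z))\<^sup>2"
    unfolding L dd unfolding wronskian_def cmod_power2 by (simp add: algebra_simps power2_eq_square)
  moreover have "?f z \<noteq> 0" using S by force
  moreover have "laplacian (\<lambda>z. ln (?f z)) z = laplacian ?f z / ?f z - ((dird 1 ?f z)\<^sup>2 + (dird \<i> ?f z)\<^sup>2) / (?f z)\<^sup>2"
    by (rule laplacian_ln[OF S(1) Ck_on_add[OF S(1) C] S(2,3)])
  moreover have "X / Y - Z / Y\<^sup>2 = (Y * X - Z) / Y\<^sup>2" if "Y \<noteq> 0" for X Y Z :: real
    using that by (simp add: field_simps power2_eq_square)
  ultimately show ?thesis by simp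
qed

text \<open>The interface between the theta functions and the analysis: the density is |T|^2 e^g,
  with the simple zeros of \<open>T\<close> on the lattice and \<open>g\<close> smooth everywhere,
  so its logarithm is 2 ln |T| + g. The mass is stated for every translate, which spares a separate
  proof that integration over \<open>P\<close> is invariant under translation of periodic
  functions.\<close>

locale liouville_potential = unit_torus +
  fixes T :: "complex \<Rightarrow> complex" and g :: "complex \<Rightarrow> real"
  assumes T_holomorphic: "T holomorphic_on UNIV"
    and T_zero_iff: "T z = 0 \<longleftrightarrow> z \<in> \<Lambda>"
    and T_simple: "deriv T 0 \<noteq> 0"
    and g_smooth: "Ck_on k g UNIV"
    and q_periodic': "w \<in> \<Lambda> \<Longrightarrow> (cmod (T (z + w)))\<^sup>2 * exp (g (z + w)) = (cmod (T z))\<^sup>2 * exp (g z)"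
    and q_even': "(cmod (T (- z)))\<^sup>2 * exp (g (- z)) = (cmod (T z))\<^sup>2 * exp (g z)"
    and q_equation': "z \<notin> \<Lambda> \<Longrightarrow> laplacian (\<lambda>z. ln ((cmod (T z))\<^sup>2 * exp (g z))) z
        = - 4 * pi * ((cmod (T z))\<^sup>2 * exp (g z))"
    and q_mass': "(LINT y|TM. (cmod (T (y - z)))\<^sup>2 * exp (g (y - z))) = 1"

text \<open>\<open>T\<close> is the Wronskian, and \<open>exp g\<close> is 2/pi divided by the
  square of \<open>S = |A|^2 + |B|^2\<close>. The multipliers of the Wronskian have the squared
  moduli of those of \<open>S^2\<close>, whence periodicity of the quotient. The mass is the
  integral of \<Delta> ln S divided by 2 pi.\<close>

theorem (in unit_torus) liouville_potential_exists:
  obtains T g where "liouville_potential \<omega>1 \<omega>2 T g"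
proof -
  obtain A B \<kappa> \<mu> where A: "A holomorphic_on UNIV" and B: "B holomorphic_on UNIV"
    and ev: "\<And>z. A (- z) = A z" "\<And>z. B (- z) = B z"
    and sh1: "\<And>z. A (z + \<omega>1) = A z" "\<And>z. B (z + \<omega>1) = - B z"
    and sh2: "\<And>z. A (z + \<omega>2) = exp (\<kappa> + \<mu> * z) * B z"
    "\<And>z. B (z + \<omega>2) = exp (\<kappa> + \<mu> * z) * A z"
    and nocommon: "\<And>z. A z = 0 \<Longrightarrow> B z \<noteq> 0"
    and Wzero: "\<And>z. wronskian A B z = 0 \<longleftrightarrow> z \<in> \<Lambda>" and W': "deriv (wronskian A B) 0 \<noteq> 0"
    and \<mu>: "\<mu> * \<omega>1 = - \<i> * (sgn (Im (cnj \<omega>1 * \<omega>2)) * pi)"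
    by (rule theta_pair) blast
  define T where "T = wronskian A B"
  define S where "S z = (cmod (A z))\<^sup>2 + (cmod (B z))\<^sup>2" for z
  define g where "g z = ln (2 / pi) + (- 2) * ln (S z)" for z
  define e where "e z = exp (\<kappa> + \<mu> * z)" for z
  have S0: "S z > 0" for z
    using nocommon[of z] unfolding S_def by (metis add_pos_nonneg add_nonneg_pos zero_le_power2 norm_eq_zero zero_less_power2)
  have enz: "e z \<noteq> 0" for z by (simp add: e_def)
  have hole: "e holomorphic_on UNIV" unfolding e_def by (intro holomorphic_intros)
  have holT: "T holomorphic_on UNIV"
    unfolding T_def wronskian_def by (intro holomorphic_intros A B) auto
  have T1: "T (z + \<omega>1) = - T z" for z
    using wronskian_shift[of A B A "\<lambda>z. - B z" "\<lambda>_. 1" \<omega>1 z] A B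
    by (simp add: T_def sh1 wronskian_minus_right holomorphic_intros)
  have T2: "T (z + \<omega>2) = - (e z)\<^sup>2 * T z" for z
    using wronskian_shift[of A B B A e \<omega>2 z] A B hole sh2 by (simp add: T_def wronskian_swap[of B A] e_def)
  have S1: "S (z + \<omega>1) = S z" for z by (simp add: S_def sh1)
  have S2: "S (z + \<omega>2) = (cmod (e z))\<^sup>2 * S z" for z
    unfolding S_def sh2 e_def[symmetric] by (simp add: norm_mult power_mult_distrib algebra_simps)
  have Sm: "S (- z) = S z" for z by (simp add: S_def ev)
  have Tm: "T (- z) = - T z" for z
  proof -
    have "((\<lambda>z. f (- z)) has_field_derivative - deriv f (- z)) (at z)" if "f holomorphic_on UNIV" for f z
      using DERIV_chain'[OF DERIV_minus[OF DERIV_ident] entire_has_derivative[OF that], of z] by simp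
    then have "deriv f (- z) = - deriv f z" if "f holomorphic_on UNIV" "\<And>z. f (- z) = f z" for f z
      using that by (metis (no_types, lifting) DERIV_imp_deriv ext minus_minus)
    from this[OF A ev(1)] this[OF B ev(2)] show ?thesis by (simp add: T_def wronskian_def ev)
  qed
  have CS: "Ck_on k S UNIV" for k
    unfolding S_def by (intro Ck_on_add Ck_on_norm_square A B) auto
  have CL: "Ck_on k (\<lambda>z. ln (S z)) UNIV" for k by (intro Ck_on_ln CS) (auto simp: S0)
  have Cg: "Ck_on k g UNIV" for k
    unfolding g_def by (intro Ck_on_add Ck_on_cmult CL Ck_on_const) auto
  have q: "(cmod (T z))\<^sup>2 * exp (g z) = 2 / pi * ((cmod (T z))\<^sup>2 / (S z)\<^sup>2)" for z
  proof -
    have "g z = ln (2 / pi) - (ln (S z) + ln (S z))" by (simp add: g_def)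
    then have "exp (g z) = 2 / pi / (S z)\<^sup>2"
      using S0[of z] by (simp only: exp_diff exp_add) (simp add: power2_eq_square)
    then show ?thesis by simp
  qed
  have "periodic (\<lambda>z. (cmod (T z))\<^sup>2 * exp (g z))"
  proof (rule periodic_if_generators)
    fix z
    show "(cmod (T (z + \<omega>1)))\<^sup>2 * exp (g (z + \<omega>1)) = (cmod (T z))\<^sup>2 * exp (g z)"
      unfolding q by (simp add: T1 S1)
    show "(cmod (T (z + \<omega>2)))\<^sup>2 * exp (g (z + \<omega>2)) = (cmod (T z))\<^sup>2 * exp (g z)"
      unfolding q unfolding T2 S2 using enz[of z] by (simp add: norm_mult norm_power power_mult_distrib field_simps)
  qed
  moreover have "(cmod (T (- z)))\<^sup>2 * exp (g (- z)) = (cmod (T z))\<^sup>2 * exp (g z)" for z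
    unfolding q by (simp add: Tm Sm)
  moreover have lapS: "laplacian (\<lambda>z. ln (S z)) z = 4 * (cmod (T z))\<^sup>2 / (S z)\<^sup>2" for z
    unfolding S_def T_def using S0 by (intro laplacian_ln_pair[of A B UNIV]) (auto simp: A B S_def)
  moreover have "laplacian (\<lambda>z. ln ((cmod (T z))\<^sup>2 * exp (g z))) z = - 4 * pi * ((cmod (T z))\<^sup>2 * exp (g z))"
    if z: "z \<notin> \<Lambda>" for z
  proof -
    have T0: "T w \<noteq> 0" if "w \<in> - \<Lambda>" for w using that Wzero by (simp add: T_def)
    \<comment> \<open>The case of a pair with second member 0, whose Wronskian vanishes: ln |T|^2 is
      harmonic off the lattice.\<close>
    have 1: "laplacian (\<lambda>z. ln ((cmod (T z))\<^sup>2)) z = 0"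
      using laplacian_ln_pair[of T "\<lambda>_. 0" "- \<Lambda>" z] holT T0 z open_off_lattice
      by (simp add: wronskian_def)
    have C1: "Ck_on 2 (\<lambda>z. ln ((cmod (T z))\<^sup>2)) (- \<Lambda>)"
      by (intro Ck_on_ln Ck_on_norm_square open_off_lattice holomorphic_on_subset[OF holT]) (use T0 in auto)
    have Cg': "Ck_on 2 g (- \<Lambda>)" and CL': "Ck_on 2 (\<lambda>z. ln (S z)) (- \<Lambda>)"
      using Ck_on_subset[OF Cg] Ck_on_subset[OF CL] by auto
    have "laplacian (\<lambda>z. ln ((cmod (T z))\<^sup>2 * exp (g z))) z = laplacian (\<lambda>z. ln ((cmod (T z))\<^sup>2) + g z) z"
      by (rule laplacian_cong_open[OF open_off_lattice]) (use z T0 in \<open>auto simp: ln_mult\<close>)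
    also have "\<dots> = laplacian g z"
      using laplacian_add[OF open_off_lattice C1 Cg'] z 1 by simp
    also have "\<dots> = - 2 * laplacian (\<lambda>z. ln (S z)) z"
      unfolding g_def using z laplacian_cmult[OF open_off_lattice CL', of z "- 2"]
      by (subst laplacian_add[OF open_off_lattice Ck_on_const Ck_on_cmult[OF open_off_lattice CL']])
         (simp_all add: laplacian_const)
    also have "\<dots> = - 4 * pi * ((cmod (T z))\<^sup>2 * exp (g z))"
      by (simp add: q lapS)
    finally show ?thesis .
  qed
  moreover have "(LINT y|TM. (cmod (T (y - z)))\<^sup>2 * exp (g (y - z))) = 1" for z
  proof -
    \<comment> \<open>Up to translation this is ln S. It is \<open>\<omega>1\<close>-periodic, and
      under \<open>\<omega>2\<close> it gains a real affine function whose derivative in direction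
      \<open>v\<close> is 2 Re (\<open>\<mu> * v\<close>). The integral of its Laplacian is
      therefore -2 Im (\<open>\<mu> * \<omega>1\<close>) divided by the signed area, and the two
      orientation signs cancel.\<close>
    define L where "L y = ln (S (- z + 1 * y))" for y
    have CLz: "Ck_on k L UNIV" for k
      unfolding L_def by (rule Ck_on_affine[OF _ _ CL]) auto
    then have D: "L differentiable (at y)" for y using Ck_on.simps(2)[of 0 L UNIV] by blast
    have C1: "Ck_on 1 (dird v L) UNIV" for v
      using CLz[of 2] by (simp add: numeral_2_eq_2)
    have sh1L: "L (\<omega>1 + 1 * y) = L y" for y
      using S1[of "y - z"] by (simp add: L_def algebra_simps)
    have sh2L: "L (\<omega>2 + 1 * y) = L y + 2 * Re (\<kappa> + \<mu> * (y - z))" for y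
    proof -
      have "S (- z + (\<omega>2 + y)) = (cmod (e (y - z)))\<^sup>2 * S (y - z)"
        using S2[of "y - z"] by (simp add: algebra_simps)
      moreover have "ln ((cmod (e (y - z)))\<^sup>2 * S (y - z)) = 2 * ln (cmod (e (y - z))) + ln (S (y - z))"
        using S0[of "y - z"] enz[of "y - z"] by (auto simp: ln_mult ln_realpow)
      moreover have "ln (cmod (e (y - z))) = Re (\<kappa> + \<mu> * (y - z))" by (simp add: e_def)
      ultimately show ?thesis by (simp add: L_def)
    qed
    have d1: "dird v L (y + \<omega>1) = dird v L y + 0" for v y
      using dird_affine(2)[of L \<omega>1 1 y v] D unfolding sh1L by (simp add: add.commute)
    have d2: "dird v L (y + \<omega>2) = dird v L y + 2 * Re (\<mu> * v)" for v y
    proof -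
      have "dird v (\<lambda>y. L y + 2 * Re (\<kappa> + \<mu> * (y - z))) y = dird v L y + 2 * Re (\<mu> * v)"
        by (rule dird_eqI) (auto intro!: derivative_eq_intros has_derivative_dird D simp del: minus_complex.sel plus_complex.sel times_complex.sel)
      then show ?thesis using dird_affine(2)[of L \<omega>2 1 y v] D unfolding sh2L by (simp add: add.commute)
    qed
    have I: "integral\<^sup>L TM (dird v (dird v L)) = coord2 v * (2 * Re (\<mu> * v))" for v
      using integral_dird[OF C1 d1 d2, of v v] by simp
    have int: "integrable TM (dird v (dird v L))" for v
      using C1[of v] by (intro continuous_integrable_TM) auto
    have "integral\<^sup>L TM (laplacian L) = coord2 1 * (2 * Re \<mu>) + coord2 \<i> * (2 * Re (\<mu> * \<i>))"
      unfolding laplacian_eq using int I[of 1] I[of \<i>] by simp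
    also have "\<dots> = - 2 * Im (\<mu> * \<omega>1) / Im (cnj \<omega>1 * \<omega>2)"
      unfolding coord2_def by (simp add: algebra_simps diff_divide_distrib add_divide_distrib)
    also have "\<dots> = 2 * pi * (sgn (Im (cnj \<omega>1 * \<omega>2)) / Im (cnj \<omega>1 * \<omega>2))"
      unfolding \<mu> by simp
    also have "\<dots> = 2 * pi"
    proof -
      have "sgn x / x = 1" if "\<bar>x\<bar> = 1" for x :: real using that by (auto simp: abs_if sgn_if split: if_splits)
      then show ?thesis using area_one by simp
    qed
    finally have m: "integral\<^sup>L TM (laplacian L) = 2 * pi" .
    have "laplacian L y = laplacian (\<lambda>z. ln (S z)) (- z + 1 * y)" for y
      unfolding L_def by (rule laplacian_affine[OF open_UNIV CL]) auto
    then have "laplacian L y = 2 * pi * ((cmod (T (y - z)))\<^sup>2 * exp (g (y - z)))" for y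
      by (simp add: lapS q)
    then have "laplacian L = (\<lambda>y. 2 * pi * ((cmod (T (y - z)))\<^sup>2 * exp (g (y - z))))" by (rule ext)
    then show ?thesis using m by simp
  qed
  ultimately have "liouville_potential \<omega>1 \<omega>2 T g"
    using holT Wzero W' Cg periodicD[of "\<lambda>z. (cmod (T z))\<^sup>2 * exp (g z)"]
    by unfold_locales (auto simp: T_def)
  then show ?thesis by (rule that)
qed

section \<open>Behaviour of the density and of its logarithm near the lattice\<close>

context liouville_potential
begin

definition q :: "complex \<Rightarrow> real" where "q z = (cmod (T z))\<^sup>2 * exp (g z)"
definition U :: "complex \<Rightarrow> real" where "U z = ln (q z)"
definition h :: "complex \<Rightarrow> complex" where "h z = (if z = 0 then deriv T 0 else T z / z)"

lemma q_nonneg: "q z \<ge> 0" by (simp add: q_def)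

lemma q_eq_0_iff: "q z = 0 \<longleftrightarrow> z \<in> \<Lambda>" by (simp add: q_def T_zero_iff)

lemma q_pos: "z \<notin> \<Lambda> \<Longrightarrow> q z > 0" using q_nonneg[of z] q_eq_0_iff[of z] by linarith

lemma q_periodic: "periodic q" unfolding periodic_def q_def using q_periodic' by blast

lemma q_even: "q (- z) = q z" using q_even' by (simp add: q_def)

lemma q_minus_commute: "q (y - z) = q (z - y)" using q_even[of "y - z"] by simp

lemma q_smooth: "Ck_on k q UNIV"
  unfolding q_def by (intro Ck_on_mult Ck_on_norm_square Ck_on_exp T_holomorphic g_smooth) auto

lemma q_continuous: "continuous_on S q"
  using Ck_on_imp_continuous[OF q_smooth] continuous_on_subset by blast

lemma q_mass: "(LINT y|TM. q (y - z)) = 1" using q_mass' by (simp add: q_def)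

lemma q_equation: "z \<notin> \<Lambda> \<Longrightarrow> laplacian U z = - 4 * pi * q z"
  using q_equation' by (simp add: q_def[abs_def] U_def[abs_def])

lemma U_smooth: "Ck_on k U (- \<Lambda>)"
  unfolding U_def using q_pos by (intro Ck_on_ln Ck_on_subset[OF q_smooth] open_off_lattice) auto

lemma U_periodic: "periodic U" using q_periodic by (simp add: periodic_def U_def)

lemma exp_U: "z \<notin> \<Lambda> \<Longrightarrow> exp (U z) = q z" using q_pos by (simp add: U_def)

lemma U_eq: "z \<notin> \<Lambda> \<Longrightarrow> U z = 2 * ln (cmod (T z)) + g z"
  by (simp add: U_def q_def ln_mult ln_realpow T_zero_iff)

lemma q_bounded: obtains B where "B > 0" "\<And>z. q z \<le> B"
proof -
  obtain B where "B > 0" "\<And>z. norm (q z) \<le> B"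
    using periodic_bounded[OF q_periodic q_continuous] by blast
  then show ?thesis using that q_nonneg by simp
qed

lemma h_holomorphic: "h holomorphic_on UNIV"
proof -
  have "(\<lambda>z. if z = 0 then deriv T 0 else (T z - T 0) / (z - 0)) holomorphic_on UNIV"
    by (rule pole_lemma[OF T_holomorphic]) auto
  moreover have "(\<lambda>z. if z = 0 then deriv T 0 else (T z - T 0) / (z - 0)) = h"
    using T_zero_iff[of 0] by (auto simp: h_def)
  ultimately show ?thesis by simp
qed

lemma T_eq: "T z = z * h z" using T_zero_iff[of 0] by (simp add: h_def)

lemma h_nonzero: "z \<in> closed_cell \<Longrightarrow> h z \<noteq> 0"
  using T_zero_iff[of z] closed_cell_lattice[of z] T_simple by (auto simp: h_def)

text \<open>The quotient of \<open>q\<close> by |z|^2 extends to |h|^2 e^g, which is continuous and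
  positive on the compact cell.\<close>

lemma q_quadratic:
  obtains c C where "c > 0" "C > 0" "\<And>z. z \<in> closed_cell \<Longrightarrow> c * (cmod z)\<^sup>2 \<le> q z"
    "\<And>z. z \<in> closed_cell \<Longrightarrow> q z \<le> C * (cmod z)\<^sup>2"
proof -
  define r where "r z = (cmod (h z))\<^sup>2 * exp (g z)" for z
  have q: "q z = r z * (cmod z)\<^sup>2" for z by (simp add: q_def T_eq r_def norm_mult power_mult_distrib)
  have cont: "continuous_on closed_cell r"
    unfolding r_def
    by (intro continuous_intros continuous_on_subset[OF holomorphic_on_imp_continuous_on[OF h_holomorphic]]
        continuous_on_subset[OF Ck_on_imp_continuous[OF g_smooth]]) auto
  have ne: "closed_cell \<noteq> {}" 
  proof -
    have "0 \<in> closed_cell" by (simp add: closed_cell_iff_coord coord1_def coord2_def)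
    then show ?thesis by blast
  qed
  obtain z1 where z1: "z1 \<in> closed_cell" "\<And>z. z \<in> closed_cell \<Longrightarrow> r z1 \<le> r z"
    using continuous_attains_inf[OF compact_closed_cell ne cont] by blast
  obtain z2 where z2: "z2 \<in> closed_cell" "\<And>z. z \<in> closed_cell \<Longrightarrow> r z \<le> r z2"
    using continuous_attains_sup[OF compact_closed_cell ne cont] by blast
  have pos: "r z > 0" if "z \<in> closed_cell" for z using h_nonzero[OF that] by (simp add: r_def)
  show ?thesis
    by (rule that[of "r z1" "r z2"]) (use z1 z2 pos in \<open>auto simp: q intro!: mult_right_mono\<close>)
qed

text \<open>The square root equals |T| e^(g/2), and the modulus is Lipschitz even at zeros of
  \<open>T\<close>. Thus \<open>sqrt q\<close> is a periodic substitute for the distance to the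
  lattice, comparable with it and free of case distinctions.\<close>

lemma sqrt_q_lipschitz:
  obtains K where "K > 0" "\<And>x y. \<bar>sqrt (q x) - sqrt (q y)\<bar> \<le> K * cmod (x - y)"
proof -
  define E where "E z = exp (g z / 2)" for z
  have sq: "sqrt (q z) = cmod (T z) * E z" for z
  proof -
    have "exp (g z) = (E z)\<^sup>2" by (simp add: E_def exp_double[symmetric])
    then have "q z = (cmod (T z) * E z)\<^sup>2" by (simp add: q_def power_mult_distrib)
    then show ?thesis by (simp add: E_def)
  qed
  obtain R0 where R0: "\<And>z. z \<in> closed_cell \<Longrightarrow> cmod z \<le> R0"
    using compact_imp_bounded[OF compact_closed_cell] unfolding bounded_iff by blast
  \<comment> \<open>The margin 1 places every point within distance 1 of the cell in the disc
    \<open>V\<close>. Periodicity moves any close pair there; for points further apart the bound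
    sqrt B on the oscillation suffices.\<close>
  define R where "R = R0 + 1"
  define V where "V = cball (0::complex) R"
  have V: "compact V" "convex V" by (simp_all add: V_def)
  have CE: "Ck_on 1 E UNIV"
  proof -
    have "Ck_on 1 (\<lambda>z. exp ((1/2) * g z)) UNIV" by (intro Ck_on_exp Ck_on_cmult g_smooth) auto
    then show ?thesis by (simp add: E_def[abs_def])
  qed
  then have DE: "E differentiable (at z)" "continuous_on UNIV (dird v E)" "continuous_on UNIV E" for z v
    using Ck_on_imp_continuous[OF CE] by auto
  have bdd: "\<exists>M. \<forall>z\<in>V. norm (f z) \<le> M" if "continuous_on UNIV f" for f :: "complex \<Rightarrow> 'b::real_normed_vector"
    using compact_imp_bounded[OF compact_continuous_image[OF continuous_on_subset[OF that] V(1)]]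
    unfolding bounded_iff by blast
  obtain M1 where M1: "\<And>z. z \<in> V \<Longrightarrow> norm (deriv T z) \<le> M1"
    using bdd[OF holomorphic_on_imp_continuous_on[OF holomorphic_deriv[OF T_holomorphic open_UNIV]]] by blast
  obtain M2 where M2: "\<And>z. z \<in> V \<Longrightarrow> norm (T z) \<le> M2"
    using bdd[OF holomorphic_on_imp_continuous_on[OF T_holomorphic]] by blast
  obtain M3 where M3: "\<And>z. z \<in> V \<Longrightarrow> norm (E z) \<le> M3" using bdd[OF DE(3)] by blast
  obtain M4 where M4: "\<And>z. z \<in> V \<Longrightarrow> norm (dird 1 E z) \<le> M4" using bdd[OF DE(2)] by blast
  obtain M5 where M5: "\<And>z. z \<in> V \<Longrightarrow> norm (dird \<i> E z) \<le> M5" using bdd[OF DE(2)] by blast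
  have lipT: "cmod (T x - T y) \<le> M1 * cmod (x - y)" if "x \<in> V" "y \<in> V" for x y
    by (rule field_differentiable_bound[OF V(2) _ M1 that])
       (auto intro: has_field_derivative_at_within entire_has_derivative[OF T_holomorphic])
  have lipE: "norm (E x - E y) \<le> (M4 + M5) * norm (x - y)" if "x \<in> V" "y \<in> V" for x y
  proof (rule differentiable_bound[OF V(2) _ _ that])
    show "(E has_derivative (\<lambda>v. dird v E z)) (at z within V)" for z
      by (rule has_derivative_at_withinI[OF has_derivative_dird[OF DE(1)]])
    show "onorm (\<lambda>v. dird v E z) \<le> M4 + M5" if "z \<in> V" for z
    proof (rule onorm_bound)
      show "norm (dird v E z) \<le> (M4 + M5) * norm v" for v
      proof -
        have "\<bar>dird v E z\<bar> \<le> \<bar>Re v\<bar> * \<bar>dird 1 E z\<bar> + \<bar>Im v\<bar> * \<bar>dird \<i> E z\<bar>"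
          using abs_triangle_ineq[of "Re v * dird 1 E z" "Im v * dird \<i> E z"] dird_Re_Im[OF DE(1), of z v]
          by (simp add: abs_mult)
        also have "\<dots> \<le> norm v * M4 + norm v * M5"
          using M4[OF that] M5[OF that] abs_Re_le_cmod abs_Im_le_cmod by (intro add_mono mult_mono) auto
        finally show ?thesis by (simp add: algebra_simps)
      qed
      show "0 \<le> M4 + M5" using M4[OF that] M5[OF that] norm_ge_zero by (metis add_nonneg_nonneg order_trans)
    qed
  qed
  obtain B where B: "B > 0" "\<And>z. q z \<le> B" by (rule q_bounded) blast
  define K where "K = \<bar>M1\<bar> * \<bar>M3\<bar> + \<bar>M2\<bar> * \<bar>M4 + M5\<bar> + sqrt B + 1"
  have K0: "K > 0" unfolding K_def using B by (intro add_nonneg_pos add_nonneg_nonneg) auto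
  have near: "\<bar>sqrt (q x) - sqrt (q y)\<bar> \<le> K * cmod (x - y)" if xy: "x \<in> closed_cell" "cmod (x - y) \<le> 1" for x y
  proof -
    have xV: "x \<in> V" using R0[OF xy(1)] by (simp add: V_def R_def)
    have "cmod y \<le> cmod x + cmod (x - y)" by (metis norm_minus_commute norm_triangle_sub)
    then have yV: "y \<in> V" using R0[OF xy(1)] xy(2) by (simp add: V_def R_def)
    have "cmod (T x) * E x - cmod (T y) * E y = (cmod (T x) - cmod (T y)) * E x + cmod (T y) * (E x - E y)"
      by (simp add: algebra_simps)
    then have "\<bar>sqrt (q x) - sqrt (q y)\<bar> \<le> \<bar>cmod (T x) - cmod (T y)\<bar> * \<bar>E x\<bar> + cmod (T y) * \<bar>E x - E y\<bar>"
      unfolding sq by (metis abs_mult abs_norm_cancel abs_triangle_ineq)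
    also have "\<dots> \<le> (\<bar>M1\<bar> * cmod (x - y)) * \<bar>M3\<bar> + \<bar>M2\<bar> * (\<bar>M4 + M5\<bar> * cmod (x - y))"
    proof (intro add_mono mult_mono)
      show "\<bar>cmod (T x) - cmod (T y)\<bar> \<le> \<bar>M1\<bar> * cmod (x - y)"
        using norm_triangle_ineq3[of "T x" "T y"] lipT[OF xV yV]
        by (meson abs_ge_self mult_right_mono norm_ge_zero order_trans)
      show "\<bar>E x\<bar> \<le> \<bar>M3\<bar>" using M3[OF xV] by simp
      show "cmod (T y) \<le> \<bar>M2\<bar>" using M2[OF yV] by simp
      show "\<bar>E x - E y\<bar> \<le> \<bar>M4 + M5\<bar> * cmod (x - y)"
        using lipE[OF xV yV] mult_right_mono[OF abs_ge_self[of "M4 + M5"] norm_ge_zero[of "x - y"]] by simp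
    qed auto
    also have "\<dots> \<le> K * cmod (x - y)"
      unfolding K_def using B by (simp add: algebra_simps)
    finally show ?thesis .
  qed
  have "\<bar>sqrt (q x) - sqrt (q y)\<bar> \<le> K * cmod (x - y)" for x y
  proof (cases "cmod (x - y) \<le> 1")
    case True
    obtain w where w: "w \<in> \<Lambda>" "x - w \<in> closed_cell" by (rule reduce_to_cell)
    have "\<bar>sqrt (q (x - w)) - sqrt (q (y - w))\<bar> \<le> K * cmod ((x - w) - (y - w))"
      by (rule near[OF w(2)]) (use True in simp)
    then show ?thesis by (simp add: periodicD_diff[OF q_periodic w(1)])
  next
    case False
    have "sqrt (q x) \<le> sqrt B" "sqrt (q y) \<le> sqrt B" "sqrt (q x) \<ge> 0" "sqrt (q y) \<ge> 0" using B q_nonneg by auto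
    then have "\<bar>sqrt (q x) - sqrt (q y)\<bar> \<le> sqrt B" by linarith
    also have "\<dots> \<le> K * 1" using B by (simp add: K_def)
    also have "\<dots> \<le> K * cmod (x - y)" using False K0 by (intro mult_left_mono) auto
    finally show ?thesis .
  qed
  then show ?thesis using that K0 by blast
qed

text \<open>U is twice the logarithm of \<open>sqrt q\<close>, and |ln a - ln b| \<le> |a - b| (1/a
  + 1/b). This stands in for the gradient bound 1/|z| without following a path around the
  singularity.\<close>

lemma U_difference:
  obtains K where "K > 0" "\<And>x y. x \<notin> \<Lambda> \<Longrightarrow> y \<notin> \<Lambda> \<Longrightarrow> \<bar>U x - U y\<bar> \<le> K * cmod (x - y) * (1 / sqrt (q x) + 1 / sqrt (q y))"
proof -
  obtain K where K: "K > 0" "\<And>x y. \<bar>sqrt (q x) - sqrt (q y)\<bar> \<le> K * cmod (x - y)"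
    by (rule sqrt_q_lipschitz) blast
  have *: "ln a - ln b \<le> \<bar>a - b\<bar> * (1 / a + 1 / b)" if "a > 0" "b > 0" for a b :: real
  proof -
    have "ln a - ln b \<le> (a - b) / b" using that ln_diff_le by blast
    also have "\<dots> \<le> \<bar>a - b\<bar> * (1 / b)" using that by (simp add: divide_right_mono)
    also have "\<dots> \<le> \<bar>a - b\<bar> * (1 / a + 1 / b)" using that by (intro mult_left_mono) auto
    finally show ?thesis .
  qed
  have "\<bar>U x - U y\<bar> \<le> 2 * K * cmod (x - y) * (1 / sqrt (q x) + 1 / sqrt (q y))" if "x \<notin> \<Lambda>" "y \<notin> \<Lambda>" for x y
  proof -
    have pos: "sqrt (q x) > 0" "sqrt (q y) > 0" using q_pos that by auto
    have U: "U z = 2 * ln (sqrt (q z))" if "z \<notin> \<Lambda>" for z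
      using q_pos[OF that] by (simp add: U_def ln_sqrt)
    have "\<bar>ln (sqrt (q x)) - ln (sqrt (q y))\<bar> \<le> \<bar>sqrt (q x) - sqrt (q y)\<bar> * (1 / sqrt (q x) + 1 / sqrt (q y))"
      using *[OF pos] *[OF pos(2,1)] by (simp add: abs_le_iff abs_minus_commute add.commute)
    also have "\<dots> \<le> (K * cmod (x - y)) * (1 / sqrt (q x) + 1 / sqrt (q y))"
      using K(2)[of x y] pos by (intro mult_right_mono) auto
    finally show ?thesis unfolding U[OF that(1)] U[OF that(2)] by (simp add: abs_if split: if_splits)
  qed
  then show ?thesis using that[of "2 * K"] K(1) by simp
qed

end

section \<open>The logarithmic kernel\<close>

text \<open>A one-dimensional factor for bounding 1/|z|: in lattice coordinates (s, t) the modulus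
  dominates a multiple of sqrt |s| sqrt |t|, which reduces integrability in the plane to the line.
  In \<open>ennreal\<close> the value at 0 is infinite.\<close>

definition inv_sqrt_kernel :: "real \<Rightarrow> ennreal" where
  "inv_sqrt_kernel x = indicator {-1..1} x * inverse (ennreal (sqrt \<bar>x\<bar>))"

lemma inv_sqrt_kernel_measurable [measurable]: "inv_sqrt_kernel \<in> borel_measurable borel"
  unfolding inv_sqrt_kernel_def[abs_def] by measurable

lemma nn_integral_inv_sqrt_kernel: "(\<integral>\<^sup>+x. inv_sqrt_kernel x \<partial>lborel) < \<infinity>"
proof -
  let ?p = "\<lambda>x::real. ennreal (x powr (-1/2)) * indicator {0..1} x"
  have "((\<lambda>x::real. x powr (-1/2)) has_integral (1 powr (-1/2 + 1) / (-1/2 + 1))) {0..1}"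
    by (rule has_integral_powr_from_0) auto
  then have "((\<lambda>x::real. if x \<in> {0..1} then x powr (-1/2) else 0) has_integral 2) UNIV"
    by (subst has_integral_restrict_UNIV) simp
  then have p: "(\<integral>\<^sup>+x. ennreal (if x \<in> {0..1} then x powr (-1/2) else 0) \<partial>lborel) = ennreal 2"
    by (intro nn_integral_has_integral_lborel) (auto intro!: measurable_If)
  have eqp: "ennreal (if x \<in> {0..1} then x powr (-1/2) else 0) = ?p x" for x
    by (simp add: indicator_def)
  have p: "(\<integral>\<^sup>+x. ?p x \<partial>lborel) = 2"
    using p unfolding eqp by simp
  have [measurable]: "?p \<in> borel_measurable borel" by measurable
  have "(\<integral>\<^sup>+x. ?p x \<partial>lborel) = ennreal \<bar>-1\<bar> * (\<integral>\<^sup>+x. ?p (0 + (-1) * x) \<partial>lborel)"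
    by (rule nn_integral_real_affine) auto
  then have m: "(\<integral>\<^sup>+x. ?p (- x) \<partial>lborel) = 2" using p by simp
  have "AE x in lborel. x \<noteq> (0::real)" by (rule AE_lborel_singleton)
  then have "(\<integral>\<^sup>+x. inv_sqrt_kernel x \<partial>lborel) \<le> (\<integral>\<^sup>+x. ?p x + ?p (- x) \<partial>lborel)"
  proof (intro nn_integral_mono_AE, eventually_elim)
    case (elim x)
    have "inverse (sqrt \<bar>x\<bar>) = \<bar>x\<bar> powr (-1/2)"
      using elim by (simp add: powr_minus powr_half_sqrt)
    then have "inverse (ennreal (sqrt \<bar>x\<bar>)) = ennreal (\<bar>x\<bar> powr (-1/2))"
      using elim by (simp add: inverse_ennreal)
    then show ?case using elim by (cases "x > 0") (auto simp: inv_sqrt_kernel_def indicator_def)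
  qed
  also have "\<dots> = 4" using p m by (subst nn_integral_add) (auto simp: mult.commute)
  finally show ?thesis by (simp add: order_le_less_trans)
qed

lemma nn_integral_inv_sqrt_kernel_shift:
  "(\<integral>\<^sup>+x. inv_sqrt_kernel (x - a) \<partial>lborel) = (\<integral>\<^sup>+x. inv_sqrt_kernel x \<partial>lborel)"
  using nn_integral_real_affine[of inv_sqrt_kernel 1 "- a"] by (simp add: add.commute)

lemma inverse_ennreal_antimono:
  assumes "a \<le> b" shows "inverse (ennreal b) \<le> inverse (ennreal a)"
proof (cases "a > 0")
  case True
  then show ?thesis using assms by (simp add: inverse_ennreal le_imp_inverse_le)
next
  case False
  then have "ennreal a = 0" by (simp add: ennreal_neg)
  then show ?thesis by simp
qed

section \<open>Integrability of the kernels, uniformly in the translation\<close>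

context liouville_potential
begin

text \<open>Near the lattice \<open>sqrt q\<close> is at least a multiple of the modulus, hence of
  sqrt |s| sqrt |t| in coordinates reduced modulo 1. The resulting majorant is a product of two
  one-dimensional kernels whose integrals do not depend on \<open>z\<close>.\<close>

lemma kernel_bound:
  obtains C where "C \<ge> 0" "\<And>z. (\<integral>\<^sup>+y. inverse (ennreal (sqrt (q (y - z)))) \<partial>TM) \<le> ennreal C"
proof -
  obtain c C where c: "c > 0" "\<And>z. z \<in> closed_cell \<Longrightarrow> c * (cmod z)\<^sup>2 \<le> q z"
    by (rule q_quadratic) blast
  obtain C' where C': "C' > 0" "\<And>z. \<bar>coord1 z\<bar> \<le> C' * cmod z" "\<And>z. \<bar>coord2 z\<bar> \<le> C' * cmod z"
    by (rule coord_bounded) blast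
  define m where "m = sqrt c / C'"
  have m: "m > 0" using c C' by (simp add: m_def)
  have cell: "m * (sqrt \<bar>coord1 z\<bar> * sqrt \<bar>coord2 z\<bar>) \<le> sqrt (q z)" if "z \<in> closed_cell" for z
  proof -
    have "\<bar>coord1 z\<bar> * \<bar>coord2 z\<bar> \<le> (C' * cmod z) * (C' * cmod z)" by (intro mult_mono C') (use C' in auto)
    then have "c / C'\<^sup>2 * (\<bar>coord1 z\<bar> * \<bar>coord2 z\<bar>) \<le> c / C'\<^sup>2 * ((C' * cmod z) * (C' * cmod z))"
      using c by (intro mult_left_mono) auto
    also have "\<dots> = c * (cmod z)\<^sup>2" using C'(1) by (simp add: field_simps power2_eq_square)
    also have "\<dots> \<le> q z" by (rule c(2)[OF that])
    finally have "sqrt (c / C'\<^sup>2 * (\<bar>coord1 z\<bar> * \<bar>coord2 z\<bar>)) \<le> sqrt (q z)" by simp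
    moreover have "sqrt (c / C'\<^sup>2 * (\<bar>coord1 z\<bar> * \<bar>coord2 z\<bar>)) = m * (sqrt \<bar>coord1 z\<bar> * sqrt \<bar>coord2 z\<bar>)"
      using C' by (simp add: m_def real_sqrt_mult real_sqrt_divide)
    ultimately show ?thesis by linarith
  qed
  \<comment> \<open>For \<open>s\<close> and \<open>a\<close> in the unit interval the integer
    nearest to \<open>s - a\<close> is -1, 0 or 1, so the sum of these three translates dominates
    the kernel at the reduced coordinate.\<close>
  define X where "X a s = inv_sqrt_kernel (s - (a - 1)) + inv_sqrt_kernel (s - a) + inv_sqrt_kernel (s - (a + 1))" for a s
  have [measurable]: "X a \<in> borel_measurable borel" for a unfolding X_def by measurable
  define I where "I = (\<integral>\<^sup>+x. inv_sqrt_kernel x \<partial>lborel)"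
  have XI: "(\<integral>\<^sup>+s. X a s \<partial>lborel) = 3 * I" for a
  proof -
    have "(\<integral>\<^sup>+s. X a s \<partial>lborel) = I + I + I"
      unfolding X_def by (simp add: nn_integral_add nn_integral_inv_sqrt_kernel_shift I_def)
    also have "\<dots> = (1 + 1 + 1) * I" by (simp only: distrib_right mult_1)
    finally show ?thesis by simp
  qed
  have X: "inverse (ennreal (sqrt \<bar>s - a - of_int (round (s - a))\<bar>)) \<le> X a s"
    if "0 \<le> s" "s < 1" "0 \<le> a" "a < 1" for s a
  proof -
    define j where "j = round (s - a)"
    have j: "\<bar>of_int j - (s - a)\<bar> \<le> 1/2" unfolding j_def by (rule of_int_round_abs_le)
    then have "\<bar>real_of_int j\<bar> < 2" using that by linarith
    then have "j = -1 \<or> j = 0 \<or> j = 1" by linarith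
    moreover have "inverse (ennreal (sqrt \<bar>s - a - of_int j\<bar>)) = inv_sqrt_kernel (s - a - of_int j)"
    proof -
      have "-1 \<le> s - a - of_int j" "s - a - of_int j \<le> 1" using j by linarith+
      then show ?thesis by (simp add: inv_sqrt_kernel_def)
    qed
    ultimately show ?thesis unfolding X_def j_def[symmetric]
      by (elim disjE) (simp_all add: add_increasing add_increasing2 algebra_simps)
  qed
  have fin: "3 * I < \<infinity>" unfolding I_def using nn_integral_inv_sqrt_kernel by (simp add: ennreal_mult_less_top)
  define C where "C = enn2real (ennreal (1 / m) * (3 * I) * (3 * I))"
  have C: "ennreal C = ennreal (1 / m) * (3 * I) * (3 * I)"
    unfolding C_def using fin by (intro ennreal_enn2real) (simp add: ennreal_mult_less_top less_top)
  have qm: "(\<lambda>y. inverse (ennreal (sqrt (q (y - z))))) \<in> borel_measurable borel" for z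
  proof -
    have [measurable]: "q \<in> borel_measurable borel"
      by (rule borel_measurable_continuous_onI[OF q_continuous])
    show ?thesis by measurable
  qed
  have "(\<integral>\<^sup>+y. inverse (ennreal (sqrt (q (y - z)))) \<partial>TM) \<le> ennreal C" for z
  proof -
    obtain w where w: "w \<in> \<Lambda>" "z - w \<in> P" by (rule reduce_to_parallelogram)
    define z0 where "z0 = z - w"
    have qz: "q (y - z) = q (y - z0)" for y
      using periodicD[OF q_periodic w(1), of "y - z"] by (simp add: z0_def algebra_simps)
    define a b where "a = coord1 z0" and "b = coord2 z0"
    have ab: "0 \<le> a" "a < 1" "0 \<le> b" "b < 1" using w(2) by (auto simp: parallelogram_iff_coord a_def b_def z0_def)
    have pt: "inverse (ennreal (sqrt (q (y - z0)))) * (indicator {0..<1} s * indicator {0..<1} t) \<le> ennreal (1 / m) * X a s * X b t"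
      if y: "y = of_real s * \<omega>1 + of_real t * \<omega>2" for y s t
    proof (cases "s \<in> {0..<1} \<and> t \<in> {0..<1}")
      case True
      define v where "v = of_real (of_int (round (s - a))) * \<omega>1 + of_real (of_int (round (t - b))) * \<omega>2"
      have v: "v \<in> \<Lambda>" unfolding v_def by (simp only: lattice_iff_coord coord_combination) auto
      have co: "coord1 (y - z0 - v) = s - a - of_int (round (s - a))" "coord2 (y - z0 - v) = t - b - of_int (round (t - b))"
        unfolding v_def y by (simp_all only: coord_diff coord_combination a_def b_def)
      have "y - z0 - v \<in> closed_cell"
        unfolding closed_cell_iff_coord co
        using of_int_round_abs_le[of "s - a"] of_int_round_abs_le[of "t - b"] by linarith
      from cell[OF this] have "m * (sqrt \<bar>s - a - of_int (round (s - a))\<bar> * sqrt \<bar>t - b - of_int (round (t - b))\<bar>) \<le> sqrt (q (y - z0))"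
        unfolding co periodicD_diff[OF q_periodic v] .
      then have "inverse (ennreal (sqrt (q (y - z0)))) \<le>
          inverse (ennreal (m * (sqrt \<bar>s - a - of_int (round (s - a))\<bar> * sqrt \<bar>t - b - of_int (round (t - b))\<bar>)))"
        by (rule inverse_ennreal_antimono)
      also have "\<dots> = ennreal (1 / m) * (inverse (ennreal (sqrt \<bar>s - a - of_int (round (s - a))\<bar>)) *
           inverse (ennreal (sqrt \<bar>t - b - of_int (round (t - b))\<bar>)))"
        using m by (simp add: ennreal_mult ennreal_inverse_mult ennreal_mult_less_top inverse_ennreal inverse_eq_divide)
      also have "\<dots> \<le> ennreal (1 / m) * (X a s * X b t)"
        using True ab by (intro mult_left_mono mult_mono X) auto
      finally show ?thesis using True by (simp add: mult.assoc)
    qed (auto simp: indicator_def)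
    have "(\<integral>\<^sup>+y. inverse (ennreal (sqrt (q (y - z)))) \<partial>TM)
       \<le> (\<integral>\<^sup>+t. \<integral>\<^sup>+s. ennreal (1 / m) * X a s * X b t \<partial>lborel \<partial>lborel)"
      unfolding qz nn_integral_TM[OF qm] by (intro nn_integral_mono pt) (rule refl)
    also have "\<dots> = ennreal (1 / m) * (3 * I) * (3 * I)"
      by (simp add: nn_integral_cmult nn_integral_multc XI)
    finally show ?thesis by (simp add: C)
  qed
  then show ?thesis using that[of C] by (simp add: C_def)
qed

lemma inv_sqrt_q_measurable: "(\<lambda>y. 1 / sqrt (q (y - z))) \<in> borel_measurable borel"
proof -
  have [measurable]: "q \<in> borel_measurable borel"
    by (rule borel_measurable_continuous_onI[OF q_continuous])
  show ?thesis by measurable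
qed

lemma kernel_integrable:
  obtains C where "C > 0" "\<And>z. integrable TM (\<lambda>y. 1 / sqrt (q (y - z)))"
    "\<And>z. (LINT y|TM. 1 / sqrt (q (y - z))) \<le> C"
proof -
  obtain C where C: "C \<ge> 0" "\<And>z. (\<integral>\<^sup>+y. inverse (ennreal (sqrt (q (y - z)))) \<partial>TM) \<le> ennreal C"
    by (rule kernel_bound) blast
  have le: "(\<integral>\<^sup>+y. ennreal (1 / sqrt (q (y - z))) \<partial>TM) \<le> ennreal C" for z
  proof -
    \<comment> \<open>Only an inequality: at \<open>x = 0\<close> the real quotient is 0 while the
      extended inverse is infinite.\<close>
    have "ennreal (1 / sqrt x) \<le> inverse (ennreal (sqrt x))" if "x \<ge> 0" for x
      using that by (cases "x = 0") (auto simp: inverse_ennreal inverse_eq_divide)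
    then have "(\<integral>\<^sup>+y. ennreal (1 / sqrt (q (y - z))) \<partial>TM) \<le> (\<integral>\<^sup>+y. inverse (ennreal (sqrt (q (y - z)))) \<partial>TM)"
      by (intro nn_integral_mono) (simp add: q_nonneg)
    then show ?thesis using C(2) order_trans by blast
  qed
  have meas: "(\<lambda>y. 1 / sqrt (q (y - z))) \<in> borel_measurable TM" for z
    by (rule measurable_TM[OF inv_sqrt_q_measurable])
  have int: "integrable TM (\<lambda>y. 1 / sqrt (q (y - z)))" for z
  proof (rule integrableI_nonneg[OF meas])
    show "AE y in TM. 0 \<le> 1 / sqrt (q (y - z))" by (simp add: q_nonneg)
    show "(\<integral>\<^sup>+y. ennreal (1 / sqrt (q (y - z))) \<partial>TM) < \<infinity>"
      using le[of z] by (rule order_le_less_trans) simp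
  qed
  have leC: "(LINT y|TM. 1 / sqrt (q (y - z))) \<le> C" for z
  proof -
    have "ennreal (LINT y|TM. 1 / sqrt (q (y - z))) = (\<integral>\<^sup>+y. ennreal (1 / sqrt (q (y - z))) \<partial>TM)"
      by (rule nn_integral_eq_integral[OF int, symmetric]) (auto simp: q_nonneg)
    then have "ennreal (LINT y|TM. 1 / sqrt (q (y - z))) \<le> ennreal C" using le by simp
    then show ?thesis using C(1) by simp
  qed
  have "(LINT y|TM. 1 / sqrt (q (y - z))) \<le> C + 1" for z using leC[of z] by linarith
  then show ?thesis using that[of "C + 1"] C(1) int by simp
qed

lemma U_square_bound:
  obtains C where "C > 0" "\<And>z. z \<notin> \<Lambda> \<Longrightarrow> (U z)\<^sup>2 \<le> C / sqrt (q z)"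
proof -
  obtain B where B: "B > 0" "\<And>z. q z \<le> B" by (rule q_bounded) blast
  have "(ln x)\<^sup>2 \<le> (16 + B\<^sup>2 * sqrt B) / sqrt x" if x: "0 < x" "x \<le> B" for x
  proof (cases "x \<le> 1")
    case True
    \<comment> \<open>With the fourth root, ln x = 4 ln y and |ln y| \<le> 1/y, so the square of ln
      x is at most 16 / sqrt x.\<close>
    define y where "y = sqrt (sqrt x)"
    have y: "y > 0" "y \<le> 1" using x True by (simp_all add: y_def)
    have "ln x = 4 * ln y" using x by (simp add: y_def ln_sqrt)
    moreover have "- ln y \<le> 1 / y"
      using ln_le_minus_one[of "1 / y"] y by (simp add: ln_div)
    moreover have "ln y \<le> 0" using y by simp
    ultimately have "\<bar>ln x\<bar> \<le> 4 / y" by simp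
    then have "(ln x)\<^sup>2 \<le> (4 / y)\<^sup>2" by (metis abs_ge_zero power2_abs power_mono)
    also have "\<dots> = 16 / sqrt x" using x by (simp add: power_divide y_def)
    also have "\<dots> \<le> (16 + B\<^sup>2 * sqrt B) / sqrt x" using x B by (intro divide_right_mono) auto
    finally show ?thesis .
  next
    case False
    have "0 \<le> ln x" "ln x \<le> B" using False x ln_le_minus_one[of x] by auto
    then have "(ln x)\<^sup>2 \<le> B\<^sup>2 * 1" by (simp add: power_mono)
    also have "\<dots> \<le> B\<^sup>2 * (sqrt B / sqrt x)" using x by (intro mult_left_mono) auto
    also have "\<dots> \<le> (16 + B\<^sup>2 * sqrt B) / sqrt x" using x by (simp add: divide_right_mono)
    finally show ?thesis .
  qed
  then have "(U z)\<^sup>2 \<le> (16 + B\<^sup>2 * sqrt B) / sqrt (q z)" if "z \<notin> \<Lambda>" for z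
    using q_pos[OF that] B unfolding U_def by blast
  moreover have "16 + B\<^sup>2 * sqrt B > 0" using B by (intro add_pos_nonneg) auto
  ultimately show ?thesis using that by blast
qed

lemma U_measurable [measurable]: "U \<in> borel_measurable borel"
proof -
  have [measurable]: "q \<in> borel_measurable borel"
    by (rule borel_measurable_continuous_onI[OF q_continuous])
  show ?thesis unfolding U_def[abs_def] by measurable
qed

text \<open>The singularity of U^2 is weaker than that of the integrable kernel 1 / sqrt q. The
  bound uniform in \<open>z\<close> will be paired with square integrability of
  \<open>exp v\<close>.\<close>

lemma U_square_integrable:
  obtains C where "C > 0" "\<And>z. integrable TM (\<lambda>y. (U (y - z))\<^sup>2)" "\<And>z. (LINT y|TM. (U (y - z))\<^sup>2) \<le> C"
    "\<And>z. integrable TM (\<lambda>y. \<bar>U (y - z)\<bar>)"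
proof -
  obtain K where K: "K > 0" "\<And>z. integrable TM (\<lambda>y. 1 / sqrt (q (y - z)))"
    "\<And>z. (LINT y|TM. 1 / sqrt (q (y - z))) \<le> K" by (rule kernel_integrable) blast
  obtain C where C: "C > 0" "\<And>z. z \<notin> \<Lambda> \<Longrightarrow> (U z)\<^sup>2 \<le> C / sqrt (q z)" by (rule U_square_bound) blast
  have ae: "AE y in TM. (U (y - z))\<^sup>2 \<le> C * (1 / sqrt (q (y - z)))" for z
    using AE_TM_off_lattice[of z] by eventually_elim (use C(2) in simp)
  have int: "integrable TM (\<lambda>y. (U (y - z))\<^sup>2)" for z
  proof (rule Bochner_Integration.integrable_bound)
    show "integrable TM (\<lambda>y. C * (1 / sqrt (q (y - z))))" by (intro integrable_mult_right K)
    show "(\<lambda>y. (U (y - z))\<^sup>2) \<in> borel_measurable TM" by (rule measurable_TM) measurable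
    show "AE y in TM. norm ((U (y - z))\<^sup>2) \<le> norm (C * (1 / sqrt (q (y - z))))"
      using ae[of z]
    proof eventually_elim
      case (elim y)
      then show ?case using abs_ge_self[of "C * (1 / sqrt (q (y - z)))"]
        unfolding real_norm_def abs_of_nonneg[OF zero_le_power2] by linarith
    qed
  qed
  have "(LINT y|TM. (U (y - z))\<^sup>2) \<le> C * K" for z
  proof -
    have "(LINT y|TM. (U (y - z))\<^sup>2) \<le> (LINT y|TM. C * (1 / sqrt (q (y - z))))"
      using ae by (intro integral_mono_AE int integrable_mult_right K)
    also have "\<dots> = C * (LINT y|TM. 1 / sqrt (q (y - z)))" by (rule integral_mult_right_zero)
    also have "\<dots> \<le> C * K" using K(3)[of z] C(1) by (intro mult_left_mono) auto
    finally show ?thesis .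
  qed
  moreover have "integrable TM (\<lambda>y. \<bar>U (y - z)\<bar>)" for z
  proof (rule Bochner_Integration.integrable_bound)
    show "integrable TM (\<lambda>y. 1 + (U (y - z))\<^sup>2)" by (intro Bochner_Integration.integrable_add int) simp
    show "(\<lambda>y. \<bar>U (y - z)\<bar>) \<in> borel_measurable TM" by (rule measurable_TM) measurable
    have "\<bar>x\<bar> \<le> 1 + x\<^sup>2" for x :: real
      using sum_squares_bound[of "\<bar>x\<bar>" 1] by (simp add: power2_eq_square)
    then show "AE y in TM. norm \<bar>U (y - z)\<bar> \<le> norm (1 + (U (y - z))\<^sup>2)"
      by (intro AE_I2) (simp add: abs_of_nonneg add_nonneg_nonneg)
  qed
  ultimately show ?thesis using that[of "C * K"] C(1) K(1) int by simp
qed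

lemma U_integrable: "integrable TM (\<lambda>y. U (y - z))"
proof -
  have "integrable TM (\<lambda>y. \<bar>U (y - z)\<bar>)" by (rule U_square_integrable)
  moreover have "(\<lambda>y. U (y - z)) \<in> borel_measurable TM" by (rule measurable_TM) measurable
  ultimately show ?thesis by (rule integrable_abs_cancel)
qed

text \<open>Smooth periodic functions that decrease to U as \<epsilon> decreases to 0 and, unlike U
  itself, are admissible in the weak equation.\<close>

definition Ureg :: "real \<Rightarrow> complex \<Rightarrow> real" where "Ureg \<epsilon> z = ln (q z + \<epsilon>)"
definition kern :: "real \<Rightarrow> complex \<Rightarrow> real" where
  "kern \<epsilon> z = laplacian (Ureg \<epsilon>) z + 4 * pi * ((q z)\<^sup>2 / (q z + \<epsilon>))"

lemma Ureg_smooth: "\<epsilon> > 0 \<Longrightarrow> Ck_on k (Ureg \<epsilon>) UNIV"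
  unfolding Ureg_def using q_nonneg
  by (intro Ck_on_ln Ck_on_add Ck_on_const q_smooth) (auto intro: add_nonneg_pos)

lemma Ureg_periodic: "periodic (Ureg \<epsilon>)"
  using q_periodic by (simp add: periodic_def Ureg_def)

lemma kern_continuous: "\<epsilon> > 0 \<Longrightarrow> continuous_on UNIV (kern \<epsilon>)"
proof -
  assume e: "\<epsilon> > 0"
  have "q z + \<epsilon> \<noteq> 0" for z using q_nonneg[of z] e by simp
  then show ?thesis unfolding kern_def[abs_def]
    by (intro continuous_intros continuous_on_laplacian[OF Ureg_smooth[OF e]] q_continuous) auto
qed

lemma kern_periodic: "\<epsilon> > 0 \<Longrightarrow> periodic (kern \<epsilon>)"
  using periodic_laplacian[OF Ureg_periodic] q_periodic
  by (simp add: periodic_def kern_def)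

text \<open>
  Since \<open>\<Delta> ln q = - 4 \<pi> q\<close>, the regularised Laplacian splits off the nonnegative term \<open>kern\<close>, which
  concentrates at the lattice as \<open>\<epsilon>\<close> tends to 0 and whose mass is controlled by \<open>\<integral>\<Delta>(\<dots>) = 0\<close>.
\<close>

lemma kern_eq:
  assumes "\<epsilon> > 0" "z \<notin> \<Lambda>"
  shows "kern \<epsilon> z = \<epsilon> * ((dird 1 q z)\<^sup>2 + (dird \<i> q z)\<^sup>2) / (q z * (q z + \<epsilon>)\<^sup>2)"
proof -
  define G where "G = (dird 1 q z)\<^sup>2 + (dird \<i> q z)\<^sup>2"
  have pos: "q z > 0" by (rule q_pos[OF assms(2)])
  have pe: "q w + \<epsilon> > 0" for w using q_nonneg[of w] assms(1) by simp
  have D: "q differentiable (at w)" for w using q_smooth[of 1] by auto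
  have "laplacian U z = laplacian q z / q z - G / (q z)\<^sup>2"
    unfolding U_def[abs_def] G_def
    by (rule laplacian_ln[OF open_off_lattice Ck_on_subset[OF q_smooth]]) (use assms q_pos in auto)
  then have L: "laplacian q z = G / q z - 4 * pi * (q z)\<^sup>2"
    using q_equation[OF assms(2)] pos by (simp add: field_simps power2_eq_square)
  have d: "dird v (\<lambda>w. q w + \<epsilon>) z = dird v q z" for v
    by (rule dird_eqI) (auto intro!: derivative_eq_intros has_derivative_dird D)
  have "laplacian (\<lambda>w. q w + \<epsilon>) z = laplacian q z"
    using laplacian_add[OF open_UNIV q_smooth Ck_on_const, of z \<epsilon>] by (simp add: laplacian_const)
  moreover have "laplacian (Ureg \<epsilon>) z = laplacian (\<lambda>w. q w + \<epsilon>) z / (q z + \<epsilon>)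
      - ((dird 1 (\<lambda>w. q w + \<epsilon>) z)\<^sup>2 + (dird \<i> (\<lambda>w. q w + \<epsilon>) z)\<^sup>2) / (q z + \<epsilon>)\<^sup>2"
    unfolding Ureg_def[abs_def]
    by (rule laplacian_ln[OF open_UNIV Ck_on_add[OF open_UNIV q_smooth Ck_on_const]]) (use pe in auto)
  ultimately have "kern \<epsilon> z = (G / q z - 4 * pi * (q z)\<^sup>2) / (q z + \<epsilon>) - G / (q z + \<epsilon>)\<^sup>2
      + 4 * pi * ((q z)\<^sup>2 / (q z + \<epsilon>))"
    by (simp add: kern_def L d G_def)
  also have "\<dots> = G / q z / (q z + \<epsilon>) - G / (q z + \<epsilon>)\<^sup>2" by (simp add: diff_divide_distrib)
  also have "\<dots> = \<epsilon> * G / (q z * (q z + \<epsilon>)\<^sup>2)"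
    using pos pe[of z] by (simp add: divide_simps power2_eq_square) (simp add: algebra_simps)
  finally show ?thesis by (simp add: G_def)
qed

lemma kern_nonneg: "\<epsilon> > 0 \<Longrightarrow> z \<notin> \<Lambda> \<Longrightarrow> kern \<epsilon> z \<ge> 0"
  using q_pos[of z] by (simp add: kern_eq)

text \<open>Where \<open>q\<close> is at least \<eta>, the denominator in the closed form of the
  kernel is at least \<eta>^3, and the gradient of \<open>q\<close> is bounded by
  periodicity.\<close>

lemma kern_small:
  obtains G where "G \<ge> 0" "\<And>\<epsilon> \<eta> z. \<epsilon> > 0 \<Longrightarrow> \<eta> > 0 \<Longrightarrow> q z \<ge> \<eta> \<Longrightarrow> kern \<epsilon> z \<le> \<epsilon> * (G / \<eta> ^ 3)"
proof -
  have C: "Ck_on 1 q UNIV" by (rule q_smooth)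
  have "periodic (\<lambda>z. (dird 1 q z)\<^sup>2 + (dird \<i> q z)\<^sup>2)"
    using periodic_dird[OF q_periodic] by (simp add: periodic_def)
  moreover have "continuous_on UNIV (\<lambda>z. (dird 1 q z)\<^sup>2 + (dird \<i> q z)\<^sup>2)"
    using C by (intro continuous_intros) auto
  ultimately obtain G where G: "G > 0" "\<And>z. norm ((dird 1 q z)\<^sup>2 + (dird \<i> q z)\<^sup>2) \<le> G"
    by (rule periodic_bounded) blast
  have "kern \<epsilon> z \<le> \<epsilon> * (G / \<eta> ^ 3)" if "\<epsilon> > 0" "\<eta> > 0" "q z \<ge> \<eta>" for \<epsilon> \<eta> z
  proof -
    have z: "z \<notin> \<Lambda>" using that q_eq_0_iff[of z] by auto
    have low: "\<eta> * \<eta>\<^sup>2 \<le> q z * (q z + \<epsilon>)\<^sup>2" using that by (intro mult_mono power_mono) auto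
    have "\<epsilon> * ((dird 1 q z)\<^sup>2 + (dird \<i> q z)\<^sup>2) / (q z * (q z + \<epsilon>)\<^sup>2) \<le> \<epsilon> * G / (\<eta> * \<eta>\<^sup>2)"
    proof -
      have "(dird 1 q z)\<^sup>2 + (dird \<i> q z)\<^sup>2 \<le> G" using G(2)[of z] by simp
      then show ?thesis using that G(1) low by (intro frac_le mult_left_mono) auto
    qed
    then show ?thesis using kern_eq[OF that(1) z] by (simp add: power3_eq_cube power2_eq_square mult.assoc)
  qed
  then show ?thesis using that[of G] G(1) by auto
qed

lemma continuous_shift:
  fixes f :: "complex \<Rightarrow> 'a::topological_space"
  assumes "continuous_on UNIV f" shows "continuous_on UNIV (\<lambda>y. f (y - z))"
  by (rule continuous_on_compose2[OF assms]) (auto intro!: continuous_intros)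

lemma periodic_shift: "periodic f \<Longrightarrow> periodic (\<lambda>y. f (y - z))"
  unfolding periodic_def by (metis diff_add_eq)

lemma Ck_shift: "Ck_on k f UNIV \<Longrightarrow> Ck_on k (\<lambda>y. f (y - z)) UNIV"
  using Ck_on_affine[of UNIV UNIV k f "- z" 1] by simp

lemma laplacian_shift: "Ck_on 2 f UNIV \<Longrightarrow> laplacian (\<lambda>y. f (y - z)) y = laplacian f (y - z)"
  using laplacian_affine[of UNIV f "- z" 1 y] by simp

lemma integrable_mult_periodic:
  fixes w k :: "complex \<Rightarrow> real"
  assumes w: "integrable TM w" and k: "continuous_on UNIV k" "periodic k"
  shows "integrable TM (\<lambda>y. w y * k (y - z))"
proof -
  obtain B where B: "B > 0" "\<And>z. norm (k z) \<le> B" using periodic_bounded[OF k(2,1)] by blast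
  show ?thesis
  proof (rule Bochner_Integration.integrable_bound)
    show "integrable TM (\<lambda>y. B * w y)" by (intro integrable_mult_right w)
    show "(\<lambda>y. w y * k (y - z)) \<in> borel_measurable TM"
      by (intro borel_measurable_times borel_measurable_integrable[OF w] continuous_measurable_TM[OF continuous_shift[OF k(1)]])
    show "AE y in TM. norm (w y * k (y - z)) \<le> norm (B * w y)"
    proof (intro AE_I2)
      fix y
      show "norm (w y * k (y - z)) \<le> norm (B * w y)"
        using mult_left_mono[OF B(2)[of "y - z"], of "\<bar>w y\<bar>"] B(1) by (simp add: abs_mult mult.commute)
    qed
  qed
qed

lemma q_ratio:
  assumes "\<epsilon> > 0" shows "\<bar>(q z)\<^sup>2 / (q z + \<epsilon>) - q z\<bar> \<le> \<epsilon>"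
proof -
  have pos: "q z + \<epsilon> > 0" using q_nonneg[of z] assms by simp
  then have eq: "(q z)\<^sup>2 / (q z + \<epsilon>) - q z = - (\<epsilon> * (q z / (q z + \<epsilon>)))"
    by (simp add: field_simps power2_eq_square)
  have "q z / (q z + \<epsilon>) \<le> 1" "q z / (q z + \<epsilon>) \<ge> 0" using pos q_nonneg[of z] assms by simp_all
  then have "\<epsilon> * (q z / (q z + \<epsilon>)) \<le> \<epsilon> * 1" "0 \<le> \<epsilon> * (q z / (q z + \<epsilon>))"
    using assms by (intro mult_left_mono mult_nonneg_nonneg; simp)+
  then show ?thesis unfolding eq abs_minus_cancel by (simp only: abs_of_nonneg mult_1_right)
qed

lemma q_ratio_continuous: "\<epsilon> > 0 \<Longrightarrow> continuous_on UNIV (\<lambda>z. (q z)\<^sup>2 / (q z + \<epsilon>))"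
  using q_nonneg by (intro continuous_intros q_continuous) (metis add_nonneg_pos less_irrefl)

lemma q_ratio_periodic: "periodic (\<lambda>z. (q z)\<^sup>2 / (q z + \<epsilon>))"
  using q_periodic by (simp add: periodic_def)

text \<open>The Laplacian integrates to 0, which leaves 4 pi times the integral of q^2/(q +
  \<epsilon>). This integrand differs from \<open>q\<close> by at most \<epsilon>, and
  \<open>q\<close> has mass 1.\<close>

lemma kern_mass:
  assumes "\<epsilon> > 0"
  shows "\<bar>(LINT y|TM. kern \<epsilon> (y - z)) - 4 * pi\<bar> \<le> 4 * pi * \<epsilon>"
proof -
  have sh: "laplacian (\<lambda>y. Ureg \<epsilon> (y - z)) = (\<lambda>y. laplacian (Ureg \<epsilon>) (y - z))"
    by (rule ext) (rule laplacian_shift[OF Ureg_smooth[OF assms]])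
  have L: "(LINT y|TM. laplacian (Ureg \<epsilon>) (y - z)) = 0"
    using integral_laplacian_periodic[OF Ck_shift[OF Ureg_smooth[OF assms]] periodic_shift[OF Ureg_periodic], of z]
    unfolding sh .
  have i1: "integrable TM (\<lambda>y. laplacian (Ureg \<epsilon>) (y - z))"
    by (rule continuous_integrable_TM[OF continuous_shift[OF continuous_on_laplacian[OF Ureg_smooth[OF assms]]]])
  have i2: "integrable TM (\<lambda>y. (q (y - z))\<^sup>2 / (q (y - z) + \<epsilon>))"
    by (rule continuous_integrable_TM[OF continuous_shift[OF q_ratio_continuous[OF assms]]])
  have i3: "integrable TM (\<lambda>y. q (y - z))"
    by (rule continuous_integrable_TM[OF continuous_shift[OF q_continuous]])
  have k: "(LINT y|TM. kern \<epsilon> (y - z)) = 4 * pi * (LINT y|TM. (q (y - z))\<^sup>2 / (q (y - z) + \<epsilon>))"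
    unfolding kern_def Bochner_Integration.integral_add[OF i1 integrable_mult_right[OF i2]] L
    by (simp only: integral_mult_right_zero add_0_left)
  have r: "\<bar>(LINT y|TM. (q (y - z))\<^sup>2 / (q (y - z) + \<epsilon>)) - 1\<bar> \<le> \<epsilon>"
  proof -
    have eq: "(LINT y|TM. (q (y - z))\<^sup>2 / (q (y - z) + \<epsilon>)) - 1 = (LINT y|TM. (q (y - z))\<^sup>2 / (q (y - z) + \<epsilon>) - q (y - z))"
      using i2 i3 q_mass by (simp add: Bochner_Integration.integral_diff)
    have "\<bar>(LINT y|TM. (q (y - z))\<^sup>2 / (q (y - z) + \<epsilon>)) - 1\<bar> \<le> (LINT y|TM. \<bar>(q (y - z))\<^sup>2 / (q (y - z) + \<epsilon>) - q (y - z)\<bar>)"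
      unfolding eq by (rule integral_abs_bound)
    also have "\<dots> \<le> (LINT y|TM. \<epsilon>)"
      using i2 i3 q_ratio[OF assms] by (intro integral_mono) auto
    finally show ?thesis by (simp add: TM.prob_space[unfolded space_TM])
  qed
  have "\<bar>4 * pi * x - 4 * pi\<bar> \<le> 4 * pi * \<epsilon>" if "\<bar>x - 1\<bar> \<le> \<epsilon>" for x
  proof -
    have "4 * pi * x - 4 * pi = 4 * pi * (x - 1)" by (simp add: algebra_simps)
    then have "\<bar>4 * pi * x - 4 * pi\<bar> = 4 * pi * \<bar>x - 1\<bar>" by (simp add: abs_mult)
    then show ?thesis using that by simp
  qed
  from this[OF r] show ?thesis unfolding k .
qed

lemma q_small_near_lattice:
  assumes "\<delta> > 0"
  obtains \<eta> where "\<eta> > 0" "\<And>x. q x < \<eta> \<Longrightarrow> \<exists>w\<in>\<Lambda>. cmod (x - w) < \<delta>"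
proof -
  obtain c where c: "c > 0" "\<And>z. z \<in> closed_cell \<Longrightarrow> c * (cmod z)\<^sup>2 \<le> q z"
    by (rule q_quadratic) blast
  have "\<exists>w\<in>\<Lambda>. cmod (x - w) < \<delta>" if "q x < c * \<delta>\<^sup>2" for x
  proof -
    obtain w where w: "w \<in> \<Lambda>" "x - w \<in> closed_cell" by (rule reduce_to_cell)
    have "c * (cmod (x - w))\<^sup>2 < c * \<delta>\<^sup>2"
      using c(2)[OF w(2)] that periodicD_diff[OF q_periodic w(1), of x] by simp
    then have "(cmod (x - w))\<^sup>2 < \<delta>\<^sup>2" using c(1) by simp
    then have "cmod (x - w) < \<delta>" using assms by (meson less_imp_le power_less_imp_less_base)
    then show ?thesis using w(1) by blast
  qed
  then show ?thesis using that[of "c * \<delta>\<^sup>2"] c(1) assms by simp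
qed

abbreviation eps :: "nat \<Rightarrow> real" where "eps n \<equiv> inverse (real (Suc n))"

text \<open>The kernels form an approximate identity of mass 4 pi at the lattice: nonnegative, of
  mass tending to 4 pi, and uniformly small away from the lattice. The last property is uniform, so
  \<open>w\<close> only has to be integrable and continuous at \<open>z\<close>, which suits a
  solution with a singularity elsewhere.\<close>

lemma kern_approximates:
  assumes w: "integrable TM w" "periodic w" "isCont w z"
  shows "(\<lambda>n. LINT y|TM. w y * kern (eps n) (y - z)) \<longlonglongrightarrow> 4 * pi * w z"
proof -
  obtain G where G: "G \<ge> 0" "\<And>\<epsilon> \<eta> z. \<epsilon> > 0 \<Longrightarrow> \<eta> > 0 \<Longrightarrow> q z \<ge> \<eta> \<Longrightarrow> kern \<epsilon> z \<le> \<epsilon> * (G / \<eta> ^ 3)"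
    by (rule kern_small) blast
  have main: "\<exists>C. \<forall>\<epsilon>. 0 < \<epsilon> \<longrightarrow> \<epsilon> \<le> 1 \<longrightarrow> \<bar>(LINT y|TM. w y * kern \<epsilon> (y - z)) - 4 * pi * w z\<bar> \<le> 8 * pi * \<kappa> + C * \<epsilon>"
    if \<kappa>: "\<kappa> > 0" for \<kappa>
  proof -
    obtain \<delta> where \<delta>: "\<delta> > 0" "\<And>x. dist x z < \<delta> \<Longrightarrow> dist (w x) (w z) < \<kappa>"
      using w(3) \<kappa> unfolding continuous_at_eps_delta by blast
    obtain \<eta> where \<eta>: "\<eta> > 0" "\<And>x. q x < \<eta> \<Longrightarrow> \<exists>w\<in>\<Lambda>. cmod (x - w) < \<delta>"
      by (rule q_small_near_lattice[OF \<delta>(1)]) blast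
    define M where "M = (LINT y|TM. \<bar>w y\<bar> + \<bar>w z\<bar>)"
    have iM: "integrable TM (\<lambda>y. \<bar>w y\<bar> + \<bar>w z\<bar>)" using w(1) by simp
    have "\<bar>(LINT y|TM. w y * kern \<epsilon> (y - z)) - 4 * pi * w z\<bar> \<le> 8 * pi * \<kappa> + (G / \<eta> ^ 3 * M + \<bar>w z\<bar> * (4 * pi)) * \<epsilon>"
      if e: "0 < \<epsilon>" "\<epsilon> \<le> 1" for \<epsilon>
    proof -
      have ik: "integrable TM (\<lambda>y. kern \<epsilon> (y - z))"
        by (rule continuous_integrable_TM[OF continuous_shift[OF kern_continuous[OF e(1)]]])
      have iw: "integrable TM (\<lambda>y. w y * kern \<epsilon> (y - z))"
        by (intro integrable_mult_periodic w kern_continuous kern_periodic e)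
      have mass: "\<bar>(LINT y|TM. kern \<epsilon> (y - z)) - 4 * pi\<bar> \<le> 4 * pi * \<epsilon>" by (rule kern_mass[OF e(1)])
      \<comment> \<open>If \<open>q (y - z)\<close> is below \<eta>, then \<open>y\<close> is
        congruent to a point close to \<open>z\<close> and continuity gives the first summand.
        Otherwise the kernel is of order \<epsilon> and gives the second.\<close>
      have pt: "\<bar>(w y - w z) * kern \<epsilon> (y - z)\<bar> \<le> \<kappa> * kern \<epsilon> (y - z) + \<epsilon> * (G / \<eta> ^ 3) * (\<bar>w y\<bar> + \<bar>w z\<bar>)"
        if y: "y - z \<notin> \<Lambda>" for y
      proof (cases "q (y - z) < \<eta>")
        case True
        then obtain v where v: "v \<in> \<Lambda>" "cmod (y - z - v) < \<delta>" using \<eta>(2) by blast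
        have "\<bar>w y - w z\<bar> < \<kappa>"
          using \<delta>(2)[of "y - v"] v periodicD_diff[OF w(2) v(1), of y] by (simp add: dist_norm algebra_simps)
        then have "\<bar>(w y - w z) * kern \<epsilon> (y - z)\<bar> \<le> \<kappa> * kern \<epsilon> (y - z)"
          using kern_nonneg[OF e(1) y] by (simp add: abs_mult mult_right_mono)
        moreover have "0 \<le> \<epsilon> * (G / \<eta> ^ 3) * (\<bar>w y\<bar> + \<bar>w z\<bar>)" using e G \<eta> by simp
        ultimately show ?thesis by linarith
      next
        case False
        have "\<bar>(w y - w z) * kern \<epsilon> (y - z)\<bar> \<le> (\<bar>w y\<bar> + \<bar>w z\<bar>) * (\<epsilon> * (G / \<eta> ^ 3))"
          unfolding abs_mult using kern_nonneg[OF e(1) y] G(2)[OF e(1) \<eta>(1), of "y - z"] False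
          by (intro mult_mono) auto
        moreover have "0 \<le> \<kappa> * kern \<epsilon> (y - z)" using \<kappa> kern_nonneg[OF e(1) y] by simp
        ultimately show ?thesis by (simp add: mult.commute)
      qed
      have "\<bar>LINT y|TM. (w y - w z) * kern \<epsilon> (y - z)\<bar> \<le> (LINT y|TM. \<bar>(w y - w z) * kern \<epsilon> (y - z)\<bar>)"
        by (rule integral_abs_bound)
      also have "\<dots> \<le> (LINT y|TM. \<kappa> * kern \<epsilon> (y - z) + \<epsilon> * (G / \<eta> ^ 3) * (\<bar>w y\<bar> + \<bar>w z\<bar>))"
      proof (rule integral_mono_AE)
        show "integrable TM (\<lambda>y. \<bar>(w y - w z) * kern \<epsilon> (y - z)\<bar>)"
          using iw ik by (simp add: left_diff_distrib)
        show "integrable TM (\<lambda>y. \<kappa> * kern \<epsilon> (y - z) + \<epsilon> * (G / \<eta> ^ 3) * (\<bar>w y\<bar> + \<bar>w z\<bar>))"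
          by (intro Bochner_Integration.integrable_add integrable_mult_right ik iM)
        show "AE y in TM. \<bar>(w y - w z) * kern \<epsilon> (y - z)\<bar> \<le> \<kappa> * kern \<epsilon> (y - z) + \<epsilon> * (G / \<eta> ^ 3) * (\<bar>w y\<bar> + \<bar>w z\<bar>)"
          using AE_TM_off_lattice[of z] by eventually_elim (rule pt)
      qed
      also have "\<dots> = \<kappa> * (LINT y|TM. kern \<epsilon> (y - z)) + \<epsilon> * (G / \<eta> ^ 3) * M"
        unfolding M_def
        by (subst Bochner_Integration.integral_add[OF integrable_mult_right[OF ik] integrable_mult_right[OF iM]]) simp
      also have "\<dots> \<le> \<kappa> * (8 * pi) + \<epsilon> * (G / \<eta> ^ 3) * M"
      proof -
        have "4 * pi * \<epsilon> \<le> 4 * pi * 1" using e by (intro mult_left_mono) auto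
        then have "(LINT y|TM. kern \<epsilon> (y - z)) \<le> 8 * pi" using mass by linarith
        then show ?thesis using \<kappa> by simp
      qed
      finally have 1: "\<bar>LINT y|TM. (w y - w z) * kern \<epsilon> (y - z)\<bar> \<le> \<kappa> * (8 * pi) + \<epsilon> * (G / \<eta> ^ 3) * M" .
      have "(LINT y|TM. (w y - w z) * kern \<epsilon> (y - z)) = (LINT y|TM. w y * kern \<epsilon> (y - z)) - w z * (LINT y|TM. kern \<epsilon> (y - z))"
        using iw ik by (simp add: left_diff_distrib Bochner_Integration.integral_diff)
      then have "(LINT y|TM. w y * kern \<epsilon> (y - z)) - 4 * pi * w z
          = (LINT y|TM. (w y - w z) * kern \<epsilon> (y - z)) + w z * ((LINT y|TM. kern \<epsilon> (y - z)) - 4 * pi)"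
        by (simp add: algebra_simps)
      moreover have "\<bar>w z * ((LINT y|TM. kern \<epsilon> (y - z)) - 4 * pi)\<bar> \<le> \<bar>w z\<bar> * (4 * pi * \<epsilon>)"
        unfolding abs_mult using mass by (intro mult_left_mono) auto
      ultimately have "\<bar>(LINT y|TM. w y * kern \<epsilon> (y - z)) - 4 * pi * w z\<bar> \<le> \<kappa> * (8 * pi) + \<epsilon> * (G / \<eta> ^ 3) * M + \<bar>w z\<bar> * (4 * pi * \<epsilon>)"
        using 1 by linarith
      then show ?thesis by (simp add: algebra_simps)
    qed
    then show ?thesis by blast
  qed
  show ?thesis
  proof (rule LIMSEQ_I)
    fix r :: real assume r: "r > 0"
    \<comment> \<open>The mass of the kernel is at most 8 pi for \<epsilon> \<le> 1, so this choice
      spends half of \<open>r\<close> on the oscillation of \<open>w\<close>; the other half absorbs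
      the terms proportional to \<epsilon>.\<close>
    define \<kappa> where "\<kappa> = r / (16 * pi)"
    have \<kappa>: "\<kappa> > 0" "8 * pi * \<kappa> = r / 2" using r by (simp_all add: \<kappa>_def)
    obtain C where C: "\<And>\<epsilon>. 0 < \<epsilon> \<Longrightarrow> \<epsilon> \<le> 1 \<Longrightarrow> \<bar>(LINT y|TM. w y * kern \<epsilon> (y - z)) - 4 * pi * w z\<bar> \<le> 8 * pi * \<kappa> + C * \<epsilon>"
      using main[OF \<kappa>(1)] by blast
    have "(\<lambda>n. C * eps n) \<longlonglongrightarrow> C * 0" by (intro tendsto_intros LIMSEQ_inverse_real_of_nat)
    then have "\<forall>\<^sub>F n in sequentially. C * eps n < r / 2" using r by (intro order_tendstoD(2)) auto
    then obtain N where N: "\<And>n. n \<ge> N \<Longrightarrow> C * eps n < r / 2" unfolding eventually_sequentially by blast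
    have "norm ((LINT y|TM. w y * kern (eps n) (y - z)) - 4 * pi * w z) < r" if "n \<ge> N" for n
    proof -
      have "0 < eps n" "eps n \<le> 1" by (simp_all add: field_simps)
      then show ?thesis using C[of "eps n"] N[OF that] \<kappa>(2) unfolding real_norm_def by linarith
    qed
    then show "\<exists>N. \<forall>n\<ge>N. norm ((LINT y|TM. w y * kern (eps n) (y - z)) - 4 * pi * w z) < r" by blast
  qed
qed

text \<open>The distributional identity \<Delta>U = 4 pi (\<delta>_0 - q), translated to
  \<open>z\<close>, in the form of a limit that applies to merely integrable \<open>w\<close>
  continuous at \<open>z\<close>.\<close>

lemma laplacian_Ureg_approximates:
  assumes w: "integrable TM w" "periodic w" "isCont w z"
  shows "(\<lambda>n. LINT y|TM. w y * laplacian (Ureg (eps n)) (y - z))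
    \<longlonglongrightarrow> 4 * pi * w z - 4 * pi * (LINT y|TM. w y * q (y - z))"
proof -
  have e: "eps n > 0" for n by simp
  define R where "R n = (LINT y|TM. w y * ((q (y - z))\<^sup>2 / (q (y - z) + eps n)))" for n
  have ir: "integrable TM (\<lambda>y. w y * ((q (y - z))\<^sup>2 / (q (y - z) + eps n)))" for n
    using integrable_mult_periodic[OF w(1) q_ratio_continuous[OF e] q_ratio_periodic] .
  have iq: "integrable TM (\<lambda>y. w y * q (y - z))" by (rule integrable_mult_periodic[OF w(1) q_continuous q_periodic])
  have ik: "integrable TM (\<lambda>y. w y * kern (eps n) (y - z))" for n
    by (intro integrable_mult_periodic w kern_continuous kern_periodic e)
  have "w y * laplacian (Ureg (eps n)) (y - z) = w y * kern (eps n) (y - z) - 4 * pi * (w y * ((q (y - z))\<^sup>2 / (q (y - z) + eps n)))" for n y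
    by (simp add: kern_def algebra_simps)
  then have eq: "(LINT y|TM. w y * laplacian (Ureg (eps n)) (y - z)) = (LINT y|TM. w y * kern (eps n) (y - z)) - 4 * pi * R n" for n
    unfolding R_def using Bochner_Integration.integral_diff[OF ik integrable_mult_right[OF ir]]
    by (simp only: integral_mult_right_zero)
  have "R \<longlonglongrightarrow> (LINT y|TM. w y * q (y - z))"
  proof (rule LIM_zero_cancel, rule Lim_null_comparison)
    show "(\<lambda>n. (LINT y|TM. \<bar>w y\<bar>) * eps n) \<longlonglongrightarrow> 0"
      using tendsto_mult_right_zero[OF LIMSEQ_inverse_real_of_nat] by simp
    show "\<forall>\<^sub>F n in sequentially. norm (R n - (LINT y|TM. w y * q (y - z))) \<le> (LINT y|TM. \<bar>w y\<bar>) * eps n"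
    proof (intro always_eventually allI)
      fix n
      have "R n - (LINT y|TM. w y * q (y - z)) = (LINT y|TM. w y * ((q (y - z))\<^sup>2 / (q (y - z) + eps n)) - w y * q (y - z))"
        unfolding R_def by (rule Bochner_Integration.integral_diff[OF ir iq, symmetric])
      then have "norm (R n - (LINT y|TM. w y * q (y - z))) \<le> (LINT y|TM. \<bar>w y * ((q (y - z))\<^sup>2 / (q (y - z) + eps n)) - w y * q (y - z)\<bar>)"
        by (simp only: real_norm_def integral_abs_bound)
      also have "\<dots> \<le> (LINT y|TM. \<bar>w y\<bar> * eps n)"
      proof (rule integral_mono)
        show "integrable TM (\<lambda>y. \<bar>w y * ((q (y - z))\<^sup>2 / (q (y - z) + eps n)) - w y * q (y - z)\<bar>)"
          by (intro integrable_abs Bochner_Integration.integrable_diff ir iq)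
        show "integrable TM (\<lambda>y. \<bar>w y\<bar> * eps n)" using w(1) by simp
        show "\<bar>w y * ((q (y - z))\<^sup>2 / (q (y - z) + eps n)) - w y * q (y - z)\<bar> \<le> \<bar>w y\<bar> * eps n" for y
          unfolding right_diff_distrib[symmetric] abs_mult by (intro mult_left_mono q_ratio e) simp
      qed
      finally show "norm (R n - (LINT y|TM. w y * q (y - z))) \<le> (LINT y|TM. \<bar>w y\<bar>) * eps n" by simp
    qed
  qed
  then show ?thesis unfolding eq by (intro tendsto_intros kern_approximates w)
qed

lemma Ureg_tendsto: "z \<notin> \<Lambda> \<Longrightarrow> (\<lambda>n. Ureg (eps n) z) \<longlonglongrightarrow> U z"
proof -
  assume "z \<notin> \<Lambda>"
  then have "q z > 0" by (rule q_pos)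
  have "(\<lambda>n. q z + eps n) \<longlonglongrightarrow> q z + 0" by (intro tendsto_intros LIMSEQ_inverse_real_of_nat)
  then show ?thesis unfolding Ureg_def U_def using \<open>q z > 0\<close> by (intro tendsto_ln) auto
qed

lemma Ureg_ge_U: "\<epsilon> > 0 \<Longrightarrow> z \<notin> \<Lambda> \<Longrightarrow> U z \<le> Ureg \<epsilon> z"
  using q_pos[of z] by (simp add: U_def Ureg_def)

lemma Ureg_upper:
  obtains B where "B \<ge> 0" "\<And>z \<epsilon>. 0 < \<epsilon> \<Longrightarrow> \<epsilon> \<le> 1 \<Longrightarrow> Ureg \<epsilon> z \<le> B"
proof -
  obtain B where B: "B > 0" "\<And>z. q z \<le> B" by (rule q_bounded) blast
  have "Ureg \<epsilon> z \<le> ln (B + 1)" if "0 < \<epsilon>" "\<epsilon> \<le> 1" for \<epsilon> z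
    unfolding Ureg_def using B(2)[of z] q_nonneg[of z] that by (subst ln_le_cancel_iff) auto
  then show ?thesis using that[of "ln (B + 1)"] B(1) by simp
qed

lemma Ureg_abs:
  obtains B where "B \<ge> 0" "\<And>z \<epsilon>. 0 < \<epsilon> \<Longrightarrow> \<epsilon> \<le> 1 \<Longrightarrow> z \<notin> \<Lambda> \<Longrightarrow> \<bar>Ureg \<epsilon> z\<bar> \<le> \<bar>U z\<bar> + B"
proof -
  obtain B where B: "B \<ge> 0" "\<And>z \<epsilon>. 0 < \<epsilon> \<Longrightarrow> \<epsilon> \<le> 1 \<Longrightarrow> Ureg \<epsilon> z \<le> B" by (rule Ureg_upper) blast
  have "\<bar>Ureg \<epsilon> z\<bar> \<le> \<bar>U z\<bar> + B" if "0 < \<epsilon>" "\<epsilon> \<le> 1" "z \<notin> \<Lambda>" for z \<epsilon>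
    using Ureg_ge_U[OF that(1,3)] B(2)[OF that(1,2), of z] B(1) by linarith
  then show ?thesis using that B(1) by blast
qed

text \<open>Green's identity holds for the regularisation. On one side the limit comes from the
  approximate identity, on the other from dominated convergence with majorant M (|U| + B).\<close>

theorem U_weak_equation:
  assumes F: "Ck_on 2 F UNIV" "periodic F"
  shows "(LINT z|TM. U z * laplacian F z) + 4 * pi * (LINT z|TM. q z * F z) = 4 * pi * F 0"
proof -
  have e: "eps n > 0" "eps n \<le> 1" for n by (simp_all add: field_simps)
  obtain B where B: "B \<ge> 0" "\<And>z \<epsilon>. 0 < \<epsilon> \<Longrightarrow> \<epsilon> \<le> 1 \<Longrightarrow> z \<notin> \<Lambda> \<Longrightarrow> \<bar>Ureg \<epsilon> z\<bar> \<le> \<bar>U z\<bar> + B"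
    by (rule Ureg_abs) blast
  have contF: "continuous_on UNIV F" by (rule Ck_on_imp_continuous[OF F(1)])
  have "isCont F 0" using contF by (simp add: continuous_on_eq_continuous_at)
  then have lim1: "(\<lambda>n. LINT y|TM. F y * laplacian (Ureg (eps n)) y) \<longlonglongrightarrow> 4 * pi * F 0 - 4 * pi * (LINT y|TM. F y * q y)"
    using laplacian_Ureg_approximates[of F 0] continuous_integrable_TM[OF contF] F(2) by simp
  obtain M where M: "M > 0" "\<And>z. norm (laplacian F z) \<le> M"
    using periodic_bounded[OF periodic_laplacian[OF F(2)] continuous_on_laplacian[OF F(1)]] by blast
  have lm: "laplacian F \<in> borel_measurable TM" by (intro continuous_measurable_TM continuous_on_laplacian[OF F(1)])
  have Um: "U \<in> borel_measurable TM" by (rule measurable_TM) measurable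
  have lim2: "(\<lambda>n. LINT y|TM. laplacian F y * Ureg (eps n) y) \<longlonglongrightarrow> (LINT y|TM. laplacian F y * U y)"
  proof (rule integral_dominated_convergence)
    show "(\<lambda>y. laplacian F y * U y) \<in> borel_measurable TM" using lm Um by measurable
    show "(\<lambda>y. laplacian F y * Ureg (eps n) y) \<in> borel_measurable TM" for n
      by (intro borel_measurable_times lm continuous_measurable_TM[OF Ck_on_imp_continuous[OF Ureg_smooth[OF e(1)]]])
    show "integrable TM (\<lambda>y. M * (\<bar>U y\<bar> + B))"
      using U_integrable[of 0] by simp
    show "AE y in TM. (\<lambda>n. laplacian F y * Ureg (eps n) y) \<longlonglongrightarrow> laplacian F y * U y"
      using AE_TM_off_lattice[of 0] by eventually_elim (use Ureg_tendsto in \<open>auto intro!: tendsto_intros\<close>)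
    show "AE y in TM. norm (laplacian F y * Ureg (eps n) y) \<le> M * (\<bar>U y\<bar> + B)" for n
      using AE_TM_off_lattice[of 0]
    proof eventually_elim
      case (elim y)
      then show ?case using B(2)[OF e, of y n] M(2)[of y] M(1) by (simp only: real_norm_def abs_mult) (intro mult_mono, auto)
    qed
  qed
  have "(LINT y|TM. F y * laplacian (Ureg (eps n)) y) = (LINT y|TM. laplacian F y * Ureg (eps n) y)" for n
    by (intro green_periodic F Ureg_smooth Ureg_periodic e)
  then have "(LINT y|TM. laplacian F y * U y) = 4 * pi * F 0 - 4 * pi * (LINT y|TM. F y * q y)"
    using lim1 lim2 LIMSEQ_unique by (metis (no_types, lifting) ext)
  then show ?thesis by (simp add: mult.commute)
qed

end

section \<open>Functions on the torus and their periodic lifts\<close>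

context lattice
begin

lemma torus_proj_eq_iff: "torus_proj \<omega>1 \<omega>2 z = torus_proj \<omega>1 \<omega>2 w \<longleftrightarrow> z - w \<in> \<Lambda>"
proof
  assume "torus_proj \<omega>1 \<omega>2 z = torus_proj \<omega>1 \<omega>2 w"
  moreover have "w \<in> torus_proj \<omega>1 \<omega>2 w" by (simp add: torus_proj_def period_rel_def)
  ultimately have "w \<in> torus_proj \<omega>1 \<omega>2 z" by (simp only:)
  then show "z - w \<in> \<Lambda>" by (simp add: torus_proj_def period_rel_def)
next
  assume "z - w \<in> \<Lambda>"
  then have "z - x \<in> \<Lambda> \<longleftrightarrow> w - x \<in> \<Lambda>" for x
    using lattice_add[of "z - w" "w - x"] lattice_diff[of "z - x" "z - w"] by auto
  then show "torus_proj \<omega>1 \<omega>2 z = torus_proj \<omega>1 \<omega>2 w" by (simp add: torus_proj_def period_rel_def set_eq_iff)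
qed

lemma torus_eq_range: "torus \<omega>1 \<omega>2 = range (torus_proj \<omega>1 \<omega>2)"
  by (auto simp: torus_def quotient_def torus_proj_def)

lemma periodic_torus_proj: "periodic (\<lambda>z. \<phi> (torus_proj \<omega>1 \<omega>2 z))"
proof -
  have "torus_proj \<omega>1 \<omega>2 (z + w) = torus_proj \<omega>1 \<omega>2 z" if "w \<in> \<Lambda>" for z w
    using that by (simp add: torus_proj_eq_iff)
  then show ?thesis by (simp add: periodic_def)
qed

definition torus_lift :: "(complex \<Rightarrow> real) \<Rightarrow> complex set \<Rightarrow> real" where
  "torus_lift F p = F (SOME z. torus_proj \<omega>1 \<omega>2 z = p)"

lemma torus_lift_proj:
  assumes "periodic F" shows "torus_lift F (torus_proj \<omega>1 \<omega>2 z) = F z"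
proof -
  have "torus_proj \<omega>1 \<omega>2 (SOME x. torus_proj \<omega>1 \<omega>2 x = torus_proj \<omega>1 \<omega>2 z) = torus_proj \<omega>1 \<omega>2 z"
    by (rule someI[where P = "\<lambda>x. torus_proj \<omega>1 \<omega>2 x = torus_proj \<omega>1 \<omega>2 z"]) (rule refl)
  then have "(SOME x. torus_proj \<omega>1 \<omega>2 x = torus_proj \<omega>1 \<omega>2 z) - z \<in> \<Lambda>" by (simp only: torus_proj_eq_iff)
  from periodicD[OF assms this, of z] show ?thesis by (simp add: torus_lift_def)
qed

end

context liouville_potential
begin

definition usol :: "complex set \<Rightarrow> real" where
  "usol = restrict (torus_lift U) (torus \<omega>1 \<omega>2 - {torus_proj \<omega>1 \<omega>2 0})"

lemma usol_proj: "z \<notin> \<Lambda> \<Longrightarrow> usol (torus_proj \<omega>1 \<omega>2 z) = U z"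
  using torus_lift_proj[OF U_periodic] by (auto simp: usol_def torus_eq_range torus_proj_eq_iff)

theorem usol_solution: "mean_field_solution \<omega>1 \<omega>2 (4 * pi) usol"
proof -
  have AEu: "AE z in TM. usol (torus_proj \<omega>1 \<omega>2 z) = U z"
    using AE_TM_off_lattice[of 0] by eventually_elim (simp add: usol_proj)
  define c where "c = usol (torus_proj \<omega>1 \<omega>2 0)"
  \<comment> \<open>At the puncture \<open>usol\<close> has an unspecified constant value.
    Displaying it by cases shows the lift to be measurable on all of \<open>P\<close>.\<close>
  have m0: "usol (torus_proj \<omega>1 \<omega>2 z) = (if z \<in> \<Lambda> then c else U z)" for z
    using torus_proj_eq_iff[of z 0] by (auto simp: usol_proj c_def)
  have [measurable]: "\<Lambda> \<in> sets borel" using closed_lattice by simp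
  have um: "(\<lambda>z. usol (torus_proj \<omega>1 \<omega>2 z)) \<in> borel_measurable TM"
    unfolding m0 by (rule measurable_TM) measurable
  have Um: "U \<in> borel_measurable TM" by (rule measurable_TM) measurable
  have qm: "q \<in> borel_measurable TM" by (rule continuous_measurable_TM[OF q_continuous])
  have AEe: "AE z in TM. exp (usol (torus_proj \<omega>1 \<omega>2 z)) = q z"
    using AE_TM_off_lattice[of 0] by eventually_elim (simp add: usol_proj exp_U)
  have em: "(\<lambda>z. exp (usol (torus_proj \<omega>1 \<omega>2 z))) \<in> borel_measurable TM" using um by measurable
  have int1: "integrable TM (\<lambda>z. usol (torus_proj \<omega>1 \<omega>2 z))"
    using integrable_cong_AE[OF um Um AEu] U_integrable[of 0] by simp
  have int2: "integrable TM (\<lambda>z. exp (usol (torus_proj \<omega>1 \<omega>2 z)))"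
    using integrable_cong_AE[OF em qm AEe] continuous_integrable_TM[OF q_continuous] by simp
  have "(LINT z|TM. usol (torus_proj \<omega>1 \<omega>2 z) * laplacian (\<lambda>w. \<phi> (torus_proj \<omega>1 \<omega>2 w)) z)
      + 4 * pi * (LINT z|TM. exp (usol (torus_proj \<omega>1 \<omega>2 z)) * \<phi> (torus_proj \<omega>1 \<omega>2 z)) = 4 * pi * \<phi> (torus_proj \<omega>1 \<omega>2 0)"
    if "torus_test_function \<omega>1 \<omega>2 \<phi>" for \<phi>
  proof -
    define F where "F z = \<phi> (torus_proj \<omega>1 \<omega>2 z)" for z
    have F: "Ck_on 2 F UNIV" "periodic F" using that periodic_torus_proj by (auto simp: torus_test_function_def F_def[abs_def])
    have lm: "laplacian F \<in> borel_measurable TM" and Fm: "F \<in> borel_measurable TM"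
      by (intro continuous_measurable_TM continuous_on_laplacian[OF F(1)] Ck_on_imp_continuous[OF F(1)])+
    have "(LINT z|TM. usol (torus_proj \<omega>1 \<omega>2 z) * laplacian F z) = (LINT z|TM. U z * laplacian F z)"
      by (rule integral_cong_AE) (use um lm Um AEu in \<open>auto elim: eventually_mono\<close>)
    moreover have "(LINT z|TM. exp (usol (torus_proj \<omega>1 \<omega>2 z)) * F z) = (LINT z|TM. q z * F z)"
      by (rule integral_cong_AE) (use em Fm qm AEe in \<open>auto elim: eventually_mono\<close>)
    ultimately show ?thesis using U_weak_equation[OF F] by (simp add: F_def[abs_def])
  qed
  moreover have "Ck_on 2 (\<lambda>z. usol (torus_proj \<omega>1 \<omega>2 z)) (- \<Lambda>)"
    using Ck_on_cong[OF open_off_lattice, of "\<lambda>z. usol (torus_proj \<omega>1 \<omega>2 z)" U 2] U_smooth usol_proj by simp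
  moreover have "usol \<in> extensional (torus \<omega>1 \<omega>2 - {torus_proj \<omega>1 \<omega>2 0})" by (simp add: usol_def)
  ultimately show ?thesis
    using int1 int2 unfolding mean_field_solution_def torus_integrable_def integrable_TM integral_TM by blast
qed

end

section \<open>Regularity of solutions\<close>

text \<open>The derivatives of e^(-1/x) for x > 0 have the form P(t) e^(-t) with t = 1/x, and
  differentiation in x sends P to t^2 (P - P').\<close>

primrec bump_poly :: "nat \<Rightarrow> real poly" where
  "bump_poly 0 = 1"
| "bump_poly (Suc j) = [:0, 0, 1:] * (bump_poly j - pderiv (bump_poly j))"

definition bump :: "nat \<Rightarrow> real \<Rightarrow> real" where
  "bump j x = (if x > 0 then poly (bump_poly j) (1 / x) * exp (- (1 / x)) else 0)"

lemma poly_times_exp_limit: "((\<lambda>t. poly p t * exp (- t)) \<longlongrightarrow> 0) at_top" for p :: "real poly"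
proof -
  have "((\<lambda>t. \<Sum>i\<le>degree p. coeff p i * (t ^ i / exp t)) \<longlongrightarrow> (\<Sum>i\<le>degree p. coeff p i * 0)) at_top"
    by (intro tendsto_intros tendsto_power_div_exp_0)
  then show ?thesis by (simp add: poly_altdef sum_distrib_right exp_minus divide_inverse mult.assoc)
qed

lemma bump_has_derivative: "(bump j has_real_derivative bump (Suc j) x) (at x)"
proof -
  consider "x > 0" | "x < 0" | "x = 0" by linarith
  then show ?thesis
  proof cases
    case 1
    have "((\<lambda>x. poly (bump_poly j) (1 / x) * exp (- (1 / x))) has_real_derivative bump (Suc j) x) (at x)"
      using 1 by (auto intro!: derivative_eq_intros DERIV_chain'[OF _ poly_DERIV]
          simp: bump_def power2_eq_square algebra_simps)
    then show ?thesis
      by (rule has_field_derivative_transform_within_open[where S = "{0<..}"]) (use 1 in \<open>auto simp: bump_def\<close>)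
  next
    case 2
    have "((\<lambda>x. 0) has_real_derivative bump (Suc j) x) (at x)" using 2 by (simp add: bump_def)
    then show ?thesis
      by (rule has_field_derivative_transform_within_open[where S = "{..<0}"]) (use 2 in \<open>auto simp: bump_def\<close>)
  next
    case 3
    \<comment> \<open>With t = 1/h the difference quotient from the right is t P(t) e^(-t), which
      tends to 0 because the exponential beats every polynomial.\<close>
    have "((\<lambda>h. bump j h / h) \<longlongrightarrow> 0) (at_right 0)"
    proof (rule Lim_transform_eventually)
      show "((\<lambda>h. poly (pCons 0 (bump_poly j)) (inverse h) * exp (- inverse h)) \<longlongrightarrow> 0) (at_right (0::real))"
        by (rule filterlim_compose[OF poly_times_exp_limit filterlim_inverse_at_top_right])
      show "\<forall>\<^sub>F h in at_right 0. poly (pCons 0 (bump_poly j)) (inverse h) * exp (- inverse h) = bump j h / h"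
        by (auto simp: bump_def eventually_at_right_field divide_inverse mult_ac intro!: exI[of _ 1])
    qed
    moreover have "((\<lambda>h. bump j h / h) \<longlongrightarrow> 0) (at_left 0)"
      by (rule tendsto_eventually) (auto simp: bump_def eventually_at_left_field intro!: exI[of _ "-1"])
    ultimately have "((\<lambda>h. bump j h / h) \<longlongrightarrow> 0) (at 0)" by (intro filterlim_split_at)
    then show ?thesis using 3 by (simp add: has_field_derivative_iff bump_def)
  qed
qed

lemma Ck_on_bump: "open S \<Longrightarrow> Ck_on k f S \<Longrightarrow> Ck_on k (\<lambda>z. bump j (f z)) S"
  using Ck_on_compose[of S UNIV bump k f j] bump_has_derivative by blast

lemma Ck_on_laplacian:
  assumes "open S" "Ck_on (Suc (Suc k)) f S"
  shows "Ck_on k (laplacian f) S"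
proof -
  have "Ck_on k (dird v (dird v f)) S" for v using assms by auto
  then show ?thesis unfolding laplacian_eq[abs_def] by (intro Ck_on_add assms)
qed

text \<open>
  The summand \<open>c\<close> comes from padding the measure to total mass \<open>c\<close> at a point where \<open>f = 0\<close>.
\<close>

lemma exp_jensen_subprob:
  fixes g f :: "'a \<Rightarrow> real"
  assumes g: "integrable M g" "\<And>x. g x \<ge> 0" "integral\<^sup>L M g \<le> c" "c > 0"
    and gf: "integrable M (\<lambda>x. g x * f x)" and f: "f \<in> borel_measurable M"
  shows "ennreal (c * exp (integral\<^sup>L M (\<lambda>x. g x * f x) / c)) \<le> (\<integral>\<^sup>+x. ennreal (g x * exp (f x)) \<partial>M) + ennreal c"
proof (cases "(\<integral>\<^sup>+x. ennreal (g x * exp (f x)) \<partial>M) < \<infinity>")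
  case False
  then show ?thesis by (simp add: not_less top_unique)
next
  case True
  have [measurable]: "g \<in> borel_measurable M" using g by auto
  note [measurable] = f
  define a where "a = integral\<^sup>L M (\<lambda>x. g x * f x) / c"
  define m where "m = integral\<^sup>L M g"
  have int: "integrable M (\<lambda>x. g x * exp (f x))"
    by (rule integrableI_nonneg) (use g True in auto)
  \<comment> \<open>The exponential lies above its tangent at \<open>a\<close>. Integration of this
    against \<open>g\<close> leaves the missing mass \<open>c - m\<close>, whose contribution is
    controlled by the same tangent evaluated at 0.\<close>
  have tangent: "exp a * (1 + t - a) \<le> exp t" for t
  proof -
    have "exp a * (1 + (t - a)) \<le> exp a * exp (t - a)" by (intro mult_left_mono exp_ge_add_one_self) auto
    also have "\<dots> = exp t" by (simp add: exp_add[symmetric])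
    finally show ?thesis by (simp add: add_diff_eq)
  qed
  have "(\<integral>x. exp a * ((1 - a) * g x + g x * f x) \<partial>M) \<le> (\<integral>x. g x * exp (f x) \<partial>M)"
  proof (rule integral_mono[OF _ int])
    show "integrable M (\<lambda>x. exp a * ((1 - a) * g x + g x * f x))" using g gf by auto
    show "exp a * ((1 - a) * g x + g x * f x) \<le> g x * exp (f x)" for x
      using mult_left_mono[OF tangent[of "f x"] g(2)[of x]] by (simp add: algebra_simps)
  qed
  moreover have "(\<integral>x. exp a * ((1 - a) * g x + g x * f x) \<partial>M) = exp a * ((1 - a) * m + c * a)"
    using g gf by (simp add: m_def a_def Bochner_Integration.integral_add)
  moreover have "(c - m) * (exp a * (1 - a)) \<le> (c - m) * 1"
    using tangent[of 0] g(3) by (intro mult_left_mono) (auto simp: m_def)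
  moreover have "m \<ge> 0" using g by (simp add: m_def)
  ultimately have "c * exp a \<le> (\<integral>x. g x * exp (f x) \<partial>M) + c"
    by (simp add: algebra_simps)
  then have "ennreal (c * exp a) \<le> ennreal ((\<integral>x. g x * exp (f x) \<partial>M) + c)" by (rule ennreal_leI)
  also have "\<dots> = ennreal (\<integral>x. g x * exp (f x) \<partial>M) + ennreal c"
    using g by (intro ennreal_plus Bochner_Integration.integral_nonneg) auto
  also have "ennreal (\<integral>x. g x * exp (f x) \<partial>M) = (\<integral>\<^sup>+x. ennreal (g x * exp (f x)) \<partial>M)"
    using g by (intro nn_integral_eq_integral[symmetric] int) auto
  finally show ?thesis by (simp add: a_def)
qed

section \<open>The lift of a solution and its representation by the kernel U\<close>

locale mean_field = liouville_potential +
  fixes u :: "complex set \<Rightarrow> real"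
  assumes solution: "mean_field_solution \<omega>1 \<omega>2 (4 * pi) u"
begin

definition v :: "complex \<Rightarrow> real" where "v z = u (torus_proj \<omega>1 \<omega>2 z)"

lemma v_periodic: "periodic v"
  using periodic_torus_proj[of u] by (simp add: v_def[abs_def])

lemma v_smooth: "Ck_on 2 v (- \<Lambda>)"
  using solution by (simp add: mean_field_solution_def v_def[abs_def])

lemma v_integrable: "integrable TM v"
  using solution by (simp add: mean_field_solution_def v_def[abs_def] torus_integrable_def integrable_TM)

lemma exp_v_integrable: "integrable TM (\<lambda>z. exp (v z))"
  using solution by (simp add: mean_field_solution_def v_def[abs_def] torus_integrable_def integrable_TM)

lemma v_measurable [measurable]: "v \<in> borel_measurable TM"
  using v_integrable by auto

lemma weak_equation:
  assumes F: "\<And>k. Ck_on k F UNIV" "periodic F"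
  shows "(LINT z|TM. v z * laplacian F z) + 4 * pi * (LINT z|TM. exp (v z) * F z) = 4 * pi * F 0"
proof -
  have "(\<lambda>z. torus_lift F (torus_proj \<omega>1 \<omega>2 z)) = F" using torus_lift_proj[OF F(2)] by auto
  moreover from this have "torus_test_function \<omega>1 \<omega>2 (torus_lift F)" using F(1) by (simp add: torus_test_function_def)
  ultimately show ?thesis
    using solution torus_lift_proj[OF F(2)] unfolding mean_field_solution_def integral_TM v_def by auto
qed

lemma exp_v_mass: "(LINT z|TM. exp (v z)) = 1"
  using weak_equation[of "\<lambda>_. 1"] by (simp add: Ck_on_const laplacian_const periodic_def)

lemma isCont_v: "z \<notin> \<Lambda> \<Longrightarrow> isCont v z"
  using Ck_on_imp_continuous[OF v_smooth] open_off_lattice by (simp add: continuous_on_eq_continuous_at)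

text \<open>The test functions are the regularised kernels centred at \<open>z\<close>. As
  \<epsilon> tends to 0 the Laplacian term reproduces \<open>v z\<close> and the background term,
  and the exponential term has to converge to what is left. Integrability of \<open>exp v\<close>
  times the singular kernel is a conclusion here.\<close>

lemma representation:
  assumes z: "z \<notin> \<Lambda>"
  shows "integrable TM (\<lambda>y. exp (v y) * U (y - z))"
    and "v z - U z = (LINT y|TM. v y * q (y - z)) - (LINT y|TM. exp (v y) * U (y - z))"
proof -
  have e: "eps n > 0" "eps n \<le> 1" for n by (simp_all add: field_simps)
  obtain B where B: "B \<ge> 0" "\<And>z \<epsilon>. 0 < \<epsilon> \<Longrightarrow> \<epsilon> \<le> 1 \<Longrightarrow> Ureg \<epsilon> z \<le> B" by (rule Ureg_upper) blast
  define I where "I n = (LINT y|TM. exp (v y) * Ureg (eps n) (y - z))" for n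
  have iU: "integrable TM (\<lambda>y. exp (v y) * Ureg (eps n) (y - z))" for n
    by (intro integrable_mult_periodic exp_v_integrable Ck_on_imp_continuous[OF Ureg_smooth[OF e(1)]] Ureg_periodic)
  have weak: "(LINT y|TM. v y * laplacian (Ureg (eps n)) (y - z)) + 4 * pi * I n = 4 * pi * Ureg (eps n) z" for n
  proof -
    have "laplacian (\<lambda>y. Ureg (eps n) (y - z)) = (\<lambda>y. laplacian (Ureg (eps n)) (y - z))"
      by (rule ext) (rule laplacian_shift[OF Ureg_smooth[OF e(1)]])
    \<comment> \<open>The right-hand side of the weak equation is evaluated at 0; evenness of
      \<open>q\<close> turns it into the value at \<open>z\<close>.\<close>
    moreover have "Ureg (eps n) (0 - z) = Ureg (eps n) z" by (simp add: Ureg_def q_even)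
    ultimately show ?thesis
      using weak_equation[OF Ck_shift[OF Ureg_smooth[OF e(1)]] periodic_shift[OF Ureg_periodic], of n z] by (simp add: I_def)
  qed
  have "(\<lambda>n. (4 * pi * Ureg (eps n) z - (LINT y|TM. v y * laplacian (Ureg (eps n)) (y - z))) / (4 * pi))
     \<longlonglongrightarrow> (4 * pi * U z - (4 * pi * v z - 4 * pi * (LINT y|TM. v y * q (y - z)))) / (4 * pi)"
    by (intro tendsto_intros Ureg_tendsto[OF z] laplacian_Ureg_approximates[OF v_integrable v_periodic isCont_v[OF z]]) simp
  moreover have "(4 * pi * Ureg (eps n) z - (LINT y|TM. v y * laplacian (Ureg (eps n)) (y - z))) / (4 * pi) = I n" for n
    using weak[of n] by (simp add: field_simps)
  moreover have "(4 * pi * U z - (4 * pi * v z - 4 * pi * (LINT y|TM. v y * q (y - z)))) / (4 * pi)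
      = U z - v z + (LINT y|TM. v y * q (y - z))" by (simp add: field_simps)
  ultimately have limI: "I \<longlonglongrightarrow> U z - v z + (LINT y|TM. v y * q (y - z))" by simp
  \<comment> \<open>These functions increase with \<open>n\<close>, since the regularised kernels
    decrease. The limit of their integrals is already known, so monotone convergence yields
    integrability of the limit along with its integral.\<close>
  define f where "f n y = exp (v y) * B - exp (v y) * Ureg (eps n) (y - z)" for n y
  have fint: "integrable TM (f n)" for n
    unfolding f_def using iU exp_v_integrable by auto
  have fmono: "AE y in TM. mono (\<lambda>n. f n y)"
  proof (intro AE_I2 monoI)
    fix y and m n :: nat assume "m \<le> n"
    then have "eps n \<le> eps m" by (simp add: field_simps)
    then have "Ureg (eps n) (y - z) \<le> Ureg (eps m) (y - z)"
      unfolding Ureg_def using q_nonneg[of "y - z"] e(1)[of n] e(1)[of m] by (subst ln_le_cancel_iff) (auto intro: add_nonneg_pos)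
    then show "f m y \<le> f n y" unfolding f_def by (simp add: mult_left_mono)
  qed
  have flim: "AE y in TM. (\<lambda>n. f n y) \<longlonglongrightarrow> exp (v y) * B - exp (v y) * U (y - z)"
    using AE_TM_off_lattice[of z]
  proof eventually_elim
    case (elim y)
    show ?case unfolding f_def by (intro tendsto_intros Ureg_tendsto elim)
  qed
  have "(LINT y|TM. f n y) = (LINT y|TM. exp (v y) * B) - I n" for n
    unfolding f_def I_def using iU exp_v_integrable by (intro Bochner_Integration.integral_diff) auto
  then have fI: "(\<lambda>n. LINT y|TM. f n y) \<longlonglongrightarrow> (LINT y|TM. exp (v y) * B) - (U z - v z + (LINT y|TM. v y * q (y - z)))"
    using tendsto_diff[OF tendsto_const limI] by simp
  have Um: "(\<lambda>y. U (y - z)) \<in> borel_measurable TM" by (rule measurable_TM) measurable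
  then have fm: "(\<lambda>y. exp (v y) * B - exp (v y) * U (y - z)) \<in> borel_measurable TM"
    using v_measurable by measurable
  have lim_int: "integrable TM (\<lambda>y. exp (v y) * B - exp (v y) * U (y - z))"
    by (rule integrable_monotone_convergence[OF fint fmono flim fI fm])
  have lim_eq: "(LINT y|TM. exp (v y) * B - exp (v y) * U (y - z))
      = (LINT y|TM. exp (v y) * B) - (U z - v z + (LINT y|TM. v y * q (y - z)))"
    by (rule integral_monotone_convergence[OF fint fmono flim fI fm])
  have iB: "integrable TM (\<lambda>y. exp (v y) * B)" using exp_v_integrable by simp
  from Bochner_Integration.integrable_diff[OF iB lim_int]
  show i: "integrable TM (\<lambda>y. exp (v y) * U (y - z))" by simp
  have "(LINT y|TM. exp (v y) * B - exp (v y) * U (y - z)) = (LINT y|TM. exp (v y) * B) - (LINT y|TM. exp (v y) * U (y - z))"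
    by (rule Bochner_Integration.integral_diff[OF iB i])
  then show "v z - U z = (LINT y|TM. v y * q (y - z)) - (LINT y|TM. exp (v y) * U (y - z))"
    using lim_eq by simp
qed

lemma q_convolution_bound:
  obtains A where "A \<ge> 0" "\<And>z. \<bar>LINT y|TM. v y * q (y - z)\<bar> \<le> A"
proof -
  obtain B where B: "B > 0" "\<And>z. q z \<le> B" by (rule q_bounded) blast
  have "\<bar>LINT y|TM. v y * q (y - z)\<bar> \<le> (LINT y|TM. \<bar>v y\<bar> * B)" for z
  proof -
    have "\<bar>LINT y|TM. v y * q (y - z)\<bar> \<le> (LINT y|TM. \<bar>v y * q (y - z)\<bar>)" by (rule integral_abs_bound)
    also have "\<dots> \<le> (LINT y|TM. \<bar>v y\<bar> * B)"
    proof (rule integral_mono)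
      show "integrable TM (\<lambda>y. \<bar>v y * q (y - z)\<bar>)"
        by (intro integrable_abs integrable_mult_periodic v_integrable q_continuous q_periodic)
      show "integrable TM (\<lambda>y. \<bar>v y\<bar> * B)" using v_integrable by simp
      show "\<bar>v y * q (y - z)\<bar> \<le> \<bar>v y\<bar> * B" for y
        using B(2)[of "y - z"] q_nonneg[of "y - z"] by (simp add: abs_mult mult_left_mono)
    qed
    finally show ?thesis .
  qed
  then show ?thesis using that[of "LINT y|TM. \<bar>v y\<bar> * B"] B(1) by (simp add: Bochner_Integration.integral_nonneg)
qed

definition negU :: "complex \<Rightarrow> real" where "negU x = max 0 (- U x)"

lemma negU_measurable [measurable]: "negU \<in> borel_measurable borel"
  unfolding negU_def[abs_def] by measurable

lemma negU_integrable:
  assumes "z \<notin> \<Lambda>" shows "integrable TM (\<lambda>y. exp (v y) * negU (y - z))"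
proof (rule Bochner_Integration.integrable_bound[OF representation(1)[OF assms]])
  have "(\<lambda>y. negU (y - z)) \<in> borel_measurable TM" by (rule measurable_TM) measurable
  then show "(\<lambda>y. exp (v y) * negU (y - z)) \<in> borel_measurable TM" using v_measurable by measurable
  show "AE y in TM. norm (exp (v y) * negU (y - z)) \<le> norm (exp (v y) * U (y - z))"
    by (intro AE_I2) (simp add: abs_mult negU_def)
qed

text \<open>The kernel enters the representation with a minus sign, so its positive part can only
  lower \<open>v - U\<close>; an upper bound involves the negative part alone.\<close>

lemma upper_bound_by_negU:
  obtains A where "A \<ge> 0" "\<And>z. z \<notin> \<Lambda> \<Longrightarrow> v z - U z \<le> A + (LINT y|TM. exp (v y) * negU (y - z))"
proof -
  obtain A where A: "A \<ge> 0" "\<And>z. \<bar>LINT y|TM. v y * q (y - z)\<bar> \<le> A" by (rule q_convolution_bound) blast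
  have "v z - U z \<le> A + (LINT y|TM. exp (v y) * negU (y - z))" if z: "z \<notin> \<Lambda>" for z
  proof -
    have "(LINT y|TM. - (exp (v y) * U (y - z))) \<le> (LINT y|TM. exp (v y) * negU (y - z))"
    proof (rule integral_mono[OF _ negU_integrable[OF z]])
      show "integrable TM (\<lambda>y. - (exp (v y) * U (y - z)))" using representation(1)[OF z] by simp
      show "- (exp (v y) * U (y - z)) \<le> exp (v y) * negU (y - z)" for y
        using mult_left_mono[of "- U (y - z)" "negU (y - z)" "exp (v y)"] by (simp add: negU_def)
    qed
    then show ?thesis using representation(2)[OF z] A(2)[of z] by simp
  qed
  then show ?thesis using that A(1) by blast
qed

text \<open>The sets where \<open>q\<close> is below a threshold shrink to the lattice, a null set,
  and \<open>exp v\<close> dominates. The value 1/4 is tuned to Jensen's inequality below: applied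
  to half of \<open>negU\<close>, mass 1/4 produces the exponent 2 needed for the square of
  \<open>exp v\<close>.\<close>

lemma small_mass:
  obtains \<delta> where "\<delta> > 0" "(LINT y|TM. indicator {y. q y < \<delta>} y * exp (v y)) \<le> 1 / 4"
proof -
  have [measurable]: "q \<in> borel_measurable TM" by (rule continuous_measurable_TM[OF q_continuous])
  have ind: "(\<lambda>y. indicator {y. q y < c} y :: real) \<in> borel_measurable TM" for c
  proof -
    have "(\<lambda>y. indicator {y. q y < c} y :: real) = (\<lambda>y. if q y < c then 1 else 0)" by (auto simp: indicator_def)
    then show ?thesis by simp
  qed
  have "(\<lambda>n. LINT y|TM. indicator {y. q y < eps n} y * exp (v y)) \<longlonglongrightarrow> (LINT y|TM. 0)"
  proof (rule integral_dominated_convergence[where w = "\<lambda>y. exp (v y)"])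
    show "AE y in TM. (\<lambda>n. indicator {y. q y < eps n} y * exp (v y)) \<longlonglongrightarrow> 0"
      using AE_TM_off_lattice[of 0]
    proof eventually_elim
      case (elim y)
      then have "q y > 0" using q_pos by simp
      then have "\<forall>\<^sub>F n in sequentially. eps n < q y"
        using LIMSEQ_inverse_real_of_nat by (rule order_tendstoD(2)[rotated])
      then show ?case
        by (intro tendsto_eventually) (auto elim!: eventually_mono simp: indicator_def)
    qed
    show "AE y in TM. norm (indicator {y. q y < eps n} y * exp (v y)) \<le> exp (v y)" for n
      by (intro AE_I2) (simp add: indicator_def)
  qed (use ind v_measurable exp_v_integrable in measurable)
  then have "\<forall>\<^sub>F n in sequentially. (LINT y|TM. indicator {y. q y < eps n} y * exp (v y)) < 1 / 4"
    by (intro order_tendstoD(2)) auto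
  then obtain n where "(LINT y|TM. indicator {y. q y < eps n} y * exp (v y)) < 1 / 4"
    by (auto simp: eventually_sequentially)
  then show ?thesis by (intro that[of "eps n"]) auto
qed

lemma v_bounded_away:
  assumes "\<delta> > 0"
  obtains M where "\<And>z. q z \<ge> \<delta> \<Longrightarrow> \<bar>v z\<bar> \<le> M"
proof -
  have "closed {z. \<delta> \<le> q z}" by (intro closed_Collect_le continuous_intros q_continuous)
  then have comp: "compact (closed_cell \<inter> {z. \<delta> \<le> q z})" using compact_closed_cell by (simp add: compact_Int_closed)
  have "closed_cell \<inter> {z. \<delta> \<le> q z} \<subseteq> - \<Lambda>" using assms by (auto simp: q_eq_0_iff[symmetric])
  then have "compact (v ` (closed_cell \<inter> {z. \<delta> \<le> q z}))"
    by (intro compact_continuous_image comp continuous_on_subset[OF Ck_on_imp_continuous[OF v_smooth]])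
  then have "bounded (v ` (closed_cell \<inter> {z. \<delta> \<le> q z}))" by (rule compact_imp_bounded)
  then obtain M where M: "\<And>z. z \<in> closed_cell \<inter> {z. \<delta> \<le> q z} \<Longrightarrow> \<bar>v z\<bar> \<le> M"
    unfolding bounded_iff by auto
  have "\<bar>v z\<bar> \<le> M" if "q z \<ge> \<delta>" for z
  proof -
    obtain w where w: "w \<in> \<Lambda>" "z - w \<in> closed_cell" by (rule reduce_to_cell)
    then show ?thesis
      using M[of "z - w"] that periodicD_diff[OF q_periodic w(1), of z] periodicD_diff[OF v_periodic w(1), of z] by simp
  qed
  then show ?thesis using that by blast
qed

text \<open>
  The Brezis--Merle argument: where the mass of \<open>exp v\<close> is small, Jensen's inequality applied to the
  representation formula bounds \<open>exp (2 (v - U))\<close> in mean.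
\<close>

lemma exp_v_square_integrable: "integrable TM (\<lambda>z. (exp (v z))\<^sup>2)"
proof -
  obtain \<delta> where \<delta>: "\<delta> > 0" "(LINT y|TM. indicator {y. q y < \<delta>} y * exp (v y)) \<le> 1 / 4"
    by (rule small_mass) blast
  obtain A where A: "A \<ge> 0" "\<And>z. z \<notin> \<Lambda> \<Longrightarrow> v z - U z \<le> A + (LINT y|TM. exp (v y) * negU (y - z))"
    by (rule upper_bound_by_negU) blast
  obtain K where K: "K > 0" "\<And>x y. \<bar>sqrt (q x) - sqrt (q y)\<bar> \<le> K * cmod (x - y)"
    by (rule sqrt_q_lipschitz) blast
  obtain B where B: "B > 0" "\<And>z. q z \<le> B" by (rule q_bounded) blast
  obtain M where M: "\<And>z. q z \<ge> \<delta> / 4 \<Longrightarrow> \<bar>v z\<bar> \<le> M" by (rule v_bounded_away[of "\<delta> / 4"]) (use \<delta> in auto)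
  obtain C where C: "C \<ge> 0" "\<And>z. (\<integral>\<^sup>+y. inverse (ennreal (sqrt (q (y - z)))) \<partial>TM) \<le> ennreal C"
    by (rule kernel_bound) blast
  have "sqrt \<delta> / (2 * K) > 0" using \<delta> K by simp
  then obtain \<eta> where \<eta>: "\<eta> > 0" "\<And>x. q x < \<eta> \<Longrightarrow> \<exists>w\<in>\<Lambda>. cmod (x - w) < sqrt \<delta> / (2 * K)"
    by (rule q_small_near_lattice) blast
  \<comment> \<open>Here \<open>sqrt q\<close> differs by at least sqrt \<delta> / 2 between
    \<open>y\<close> and \<open>z\<close>, so the Lipschitz bound keeps \<open>y - z\<close> at
    distance at least sqrt \<delta> / (2 K) from the lattice, and U is bounded below there.\<close>
  have far: "q (y - z) \<ge> \<eta>" if "q z < \<delta> / 4" "q y \<ge> \<delta>" for y z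
  proof (rule ccontr)
    assume "\<not> q (y - z) \<ge> \<eta>"
    then obtain w where w: "w \<in> \<Lambda>" "cmod (y - z - w) < sqrt \<delta> / (2 * K)" using \<eta>(2)[of "y - z"] by auto
    have "\<bar>sqrt (q (y - w)) - sqrt (q z)\<bar> \<le> K * cmod (y - w - z)" by (rule K(2))
    also have "\<dots> < sqrt \<delta> / 2" using w(2) K(1) by (simp add: field_simps)
    finally have "\<bar>sqrt (q y) - sqrt (q z)\<bar> < sqrt \<delta> / 2"
      unfolding periodicD_diff[OF q_periodic w(1)] .
    moreover have "sqrt (q z) < sqrt \<delta> / 2" using that(1) real_sqrt_less_mono[of "q z" "\<delta> / 4"] by (simp add: real_sqrt_divide)
    moreover have "sqrt \<delta> \<le> sqrt (q y)" using that(2) by simp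
    ultimately show False by linarith
  qed
  define n0 where "n0 = \<bar>ln \<eta>\<bar>"
  \<comment> \<open>The part of the measure close to the lattice, of mass at most 1/4. For
    \<open>z\<close> close to the lattice the remaining part contributes at most \<open>n0\<close>
    to the potential.\<close>
  define \<theta> where "\<theta> y = indicator {y. q y < \<delta>} y * exp (v y)" for y
  have [measurable]: "q \<in> borel_measurable TM" by (rule continuous_measurable_TM[OF q_continuous])
  have \<theta>m: "\<theta> \<in> borel_measurable TM"
  proof -
    have "\<theta> = (\<lambda>y. if q y < \<delta> then exp (v y) else 0)" by (auto simp: \<theta>_def indicator_def)
    then show ?thesis by simp
  qed
  have \<theta>0: "0 \<le> \<theta> y" "\<theta> y \<le> exp (v y)" for y by (auto simp: \<theta>_def indicator_def)
  have \<theta>i: "integrable TM \<theta>"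
    by (rule Bochner_Integration.integrable_bound[OF exp_v_integrable \<theta>m]) (use \<theta>0 in auto)
  have \<theta>mass: "integral\<^sup>L TM \<theta> \<le> 1 / 4" using \<delta>(2) by (simp add: \<theta>_def[abs_def])
  have Nm: "(\<lambda>y. negU (y - z)) \<in> borel_measurable TM" for z by (rule measurable_TM) measurable
  define J where "J z = (\<integral>\<^sup>+y. ennreal (exp (v y)) * (1 + inverse (ennreal (sqrt (q (y - z))))) \<partial>TM)" for z
  have main: "ennreal ((exp (v z))\<^sup>2) \<le> ennreal (B\<^sup>2 * exp (2 * (A + n0))) * (4 * J z + 1)"
    if z: "z \<notin> \<Lambda>" "q z < \<delta> / 4" for z
  proof -
    have \<theta>N: "integrable TM (\<lambda>y. \<theta> y * negU (y - z))"
    proof (rule Bochner_Integration.integrable_bound[OF negU_integrable[OF z(1)]])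
      show "(\<lambda>y. \<theta> y * negU (y - z)) \<in> borel_measurable TM" using \<theta>m Nm by measurable
      show "AE y in TM. norm (\<theta> y * negU (y - z)) \<le> norm (exp (v y) * negU (y - z))"
        using \<theta>0 by (intro AE_I2) (auto simp: abs_mult intro!: mult_right_mono)
    qed
    have "(LINT y|TM. exp (v y) * negU (y - z)) \<le> (LINT y|TM. n0 * exp (v y) + \<theta> y * negU (y - z))"
    proof (rule integral_mono_AE[OF negU_integrable[OF z(1)]])
      show "integrable TM (\<lambda>y. n0 * exp (v y) + \<theta> y * negU (y - z))" using exp_v_integrable \<theta>N by auto
      show "AE y in TM. exp (v y) * negU (y - z) \<le> n0 * exp (v y) + \<theta> y * negU (y - z)"
        using AE_TM_off_lattice[of z]
      proof eventually_elim
        case (elim y)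
        show ?case
        proof (cases "q y < \<delta>")
          case True
          then show ?thesis by (simp add: \<theta>_def n0_def)
        next
          case False
          then have "\<eta> \<le> q (y - z)" using far z(2) by simp
          then have "ln \<eta> \<le> U (y - z)" unfolding U_def using \<eta>(1) by simp
          then have "negU (y - z) \<le> n0" by (simp add: negU_def n0_def)
          then have "exp (v y) * negU (y - z) \<le> exp (v y) * n0" by (intro mult_left_mono) auto
          then show ?thesis using False by (simp add: \<theta>_def mult.commute)
        qed
      qed
    qed
    also have "\<dots> = n0 + (LINT y|TM. \<theta> y * negU (y - z))"
      using exp_v_integrable \<theta>N by (simp add: Bochner_Integration.integral_add exp_v_mass)
    finally have w: "v z - U z \<le> A + n0 + (LINT y|TM. \<theta> y * negU (y - z))" using A(2)[OF z(1)] by simp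
    define a where "a = 2 * (LINT y|TM. \<theta> y * negU (y - z))"
    \<comment> \<open>The factor 1/2 keeps the right-hand side integrable: exp (negU / 2) is at most
      1 + 1 / sqrt q, a singularity of order 1/|z|. Division by the mass 1/4 turns 1/2 into
      2.\<close>
    have jens: "ennreal (1/4 * exp (integral\<^sup>L TM (\<lambda>y. \<theta> y * (1/2 * negU (y - z))) / (1/4)))
        \<le> (\<integral>\<^sup>+y. ennreal (\<theta> y * exp (1/2 * negU (y - z))) \<partial>TM) + ennreal (1/4)"
    proof (rule exp_jensen_subprob)
      show "integrable TM (\<lambda>y. \<theta> y * (1/2 * negU (y - z)))" using \<theta>N by (simp add: mult.left_commute)
      show "(\<lambda>y. 1/2 * negU (y - z)) \<in> borel_measurable TM" using Nm by measurable
    qed (use \<theta>i \<theta>0 \<theta>mass in auto)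
    have aeq: "integral\<^sup>L TM (\<lambda>y. \<theta> y * (1/2 * negU (y - z))) / (1/4) = a"
      unfolding a_def by (simp add: mult.left_commute[of _ "1/2"])
    have JJ: "(\<integral>\<^sup>+y. ennreal (\<theta> y * exp (1/2 * negU (y - z))) \<partial>TM) \<le> J z"
      unfolding J_def
    proof (rule nn_integral_mono_AE)
      show "AE y in TM. ennreal (\<theta> y * exp (1/2 * negU (y - z))) \<le> ennreal (exp (v y)) * (1 + inverse (ennreal (sqrt (q (y - z)))))"
        using AE_TM_off_lattice[of z]
      proof eventually_elim
        case (elim y)
        then have pos: "q (y - z) > 0" by (rule q_pos)
        have "exp (1/2 * negU (y - z)) \<le> 1 + 1 / sqrt (q (y - z))"
        proof (cases "U (y - z) \<le> 0")
          case True
          have "exp (1/2 * negU (y - z)) = exp (- ln (sqrt (q (y - z))))"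
            using True pos by (simp add: negU_def U_def ln_sqrt)
          also have "\<dots> = 1 / sqrt (q (y - z))" using pos by (simp add: exp_minus inverse_eq_divide)
          finally show ?thesis by simp
        next
          case False
          then show ?thesis using pos by (simp add: negU_def)
        qed
        then have "\<theta> y * exp (1/2 * negU (y - z)) \<le> exp (v y) * (1 + 1 / sqrt (q (y - z)))"
          using \<theta>0 by (intro mult_mono) auto
        then have "ennreal (\<theta> y * exp (1/2 * negU (y - z))) \<le> ennreal (exp (v y) * (1 + 1 / sqrt (q (y - z))))" by (rule ennreal_leI)
        also have "\<dots> = ennreal (exp (v y)) * (1 + inverse (ennreal (sqrt (q (y - z)))))"
          using pos by (simp add: ennreal_mult ennreal_plus inverse_ennreal inverse_eq_divide)
        finally show ?case .
      qed
    qed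
    have "ennreal (1/4 * exp a) \<le> J z + ennreal (1/4)"
      using jens add_right_mono[OF JJ, of "ennreal (1/4)"] unfolding aeq by (rule order_trans)
    then have "4 * ennreal (1/4 * exp a) \<le> 4 * (J z + ennreal (1/4))" by (rule mult_left_mono) simp
    moreover have four: "4 * ennreal (1/4 * x) = ennreal x" if "x \<ge> 0" for x
    proof -
      have "4 * ennreal (1/4 * x) = ennreal 4 * ennreal (1/4 * x)" by simp
      also have "\<dots> = ennreal (4 * (1/4 * x))" using that by (intro ennreal_mult[symmetric]) auto
      finally show ?thesis by simp
    qed
    ultimately have ea: "ennreal (exp a) \<le> 4 * J z + 1"
      using four[of 1] four[of "exp a"] by (simp add: distrib_left)
    have "exp (v z) = q z * exp (v z - U z)"
      unfolding exp_U[OF z(1), symmetric] exp_add[symmetric] by simp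
    also have "\<dots> \<le> B * exp (A + n0 + a / 2)"
      using w B q_nonneg[of z] by (intro mult_mono) (auto simp: a_def)
    finally have "(exp (v z))\<^sup>2 \<le> (B * exp (A + n0 + a / 2))\<^sup>2" by (intro power_mono) auto
    also have "\<dots> = (B\<^sup>2 * exp (2 * (A + n0))) * exp a"
    proof -
      have "(exp (A + n0 + a / 2))\<^sup>2 = exp (2 * (A + n0)) * exp a"
        unfolding power2_eq_square exp_add[symmetric] by (rule arg_cong[of _ _ exp]) simp
      then show ?thesis by (simp add: power_mult_distrib)
    qed
    finally have "ennreal ((exp (v z))\<^sup>2) \<le> ennreal ((B\<^sup>2 * exp (2 * (A + n0))) * exp a)" by (rule ennreal_leI)
    also have "\<dots> = ennreal (B\<^sup>2 * exp (2 * (A + n0))) * ennreal (exp a)" by (intro ennreal_mult) auto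
    also have "\<dots> \<le> ennreal (B\<^sup>2 * exp (2 * (A + n0))) * (4 * J z + 1)" by (rule mult_left_mono[OF ea]) simp
    finally show ?thesis .
  qed
  have kb: "(\<lambda>x. inverse (ennreal (sqrt (q x)))) \<in> borel_measurable borel"
  proof -
    have [measurable]: "q \<in> borel_measurable borel"
      by (rule borel_measurable_continuous_onI[OF q_continuous])
    show ?thesis by measurable
  qed
  have id1: "(\<lambda>x. x) \<in> borel_measurable TM" by (rule measurable_TM) simp
  have pm: "(\<lambda>(y, z). ennreal (exp (v y)) * (1 + inverse (ennreal (sqrt (q (y - z)))))) \<in> borel_measurable (TM \<Otimes>\<^sub>M TM)"
  proof -
    have [measurable]: "(\<lambda>p. fst p) \<in> borel_measurable (TM \<Otimes>\<^sub>M TM)"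
      by (rule measurable_compose[OF measurable_fst id1])
    have [measurable]: "(\<lambda>p. snd p) \<in> borel_measurable (TM \<Otimes>\<^sub>M TM)"
      by (rule measurable_compose[OF measurable_snd id1])
    have "(\<lambda>p. fst p - snd p) \<in> borel_measurable (TM \<Otimes>\<^sub>M TM)" by measurable
    from measurable_compose[OF this kb] have [measurable]: "(\<lambda>p. inverse (ennreal (sqrt (q (fst p - snd p))))) \<in> borel_measurable (TM \<Otimes>\<^sub>M TM)" .
    have [measurable]: "(\<lambda>p. v (fst p)) \<in> borel_measurable (TM \<Otimes>\<^sub>M TM)"
      using measurable_compose[OF measurable_fst v_measurable] .
    show ?thesis unfolding case_prod_beta by measurable
  qed
  have Jm: "J \<in> borel_measurable TM"
    unfolding J_def using TM.borel_measurable_nn_integral_fst[OF measurable_pair_swap[OF pm]] by (simp add: case_prod_beta)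
  \<comment> \<open>After the exchange of integrals, evenness of \<open>q\<close> and the uniform
    kernel bound leave the total mass of \<open>exp v\<close>, which is 1.\<close>
  have JI: "(\<integral>\<^sup>+z. J z \<partial>TM) \<le> ennreal (1 + C)"
  proof -
    interpret pair_sigma_finite TM TM by unfold_locales
    have "(\<integral>\<^sup>+z. J z \<partial>TM) = (\<integral>\<^sup>+y. \<integral>\<^sup>+z. ennreal (exp (v y)) * (1 + inverse (ennreal (sqrt (q (y - z))))) \<partial>TM \<partial>TM)"
      unfolding J_def using Fubini'[of "\<lambda>y z. ennreal (exp (v y)) * (1 + inverse (ennreal (sqrt (q (y - z)))))"] pm by simp
    also have "\<dots> \<le> (\<integral>\<^sup>+y. ennreal (exp (v y)) * ennreal (1 + C) \<partial>TM)"
    proof (rule nn_integral_mono)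
      fix y
      have sw: "q (y - z) = q (z - y)" for z by (rule q_minus_commute)
      have m1: "(\<lambda>z. inverse (ennreal (sqrt (q (z - y))))) \<in> borel_measurable TM"
        by (rule measurable_TM, rule measurable_compose[OF _ kb]) measurable
      have "(\<integral>\<^sup>+z. ennreal (exp (v y)) * (1 + inverse (ennreal (sqrt (q (y - z))))) \<partial>TM)
         = ennreal (exp (v y)) * (1 + (\<integral>\<^sup>+z. inverse (ennreal (sqrt (q (z - y)))) \<partial>TM))"
        unfolding sw using m1 by (simp add: nn_integral_cmult nn_integral_add TM.emeasure_space_1[unfolded space_TM] space_TM)
      also have "\<dots> \<le> ennreal (exp (v y)) * (1 + ennreal C)"
        by (intro mult_left_mono add_left_mono C(2)) auto
      finally show "(\<integral>\<^sup>+z. ennreal (exp (v y)) * (1 + inverse (ennreal (sqrt (q (y - z))))) \<partial>TM) \<le> ennreal (exp (v y)) * ennreal (1 + C)"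
        using C(1) by (simp add: ennreal_plus)
    qed
    also have "\<dots> = (\<integral>\<^sup>+y. ennreal (exp (v y)) \<partial>TM) * ennreal (1 + C)"
      using v_measurable by (intro nn_integral_multc) measurable
    also have "(\<integral>\<^sup>+y. ennreal (exp (v y)) \<partial>TM) = 1"
      by (subst nn_integral_eq_integral[OF exp_v_integrable]) (simp_all add: exp_v_mass)
    finally show ?thesis by simp
  qed
  show ?thesis
  proof (rule integrableI_nonneg)
    show "(\<lambda>z. (exp (v z))\<^sup>2) \<in> borel_measurable TM" using v_measurable by measurable
    let ?c = "ennreal (B\<^sup>2 * exp (2 * (A + n0)))"
    have "(\<integral>\<^sup>+z. ennreal ((exp (v z))\<^sup>2) \<partial>TM) \<le> (\<integral>\<^sup>+z. ennreal ((exp M)\<^sup>2) + ?c * (4 * J z + 1) \<partial>TM)"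
    proof (rule nn_integral_mono_AE)
      show "AE z in TM. ennreal ((exp (v z))\<^sup>2) \<le> ennreal ((exp M)\<^sup>2) + ?c * (4 * J z + 1)"
        using AE_TM_off_lattice[of 0]
      proof eventually_elim
        case (elim z)
        show ?case
        proof (cases "q z < \<delta> / 4")
          case True
          have "ennreal ((exp (v z))\<^sup>2) \<le> ?c * (4 * J z + 1)" using main[OF _ True] elim by simp
          then show ?thesis by (rule add_increasing[rotated]) simp
        next
          case False
          then have "exp (v z) \<le> exp M" using M[of z] by simp
          then have "ennreal ((exp (v z))\<^sup>2) \<le> ennreal ((exp M)\<^sup>2)" by (intro ennreal_leI power_mono) auto
          then show ?thesis by (rule add_increasing2[rotated]) simp
        qed
      qed
    qed
    also have "\<dots> = ennreal ((exp M)\<^sup>2) + ?c * (4 * (\<integral>\<^sup>+z. J z \<partial>TM) + 1)"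
      using Jm by (simp add: nn_integral_cmult nn_integral_add TM.emeasure_space_1[unfolded space_TM] space_TM)
    also have "\<dots> < \<infinity>"
    proof -
      have "(\<integral>\<^sup>+z. J z \<partial>TM) < \<infinity>" using JI by (rule order_le_less_trans) simp
      then show ?thesis by (simp add: ennreal_mult_less_top ennreal_add_less_top)
    qed
    finally show "(\<integral>\<^sup>+z. ennreal ((exp (v z))\<^sup>2) \<partial>TM) < \<infinity>" .
  qed auto
qed

text \<open>Now \<open>exp v\<close> and the translated kernels are square integrable, the latter
  uniformly, so the inequality 2ab \<le> a^2 + b^2 bounds the potential. In particular
  \<open>exp v\<close> vanishes to second order at the puncture.\<close>

lemma exp_v_le_q:
  obtains C where "C > 0" "\<And>z. z \<notin> \<Lambda> \<Longrightarrow> exp (v z) \<le> C * q z"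
proof -
  obtain A where A: "A \<ge> 0" "\<And>z. z \<notin> \<Lambda> \<Longrightarrow> v z - U z \<le> A + (LINT y|TM. exp (v y) * negU (y - z))"
    by (rule upper_bound_by_negU) blast
  obtain D where D: "D > 0" "\<And>z. integrable TM (\<lambda>y. (U (y - z))\<^sup>2)" "\<And>z. (LINT y|TM. (U (y - z))\<^sup>2) \<le> D"
    by (rule U_square_integrable) blast
  define I where "I = (LINT y|TM. (exp (v y))\<^sup>2)"
  have "v z - U z \<le> A + (I + D)" if z: "z \<notin> \<Lambda>" for z
  proof -
    have "(LINT y|TM. exp (v y) * negU (y - z)) \<le> (LINT y|TM. (exp (v y))\<^sup>2 + (U (y - z))\<^sup>2)"
    proof (rule integral_mono[OF negU_integrable[OF z]])
      show "integrable TM (\<lambda>y. (exp (v y))\<^sup>2 + (U (y - z))\<^sup>2)" using exp_v_square_integrable D(2) by auto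
      show "exp (v y) * negU (y - z) \<le> (exp (v y))\<^sup>2 + (U (y - z))\<^sup>2" for y
      proof -
        have "2 * exp (v y) * negU (y - z) \<le> (exp (v y))\<^sup>2 + (negU (y - z))\<^sup>2" by (rule sum_squares_bound)
        moreover have "(negU (y - z))\<^sup>2 \<le> (U (y - z))\<^sup>2" by (simp add: negU_def max_def)
        moreover have "0 \<le> exp (v y) * negU (y - z)" by (simp add: negU_def)
        ultimately show ?thesis by linarith
      qed
    qed
    also have "\<dots> = I + (LINT y|TM. (U (y - z))\<^sup>2)"
      unfolding I_def by (rule Bochner_Integration.integral_add[OF exp_v_square_integrable D(2)])
    finally show ?thesis using A(2)[OF z] D(3)[of z] by linarith
  qed
  then have "exp (v z) \<le> exp (A + (I + D)) * q z" if "z \<notin> \<Lambda>" for z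
  proof -
    have "exp (v z) = exp (v z - U z) * q z"
      unfolding exp_U[OF that, symmetric] exp_add[symmetric] by simp
    also have "\<dots> \<le> exp (A + (I + D)) * q z"
      using \<open>\<And>z. z \<notin> \<Lambda> \<Longrightarrow> v z - U z \<le> A + (I + D)\<close>[OF that] q_nonneg[of z] by (intro mult_right_mono) auto
    finally show ?thesis .
  qed
  then show ?thesis using that[of "exp (A + (I + D))"] by simp
qed

text \<open>Both terms of the representation are Lipschitz in the centre: the first because
  \<open>q\<close> is, the second because \<open>exp v\<close> is bounded and the difference
  quotients of U are dominated by the uniformly integrable kernel 1 / sqrt q.\<close>

lemma difference_lipschitz:
  obtains L where "L > 0" "\<And>x y. x \<notin> \<Lambda> \<Longrightarrow> y \<notin> \<Lambda> \<Longrightarrow> \<bar>(v x - U x) - (v y - U y)\<bar> \<le> L * cmod (x - y)"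
proof -
  obtain C where C: "C > 0" "\<And>z. z \<notin> \<Lambda> \<Longrightarrow> exp (v z) \<le> C * q z" by (rule exp_v_le_q) blast
  obtain B where B: "B > 0" "\<And>z. q z \<le> B" by (rule q_bounded) blast
  obtain K where K: "K > 0" "\<And>x y. \<bar>sqrt (q x) - sqrt (q y)\<bar> \<le> K * cmod (x - y)" by (rule sqrt_q_lipschitz) blast
  obtain K' where K': "K' > 0" "\<And>x y. x \<notin> \<Lambda> \<Longrightarrow> y \<notin> \<Lambda> \<Longrightarrow> \<bar>U x - U y\<bar> \<le> K' * cmod (x - y) * (1 / sqrt (q x) + 1 / sqrt (q y))"
    by (rule U_difference) blast
  obtain D where D: "D > 0" "\<And>z. integrable TM (\<lambda>y. 1 / sqrt (q (y - z)))" "\<And>z. (LINT y|TM. 1 / sqrt (q (y - z))) \<le> D"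
    by (rule kernel_integrable) blast
  have qlip: "\<bar>q x - q y\<bar> \<le> 2 * sqrt B * K * cmod (x - y)" for x y
  proof -
    have "q x - q y = (sqrt (q x) - sqrt (q y)) * (sqrt (q x) + sqrt (q y))"
      using q_nonneg by (simp add: algebra_simps)
    then have "\<bar>q x - q y\<bar> = \<bar>sqrt (q x) - sqrt (q y)\<bar> * (sqrt (q x) + sqrt (q y))"
      using q_nonneg by (simp add: abs_mult)
    also have "\<dots> \<le> (K * cmod (x - y)) * (sqrt B + sqrt B)"
      using K B q_nonneg by (intro mult_mono add_mono) auto
    finally show ?thesis by (simp add: algebra_simps)
  qed
  define V where "V = (LINT y|TM. \<bar>v y\<bar>)"
  have V0: "V \<ge> 0" by (simp add: V_def)
  define L where "L = 2 * sqrt B * K * V + C * B * K' * (2 * D) + 1"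
  have "L > 0" unfolding L_def using B K V0 C K' D by (intro add_nonneg_pos add_nonneg_nonneg mult_nonneg_nonneg) auto
  moreover have "\<bar>(v a - U a) - (v b - U b)\<bar> \<le> L * cmod (a - b)" if ab: "a \<notin> \<Lambda>" "b \<notin> \<Lambda>" for a b
  proof -
    define s where "s = cmod (a - b)"
    have iq: "integrable TM (\<lambda>y. v y * q (y - z))" for z
      by (intro integrable_mult_periodic v_integrable q_continuous q_periodic)
    have "(v a - U a) - (v b - U b) = (LINT y|TM. v y * q (y - a) - v y * q (y - b)) - (LINT y|TM. exp (v y) * U (y - a) - exp (v y) * U (y - b))"
      using representation[OF ab(1)] representation[OF ab(2)] iq by (simp add: Bochner_Integration.integral_diff)
    moreover have "\<bar>LINT y|TM. v y * q (y - a) - v y * q (y - b)\<bar> \<le> 2 * sqrt B * K * s * V"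
    proof -
      have "\<bar>LINT y|TM. v y * q (y - a) - v y * q (y - b)\<bar> \<le> (LINT y|TM. \<bar>v y * q (y - a) - v y * q (y - b)\<bar>)" by (rule integral_abs_bound)
      also have "\<dots> \<le> (LINT y|TM. 2 * sqrt B * K * s * \<bar>v y\<bar>)"
      proof (rule integral_mono)
        show "integrable TM (\<lambda>y. \<bar>v y * q (y - a) - v y * q (y - b)\<bar>)" using iq by auto
        show "integrable TM (\<lambda>y. 2 * sqrt B * K * s * \<bar>v y\<bar>)" using v_integrable by simp
        fix y
        have "\<bar>v y * q (y - a) - v y * q (y - b)\<bar> = \<bar>v y\<bar> * \<bar>q (y - a) - q (y - b)\<bar>"
          by (simp add: right_diff_distrib[symmetric] abs_mult)
        also have "\<dots> \<le> \<bar>v y\<bar> * (2 * sqrt B * K * s)"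
          using qlip[of "y - a" "y - b"] by (intro mult_left_mono) (auto simp: s_def norm_minus_commute)
        finally show "\<bar>v y * q (y - a) - v y * q (y - b)\<bar> \<le> 2 * sqrt B * K * s * \<bar>v y\<bar>" by (simp add: mult.commute)
      qed
      finally show ?thesis by (simp add: V_def)
    qed
    moreover have "\<bar>LINT y|TM. exp (v y) * U (y - a) - exp (v y) * U (y - b)\<bar> \<le> C * B * K' * s * (2 * D)"
    proof -
      have iE: "integrable TM (\<lambda>y. exp (v y) * U (y - a) - exp (v y) * U (y - b))"
        using representation(1)[OF ab(1)] representation(1)[OF ab(2)] by auto
      have iD: "integrable TM (\<lambda>y. 1 / sqrt (q (y - a)) + 1 / sqrt (q (y - b)))"
        by (intro Bochner_Integration.integrable_add D)
      have "\<bar>LINT y|TM. exp (v y) * U (y - a) - exp (v y) * U (y - b)\<bar> \<le> (LINT y|TM. \<bar>exp (v y) * U (y - a) - exp (v y) * U (y - b)\<bar>)"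
        by (rule integral_abs_bound)
      also have "\<dots> \<le> (LINT y|TM. C * B * K' * s * (1 / sqrt (q (y - a)) + 1 / sqrt (q (y - b))))"
      proof (rule integral_mono_AE[OF integrable_abs[OF iE] integrable_mult_right[OF iD]])
        show "AE y in TM. \<bar>exp (v y) * U (y - a) - exp (v y) * U (y - b)\<bar> \<le> C * B * K' * s * (1 / sqrt (q (y - a)) + 1 / sqrt (q (y - b)))"
          using AE_TM_off_lattice[of 0] AE_TM_off_lattice[of a] AE_TM_off_lattice[of b]
        proof eventually_elim
          case (elim y)
          have "\<bar>exp (v y) * U (y - a) - exp (v y) * U (y - b)\<bar> = exp (v y) * \<bar>U (y - a) - U (y - b)\<bar>"
            by (simp add: right_diff_distrib[symmetric] abs_mult)
          also have "\<dots> \<le> (C * B) * (K' * s * (1 / sqrt (q (y - a)) + 1 / sqrt (q (y - b))))"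
          proof (intro mult_mono)
            have "exp (v y) \<le> C * q y" using C(2)[of y] elim by simp
            also have "\<dots> \<le> C * B" using B C by simp
            finally show "exp (v y) \<le> C * B" .
            show "\<bar>U (y - a) - U (y - b)\<bar> \<le> K' * s * (1 / sqrt (q (y - a)) + 1 / sqrt (q (y - b)))"
              using K'(2)[of "y - a" "y - b"] elim by (simp add: s_def norm_minus_commute)
          qed (use B C in auto)
          finally show ?case by (simp add: mult.assoc)
        qed
      qed
      also have "\<dots> = C * B * K' * s * ((LINT y|TM. 1 / sqrt (q (y - a))) + (LINT y|TM. 1 / sqrt (q (y - b))))"
        unfolding integral_mult_right_zero Bochner_Integration.integral_add[OF D(2) D(2)] ..
      also have "\<dots> \<le> C * B * K' * s * (D + D)"
        using D(3)[of a] D(3)[of b] C B K' by (intro mult_left_mono add_mono mult_nonneg_nonneg) (auto simp: s_def)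
      finally show ?thesis by simp
    qed
    ultimately have "\<bar>(v a - U a) - (v b - U b)\<bar> \<le> 2 * sqrt B * K * s * V + C * B * K' * s * (2 * D)" by linarith
    also have "\<dots> \<le> L * s" unfolding L_def by (simp add: algebra_simps s_def)
    finally show ?thesis by (simp add: s_def)
  qed
  ultimately show ?thesis using that by blast
qed

lemma kern_smooth: "\<epsilon> > 0 \<Longrightarrow> Ck_on k (kern \<epsilon>) UNIV"
  unfolding kern_def[abs_def] using q_nonneg
  by (intro Ck_on_add Ck_on_cmult Ck_on_laplacian Ureg_smooth Ck_on_divide Ck_on_const q_smooth)
     (auto intro!: add_nonneg_pos Ck_on_mult q_smooth simp: power2_eq_square)

text \<open>The approximate identity multiplied by a cutoff is a smooth test function vanishing near
  the lattice. Green's identity moves the Laplacian to \<open>v\<close>, and the limit evaluates the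
  equation times the cutoff at \<open>z\<close>, where the cutoff is positive.\<close>

theorem pointwise_equation:
  assumes z: "z \<notin> \<Lambda>"
  shows "laplacian v z = - 4 * pi * exp (v z)"
proof -
  \<comment> \<open>Half of \<open>q z\<close> separates the two requirements on the cutoff: at
    \<open>z\<close> the argument of \<open>q\<close> is 0, so \<delta> exceeds
    \<open>q 0 = 0\<close>, while at lattice points \<open>q (y - z)\<close> equals
    \<open>q z\<close>, which exceeds \<delta>.\<close>
  define \<delta> where "\<delta> = q z / 2"
  have \<delta>: "\<delta> > 0" "\<delta> < q z" using q_pos[OF z] by (simp_all add: \<delta>_def)
  define \<phi> where "\<phi> y = bump 0 (\<delta> - q (y - z))" for y
  define N where "N = {y. q (y - z) > \<delta>}"
  have e: "eps n > 0" for n by simp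
  have opN: "open N" unfolding N_def by (intro open_Collect_less continuous_intros continuous_shift[OF q_continuous])
  have N: "- \<Lambda> \<union> N = UNIV"
  proof -
    have "y \<in> N" if "y \<in> \<Lambda>" for y
      using periodicD[OF q_periodic that, of "- z"] q_even[of z] \<delta> by (simp add: N_def)
    then show ?thesis by blast
  qed
  have \<phi>N: "\<phi> y = 0" if "y \<in> N" for y using that by (simp add: \<phi>_def N_def bump_def)
  have \<phi>C: "Ck_on k \<phi> UNIV" for k
    unfolding \<phi>_def by (intro Ck_on_bump Ck_on_diff Ck_on_const Ck_shift[OF q_smooth]) auto
  have \<phi>P: "periodic \<phi>" using periodic_shift[OF q_periodic, of z] by (simp add: periodic_def \<phi>_def)
  define F where "F n y = \<phi> y * kern (eps n) (y - z)" for n y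
  have FC: "Ck_on k (F n) UNIV" for k n
    unfolding F_def by (intro Ck_on_mult \<phi>C Ck_shift[OF kern_smooth[OF e]]) auto
  have FP: "periodic (F n)" for n
    using \<phi>P periodic_shift[OF kern_periodic[OF e], of n z] by (simp add: periodic_def F_def)
  define H where "H y = (laplacian v y + 4 * pi * exp (v y)) * \<phi> y" for y
  have c0: "continuous_on UNIV (\<lambda>y. laplacian v y * \<phi> y)"
    by (rule green_periodic_supported(2)[OF v_smooth v_periodic open_off_lattice \<phi>C \<phi>P opN \<phi>N N])
  have c1: "continuous_on UNIV (\<lambda>y. exp (v y) * \<phi> y)"
  proof -
    have "continuous_on (- \<Lambda>) (\<lambda>y. exp (v y) * \<phi> y)"
      using Ck_on_imp_continuous[OF v_smooth] continuous_on_subset[OF Ck_on_imp_continuous[OF \<phi>C[of 0]], of "- \<Lambda>"]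
      by (intro continuous_intros) auto
    moreover have "continuous_on N (\<lambda>y. exp (v y) * \<phi> y)" using \<phi>N by (simp cong: continuous_on_cong)
    ultimately show ?thesis using continuous_on_open_Un[OF open_off_lattice opN] N by metis
  qed
  have Hc: "continuous_on UNIV H"
    using continuous_on_add[OF c0 continuous_on_mult_left[OF c1, of "4 * pi"]] by (simp add: H_def[abs_def] algebra_simps)
  have Hp: "periodic H"
    using periodic_laplacian[OF v_periodic] v_periodic \<phi>P by (simp add: periodic_def H_def)
  have "(LINT y|TM. H y * kern (eps n) (y - z)) = 0" for n
  proof -
    have "0 \<in> N" using N lattice_zero by blast
    then have zero: "F n 0 = 0" using \<phi>N[of 0] by (simp add: F_def)
    have FN: "F n y = 0" if "y \<in> N" for y using \<phi>N[OF that] by (simp add: F_def)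
    note G = green_periodic_supported[OF v_smooth v_periodic open_off_lattice FC[of 2 n] FP[of n] opN FN N]
    have "(LINT y|TM. laplacian v y * F n y) + 4 * pi * (LINT y|TM. exp (v y) * F n y) = 0"
      using weak_equation[OF FC FP, of n] G(1) zero by simp
    moreover have "integrable TM (\<lambda>y. laplacian v y * F n y)" by (rule continuous_integrable_TM[OF G(2)])
    moreover have "integrable TM (\<lambda>y. exp (v y) * F n y)"
    proof -
      have "continuous_on UNIV (\<lambda>y. exp (v y) * \<phi> y * kern (eps n) (y - z))"
        by (intro continuous_on_mult c1 Ck_on_imp_continuous[OF Ck_shift[OF kern_smooth[OF e, of 0]]])
      then show ?thesis by (intro continuous_integrable_TM) (simp add: F_def mult.assoc)
    qed
    moreover have "H y * kern (eps n) (y - z) = laplacian v y * F n y + 4 * pi * (exp (v y) * F n y)" for y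
      by (simp add: H_def F_def algebra_simps)
    ultimately show ?thesis by (simp add: Bochner_Integration.integral_add)
  qed
  then have "(\<lambda>n. LINT y|TM. H y * kern (eps n) (y - z)) \<longlonglongrightarrow> 0" by simp
  moreover have "(\<lambda>n. LINT y|TM. H y * kern (eps n) (y - z)) \<longlonglongrightarrow> 4 * pi * H z"
    using Hc by (intro kern_approximates Hp continuous_integrable_TM) (auto simp: continuous_on_eq_continuous_at)
  ultimately have "H z = 0" using LIMSEQ_unique by force
  moreover have "\<phi> z > 0" using \<delta> q_eq_0_iff[of 0] by (simp add: \<phi>_def bump_def)
  ultimately show ?thesis by (simp add: H_def)
qed

end

section \<open>Wirtinger derivatives\<close>

text \<open>The numbers \<open>a\<close> and \<open>b\<close> are the derivatives of
  \<open>p\<close> with respect to z and its conjugate; differentiability is understood in the real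
  sense.\<close>

abbreviation has_wirtinger :: "(complex \<Rightarrow> complex) \<Rightarrow> complex \<Rightarrow> complex \<Rightarrow> complex \<Rightarrow> bool" where
  "has_wirtinger p a b z \<equiv> (p has_derivative (\<lambda>h. a * h + b * cnj h)) (at z)"

definition wirt :: "(complex \<Rightarrow> real) \<Rightarrow> complex \<Rightarrow> complex" where
  "wirt f z = (of_real (dird 1 f z) - \<i> * of_real (dird \<i> f z)) / 2"

text \<open>This is f_zz, with the mixed derivative taken in one fixed order. For a twice
  continuously differentiable f the derivative of f_z with respect to the conjugate variable is
  \<Delta>f/4.\<close>

definition wirt2 :: "(complex \<Rightarrow> real) \<Rightarrow> complex \<Rightarrow> complex" where
  "wirt2 f z = (of_real (dird 1 (dird 1 f) z - dird \<i> (dird \<i> f) z) - 2 * \<i> * of_real (dird \<i> (dird 1 f) z)) / 4"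

lemma dird_wirt: "f differentiable (at z) \<Longrightarrow> dird h f z = 2 * Re (wirt f z * h)"
  by (subst dird_Re_Im) (simp_all add: wirt_def algebra_simps)

lemma wirt_has_wirtinger:
  assumes "Ck_on 2 f S" "open S" "z \<in> S"
  shows "has_wirtinger (wirt f) (wirt2 f z) (of_real (laplacian f z / 4)) z"
proof -
  have D: "dird w f differentiable (at z)" for w
    using assms by (auto simp: numeral_2_eq_2)
  have com: "dird 1 (dird \<i> f) z = dird \<i> (dird 1 f) z" by (rule dird_commute[OF assms(2,1,3)])
  have "((\<lambda>z. (of_real (dird 1 f z) - \<i> * of_real (dird \<i> f z)) / 2) has_derivative
      (\<lambda>h. (of_real (dird h (dird 1 f) z) - \<i> * of_real (dird h (dird \<i> f) z)) / 2)) (at z)"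
    by (auto intro!: derivative_eq_intros has_derivative_dird D has_derivative_of_real)
  moreover have "(of_real (dird h (dird 1 f) z) - \<i> * of_real (dird h (dird \<i> f) z)) / 2
      = wirt2 f z * h + of_real (laplacian f z / 4) * cnj h" for h
  proof -
    have e: "dird h (dird 1 f) z = Re h * dird 1 (dird 1 f) z + Im h * dird \<i> (dird 1 f) z"
      "dird h (dird \<i> f) z = Re h * dird \<i> (dird 1 f) z + Im h * dird \<i> (dird \<i> f) z"
      using dird_Re_Im[OF D[of 1], of h] dird_Re_Im[OF D[of \<i>], of h] by (simp_all add: com)
    show ?thesis unfolding e wirt2_def laplacian_eq by (simp add: complex_eq_iff field_simps)
  qed
  ultimately show ?thesis by (simp add: wirt_def[abs_def])
qed

lemma has_wirtinger_mult:
  assumes "has_wirtinger p a b z" "has_wirtinger p' a' b' z"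
  shows "has_wirtinger (\<lambda>z. p z * p' z) (a * p' z + p z * a') (b * p' z + p z * b') z"
  by (rule has_derivative_eq_rhs[OF has_derivative_mult[OF assms]]) (simp add: fun_eq_iff algebra_simps)

lemma has_wirtinger_add:
  assumes "has_wirtinger p a b z" "has_wirtinger p' a' b' z"
  shows "has_wirtinger (\<lambda>z. p z + p' z) (a + a') (b + b') z"
  by (rule has_derivative_eq_rhs[OF has_derivative_add[OF assms]]) (simp add: fun_eq_iff algebra_simps)

lemma has_wirtinger_diff:
  assumes "has_wirtinger p a b z" "has_wirtinger p' a' b' z"
  shows "has_wirtinger (\<lambda>z. p z - p' z) (a - a') (b - b') z"
  by (rule has_derivative_eq_rhs[OF has_derivative_diff[OF assms]]) (simp add: fun_eq_iff algebra_simps)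

lemma has_wirtinger_cmult:
  assumes "has_wirtinger p a b z" shows "has_wirtinger (\<lambda>z. c * p z) (c * a) (c * b) z"
  by (rule has_derivative_eq_rhs[OF has_derivative_mult_right[OF assms]]) (simp add: fun_eq_iff algebra_simps)

lemma has_wirtinger_exp:
  assumes "f differentiable (at z)"
  shows "has_wirtinger (\<lambda>z. of_real (exp (f z))) (of_real (exp (f z)) * wirt f z) (of_real (exp (f z)) * cnj (wirt f z)) z"
proof -
  have "((\<lambda>z. exp (f z)) has_derivative (\<lambda>h. exp (f z) * dird h f z)) (at z)"
    by (rule dird_compose(1)[OF assms DERIV_exp])
  from has_derivative_of_real[OF this]
  have "((\<lambda>z. complex_of_real (exp (f z))) has_derivative (\<lambda>h. of_real (exp (f z) * dird h f z))) (at z)" .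
  moreover have "complex_of_real (exp (f z) * dird h f z)
      = of_real (exp (f z)) * wirt f z * h + of_real (exp (f z)) * cnj (wirt f z) * cnj h" for h
    unfolding dird_wirt[OF assms] by (simp add: complex_eq_iff algebra_simps)
  ultimately show ?thesis by simp
qed

lemma has_wirtinger_lines:
  assumes "has_wirtinger p a b (Complex x y)"
  shows "((\<lambda>s. p (Complex s y)) has_vector_derivative a + b) (at x)"
    and "((\<lambda>t. p (Complex x t)) has_vector_derivative \<i> * (a - b)) (at y)"
proof -
  have "((\<lambda>s. Complex s y) has_derivative (\<lambda>h. of_real h)) (at x)"
    unfolding Complex_eq by (auto intro!: derivative_eq_intros)
  from diff_chain_at[OF this assms] show "((\<lambda>s. p (Complex s y)) has_vector_derivative a + b) (at x)"
    unfolding has_vector_derivative_def by (simp add: o_def scaleR_conv_of_real algebra_simps)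
  have "((\<lambda>t. Complex x t) has_derivative (\<lambda>h. \<i> * of_real h)) (at y)"
    unfolding Complex_eq by (auto intro!: derivative_eq_intros)
  from diff_chain_at[OF this assms] show "((\<lambda>t. p (Complex x t)) has_vector_derivative \<i> * (a - b)) (at y)"
    unfolding has_vector_derivative_def by (simp add: o_def scaleR_conv_of_real algebra_simps)
qed

text \<open>The Poincare lemma on a square for the form a dx + b dy. The primitive integrates
  \<open>a\<close> along the lower edge and then \<open>b\<close> upwards; its x-derivative comes
  from Leibniz's rule and the equality of a_y and b_x. Only these two partial derivatives are
  required, not differentiability of the coefficients.\<close>

lemma closed_form_primitive:
  fixes a b c :: "complex \<Rightarrow> complex"
  assumes S: "open S" "z0 \<in> S"
    and ay: "\<And>x y. Complex x y \<in> S \<Longrightarrow> ((\<lambda>t. a (Complex x t)) has_vector_derivative c (Complex x y)) (at y)"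
    and bx: "\<And>x y. Complex x y \<in> S \<Longrightarrow> ((\<lambda>s. b (Complex s y)) has_vector_derivative c (Complex x y)) (at x)"
    and cont: "continuous_on S a" "continuous_on S b" "continuous_on S c"
  obtains N \<Phi> where "open N" "z0 \<in> N" "N \<subseteq> S"
    "\<And>z. z \<in> N \<Longrightarrow> (\<Phi> has_derivative (\<lambda>h. Re h *\<^sub>R a z + Im h *\<^sub>R b z)) (at z)"
proof -
  obtain d where d: "d > 0" "ball z0 d \<subseteq> S" using S by (rule openE)
  define r where "r = d / 3"
  have r: "r > 0" using d by (simp add: r_def)
  define x0 x1 y0 y1 where xy: "x0 = Re z0 - r" "x1 = Re z0 + r" "y0 = Im z0 - r" "y1 = Im z0 + r"
  have inS: "Complex x y \<in> S" if "x \<in> {x0..x1}" "y \<in> {y0..y1}" for x y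
  proof -
    have "cmod (z0 - Complex x y) \<le> \<bar>Re z0 - x\<bar> + \<bar>Im z0 - y\<bar>"
      using cmod_le[of "z0 - Complex x y"] by simp
    also have "\<dots> \<le> r + r" using that by (intro add_mono) (auto simp: xy abs_le_iff)
    also have "\<dots> < d" using d by (simp add: r_def)
    finally show ?thesis using d(2) by (auto simp: dist_norm)
  qed
  have cont2: "continuous_on ({x0..x1} \<times> {y0..y1}) (\<lambda>p. f (Complex (fst p) (snd p)))" if "continuous_on S f" for f :: "complex \<Rightarrow> complex"
    by (rule continuous_on_compose2[OF that]) (auto simp: Complex_eq intro!: continuous_intros inS[unfolded Complex_eq])
  have contx: "continuous_on {x0..x1} (\<lambda>x. f (Complex x y))" if "continuous_on S f" "y \<in> {y0..y1}" for f :: "complex \<Rightarrow> complex" and y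
    by (rule continuous_on_compose2[OF that(1)]) (use that(2) in \<open>auto simp: Complex_eq intro!: continuous_intros inS[unfolded Complex_eq]\<close>)
  have conty: "continuous_on {y0..y1} (\<lambda>y. f (Complex x y))" if "continuous_on S f" "x \<in> {x0..x1}" for f :: "complex \<Rightarrow> complex" and x
    by (rule continuous_on_compose2[OF that(1)]) (use that(2) in \<open>auto simp: Complex_eq intro!: continuous_intros inS[unfolded Complex_eq]\<close>)
  define \<phi> where "\<phi> x y = integral {x0..x} (\<lambda>s. a (Complex s y0)) + integral {y0..y} (\<lambda>t. b (Complex x t))" for x y
  have y0: "y0 \<in> {y0..y1}" using r by (simp add: xy)
  have fy: "((\<lambda>y. \<phi> x y) has_vector_derivative b (Complex x y)) (at y within {y0..y1})"
    if "x \<in> {x0..x1}" "y \<in> {y0..y1}" for x y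
    unfolding \<phi>_def using has_vector_derivative_add[OF has_vector_derivative_const integral_has_vector_derivative[OF conty[OF cont(2) that(1)] that(2)]]
    by simp
  have fx: "((\<lambda>x. \<phi> x y) has_vector_derivative a (Complex x y)) (at x within {x0..x1})"
    if x: "x \<in> {x0..x1}" and y: "y \<in> {y0..y1}" for x y
  proof -
    have "((\<lambda>x. integral (cbox y0 y) (\<lambda>t. b (Complex x t))) has_vector_derivative integral (cbox y0 y) (\<lambda>t. c (Complex x t))) (at x within {x0..x1})"
    proof (rule leibniz_rule_vector_derivative)
      fix x t assume "x \<in> {x0..x1}" "t \<in> cbox y0 y"
      then show "((\<lambda>x. b (Complex x t)) has_vector_derivative c (Complex x t)) (at x within {x0..x1})"
        using y by (intro has_vector_derivative_at_within[OF bx] inS) auto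
    next
      fix x assume "x \<in> {x0..x1}"
      then show "(\<lambda>t. b (Complex x t)) integrable_on cbox y0 y"
        using y by (intro integrable_continuous continuous_on_subset[OF conty[OF cont(2)]]) auto
    next
      show "continuous_on ({x0..x1} \<times> cbox y0 y) (\<lambda>(x, t). c (Complex x t))"
      proof -
        have "{x0..x1} \<times> cbox y0 y \<subseteq> {x0..x1} \<times> {y0..y1}" using y by auto
        then show ?thesis using continuous_on_subset[OF cont2[OF cont(3)]] by (simp add: split_beta')
      qed
    qed (use x in auto)
    moreover have "integral (cbox y0 y) (\<lambda>t. c (Complex x t)) = a (Complex x y) - a (Complex x y0)"
    proof -
      have "((\<lambda>t. c (Complex x t)) has_integral (a (Complex x y) - a (Complex x y0))) {y0..y}"
        using x y by (intro fundamental_theorem_of_calculus has_vector_derivative_at_within[OF ay] inS) auto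
      then show ?thesis by (simp add: integral_unique)
    qed
    ultimately have "((\<lambda>x. integral {y0..y} (\<lambda>t. b (Complex x t))) has_vector_derivative a (Complex x y) - a (Complex x y0)) (at x within {x0..x1})"
      by simp
    from has_vector_derivative_add[OF integral_has_vector_derivative[OF contx[OF cont(1) y0] x] this]
    show ?thesis by (simp add: \<phi>_def)
  qed
  define N where "N = {z. Re z \<in> {x0<..<x1} \<and> Im z \<in> {y0<..<y1}}"
  have N: "N = Re -` {x0<..<x1} \<inter> Im -` {y0<..<y1}" by (auto simp: N_def)
  have "open N" unfolding N by (intro open_Int open_vimage continuous_intros)
  moreover have "z0 \<in> N" using r by (simp add: N_def xy)
  moreover have "N \<subseteq> S"
  proof
    fix z assume "z \<in> N"
    then show "z \<in> S" using inS[of "Re z" "Im z"] by (simp add: N_def complex_surj)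
  qed
  moreover have "((\<lambda>z. \<phi> (Re z) (Im z)) has_derivative (\<lambda>h. Re h *\<^sub>R a z + Im h *\<^sub>R b z)) (at z)" if "z \<in> N" for z
  proof -
    define x y where "x = Re z" and "y = Im z"
    have xy': "x \<in> {x0<..<x1}" "y \<in> {y0<..<y1}" using that by (auto simp: N_def x_def y_def)
    have z: "Complex x y = z" by (simp add: x_def y_def complex_surj)
    have "((\<lambda>(x, y). \<phi> x y) has_derivative (\<lambda>(tx, ty). tx *\<^sub>R a (Complex x y) + blinfun_apply (blinfun_scaleR_left (b (Complex x y))) ty))
        (at (x, y) within {x0..x1} \<times> {y0..y1})"
    proof (rule has_derivative_partialsI)
      show "((\<lambda>x. \<phi> x y) has_derivative (\<lambda>tx. tx *\<^sub>R a (Complex x y))) (at x within {x0..x1})"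
        using fx[of x y] xy' by (simp add: has_vector_derivative_def)
      show "((\<lambda>y. \<phi> x y) has_derivative blinfun_apply (blinfun_scaleR_left (b (Complex x y)))) (at y within {y0..y1})"
        if "x \<in> {x0..x1}" "y \<in> {y0..y1}" for x y
        using fy[OF that] by (simp add: has_vector_derivative_def)
      have "continuous_on ({x0..x1} \<times> {y0..y1}) (\<lambda>p. blinfun_scaleR_left (b (Complex (fst p) (snd p))))"
        by (intro bounded_linear.continuous_on[OF bounded_linear_blinfun_scaleR_left] cont2 cont)
      then show "continuous (at (x, y) within {x0..x1} \<times> {y0..y1}) (\<lambda>(x, y). blinfun_scaleR_left (b (Complex x y)))"
        using xy' by (simp add: continuous_on_eq_continuous_within split_beta')
    qed (use xy' in auto)
    then have "((\<lambda>(x, y). \<phi> x y) has_derivative (\<lambda>(tx, ty). tx *\<^sub>R a z + ty *\<^sub>R b z)) (at (x, y) within {x0<..<x1} \<times> {y0<..<y1})" (is ?D)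
      unfolding z by (rule has_derivative_subset[THEN has_derivative_eq_rhs]) auto
    have *: "((\<lambda>p. \<phi> (fst p) (snd p)) has_derivative (\<lambda>p. fst p *\<^sub>R a z + snd p *\<^sub>R b z)) (at (Re z, Im z))"
    proof -
      have "at (x, y) within {x0<..<x1} \<times> {y0<..<y1} = at (x, y)"
        by (rule at_within_open) (use xy' in \<open>auto intro!: open_Times\<close>)
      with \<open>?D\<close> show ?thesis by (simp add: split_beta' x_def y_def)
    qed
    have "((\<lambda>z. (Re z, Im z)) has_derivative (\<lambda>h. (Re h, Im h))) (at z)"
      by (auto intro!: derivative_eq_intros)
    from diff_chain_at[OF this *] show ?thesis by (simp add: o_def)
  qed
  ultimately show ?thesis by (rule that)
qed

text \<open>
  With \<open>F = - \<pi> e\<^sup>f\<close> and \<open>s = \<partial>f\<close> the Liouville equation says \<open>s\<^bsub>zbar\<^esub> = F\<close>, and the form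
  \<open>F dzbar + (s\<^sup>2/2) dz\<close> is closed. If \<open>\<Phi>\<close> is a local primitive, then \<open>s - \<Phi>\<close> is holomorphic and its
  derivative is \<open>s\<^bsub>z\<^esub> - s\<^sup>2/2\<close>. This avoids third derivatives of \<open>f\<close>.
\<close>

lemma schwarzian_holomorphic:
  assumes S: "open S" and f: "Ck_on 2 f S" and eq: "\<And>z. z \<in> S \<Longrightarrow> laplacian f z = - 4 * pi * exp (f z)"
  shows "(\<lambda>z. wirt2 f z - (wirt f z)\<^sup>2 / 2) holomorphic_on S"
proof -
  define s where "s = wirt f"
  define A where "A = wirt2 f"
  define F where "F z = - of_real pi * complex_of_real (exp (f z))" for z
  have D: "f differentiable (at z)" if "z \<in> S" for z using f that by (auto simp: numeral_2_eq_2)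
  have ws: "has_wirtinger s (A z) (F z) z" if "z \<in> S" for z
    using wirt_has_wirtinger[OF f S that] eq[OF that] by (simp add: s_def A_def F_def)
  have wF: "has_wirtinger F (F z * s z) (F z * cnj (s z)) z" if "z \<in> S" for z
    using has_wirtinger_cmult[OF has_wirtinger_exp[OF D[OF that]], of "- of_real pi"]
    unfolding F_def[abs_def] by (simp add: s_def mult.assoc)
  have cs: "continuous_on S s" "continuous_on S F"
    by (auto intro!: continuous_at_imp_continuous_on has_derivative_continuous[OF ws] has_derivative_continuous[OF wF])
  have cA: "continuous_on S A"
    unfolding A_def wirt2_def using f by (intro continuous_intros) (auto simp: numeral_2_eq_2)
  \<comment> \<open>The coefficients of dx and dy in the closed form, from dz = dx + i dy;
    \<open>c\<close> is the common value of a_y and b_x.\<close>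
  define a where "a z = (s z)\<^sup>2 / 2 + F z" for z
  define b where "b z = \<i> * ((s z)\<^sup>2 / 2 - F z)" for z
  define c where "c z = \<i> * (s z * A z - F z * cnj (s z))" for z
  have wss: "has_wirtinger (\<lambda>z. (s z)\<^sup>2 / 2) (s z * A z) (s z * F z) z" if "z \<in> S" for z
    using has_wirtinger_cmult[OF has_wirtinger_mult[OF ws[OF that] ws[OF that]], of "1/2"]
    by (simp add: power2_eq_square field_simps)
  have wa: "has_wirtinger a (s z * A z + F z * s z) (s z * F z + F z * cnj (s z)) z" if "z \<in> S" for z
    unfolding a_def[abs_def] by (rule has_wirtinger_add[OF wss[OF that] wF[OF that]])
  have wb: "has_wirtinger b (\<i> * (s z * A z - F z * s z)) (\<i> * (s z * F z - F z * cnj (s z))) z" if "z \<in> S" for z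
    unfolding b_def[abs_def] by (rule has_wirtinger_cmult[OF has_wirtinger_diff[OF wss[OF that] wF[OF that]]])
  have ay: "((\<lambda>t. a (Complex x t)) has_vector_derivative c (Complex x y)) (at y)" if "Complex x y \<in> S" for x y
    using has_wirtinger_lines(2)[OF wa[OF that]] by (simp add: c_def algebra_simps)
  have bx: "((\<lambda>t. b (Complex t y)) has_vector_derivative c (Complex x y)) (at x)" if "Complex x y \<in> S" for x y
    using has_wirtinger_lines(1)[OF wb[OF that]] by (simp add: c_def algebra_simps)
  have cont: "continuous_on S a" "continuous_on S b" "continuous_on S c"
    unfolding a_def b_def c_def by (intro continuous_intros cs cA; simp)+
  have "(\<lambda>z. A z - (s z)\<^sup>2 / 2) field_differentiable (at z0)" if z0: "z0 \<in> S" for z0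
  proof -
    obtain N \<Phi> where N: "open N" "z0 \<in> N" "N \<subseteq> S"
      and \<Phi>: "\<And>z. z \<in> N \<Longrightarrow> (\<Phi> has_derivative (\<lambda>h. Re h *\<^sub>R a z + Im h *\<^sub>R b z)) (at z)"
      by (rule closed_form_primitive[OF S z0 ay bx cont]) blast+
    define K where "K z = s z - \<Phi> z" for z
    have K: "(K has_field_derivative (A z - (s z)\<^sup>2 / 2)) (at z)" if "z \<in> N" for z
    proof -
      have "z \<in> S" using that N by blast
      have "(K has_derivative (\<lambda>h. (A z * h + F z * cnj h) - (Re h *\<^sub>R a z + Im h *\<^sub>R b z))) (at z)"
        unfolding K_def[abs_def] by (rule has_derivative_diff[OF ws[OF \<open>z \<in> S\<close>] \<Phi>[OF that]])
      moreover have "Re h *\<^sub>R a z + Im h *\<^sub>R b z = (s z)\<^sup>2 / 2 * h + F z * cnj h" for h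
      proof -
        have "h = of_real (Re h) + \<i> * of_real (Im h)" "cnj h = of_real (Re h) - \<i> * of_real (Im h)"
          by (simp_all add: complex_eq_iff)
        then have "(s z)\<^sup>2 / 2 * h + F z * cnj h
            = (s z)\<^sup>2 / 2 * (of_real (Re h) + \<i> * of_real (Im h)) + F z * (of_real (Re h) - \<i> * of_real (Im h))" by metis
        then show ?thesis by (simp add: a_def b_def scaleR_conv_of_real algebra_simps)
      qed
      ultimately have "(K has_derivative (\<lambda>h. (A z - (s z)\<^sup>2 / 2) * h)) (at z)"
        by (simp add: algebra_simps)
      then show ?thesis by (simp add: has_field_derivative_def)
    qed
    then have "K holomorphic_on N" using N(1) by (auto simp: holomorphic_on_open)
    then have "deriv K holomorphic_on N" using N(1) by (rule holomorphic_deriv)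
    then have "(\<lambda>z. A z - (s z)\<^sup>2 / 2) holomorphic_on N"
      by (rule holomorphic_transform) (use K DERIV_imp_deriv in blast)
    then show ?thesis using N holomorphic_on_imp_differentiable_at by blast
  qed
  then show ?thesis using field_differentiable_at_within unfolding holomorphic_on_def A_def s_def by blast
qed

text \<open>On the circle, p / (x - z0) returns to its initial value, so its derivative in the angle
  integrates to 0. Averages of p_z over circles can thus be traded for \<open>p\<close> and its
  conjugate derivative, which are the quantities under control.\<close>

lemma circle_identity:
  assumes s: "s > 0" and w: "\<And>x. cmod (x - z0) = s \<Longrightarrow> has_wirtinger p (a x) (b x) x"
  defines "\<gamma> \<equiv> circlepath z0 s"
  shows "((\<lambda>t. a (\<gamma> t) - p (\<gamma> t) / (\<gamma> t - z0) - cnj (\<gamma> t - z0) / (\<gamma> t - z0) * b (\<gamma> t)) has_integral 0) {0..1}"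
proof -
  define k where "k = 2 * of_real pi * \<i>"
  have k0: "k \<noteq> 0" "cnj k = - k" by (simp_all add: k_def)
  define E where "E t = exp (k * of_real t)" for t :: real
  have \<gamma>: "\<gamma> t = z0 + s * E t" for t by (simp add: \<gamma>_def circlepath E_def k_def)
  have E1: "cmod (E t) = 1" for t by (simp add: E_def k_def)
  have expline: "((\<lambda>t. exp (k' * of_real t)) has_vector_derivative k' * exp (k' * of_real t)) (at t)" for k' :: complex and t :: real
    by (rule has_vector_derivative_real_field) (auto intro!: derivative_eq_intros)
  have Enz: "E t \<noteq> 0" for t by (simp add: E_def)
  have dE: "(E has_vector_derivative k * E t) (at t)" for t
    unfolding E_def by (rule expline)
  have dI: "((\<lambda>t. inverse (E t)) has_vector_derivative - (k * inverse (E t))) (at t)" for t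
    using expline[of "- k" t] by (simp add: E_def exp_minus)
  have d\<gamma>: "(\<gamma> has_vector_derivative s * (k * E t)) (at t)" for t
  proof -
    have "\<gamma> = (\<lambda>t. z0 + s * E t)" using \<gamma> by auto
    then show ?thesis
      using has_vector_derivative_add[OF has_vector_derivative_const has_vector_derivative_mult_right[OF dE]] by simp
  qed
  have dp: "((\<lambda>t. p (\<gamma> t) * inverse (E t)) has_vector_derivative
      k * s * (a (\<gamma> t) - p (\<gamma> t) / (\<gamma> t - z0) - cnj (\<gamma> t - z0) / (\<gamma> t - z0) * b (\<gamma> t))) (at t)" for t
  proof -
    have "cmod (\<gamma> t - z0) = s" using s by (simp add: \<gamma> norm_mult E1)
    from diff_chain_at[OF d\<gamma>[unfolded has_vector_derivative_def] w[OF this]]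
    have "((\<lambda>t. p (\<gamma> t)) has_vector_derivative a (\<gamma> t) * (s * (k * E t)) + b (\<gamma> t) * cnj (s * (k * E t))) (at t)"
      unfolding has_vector_derivative_def by (simp add: o_def scaleR_conv_of_real algebra_simps)
    from has_vector_derivative_mult[OF this dI]
    have "((\<lambda>t. p (\<gamma> t) * inverse (E t)) has_vector_derivative
        p (\<gamma> t) * (- (k * inverse (E t)))
        + (a (\<gamma> t) * (s * (k * E t)) + b (\<gamma> t) * cnj (s * (k * E t))) * inverse (E t)) (at t)" .
    moreover have "p (\<gamma> t) * (- (k * inverse (E t)))
        + (a (\<gamma> t) * (s * (k * E t)) + b (\<gamma> t) * cnj (s * (k * E t))) * inverse (E t)
       = k * s * (a (\<gamma> t) - p (\<gamma> t) / (\<gamma> t - z0) - cnj (\<gamma> t - z0) / (\<gamma> t - z0) * b (\<gamma> t))"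
    proof -
      have alg: "P * - (k * inverse e) + (X * (S * (k * e)) + Y * (S * (- k * c))) * inverse e
          = k * S * (X - P / (S * e) - S * c / (S * e) * Y)" if "e \<noteq> 0" "S \<noteq> 0" for P X Y S e c :: complex
        using that by (simp add: field_simps)
      have c: "cnj (s * (k * E t)) = s * (- k * cnj (E t))" by (simp only: complex_cnj_mult k0 complex_cnj_complex_of_real)
      have g: "\<gamma> t - z0 = s * E t" "cnj (\<gamma> t - z0) = s * cnj (E t)" by (simp_all add: \<gamma>)
      show ?thesis unfolding c unfolding g(1) complex_cnj_mult complex_cnj_complex_of_real by (rule alg) (use Enz s in auto)
    qed
    ultimately show ?thesis by (simp only:)
  qed
  have FT: "((\<lambda>t. k * s * (a (\<gamma> t) - p (\<gamma> t) / (\<gamma> t - z0) - cnj (\<gamma> t - z0) / (\<gamma> t - z0) * b (\<gamma> t)))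
      has_integral p (\<gamma> 1) * inverse (E 1) - p (\<gamma> 0) * inverse (E 0)) {0..1}"
    by (intro fundamental_theorem_of_calculus has_vector_derivative_at_within[OF dp] zero_le_one)
  have "E 1 = 1" "E 0 = 1" by (simp_all add: E_def k_def)
  then have "p (\<gamma> 1) * inverse (E 1) - p (\<gamma> 0) * inverse (E 0) = 0" by (simp add: \<gamma>)
  with FT have "((\<lambda>t. k * s * (a (\<gamma> t) - p (\<gamma> t) / (\<gamma> t - z0) - cnj (\<gamma> t - z0) / (\<gamma> t - z0) * b (\<gamma> t)))
      has_integral 0) {0..1}" by (simp only:)
  from has_integral_mult_right[OF this, where c = "inverse (k * s)"]
  have "((\<lambda>t. inverse (k * s) * (k * s * (a (\<gamma> t) - p (\<gamma> t) / (\<gamma> t - z0) - cnj (\<gamma> t - z0) / (\<gamma> t - z0) * b (\<gamma> t))))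
      has_integral inverse (k * s) * 0) {0..1}" .
  moreover have "inverse (k * s) * (k * s * X) = X" for X
  proof -
    have "inverse c * (c * X) = X" if "c \<noteq> 0" for c :: complex using that by simp
    moreover have "k * s \<noteq> 0" using k0(1) s by auto
    ultimately show ?thesis by blast
  qed
  ultimately show ?thesis by (simp only: mult_zero_right)
qed

lemma circle_mean_holomorphic:
  assumes s: "s > 0" and f: "f holomorphic_on cball z0 s"
  shows "((\<lambda>t. f (circlepath z0 s t)) has_integral f z0) {0..1}"
proof -
  have "((\<lambda>u. f u / (u - z0)) has_contour_integral (2 * of_real pi * \<i> * f z0)) (circlepath z0 s)"
    by (rule Cauchy_integral_circlepath_simple[OF f]) (use s in simp)
  then have "((\<lambda>t. f (circlepath z0 s t) / (circlepath z0 s t - z0) * vector_derivative (circlepath z0 s) (at t within {0..1}))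
      has_integral 2 * of_real pi * \<i> * f z0) {0..1}"
    by (simp add: has_contour_integral_def)
  moreover have "f (circlepath z0 s t) / (circlepath z0 s t - z0) * vector_derivative (circlepath z0 s) (at t within {0..1})
      = 2 * of_real pi * \<i> * f (circlepath z0 s t)" if "t \<in> {0..1}" for t
  proof -
    have vd: "vector_derivative (circlepath z0 s) (at t within {0..1}) = 2 * pi * \<i> * s * exp (2 * of_real pi * \<i> * t)"
      using that by (intro vector_derivative_circlepath01) auto
    have g: "circlepath z0 s t - z0 = s * exp (2 * of_real pi * \<i> * t)" by (simp add: circlepath)
    show ?thesis unfolding vd g using s by simp
  qed
  ultimately have "((\<lambda>t. 2 * of_real pi * \<i> * f (circlepath z0 s t)) has_integral 2 * of_real pi * \<i> * f z0) {0..1}"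
    by (rule has_integral_eq[rotated]) auto
  from has_integral_mult_right[OF this, of "inverse (2 * of_real pi * \<i>)"]
  have "((\<lambda>t. inverse (2 * of_real pi * \<i>) * (2 * of_real pi * \<i> * f (circlepath z0 s t))) has_integral
      inverse (2 * of_real pi * \<i>) * (2 * of_real pi * \<i> * f z0)) {0..1}" .
  moreover have "inverse (2 * of_real pi * \<i>) * (2 * of_real pi * \<i> * X) = X" for X :: complex
  proof -
    have "inverse c * (c * X) = X" if "c \<noteq> 0" for c :: complex using that by simp
    moreover have "2 * of_real pi * \<i> \<noteq> 0" by simp
    ultimately show ?thesis by blast
  qed
  ultimately show ?thesis by (simp only:)
qed

lemma norm_unit_integral_le:
  fixes f :: "real \<Rightarrow> complex"
  assumes "(f has_integral I) {0..1}" "\<And>t. t \<in> {0..1} \<Longrightarrow> norm (f t) \<le> B"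
  shows "norm I \<le> B"
proof -
  have "0 \<le> B" using assms(2)[of 0] norm_ge_zero by (metis atLeastAtMost_iff order_refl order_trans zero_le_one)
  then show ?thesis using has_integral_bound[of B f I 0 1] assms by simp
qed


lemma Re_of_real_mult: "Re (of_real r * z) = r * Re z" by simp

lemma wirt_eqI: "(f has_derivative (\<lambda>k. 2 * Re (a * k))) (at z) \<Longrightarrow> wirt f z = a"
  unfolding wirt_def by (simp add: dird_eqI complex_eq_iff)

lemma has_derivative_wirt:
  assumes "f differentiable (at z)"
  shows "(f has_derivative (\<lambda>k. 2 * Re (wirt f z * k))) (at z)"
  using has_derivative_dird[OF assms] by (simp only: dird_wirt[OF assms])

lemma wirt_linear_combination:
  assumes "f1 differentiable (at z)" "f2 differentiable (at z)"
  shows "(\<lambda>z. c1 * f1 z + c2 * f2 z) differentiable (at z)"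
    and "wirt (\<lambda>z. c1 * f1 z + c2 * f2 z) z = c1 * wirt f1 z + c2 * wirt f2 z"
proof -
  have "((\<lambda>z. c1 * f1 z + c2 * f2 z) has_derivative
      (\<lambda>k. c1 * (2 * Re (wirt f1 z * k)) + c2 * (2 * Re (wirt f2 z * k)))) (at z)"
    by (intro has_derivative_add has_derivative_mult_right has_derivative_wirt assms)
  moreover have "c1 * (2 * Re (wirt f1 z * k)) + c2 * (2 * Re (wirt f2 z * k))
      = 2 * Re ((of_real c1 * wirt f1 z + of_real c2 * wirt f2 z) * k)" for k
    by (simp add: algebra_simps)
  ultimately have *: "((\<lambda>z. c1 * f1 z + c2 * f2 z) has_derivative
      (\<lambda>k. 2 * Re ((of_real c1 * wirt f1 z + of_real c2 * wirt f2 z) * k))) (at z)" by (simp only:)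
  then show "(\<lambda>z. c1 * f1 z + c2 * f2 z) differentiable (at z)" by (rule differentiableI)
  show "wirt (\<lambda>z. c1 * f1 z + c2 * f2 z) z = c1 * wirt f1 z + c2 * wirt f2 z"
    by (rule wirt_eqI[OF *])
qed

lemma has_wirtinger_ray:
  assumes "has_wirtinger p a b (of_real t * e)"
  shows "((\<lambda>t. p (of_real t * e)) has_vector_derivative a * e + b * cnj e) (at t)"
proof -
  have "((\<lambda>t. complex_of_real t * e) has_derivative (\<lambda>x. of_real x * e)) (at t)"
    by (auto intro!: derivative_eq_intros)
  from diff_chain_at[OF this assms] show ?thesis
    unfolding has_vector_derivative_def by (simp add: o_def scaleR_conv_of_real algebra_simps)
qed

lemma (in unit_torus) periodic_wirt:
  assumes "periodic F" shows "periodic (wirt F)"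
  by (simp add: periodic_def wirt_def periodicD[OF periodic_dird[OF assms]])

lemma (in unit_torus) periodic_wirt2:
  assumes "periodic F" shows "periodic (wirt2 F)"
  by (simp add: periodic_def wirt2_def periodicD[OF periodic_dird[OF periodic_dird[OF assms]]])

section \<open>The simple pole of the z-derivative of the potential\<close>

context liouville_potential
begin

lemma wirt_U:
  assumes z: "z \<notin> \<Lambda>"
  shows "wirt U z = deriv T z / T z + wirt g z"
proof (rule wirt_eqI)
  have T: "T z \<noteq> 0" using z T_zero_iff by blast
  have N: "((\<lambda>z. (cmod (T z))\<^sup>2) has_derivative (\<lambda>k. 2 * Re (cnj (T z) * (deriv T z * k)))) (at z)"
    using norm_square_derivative[OF T_holomorphic open_UNIV UNIV_I] by simp
  have "((\<lambda>z. ln ((cmod (T z))\<^sup>2)) has_derivative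
      (\<lambda>k. 2 * Re (cnj (T z) * (deriv T z * k)) * inverse ((cmod (T z))\<^sup>2))) (at z)"
    by (rule has_derivative_ln[OF _ N]) (use T in simp)
  moreover have "g differentiable (at z)" using g_smooth[of 1] by auto
  ultimately have "((\<lambda>z. ln ((cmod (T z))\<^sup>2) + g z) has_derivative
      (\<lambda>k. 2 * Re (cnj (T z) * (deriv T z * k)) * inverse ((cmod (T z))\<^sup>2) + 2 * Re (wirt g z * k))) (at z)"
    by (intro has_derivative_add has_derivative_wirt)
  moreover have "2 * Re (cnj (T z) * (deriv T z * k)) * inverse ((cmod (T z))\<^sup>2) + 2 * Re (wirt g z * k)
      = 2 * Re ((deriv T z / T z + wirt g z) * k)" for k
  proof -
    have "deriv T z / T z = cnj (T z) * deriv T z * of_real (inverse ((cmod (T z))\<^sup>2))"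
      using T complex_norm_square[of "T z"] by (simp add: field_simps)
    then have "(deriv T z / T z + wirt g z) * k
        = of_real (inverse ((cmod (T z))\<^sup>2)) * (cnj (T z) * (deriv T z * k)) + wirt g z * k"
      by (simp only: ring_distribs mult_ac)
    then show ?thesis by (simp only: plus_complex.sel Re_of_real_mult ring_distribs) (simp add: mult_ac)
  qed
  ultimately have "((\<lambda>z. ln ((cmod (T z))\<^sup>2) + g z) has_derivative
      (\<lambda>k. 2 * Re ((deriv T z / T z + wirt g z) * k))) (at z)" by (simp only:)
  then show "(U has_derivative (\<lambda>k. 2 * Re ((deriv T z / T z + wirt g z) * k))) (at z)"
    by (rule has_derivative_transform_within_open[OF _ open_off_lattice]) (use z in \<open>auto simp: U_eq ln_realpow T_zero_iff\<close>)
qed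

text \<open>From T = z h one obtains T'/T = 1/z + h'/h, and h has no zero on the compact
  cell.\<close>

lemma wirt_U_singularity:
  obtains M where "M > 0" "\<And>z. z \<in> closed_cell \<Longrightarrow> z \<noteq> 0 \<Longrightarrow> cmod (wirt U z - 1 / z) \<le> M"
proof -
  have dh: "(h has_field_derivative deriv h z) (at z)" for z
    using h_holomorphic holomorphic_derivI[OF _ open_UNIV] by blast
  have "continuous_on closed_cell (wirt g)"
    unfolding wirt_def using g_smooth[of 1]
    by (intro continuous_intros) (auto intro: continuous_on_subset)
  moreover have "continuous_on closed_cell h" "continuous_on closed_cell (deriv h)"
    using holomorphic_on_imp_continuous_on[OF h_holomorphic]
      holomorphic_on_imp_continuous_on[OF holomorphic_deriv[OF h_holomorphic open_UNIV]]
    by (auto intro: continuous_on_subset)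
  ultimately have "continuous_on closed_cell (\<lambda>z. deriv h z / h z + wirt g z)"
    using h_nonzero by (intro continuous_intros) auto
  from compact_imp_bounded[OF compact_continuous_image[OF this compact_closed_cell]]
  obtain M where M: "M > 0" "\<And>z. z \<in> closed_cell \<Longrightarrow> cmod (deriv h z / h z + wirt g z) \<le> M"
    unfolding bounded_pos by blast
  show ?thesis
  proof (rule that[OF M(1)])
    fix z assume z: "z \<in> closed_cell" "z \<noteq> 0"
    then have off: "z \<notin> \<Lambda>" using closed_cell_lattice by blast
    have "((\<lambda>z. z * h z) has_field_derivative (h z + z * deriv h z)) (at z)"
      using DERIV_mult[OF DERIV_ident dh, of z] by (simp add: mult.commute)
    moreover have "(\<lambda>z. z * h z) = T" using T_eq by auto
    ultimately have dT: "deriv T z = h z + z * deriv h z" by (simp add: DERIV_imp_deriv)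
    have "(h z + z * a) / (z * h z) + b - 1 / z = a / h z + b" for a b
      using z h_nonzero[OF z(1)] by (simp add: field_simps)
    then have "wirt U z - 1 / z = deriv h z / h z + wirt g z"
      by (simp only: wirt_U[OF off] dT T_eq[of z])
    then show "cmod (wirt U z - 1 / z) \<le> M" using M(2)[OF z(1)] by simp
  qed
qed

end

section \<open>Uniqueness\<close>

context mean_field
begin

text \<open>
  With \<open>w = v - U\<close>: \<open>p = w\<^bsub>z\<^esub>\<close>, \<open>p1 = w\<^bsub>zz\<^esub>\<close>, \<open>src\<close> is the \<open>zbar\<close>-derivative of \<open>p\<close>, and \<open>Q\<close> is the difference
  of the Schwarzians of \<open>v\<close> and \<open>U\<close> expressed through \<open>p\<close>.
\<close>

definition p :: "complex \<Rightarrow> complex" where "p z = wirt v z - wirt U z"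
definition p1 :: "complex \<Rightarrow> complex" where "p1 z = wirt2 v z - wirt2 U z"
definition src :: "complex \<Rightarrow> complex" where "src z = of_real (- pi * (exp (v z) - q z))"
definition Q :: "complex \<Rightarrow> complex" where "Q z = p1 z - wirt U z * p z - (p z)\<^sup>2 / 2"

lemma v_differentiable: "z \<notin> \<Lambda> \<Longrightarrow> v differentiable (at z)"
  using laplacian_eq_dird(2)[OF v_smooth] by simp

lemma U_differentiable: "z \<notin> \<Lambda> \<Longrightarrow> U differentiable (at z)"
  using laplacian_eq_dird(2)[OF U_smooth] by simp

lemma p_has_wirtinger: "z \<notin> \<Lambda> \<Longrightarrow> has_wirtinger p (p1 z) (src z) z"
proof -
  assume z: "z \<notin> \<Lambda>"
  have "has_wirtinger (\<lambda>z. wirt v z - wirt U z) (wirt2 v z - wirt2 U z)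
      (of_real (laplacian v z / 4) - of_real (laplacian U z / 4)) z"
    using z by (intro has_wirtinger_diff wirt_has_wirtinger[OF _ open_off_lattice] v_smooth U_smooth) auto
  moreover have "of_real (laplacian v z / 4) - of_real (laplacian U z / 4) = src z"
    unfolding pointwise_equation[OF z] q_equation[OF z] src_def by (simp add: algebra_simps)
  ultimately show ?thesis by (simp add: p_def[abs_def] p1_def)
qed

text \<open>As v_z = U_z + p, the squares in the two Schwarzians differ by 2 U_z p + p^2, so
  \<open>Q\<close> is the difference of two holomorphic functions.\<close>

lemma Q_holomorphic: "Q holomorphic_on - \<Lambda>"
proof -
  have "(\<lambda>z. (wirt2 v z - (wirt v z)\<^sup>2 / 2) - (wirt2 U z - (wirt U z)\<^sup>2 / 2)) holomorphic_on - \<Lambda>"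
    by (intro holomorphic_on_diff schwarzian_holomorphic open_off_lattice v_smooth U_smooth)
       (auto simp: pointwise_equation q_equation exp_U)
  moreover have "(\<lambda>z. (wirt2 v z - (wirt v z)\<^sup>2 / 2) - (wirt2 U z - (wirt U z)\<^sup>2 / 2)) = Q"
    by (simp add: fun_eq_iff Q_def p_def p1_def power2_eq_square field_simps)
  ultimately show ?thesis by simp
qed

lemma p_periodic: "w \<in> \<Lambda> \<Longrightarrow> p (z + w) = p z"
  using periodicD[OF periodic_wirt[OF v_periodic]] periodicD[OF periodic_wirt[OF U_periodic]] by (simp add: p_def)

lemma Q_periodic: "w \<in> \<Lambda> \<Longrightarrow> Q (z + w) = Q z"
  using periodicD[OF periodic_wirt[OF U_periodic]] periodicD[OF periodic_wirt2[OF v_periodic]]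
    periodicD[OF periodic_wirt2[OF U_periodic]] by (simp add: Q_def p_periodic p1_def)

lemma difference_has_derivative:
  assumes "z \<notin> \<Lambda>" shows "((\<lambda>z. v z - U z) has_derivative (\<lambda>k. 2 * Re (p z * k))) (at z)"
proof -
  have "((\<lambda>z. v z - U z) has_derivative (\<lambda>k. 2 * Re (wirt v z * k) - 2 * Re (wirt U z * k))) (at z)"
    using assms by (intro has_derivative_diff has_derivative_wirt v_differentiable U_differentiable)
  moreover have "2 * Re (wirt v z * k) - 2 * Re (wirt U z * k) = 2 * Re (p z * k)" for k
    by (simp add: p_def algebra_simps)
  ultimately show ?thesis by (simp only:)
qed

lemma difference_line_derivative:
  assumes "a + of_real t * k \<notin> \<Lambda>"
  shows "((\<lambda>t. v (a + of_real t * k) - U (a + of_real t * k)) has_real_derivative 2 * Re (p (a + of_real t * k) * k)) (at t)"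
proof -
  have "((\<lambda>t. a + complex_of_real t * k) has_derivative (\<lambda>x. of_real x * k)) (at t)"
    by (auto intro!: derivative_eq_intros)
  from diff_chain_at[OF this difference_has_derivative[OF assms]]
  have "((\<lambda>t. v (a + of_real t * k) - U (a + of_real t * k)) has_derivative
      (\<lambda>x. 2 * Re (p (a + of_real t * k) * (of_real x * k)))) (at t)" by (simp add: o_def)
  moreover have "2 * Re (p (a + of_real t * k) * (of_real x * k)) = 2 * Re (p (a + of_real t * k) * k) * x" for x
    by (simp add: algebra_simps)
  ultimately show ?thesis unfolding has_field_derivative_def by (simp only:)
qed

lemma p_bounded:
  obtains L where "L > 0" "\<And>z. z \<notin> \<Lambda> \<Longrightarrow> cmod (p z) \<le> L"
proof -
  obtain L where L: "L > 0" "\<And>x y. x \<notin> \<Lambda> \<Longrightarrow> y \<notin> \<Lambda> \<Longrightarrow> \<bar>(v x - U x) - (v y - U y)\<bar> \<le> L * cmod (x - y)"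
    by (rule difference_lipschitz) blast
  show ?thesis
  proof (rule that[OF L(1)])
    fix z assume z: "z \<notin> \<Lambda>"
    \<comment> \<open>In the direction of the conjugate of \<open>p z\<close> the derivative of
      \<open>v - U\<close> is 2 |p|^2, which the Lipschitz bound compares with L |p|.\<close>
    define k where "k = cnj (p z)"
    define w where "w t = v (z + of_real t * k) - U (z + of_real t * k)" for t
    have "(w has_real_derivative 2 * Re (p z * k)) (at 0)"
      using difference_line_derivative[of z 0 k] z by (simp add: w_def[abs_def])
    then have "((\<lambda>t. (w t - w 0) / t) \<longlongrightarrow> 2 * Re (p z * k)) (at 0)"
      by (simp add: has_field_derivative_iff)
    then have lim: "((\<lambda>t. \<bar>(w t - w 0) / t\<bar>) \<longlongrightarrow> \<bar>2 * Re (p z * k)\<bar>) (at 0)" by (rule tendsto_rabs)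
    have "((\<lambda>t. z + complex_of_real t * k) \<longlongrightarrow> z + of_real 0 * k) (at 0)" by (intro tendsto_intros)
    then have "\<forall>\<^sub>F t in at 0. z + complex_of_real t * k \<in> - \<Lambda>"
      by (rule topological_tendstoD) (use z open_off_lattice in auto)
    then have "\<forall>\<^sub>F t in at 0. \<bar>(w t - w 0) / t\<bar> \<le> L * cmod k"
    proof (rule eventually_mono)
      fix t assume t: "z + complex_of_real t * k \<in> - \<Lambda>"
      have "\<bar>w t - w 0\<bar> \<le> L * cmod (z + of_real t * k - z)"
        using L(2)[of "z + of_real t * k" z] t z by (simp add: w_def)
      then have "\<bar>w t - w 0\<bar> \<le> L * cmod k * \<bar>t\<bar>" by (simp add: norm_mult mult_ac)
      moreover have "0 \<le> L * cmod k" using L(1) by simp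
      ultimately show "\<bar>(w t - w 0) / t\<bar> \<le> L * cmod k"
        by (cases "t = 0") (simp_all add: abs_divide divide_le_eq)
    qed
    then have "\<bar>2 * Re (p z * k)\<bar> \<le> L * cmod k" by (intro tendsto_upperbound[OF lim]) auto
    moreover have "Re (p z * k) = (cmod (p z))\<^sup>2"
      unfolding k_def complex_norm_square[symmetric, of "p z"] by (simp add: complex_mult_cnj cmod_power2)
    ultimately have "2 * (cmod (p z))\<^sup>2 \<le> L * cmod (p z)" by (simp add: k_def)
    then have "cmod (p z) * (2 * cmod (p z) - L) \<le> 0" by (simp add: power2_eq_square algebra_simps)
    then have "cmod (p z) = 0 \<or> 2 * cmod (p z) - L \<le> 0"
      using mult_pos_pos[of "cmod (p z)" "2 * cmod (p z) - L"] norm_ge_zero[of "p z"] by (meson less_eq_real_def not_le)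
    then show "cmod (p z) \<le> L" using L(1) norm_ge_zero[of "p z"] by auto
  qed
qed

lemma local_bounds:
  obtains R L M where "0 < R" "R \<le> 1" "0 < L" "0 < M"
    "\<And>z. z \<noteq> 0 \<Longrightarrow> cmod z < R \<Longrightarrow> z \<notin> \<Lambda>"
    "\<And>z. z \<notin> \<Lambda> \<Longrightarrow> cmod (p z) \<le> L"
    "\<And>z. z \<noteq> 0 \<Longrightarrow> cmod z < R \<Longrightarrow> cmod (wirt U z - 1 / z) \<le> M"
    "\<And>z. z \<noteq> 0 \<Longrightarrow> cmod z < R \<Longrightarrow> cmod (src z) \<le> M * (cmod z)\<^sup>2"
proof -
  obtain L where L: "L > 0" "\<And>z. z \<notin> \<Lambda> \<Longrightarrow> cmod (p z) \<le> L" by (rule p_bounded) blast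
  obtain d where d: "d > 0" "ball 0 d \<subseteq> closed_cell" by (rule ball_subset_cell) blast
  obtain M where M: "M > 0" "\<And>z. z \<in> closed_cell \<Longrightarrow> z \<noteq> 0 \<Longrightarrow> cmod (wirt U z - 1 / z) \<le> M"
    by (rule wirt_U_singularity) blast
  obtain c where c: "c > 0" "\<And>z. z \<notin> \<Lambda> \<Longrightarrow> exp (v z) \<le> c * q z" by (rule exp_v_le_q) blast
  obtain c' C where C: "c' > 0" "C > 0" "\<And>z. z \<in> closed_cell \<Longrightarrow> c' * (cmod z)\<^sup>2 \<le> q z"
    "\<And>z. z \<in> closed_cell \<Longrightarrow> q z \<le> C * (cmod z)\<^sup>2" by (rule q_quadratic) blast
  define R where "R = min 1 d"
  define M' where "M' = max M (pi * ((c + 1) * C))"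
  have cell: "z \<in> closed_cell" if "cmod z < R" for z
    using that d(2) by (auto simp: R_def subset_iff)
  have off: "z \<notin> \<Lambda>" if "z \<noteq> 0" "cmod z < R" for z
    using cell[OF that(2)] that(1) closed_cell_lattice by blast
  have src: "cmod (src z) \<le> M' * (cmod z)\<^sup>2" if z: "z \<noteq> 0" "cmod z < R" for z
  proof -
    have "\<bar>exp (v z) - q z\<bar> \<le> c * q z + q z"
      using c(2)[OF off[OF z]] q_nonneg[of z] exp_gt_zero[of "v z"] by linarith
    also have "\<dots> = (c + 1) * q z" by (simp add: algebra_simps)
    also have "\<dots> \<le> (c + 1) * (C * (cmod z)\<^sup>2)" using C(4)[OF cell[OF z(2)]] c(1) by (intro mult_left_mono) auto
    finally have 1: "pi * \<bar>exp (v z) - q z\<bar> \<le> pi * ((c + 1) * (C * (cmod z)\<^sup>2))" by (intro mult_left_mono) auto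
    have 2: "cmod (src z) = pi * \<bar>exp (v z) - q z\<bar>" unfolding src_def norm_of_real by (simp add: abs_mult)
    have "pi * ((c + 1) * C) * (cmod z)\<^sup>2 \<le> M' * (cmod z)\<^sup>2"
      by (rule mult_right_mono) (auto simp: M'_def)
    then have "pi * ((c + 1) * (C * (cmod z)\<^sup>2)) \<le> M' * (cmod z)\<^sup>2" by (simp only: mult.assoc)
    with 1 2 show ?thesis by linarith
  qed
  show ?thesis
  proof (rule that[of R L M'])
    show "cmod (wirt U z - 1 / z) \<le> M'" if "z \<noteq> 0" "cmod z < R" for z
      using M(2)[OF cell[OF that(2)] that(1)] by (simp add: M'_def)
  qed (use d L M off src in \<open>auto simp: R_def M'_def\<close>)
qed

text \<open>Subtracting the circle identity from the mean of \<open>Q\<close> eliminates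
  \<open>p1\<close>, for which there is no bound. The term p / (x - z0) is kept together with U_z p
  because on circles about the origin their leading parts cancel.\<close>

lemma Q_mean_bound:
  assumes s: "s > 0" and off: "\<And>x. cmod (x - z0) = s \<Longrightarrow> x \<notin> \<Lambda>"
    and I: "((\<lambda>t. Q (circlepath z0 s t)) has_integral I) {0..1}"
    and B: "\<And>x. cmod (x - z0) = s \<Longrightarrow> cmod (p x / (x - z0) - wirt U x * p x) \<le> B1"
      "\<And>x. cmod (x - z0) = s \<Longrightarrow> cmod (p x) \<le> B2" "\<And>x. cmod (x - z0) = s \<Longrightarrow> cmod (src x) \<le> B3"
  shows "cmod I \<le> B1 + B2\<^sup>2 / 2 + B3"
proof (rule norm_unit_integral_le)
  let ?F = "\<lambda>x. Q x - (p1 x - p x / (x - z0) - cnj (x - z0) / (x - z0) * src x)"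
  show "((\<lambda>t. ?F (circlepath z0 s t)) has_integral I) {0..1}"
    using has_integral_diff[OF I circle_identity[OF s p_has_wirtinger[OF off]]] by (simp only: diff_zero)
  fix t
  define x where "x = circlepath z0 s t"
  have x: "cmod (x - z0) = s" using s by (simp add: x_def circlepath norm_mult)
  have tri: "cmod (a - b + c) \<le> cmod a + cmod b + cmod c" for a b c :: complex
    using norm_triangle_ineq[of "a - b" c] norm_triangle_ineq4[of a b] by linarith
  have e: "?F x = (p x / (x - z0) - wirt U x * p x) - (p x)\<^sup>2 / 2 + cnj (x - z0) / (x - z0) * src x"
    by (simp add: Q_def)
  have "cmod (?F x) \<le> cmod (p x / (x - z0) - wirt U x * p x) + cmod ((p x)\<^sup>2 / 2) + cmod (cnj (x - z0) / (x - z0) * src x)"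
    unfolding e by (rule tri)
  also have "\<dots> \<le> B1 + B2\<^sup>2 / 2 + B3"
  proof (intro add_mono)
    show "cmod (p x / (x - z0) - wirt U x * p x) \<le> B1" by (rule B(1)[OF x])
    have "(cmod (p x))\<^sup>2 / 2 \<le> B2\<^sup>2 / 2" using B(2)[OF x] by (intro divide_right_mono power_mono) auto
    then show "cmod ((p x)\<^sup>2 / 2) \<le> B2\<^sup>2 / 2" by (simp add: norm_divide norm_power)
    have "cmod (cnj (x - z0) / (x - z0) * src x) = cmod (src x)"
      unfolding norm_mult norm_divide complex_mod_cnj using x s by simp
    then show "cmod (cnj (x - z0) / (x - z0) * src x) \<le> B3" using B(3)[OF x] by simp
  qed
  finally show "cmod (?F (circlepath z0 s t)) \<le> B1 + B2\<^sup>2 / 2 + B3" by (simp add: x_def)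
qed

text \<open>On the circle about z of radius |z|/2 both 1/(x - z) and U_z are of order 1/|z| while
  \<open>p\<close> is bounded. The mean value property gives |Q(z)| = O(1/|z|), so the pole is at
  most simple.\<close>

lemma Q_constant: obtains b where "\<And>z. z \<notin> \<Lambda> \<Longrightarrow> Q z = b"
proof -
  obtain R L M where R: "0 < R" "R \<le> 1" and LM: "0 < L" "0 < M"
    and off: "\<And>z. z \<noteq> 0 \<Longrightarrow> cmod z < R \<Longrightarrow> z \<notin> \<Lambda>"
    and pL: "\<And>z. z \<notin> \<Lambda> \<Longrightarrow> cmod (p z) \<le> L"
    and wM: "\<And>z. z \<noteq> 0 \<Longrightarrow> cmod z < R \<Longrightarrow> cmod (wirt U z - 1 / z) \<le> M"
    and sM: "\<And>z. z \<noteq> 0 \<Longrightarrow> cmod z < R \<Longrightarrow> cmod (src z) \<le> M * (cmod z)\<^sup>2"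
    by (rule local_bounds) blast
  define C where "C = 4 * L + M * L + L\<^sup>2 / 2 + M"
  have bound: "cmod (z\<^sup>2 * Q z) \<le> C * cmod z" if z: "z \<noteq> 0" "cmod z < R / 2" for z
  proof -
    define r where "r = cmod z"
    have r: "r > 0" "r < R / 2" "r \<le> 1" using z R by (auto simp: r_def)
    have ann: "r / 2 \<le> cmod x \<and> cmod x < R" if "cmod (x - z) \<le> r / 2" for x
      using that norm_triangle_ineq2[of z "z - x"] norm_triangle_ineq2[of x z] r
      by (auto simp: r_def norm_minus_commute)
    have nz: "x \<noteq> 0" if "cmod (x - z) \<le> r / 2" for x using ann[OF that] r by auto
    have offx: "x \<notin> \<Lambda>" if "cmod (x - z) \<le> r / 2" for x using off nz[OF that] ann[OF that] by blast
    have "Q holomorphic_on cball z (r / 2)"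
      by (rule holomorphic_on_subset[OF Q_holomorphic]) (use offx in \<open>auto simp: dist_norm norm_minus_commute\<close>)
    then have I: "((\<lambda>t. Q (circlepath z (r / 2) t)) has_integral Q z) {0..1}"
      using r by (intro circle_mean_holomorphic) auto
    have "cmod (Q z) \<le> (L * (2 / r) + (M + 2 / r) * L) + L\<^sup>2 / 2 + M"
    proof (rule Q_mean_bound[OF _ _ I])
      fix x assume x: "cmod (x - z) = r / 2"
      then have x': "cmod (x - z) \<le> r / 2" by simp
      show "x \<notin> \<Lambda>" "cmod (p x) \<le> L" using offx[OF x'] pL by auto
      have "cmod (src x) \<le> M * (cmod x)\<^sup>2" using sM nz[OF x'] ann[OF x'] by blast
      also have "\<dots> \<le> M * 1" using ann[OF x'] R LM by (intro mult_left_mono power_le_one) auto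
      finally show "cmod (src x) \<le> M" by simp
      have "1 / cmod x \<le> 1 / (r / 2)" using ann[OF x'] r nz[OF x'] by (intro divide_left_mono mult_pos_pos) auto
      then have "1 / cmod x \<le> 2 / r" by simp
      moreover have "cmod (wirt U x) \<le> cmod (wirt U x - 1 / x) + cmod (1 / x)"
        using norm_triangle_ineq[of "wirt U x - 1 / x" "1 / x"] by simp
      ultimately have wU: "cmod (wirt U x) \<le> M + 2 / r"
        using wM[of x] nz[OF x'] ann[OF x'] by (simp add: norm_divide)
      have "cmod (p x / (x - z) - wirt U x * p x) \<le> cmod (p x / (x - z)) + cmod (wirt U x * p x)"
        by (rule norm_triangle_ineq4)
      also have "\<dots> = cmod (p x) * (2 / r) + cmod (wirt U x) * cmod (p x)" by (simp add: norm_divide norm_mult x)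
      also have "\<dots> \<le> L * (2 / r) + (M + 2 / r) * L"
        using r pL[OF offx[OF x']] wU LM by (intro add_mono mult_mono) auto
      finally show "cmod (p x / (x - z) - wirt U x * p x) \<le> L * (2 / r) + (M + 2 / r) * L" .
    qed (use r in simp)
    then have "r * cmod (Q z) \<le> r * ((L * (2 / r) + (M + 2 / r) * L) + L\<^sup>2 / 2 + M)"
      using r by (intro mult_left_mono) auto
    also have "\<dots> = 4 * L + r * (M * L + L\<^sup>2 / 2 + M)" using r by (simp add: field_simps)
    also have "\<dots> \<le> 4 * L + 1 * (M * L + L\<^sup>2 / 2 + M)"
      using r LM by (intro add_left_mono mult_right_mono) auto
    finally have "r * cmod (Q z) \<le> C" by (simp add: C_def)
    then have "r * (r * cmod (Q z)) \<le> r * C" using r by (intro mult_left_mono) auto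
    then show ?thesis by (simp add: norm_mult norm_power r_def power2_eq_square mult_ac)
  qed
  have "((\<lambda>z. z\<^sup>2 * Q z) \<longlongrightarrow> 0) (at 0)"
  proof (rule Lim_null_comparison)
    show "\<forall>\<^sub>F z in at 0. cmod (z\<^sup>2 * Q z) \<le> C * cmod z"
      unfolding eventually_at using bound R by (intro exI[of _ "R / 2"]) (auto simp: dist_norm)
    have "((\<lambda>z. C * cmod z) \<longlongrightarrow> C * cmod (0 :: complex)) (at 0)" by (intro tendsto_intros)
    then show "((\<lambda>z::complex. C * cmod z) \<longlongrightarrow> 0) (at 0)" by simp
  qed
  from elliptic_simple_pole_constant[OF Q_holomorphic Q_periodic this] show ?thesis using that by blast
qed

text \<open>
  Since \<open>Q\<close> is constant, \<open>p\<^bsub>z\<^esub> - p/z\<close> is bounded, so \<open>p(te)/t\<close> grows at most like \<open>ln t\<close> along rays.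
\<close>

lemma p_sqrt_bound:
  obtains K r where "K > 0" "r > 0" "\<And>z. z \<noteq> 0 \<Longrightarrow> cmod z < r \<Longrightarrow> cmod (p z) \<le> K * sqrt (cmod z)"
proof -
  obtain R L M where R: "0 < R" "R \<le> 1" and LM: "0 < L" "0 < M"
    and off: "\<And>z. z \<noteq> 0 \<Longrightarrow> cmod z < R \<Longrightarrow> z \<notin> \<Lambda>"
    and pL: "\<And>z. z \<notin> \<Lambda> \<Longrightarrow> cmod (p z) \<le> L"
    and wM: "\<And>z. z \<noteq> 0 \<Longrightarrow> cmod z < R \<Longrightarrow> cmod (wirt U z - 1 / z) \<le> M"
    and sM: "\<And>z. z \<noteq> 0 \<Longrightarrow> cmod z < R \<Longrightarrow> cmod (src z) \<le> M * (cmod z)\<^sup>2"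
    by (rule local_bounds) blast
  obtain b where b: "\<And>z. z \<notin> \<Lambda> \<Longrightarrow> Q z = b" by (rule Q_constant) blast
  define N where "N = cmod b + M * L + L\<^sup>2 / 2 + M"
  define r where "r = R / 2"
  have r: "0 < r" "r < R" "r < 1" using R by (auto simp: r_def)
  have N: "N \<ge> 0" using LM by (simp add: N_def)
  have "cmod (p z) \<le> (L / r + 2 * N) * sqrt (cmod z)" if z: "z \<noteq> 0" "cmod z < r" for z
  proof -
    define \<tau> where "\<tau> = cmod z"
    define e where "e = z / of_real \<tau>"
    have \<tau>: "0 < \<tau>" "\<tau> < r" using z by (auto simp: \<tau>_def)
    have e: "cmod e = 1" "of_real \<tau> * e = z" using \<tau> by (simp_all add: e_def \<tau>_def norm_divide)
    then have e0: "e \<noteq> 0" by auto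
    \<comment> \<open>Constancy of \<open>Q\<close> gives p_z = b + U_z p + p^2/2. The part 1/x of
      U_z cancels the derivative of the factor 1/t, so \<open>f'\<close> is of order 1/t and
      \<open>f\<close> at most logarithmic.\<close>
    define f where "f t = p (of_real t * e) * inverse (of_real t)" for t :: real
    define f' where "f' t = (b * e + (wirt U (of_real t * e) - 1 / (of_real t * e)) * p (of_real t * e) * e
        + (p (of_real t * e))\<^sup>2 / 2 * e + src (of_real t * e) * cnj e) * inverse (of_real t)" for t :: real
    have ray: "of_real t * e \<noteq> 0" "cmod (of_real t * e) = t" "of_real t * e \<notin> \<Lambda>" if "t > 0" "t \<le> r" for t
    proof -
      show 1: "of_real t * e \<noteq> 0" "cmod (of_real t * e) = t" using that e0 e(1) by (simp_all add: norm_mult)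
      show "of_real t * e \<notin> \<Lambda>" using off[OF 1(1)] 1(2) that r by simp
    qed
    have df: "(f has_vector_derivative f' t) (at t)" if t: "t > 0" "t \<le> r" for t
    proof -
      define x where "x = of_real t * e"
      have x: "x \<notin> \<Lambda>" "x \<noteq> 0" using ray[OF t] by (simp_all add: x_def)
      have "((\<lambda>t. inverse (complex_of_real t)) has_vector_derivative - (inverse (of_real t) * inverse (of_real t))) (at t)"
        by (rule has_vector_derivative_real_field) (use t in \<open>auto intro!: derivative_eq_intros simp: power2_eq_square\<close>)
      from has_vector_derivative_mult[OF has_wirtinger_ray[OF p_has_wirtinger[OF ray(3)[OF t]]] this]
      have "(f has_vector_derivative p x * - (inverse (of_real t) * inverse (of_real t)) + (p1 x * e + src x * cnj e) * inverse (of_real t)) (at t)"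
        by (simp only: f_def[abs_def] x_def)
      moreover have "p1 x = b + wirt U x * p x + (p x)\<^sup>2 / 2" using b[OF x(1)] by (simp add: Q_def algebra_simps)
      then have "p x * - (inverse (of_real t) * inverse (of_real t)) + (p1 x * e + src x * cnj e) * inverse (of_real t)
          = (b * e + (wirt U x - 1 / x) * p x * e + (p x)\<^sup>2 / 2 * e + src x * cnj e) * inverse (of_real t)"
        using t e0 by (simp add: x_def field_simps)
      ultimately show ?thesis by (simp only: f'_def x_def)
    qed
    have bf: "cmod (f' t) \<le> N * inverse t" if t: "t > 0" "t \<le> r" for t
    proof -
      define x where "x = of_real t * e"
      have x: "x \<notin> \<Lambda>" "x \<noteq> 0" "cmod x < R" "cmod x \<le> 1" using ray[OF t] t r R by (simp_all add: x_def)
      have tri: "cmod (w1 + w2 + w3 + w4) \<le> cmod w1 + cmod w2 + cmod w3 + cmod w4" for w1 w2 w3 w4 :: complex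
        using norm_triangle_ineq[of "w1 + w2 + w3" w4] norm_triangle_ineq[of "w1 + w2" w3] norm_triangle_ineq[of w1 w2] by linarith
      have "cmod (b * e + (wirt U x - 1 / x) * p x * e + (p x)\<^sup>2 / 2 * e + src x * cnj e)
         \<le> cmod (b * e) + cmod ((wirt U x - 1 / x) * p x * e) + cmod ((p x)\<^sup>2 / 2 * e) + cmod (src x * cnj e)"
        by (rule tri)
      also have "\<dots> = cmod b + cmod (wirt U x - 1 / x) * cmod (p x) + (cmod (p x))\<^sup>2 / 2 + cmod (src x)"
        by (simp only: norm_mult norm_divide norm_power complex_mod_cnj e mult_1_right norm_numeral)
      also have "\<dots> \<le> cmod b + M * L + L\<^sup>2 / 2 + M * 1"
      proof (intro add_mono mult_mono divide_right_mono power_mono order_refl)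
        have "M * (cmod x)\<^sup>2 \<le> M * 1" using x LM by (intro mult_left_mono power_le_one) auto
        then show "cmod (src x) \<le> M * 1" using sM[OF x(2,3)] by linarith
      qed (use pL[OF x(1)] wM[OF x(2,3)] LM in auto)
      finally have "cmod (b * e + (wirt U x - 1 / x) * p x * e + (p x)\<^sup>2 / 2 * e + src x * cnj e) \<le> N"
        by (simp add: N_def)
      moreover have "cmod (inverse (of_real t)) \<le> inverse t" using t by (simp add: norm_inverse)
      ultimately show ?thesis unfolding f'_def x_def norm_mult using N by (intro mult_mono) auto
    qed
    have "cmod (f r - f \<tau>) \<le> N * ln r - N * ln \<tau>"
    proof (rule differentiable_bound_general[OF \<tau>(2)])
      show "continuous_on {\<tau>..r} f"
        by (intro continuous_at_imp_continuous_on ballI has_vector_derivative_continuous[OF df]) (use \<tau> in auto)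
      show "continuous_on {\<tau>..r} (\<lambda>t. N * ln t)" using \<tau> by (intro continuous_intros) auto
      fix t assume t: "\<tau> < t" "t < r"
      show "(f has_vector_derivative f' t) (at t)" using df t \<tau> by simp
      show "((\<lambda>t. N * ln t) has_vector_derivative N * inverse t) (at t)"
        using t \<tau> unfolding has_real_derivative_iff_has_vector_derivative[symmetric]
        by (auto intro!: derivative_eq_intros simp: field_simps)
      show "cmod (f' t) \<le> N * inverse t" using bf t \<tau> by simp
    qed
    moreover have "cmod (f r) \<le> L / r"
      using pL[OF ray(3)[of r]] r by (simp add: f_def norm_mult norm_inverse divide_inverse)
    moreover have "cmod (f \<tau>) \<le> cmod (f r) + cmod (f r - f \<tau>)"
      using norm_triangle_ineq4[of "f r" "f r - f \<tau>"] by simp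
    moreover have "N * ln r \<le> 0" using N r by (intro mult_nonneg_nonpos) (auto simp: ln_le_zero_iff)
    ultimately have "cmod (f \<tau>) \<le> L / r + N * (- ln \<tau>)" by simp
    \<comment> \<open>A square root in place of the logarithm: any positive power of |z| in the
      bound for \<open>p\<close> suffices later.\<close>
    also have "- ln \<tau> \<le> 2 / sqrt \<tau>"
    proof -
      have "- ln \<tau> = 2 * ln (1 / sqrt \<tau>)" using \<tau> by (simp add: ln_div ln_sqrt)
      also have "\<dots> \<le> 2 * (1 / sqrt \<tau>)" using \<tau> ln_le_minus_one[of "1 / sqrt \<tau>"] by simp
      finally show ?thesis by simp
    qed
    then have "L / r + N * (- ln \<tau>) \<le> L / r + N * (2 / sqrt \<tau>)" using N by (intro add_left_mono mult_left_mono)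
    finally have "\<tau> * cmod (f \<tau>) \<le> \<tau> * (L / r + N * (2 / sqrt \<tau>))" using \<tau> by (intro mult_left_mono) auto
    moreover have "\<tau> * cmod (f \<tau>) = cmod (p z)" using \<tau> e(2) by (simp add: f_def norm_mult norm_inverse)
    moreover have "\<tau> * (L / r + N * (2 / sqrt \<tau>)) \<le> (L / r + 2 * N) * sqrt \<tau>"
    proof -
      define y where "y = sqrt \<tau>"
      have y: "0 < y" "y \<le> 1" "\<tau> = y * y" using \<tau> r by (auto simp: y_def)
      have "y * y * (L / r) \<le> y * 1 * (L / r)" using y LM r by (intro mult_right_mono mult_left_mono) auto
      moreover have "y * y * (N * (2 / y)) = 2 * N * y" using y by simp
      ultimately have "y * y * (L / r + N * (2 / y)) \<le> (L / r + 2 * N) * y" by (simp only: ring_distribs mult_1_right mult.commute)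
      then show ?thesis unfolding y(3)[symmetric] unfolding y_def .
    qed
    ultimately show ?thesis by (simp add: \<tau>_def)
  qed
  moreover have "L / r + 2 * N > 0" using LM r N by (simp add: add_pos_nonneg)
  ultimately show ?thesis using that[of "L / r + 2 * N" r] r by blast
qed

text \<open>The constant is the mean of \<open>Q\<close> over a small circle about 0. There p/x -
  U_z p = -(U_z - 1/x) p tends to 0 with \<open>p\<close>, and so do the other two terms.\<close>

lemma Q_zero: "z \<notin> \<Lambda> \<Longrightarrow> Q z = 0"
proof -
  obtain R L M where R: "0 < R" "R \<le> 1" and LM: "0 < L" "0 < M"
    and off: "\<And>z. z \<noteq> 0 \<Longrightarrow> cmod z < R \<Longrightarrow> z \<notin> \<Lambda>"
    and pL: "\<And>z. z \<notin> \<Lambda> \<Longrightarrow> cmod (p z) \<le> L"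
    and wM: "\<And>z. z \<noteq> 0 \<Longrightarrow> cmod z < R \<Longrightarrow> cmod (wirt U z - 1 / z) \<le> M"
    and sM: "\<And>z. z \<noteq> 0 \<Longrightarrow> cmod z < R \<Longrightarrow> cmod (src z) \<le> M * (cmod z)\<^sup>2"
    by (rule local_bounds) blast
  obtain K r where K: "K > 0" "r > 0" "\<And>z. z \<noteq> 0 \<Longrightarrow> cmod z < r \<Longrightarrow> cmod (p z) \<le> K * sqrt (cmod z)"
    by (rule p_sqrt_bound) blast
  obtain b where b: "\<And>z. z \<notin> \<Lambda> \<Longrightarrow> Q z = b" by (rule Q_constant) blast
  have bound: "cmod b \<le> M * (K * sqrt s) + (K * sqrt s)\<^sup>2 / 2 + M * s\<^sup>2" if s: "0 < s" "s < min r R" for s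
  proof (rule Q_mean_bound[of s 0])
    have circ: "x \<noteq> 0 \<and> cmod x = s \<and> x \<notin> \<Lambda>" if "cmod (x - 0) = s" for x using that s off[of x] by auto
    show "s > 0" by fact
    have "((\<lambda>t. b) has_integral b) {0..1::real}" using has_integral_const_real[of b 0 1] by simp
    then show "((\<lambda>t. Q (circlepath 0 s t)) has_integral b) {0..1}"
    proof (rule has_integral_eq[rotated])
      fix t :: real
      have "cmod (circlepath 0 s t - 0) = s" using s by (simp add: circlepath norm_mult)
      then show "b = Q (circlepath 0 s t)" using circ b by simp
    qed
    fix x assume "cmod (x - 0) = s"
    then have x: "x \<noteq> 0" "cmod x = s" "x \<notin> \<Lambda>" using circ by auto
    show "x \<notin> \<Lambda>" by fact
    show "cmod (src x) \<le> M * s\<^sup>2" using sM[OF x(1)] x s by simp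
    show p: "cmod (p x) \<le> K * sqrt s" using K(3)[OF x(1)] x s by simp
    have e: "p x / (x - 0) - wirt U x * p x = - ((wirt U x - 1 / x) * p x)" by (simp add: algebra_simps)
    show "cmod (p x / (x - 0) - wirt U x * p x) \<le> M * (K * sqrt s)"
      unfolding e norm_minus_cancel norm_mult using wM[OF x(1)] x s p LM by (intro mult_mono) auto
  qed
  have "((\<lambda>s. M * (K * sqrt s) + (K * sqrt s)\<^sup>2 / 2 + M * s\<^sup>2) \<longlongrightarrow> M * (K * sqrt 0) + (K * sqrt 0)\<^sup>2 / 2 + M * 0\<^sup>2) (at_right 0)"
    by (intro tendsto_intros) auto
  then have "cmod b \<le> M * (K * sqrt 0) + (K * sqrt 0)\<^sup>2 / 2 + M * 0\<^sup>2"
  proof (rule tendsto_lowerbound)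
    show "\<forall>\<^sub>F s in at_right 0. cmod b \<le> M * (K * sqrt s) + (K * sqrt s)\<^sup>2 / 2 + M * s\<^sup>2"
      using bound K R unfolding eventually_at_right_field by (intro exI[of _ "min r R"]) auto
  qed simp
  then show "z \<notin> \<Lambda> \<Longrightarrow> Q z = 0" using b by simp
qed

text \<open>Since (v_z + U_z)/2 = U_z + p/2, the z-derivative of D = e^(-(v+U)/2) p is e^(-(v+U)/2)
  Q = 0, so the conjugate of \<open>D\<close> is holomorphic and elliptic. The exponential factor is
  O(|z|^(-2)) and \<open>p\<close> is O(sqrt |z|), hence z^2 times it tends to 0 and it is
  constant.\<close>

lemma p_formula:
  obtains k where "\<And>z. z \<notin> \<Lambda> \<Longrightarrow> p z = k * of_real (exp ((v z + U z) / 2))"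
proof -
  define D where "D z = of_real (exp (- 1/2 * v z + - 1/2 * U z)) * p z" for z
  have Dw: "\<exists>\<beta>. has_wirtinger D 0 \<beta> z" if z: "z \<notin> \<Lambda>" for z
  proof -
    define E where "E = complex_of_real (exp (- 1/2 * v z + - 1/2 * U z))"
    define \<sigma> where "\<sigma> = of_real (- 1/2) * wirt v z + of_real (- 1/2) * wirt U z"
    note lc = wirt_linear_combination[OF v_differentiable[OF z] U_differentiable[OF z], of "- 1/2" "- 1/2"]
    from has_wirtinger_mult[OF has_wirtinger_exp[OF lc(1)] p_has_wirtinger[OF z]]
    have "has_wirtinger D (E * \<sigma> * p z + E * p1 z) (E * cnj \<sigma> * p z + E * src z) z"
      unfolding D_def[abs_def] E_def \<sigma>_def lc(2) .
    moreover have "E * \<sigma> * p z + E * p1 z = E * Q z"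
      by (simp add: \<sigma>_def Q_def p_def power2_eq_square field_simps)
    ultimately show ?thesis using Q_zero[OF z] by auto
  qed
  have hol: "(\<lambda>z. cnj (D z)) holomorphic_on - \<Lambda>"
    unfolding holomorphic_on_def
  proof
    fix z assume "z \<in> - \<Lambda>"
    then obtain \<beta> where "has_wirtinger D 0 \<beta> z" using Dw by blast
    from bounded_linear.has_derivative[OF bounded_linear_cnj this]
    have "((\<lambda>z. cnj (D z)) has_derivative (\<lambda>x. cnj \<beta> * x)) (at z)" by simp
    then have "((\<lambda>z. cnj (D z)) has_field_derivative cnj \<beta>) (at z)" by (simp add: has_field_derivative_def)
    then show "(\<lambda>z. cnj (D z)) field_differentiable (at z within - \<Lambda>)"
      using field_differentiable_at_within field_differentiable_def by blast
  qed
  have per: "cnj (D (z + w)) = cnj (D z)" if "w \<in> \<Lambda>" for z w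
    using periodicD[OF v_periodic that] periodicD[OF U_periodic that] p_periodic[OF that] by (simp add: D_def)
  obtain d where d: "d > 0" "ball 0 d \<subseteq> closed_cell" by (rule ball_subset_cell) blast
  obtain c C where c: "c > 0" "C > 0" "\<And>z. z \<in> closed_cell \<Longrightarrow> c * (cmod z)\<^sup>2 \<le> q z"
    "\<And>z. z \<in> closed_cell \<Longrightarrow> q z \<le> C * (cmod z)\<^sup>2" by (rule q_quadratic) blast
  obtain K r where K: "K > 0" "r > 0" "\<And>z. z \<noteq> 0 \<Longrightarrow> cmod z < r \<Longrightarrow> cmod (p z) \<le> K * sqrt (cmod z)"
    by (rule p_sqrt_bound) blast
  obtain L where L: "L > 0" "\<And>x y. x \<notin> \<Lambda> \<Longrightarrow> y \<notin> \<Lambda> \<Longrightarrow> \<bar>(v x - U x) - (v y - U y)\<bar> \<le> L * cmod (x - y)"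
    by (rule difference_lipschitz) blast
  obtain x0 where x0: "cmod x0 < 1" "x0 \<notin> \<Lambda>" using open_meets_off_lattice[of "ball 0 1"] by auto
  \<comment> \<open>A bound for |v - U| near 0: the value at the anchor \<open>x0\<close> plus the
    Lipschitz constant times the distance, which is at most 2.\<close>
  define A where "A = \<bar>v x0 - U x0\<bar> + 2 * L"
  define R where "R = min 1 (min d r)"
  have bound: "cmod (z\<^sup>2 * cnj (D z)) \<le> exp (A / 2) / c * K * sqrt (cmod z)" if z: "z \<noteq> 0" "cmod z < R" for z
  proof -
    have cell: "z \<in> closed_cell" using z d(2) by (auto simp: R_def subset_iff)
    then have off: "z \<notin> \<Lambda>" using z closed_cell_lattice by blast
    have "cmod (z - x0) \<le> 2" using norm_triangle_ineq4[of z x0] z x0 by (simp add: R_def)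
    then have "L * cmod (z - x0) \<le> L * 2" using L by (intro mult_left_mono) auto
    then have "\<bar>v z - U z\<bar> \<le> A" using L(2)[OF off x0(2)] by (simp add: A_def)
    then have "exp (- 1/2 * v z + - 1/2 * U z) \<le> exp (A / 2 - U z)" by simp
    also have "\<dots> = exp (A / 2) / q z" by (simp add: exp_diff exp_U[OF off])
    also have "\<dots> \<le> exp (A / 2) / (c * (cmod z)\<^sup>2)"
      using c(1) c(3)[OF cell] z q_pos[OF off] by (intro divide_left_mono) auto
    finally have "cmod (D z) \<le> exp (A / 2) / (c * (cmod z)\<^sup>2) * (K * sqrt (cmod z))"
      unfolding D_def norm_mult norm_of_real using K(3)[OF z(1)] z c(1) by (intro mult_mono) (auto simp: R_def)
    then have "(cmod z)\<^sup>2 * cmod (D z) \<le> (cmod z)\<^sup>2 * (exp (A / 2) / (c * (cmod z)\<^sup>2) * (K * sqrt (cmod z)))"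
      by (intro mult_left_mono) auto
    also have "\<dots> = exp (A / 2) / c * K * sqrt (cmod z)" using z by simp
    finally show ?thesis by (simp add: norm_mult norm_power)
  qed
  have "((\<lambda>z. z\<^sup>2 * cnj (D z)) \<longlongrightarrow> 0) (at 0)"
  proof (rule Lim_null_comparison)
    have "R > 0" using d K by (simp add: R_def)
    then show "\<forall>\<^sub>F z in at 0. cmod (z\<^sup>2 * cnj (D z)) \<le> exp (A / 2) / c * K * sqrt (cmod z)"
      unfolding eventually_at using bound by (intro exI[of _ R]) (auto simp: dist_norm)
    have "((\<lambda>z. exp (A / 2) / c * K * sqrt (cmod z)) \<longlongrightarrow> exp (A / 2) / c * K * sqrt (cmod (0 :: complex))) (at 0)"
      by (intro tendsto_intros)
    then show "((\<lambda>z::complex. exp (A / 2) / c * K * sqrt (cmod z)) \<longlongrightarrow> 0) (at 0)" by simp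
  qed
  from elliptic_simple_pole_constant[OF hol per this]
  obtain k where k: "\<And>z. z \<notin> \<Lambda> \<Longrightarrow> cnj (D z) = k" by blast
  show ?thesis
  proof (rule that[of "cnj k"])
    fix z assume "z \<notin> \<Lambda>"
    from k[OF this] have D: "D z = cnj k" by auto
    have 1: "exp (- 1/2 * v z + - 1/2 * U z) * exp ((v z + U z) / 2) = 1"
      unfolding exp_add[symmetric] by (simp add: add_divide_distrib)
    have "cnj k * of_real (exp ((v z + U z) / 2))
        = p z * of_real (exp (- 1/2 * v z + - 1/2 * U z) * exp ((v z + U z) / 2))"
      unfolding D[symmetric] D_def of_real_mult by (simp only: mult_ac)
    then show "p z = cnj k * of_real (exp ((v z + U z) / 2))" unfolding 1 by simp
  qed
qed

text \<open>Along a period \<open>w\<close> the derivative of \<open>v - U\<close> is a positive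
  function times 2 Re (k w), so one critical point on a closed line already forces Re (k w) = 0. The
  lines through half periods miss the lattice, hence Rolle's theorem applies on them.\<close>

lemma p_zero: "z \<notin> \<Lambda> \<Longrightarrow> p z = 0"
proof -
  obtain k where k: "\<And>z. z \<notin> \<Lambda> \<Longrightarrow> p z = k * of_real (exp ((v z + U z) / 2))" by (rule p_formula) blast
  have zero: "Re (k * w) = 0" if off: "\<And>t. a + of_real t * w \<notin> \<Lambda>" and w: "w \<in> \<Lambda>" for a w
  proof -
    define f where "f t = v (a + of_real t * w) - U (a + of_real t * w)" for t
    have df: "(f has_real_derivative 2 * Re (p (a + of_real t * w) * w)) (at t)" for t
      unfolding f_def[abs_def] by (rule difference_line_derivative[OF off])
    have "f 0 = f 1" using periodicD[OF v_periodic w, of a] periodicD[OF U_periodic w, of a] by (simp add: f_def)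
    moreover have "continuous_on {0..1} f"
      by (intro continuous_at_imp_continuous_on ballI DERIV_isCont[OF df])
    ultimately obtain t where "(\<lambda>x. 2 * Re (p (a + of_real t * w) * w) * x) = (\<lambda>x. 0)"
      using Rolle_deriv[of 0 1 f "\<lambda>t x. 2 * Re (p (a + of_real t * w) * w) * x"] df
      unfolding has_field_derivative_def by auto
    from fun_cong[OF this, of 1] have "Re (p (a + of_real t * w) * w) = 0" by simp
    moreover have "p (a + of_real t * w) * w = of_real (exp ((v (a + of_real t * w) + U (a + of_real t * w)) / 2)) * (k * w)"
      unfolding k[OF off] by (simp only: mult_ac)
    ultimately show ?thesis by (simp only: Re_of_real_mult mult_eq_0_iff exp_not_eq_zero simp_thms)
  qed
  have half: "(1/2::real) \<notin> \<int>" using Ints_nonzero_abs_ge1[of "1/2::real"] by auto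
  have "of_real (1/2) * \<omega>2 + of_real t * \<omega>1 \<notin> \<Lambda>" "of_real (1/2) * \<omega>1 + of_real t * \<omega>2 \<notin> \<Lambda>" for t
    using half by (simp_all only: lattice_iff_coord coord_add coord_scale coord_generators mult_zero_right mult_1_right add_0_left add_0_right simp_thms)
  from zero[OF this(1)] zero[OF this(2)] have z: "Re (k * \<omega>1) = 0" "Re (k * \<omega>2) = 0" using lattice_generators by auto
  have "Re (k * x) = 0" for x
  proof -
    have "k * x = of_real (coord1 x) * (k * \<omega>1) + of_real (coord2 x) * (k * \<omega>2)"
      using arg_cong[OF coord_decomp[of x], of "\<lambda>y. k * y"] by (simp add: algebra_simps)
    then show ?thesis using z by (simp only: plus_complex.sel Re_of_real_mult mult_zero_right add_0_left)
  qed
  \<comment> \<open>At the conjugate of \<open>k\<close> the real part is |k|^2.\<close>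
  from this[of "cnj k"] have "k = 0" by (simp add: complex_eq_iff add_nonneg_eq_0_iff)
  then show "z \<notin> \<Lambda> \<Longrightarrow> p z = 0" using k by simp
qed

text \<open>As \<open>p\<close> vanishes on an open set, so do both of its derivatives. The
  conjugate one is \<open>src\<close>, a multiple of \<open>exp v - q\<close>, so the equation
  itself excludes a nonzero constant difference.\<close>

lemma v_eq_U: assumes z: "z \<notin> \<Lambda>" shows "v z = U z"
proof -
  have "(p has_derivative (\<lambda>_. 0)) (at z)"
    by (rule has_derivative_transform_within_open[OF has_derivative_const open_off_lattice]) (use z p_zero in auto)
  from has_derivative_unique[OF p_has_wirtinger[OF z] this]
  have *: "p1 z * x + src z * cnj x = 0" for x by (rule fun_cong)
  from *[of 1] *[of \<i>] have "src z = 0" by (simp add: complex_eq_iff)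
  then have "exp (v z) = exp (U z)" by (simp add: src_def exp_U[OF z])
  then show ?thesis by simp
qed

theorem solution_unique: "u = usol"
proof (rule extensionalityI)
  show "u \<in> extensional (torus \<omega>1 \<omega>2 - {torus_proj \<omega>1 \<omega>2 0})"
    using solution by (simp add: mean_field_solution_def)
  show "usol \<in> extensional (torus \<omega>1 \<omega>2 - {torus_proj \<omega>1 \<omega>2 0})" by (simp add: usol_def)
  fix x assume "x \<in> torus \<omega>1 \<omega>2 - {torus_proj \<omega>1 \<omega>2 0}"
  then obtain z where x: "x = torus_proj \<omega>1 \<omega>2 z" and "z \<notin> \<Lambda>"
    using torus_proj_eq_iff[of _ 0] by (auto simp: torus_eq_range)
  then show "u x = usol x" using v_eq_U usol_proj by (simp add: v_def)
qed

end

theorem theorem3p2: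
  fixes \<omega>1 \<omega>2 :: complex
  assumes "\<omega>1 \<noteq> \<omega>2" and "independent {\<omega>1, \<omega>2}"
    and "torus_volume \<omega>1 \<omega>2 = 1"
  shows "\<exists>!u. mean_field_solution \<omega>1 \<omega>2 (4 * pi) u"
proof -
  interpret lattice \<omega>1 \<omega>2 by (rule lattice_if_independent[OF assms(1,2)])
  interpret unit_torus \<omega>1 \<omega>2 by unfold_locales (rule assms(3))
  obtain T g where "liouville_potential \<omega>1 \<omega>2 T g" by (rule liouville_potential_exists)
  then interpret liouville_potential \<omega>1 \<omega>2 T g .
  show ?thesis
  proof (rule ex1I)
    show "mean_field_solution \<omega>1 \<omega>2 (4 * pi) usol" by (rule usol_solution)
    fix u assume "mean_field_solution \<omega>1 \<omega>2 (4 * pi) u"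
    then interpret mean_field \<omega>1 \<omega>2 T g u by unfold_locales
    show "u = usol" by (rule solution_unique)
  qed
qed


end
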